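(* (1) Every regular Mal'cev category is positively regular. (2) Conversely, let $\mathbf{C}$ be a positively regular category, so that $\mathbf{CP}(\mathbf{Rel}(\mathbf{C}))$ is equivalent to the category $\mathbf{G}$ of internal groupoids in $\mathbf{C}$ and relations in $\mathbf{C}$ that respect inverses. Then $\mathbf{C}$ is Mal'cev if and only if this equivalence provides equivalences $$\mathbf{CP}(\mathbf{Rel}(\mathbf{C}))\simeq \mathbf{Rel}(\mathbf{Gpd}(\mathbf{C}))\simeq \mathbf{Rel}(\mathbf{Cat}(\mathbf{C})).$$ Here "this equivalence provides equivalences" means: $\mathbf{Gpd}(\mathbf{C})$ and $\mathbf{Cat}(\mathbf{C})$ are regular (so that the categories of relations on the right exist); the forgetful assignment $\mathbf{Rel}(\mathbf{Gpd}(\mathbf{C}))\to\mathbf{G}$, which is the identity on objects and sends a subobject $(R_0,R_1)\rightarrowtail (A_0,A_1)\times(B_0,B_1)$ in $\mathbf{Gpd}(\mathbf{C})$ to the relation $R_1\rightarrowtail A_1\times B_1$ in $\mathbf{C}$, is a well-defined functor and an isomorphism of categories; and the forgetful functor $\mathbf{Gpd}(\mathbf{C})\to\mathbf{Cat}(\mathbf{C})$ is an isomorphism, inducing the second equivalence.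
   Context: A category is regular when it has finite limits, coequalizers of kernel pairs, and regular epimorphisms are stable under pullback. For $\mathbf{C}$ regular, $\mathbf{Rel}(\mathbf{C})$ has the same objects as $\mathbf{C}$; a morphism (relation) $R\colon A\to B$ is a subobject $R\rightarrowtail A\times B$; identities are diagonals; $S\circ R$ is the image of $R\times_B S\to A\times C$, i.e. $\{(a,c)\mid (\exists b)\,R(a,b)\wedge S(b,c)\}$. Formulas with elements are interpreted in the internal regular logic of $\mathbf{C}$ (equality by equalizers, conjunction by pullback, $\exists$ by images, implication by inclusion of subobjects). $\mathbf{Rel}(\mathbf{C})$ is a compact dagger category with $\otimes=\times$, $I=1$, $R^\dagger(b,a)\Leftrightarrow R(a,b)$. A category with finite limits is Mal'cev if every reflexive relation $R\rightarrowtail A\times A$ is an equivalence relation. An endomorphism in a dagger category is positive if it has the form $g^\dagger\circ g$. A regular category $\mathbf{C}$ is positively regular if every reflexive symmetric relation $R\rightarrowtail A\times A$ is positive in $\mathbf{Rel}(\mathbf{C})$. An internal category in $\mathbf{C}$ consists of objects $C_0,C_1$ and morphisms $s,t\colon C_1\to C_0$ (source/dom, target/cod), $u\colon C_0\to C_1$ (identities $\mathrm{id}_x=u(x)$), $m\colon C_1\times_{C_0}C_1\to C_1$ (composition) satisfying the usual equations; an internal groupoid also has an inversion $i\colon C_1\to C_1$, $a\mapsto a^{-1}$. An internal functor is a pair $(f_0,f_1)$ commuting with the structure. $\mathbf{Cat}(\mathbf{C})$ and $\mathbf{Gpd}(\mathbf{C})$ denote the categories of internal categories and of internal groupoids in $\mathbf{C}$,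 with internal functors. A relation $R\colon A_1\to B_1$ between (the objects of morphisms of) internal groupoids respects inverses if $R(a,b)\Rightarrow R(a^{-1},b^{-1})\wedge R(\mathrm{id}_{\mathrm{dom}(a)},\mathrm{id}_{\mathrm{dom}(b)})$. The category $\mathbf{G}$ has internal groupoids as objects and such relations as morphisms, composed as in $\mathbf{Rel}(\mathbf{C})$. A special dagger Frobenius structure in a dagger monoidal category is an object $A$ with $\mu\colon A\otimes A\to A$, $\eta\colon I\to A$ satisfying $\mu(\mathrm{id}\otimes\eta)=\mathrm{id}_A=\mu(\eta\otimes\mathrm{id})$, $\mu(\mu\otimes\mathrm{id})=\mu(\mathrm{id}\otimes\mu)$, $\mu\circ\mu^\dagger=\mathrm{id}_A$, and $(\mu\otimes\mathrm{id})(\mathrm{id}\otimes\mu^\dagger)=(\mathrm{id}\otimes\mu)(\mu^\dagger\otimes\mathrm{id})$. For a compact dagger category $\mathbf{D}$, $\mathbf{CP}(\mathbf{D})$ has special dagger Frobenius structures in $\mathbf{D}$ as objects, and morphisms $(A,\mu_A)\to(B,\mu_B)$ are the morphisms $f\colon A\to B$ of $\mathbf{D}$ that are completely positive, i.e. whose Choi matrix $(\mathrm{id}_A\otimes\mu_B)\circ(\mathrm{id}_A\otimes f\otimes\mathrm{id}_B)\circ(\mu_A^\dagger\otimes\mathrm{id}_B)\colon A\otimes B\to A\otimes B$ equals $g^\dagger\circ g$ for some $g\colon A\otimes B\to X$ in $\mathbf{D}$. Special dagger Frobenius structures in $\mathbf{Rel}(\mathbf{C})$ correspond to internal groupoids in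 $\mathbf{C}$: $A=C_1$, $\mu$ is the graph of the partial composition $m$, and $\eta$ is the subobject $u\colon C_0\rightarrowtail C_1$. Under this correspondence, the equivalence of $\mathbf{CP}(\mathbf{Rel}(\mathbf{C}))$ with $\mathbf{G}$ for positively regular $\mathbf{C}$ is the identity on underlying relations. *)

theory Defs
  imports Main
begin

section \<open>Categories\<close>

text \<open>The fields \<open>Dom\<close>, \<open>Cod\<close>, \<open>Ident\<close> and \<open>Cmp\<close> are total HOL functions; they carry
  information only on \<open>Arr\<close>, on \<open>Obj\<close> and on composable pairs. Composition is written in the
  applicative order, \<open>g \<cdot>\<^bsub>C\<^esub> f\<close> being ``g after f''.\<close>

record ('o, 'm) cat =
  Obj :: "'o set"
  Arr :: "'m set"
  Dom :: "'m \<Rightarrow> 'o"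
  Cod :: "'m \<Rightarrow> 'o"
  Ident :: "'o \<Rightarrow> 'm"
  Cmp :: "'m \<Rightarrow> 'm \<Rightarrow> 'm"  (infixr "\<cdot>\<index>" 70)

definition hom :: "('o, 'm, 'z) cat_scheme \<Rightarrow> 'o \<Rightarrow> 'o \<Rightarrow> 'm set" where
  "hom C A B = {f \<in> Arr C. Dom C f = A \<and> Cod C f = B}"

definition is_category :: "('o, 'm, 'z) cat_scheme \<Rightarrow> bool" where
  "is_category C \<longleftrightarrow>
     (\<forall>f\<in>Arr C. Dom C f \<in> Obj C \<and> Cod C f \<in> Obj C) \<and>
     (\<forall>A\<in>Obj C. Ident C A \<in> hom C A A) \<and>
     (\<forall>f\<in>Arr C. \<forall>g\<in>Arr C. Cod C f = Dom C g \<longrightarrow> g \<cdot>\<^bsub>C\<^esub> f \<in> hom C (Dom C f) (Cod C g)) \<and>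
     (\<forall>f\<in>Arr C. f \<cdot>\<^bsub>C\<^esub> Ident C (Dom C f) = f \<and> Ident C (Cod C f) \<cdot>\<^bsub>C\<^esub> f = f) \<and>
     (\<forall>f\<in>Arr C. \<forall>g\<in>Arr C. \<forall>h\<in>Arr C. Cod C f = Dom C g \<longrightarrow> Cod C g = Dom C h \<longrightarrow>
        h \<cdot>\<^bsub>C\<^esub> (g \<cdot>\<^bsub>C\<^esub> f) = (h \<cdot>\<^bsub>C\<^esub> g) \<cdot>\<^bsub>C\<^esub> f)"

definition is_iso :: "('o, 'm, 'z) cat_scheme \<Rightarrow> 'm \<Rightarrow> bool" where
  "is_iso C f \<longleftrightarrow> f \<in> Arr C \<and>
     (\<exists>g\<in>hom C (Cod C f) (Dom C f).
        g \<cdot>\<^bsub>C\<^esub> f = Ident C (Dom C f) \<and> f \<cdot>\<^bsub>C\<^esub> g = Ident C (Cod C f))"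

definition is_mono :: "('o, 'm, 'z) cat_scheme \<Rightarrow> 'm \<Rightarrow> bool" where
  "is_mono C m \<longleftrightarrow> m \<in> Arr C \<and>
     (\<forall>X. \<forall>f\<in>hom C X (Dom C m). \<forall>g\<in>hom C X (Dom C m). m \<cdot>\<^bsub>C\<^esub> f = m \<cdot>\<^bsub>C\<^esub> g \<longrightarrow> f = g)"

definition is_coequalizer :: "('o, 'm, 'z) cat_scheme \<Rightarrow> 'm \<Rightarrow> 'm \<Rightarrow> 'm \<Rightarrow> bool" where
  "is_coequalizer C f g e \<longleftrightarrow>
     f \<in> Arr C \<and> g \<in> Arr C \<and> Dom C f = Dom C g \<and> Cod C f = Cod C g \<and>
     e \<in> Arr C \<and> Dom C e = Cod C f \<and> e \<cdot>\<^bsub>C\<^esub> f = e \<cdot>\<^bsub>C\<^esub> g \<and>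
     (\<forall>X. \<forall>h\<in>hom C (Cod C f) X. h \<cdot>\<^bsub>C\<^esub> f = h \<cdot>\<^bsub>C\<^esub> g \<longrightarrow>
        (\<exists>!k. k \<in> hom C (Cod C e) X \<and> k \<cdot>\<^bsub>C\<^esub> e = h))"

definition regular_epi :: "('o, 'm, 'z) cat_scheme \<Rightarrow> 'm \<Rightarrow> bool" where
  "regular_epi C e \<longleftrightarrow> (\<exists>f g. is_coequalizer C f g e)"

definition is_terminal :: "('o, 'm, 'z) cat_scheme \<Rightarrow> 'o \<Rightarrow> bool" where
  "is_terminal C T \<longleftrightarrow> T \<in> Obj C \<and> (\<forall>A\<in>Obj C. \<exists>!f. f \<in> hom C A T)"

definition is_product :: "('o, 'm, 'z) cat_scheme \<Rightarrow> 'o \<Rightarrow> 'o \<Rightarrow> 'o \<Rightarrow> 'm \<Rightarrow> 'm \<Rightarrow> bool" where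
  "is_product C A B P p q \<longleftrightarrow> P \<in> Obj C \<and> p \<in> hom C P A \<and> q \<in> hom C P B \<and>
     (\<forall>X. \<forall>f\<in>hom C X A. \<forall>g\<in>hom C X B.
        \<exists>!h. h \<in> hom C X P \<and> p \<cdot>\<^bsub>C\<^esub> h = f \<and> q \<cdot>\<^bsub>C\<^esub> h = g)"

definition is_pullback :: "('o, 'm, 'z) cat_scheme \<Rightarrow> 'm \<Rightarrow> 'm \<Rightarrow> 'o \<Rightarrow> 'm \<Rightarrow> 'm \<Rightarrow> bool" where
  "is_pullback C f g P p q \<longleftrightarrow>
     f \<in> Arr C \<and> g \<in> Arr C \<and> Cod C f = Cod C g \<and>
     P \<in> Obj C \<and> p \<in> hom C P (Dom C f) \<and> q \<in> hom C P (Dom C g) \<and> f \<cdot>\<^bsub>C\<^esub> p = g \<cdot>\<^bsub>C\<^esub> q \<and>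
     (\<forall>X. \<forall>a\<in>hom C X (Dom C f). \<forall>b\<in>hom C X (Dom C g). f \<cdot>\<^bsub>C\<^esub> a = g \<cdot>\<^bsub>C\<^esub> b \<longrightarrow>
        (\<exists>!h. h \<in> hom C X P \<and> p \<cdot>\<^bsub>C\<^esub> h = a \<and> q \<cdot>\<^bsub>C\<^esub> h = b))"

definition has_finite_limits :: "('o, 'm, 'z) cat_scheme \<Rightarrow> bool" where
  "has_finite_limits C \<longleftrightarrow>
     (\<exists>T. is_terminal C T) \<and>
     (\<forall>f\<in>Arr C. \<forall>g\<in>Arr C. Cod C f = Cod C g \<longrightarrow> (\<exists>P p q. is_pullback C f g P p q))"

definition regular :: "('o, 'm, 'z) cat_scheme \<Rightarrow> bool" where
  "regular C \<longleftrightarrow> is_category C \<and> has_finite_limits C \<and>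
     (\<forall>f P p q. is_pullback C f f P p q \<longrightarrow> (\<exists>e. is_coequalizer C p q e)) \<and>
     (\<forall>e g P p q. regular_epi C e \<longrightarrow> is_pullback C e g P p q \<longrightarrow> regular_epi C q)"


section \<open>Functors\<close>

record ('o, 'm, 'p, 'n) ftr =
  OMap :: "'o \<Rightarrow> 'p"
  AMap :: "'m \<Rightarrow> 'n"

definition id_ftr :: "('o, 'm, 'o, 'm) ftr" where
  "id_ftr = \<lparr>OMap = (\<lambda>A. A), AMap = (\<lambda>f. f)\<rparr>"

definition comp_ftr :: "('p, 'n, 'q, 'k) ftr \<Rightarrow> ('o, 'm, 'p, 'n) ftr \<Rightarrow> ('o, 'm, 'q, 'k) ftr" where
  "comp_ftr G F = \<lparr>OMap = (\<lambda>A. OMap G (OMap F A)), AMap = (\<lambda>f. AMap G (AMap F f))\<rparr>"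

definition is_functor ::
  "('o, 'm, 'y) cat_scheme \<Rightarrow> ('p, 'n, 'z) cat_scheme \<Rightarrow> ('o, 'm, 'p, 'n) ftr \<Rightarrow> bool" where
  "is_functor C D F \<longleftrightarrow> is_category C \<and> is_category D \<and>
     (\<forall>A\<in>Obj C. OMap F A \<in> Obj D) \<and>
     (\<forall>f\<in>Arr C. AMap F f \<in> hom D (OMap F (Dom C f)) (OMap F (Cod C f))) \<and>
     (\<forall>A\<in>Obj C. AMap F (Ident C A) = Ident D (OMap F A)) \<and>
     (\<forall>f\<in>Arr C. \<forall>g\<in>Arr C. Cod C f = Dom C g \<longrightarrow>
        AMap F (g \<cdot>\<^bsub>C\<^esub> f) = AMap F g \<cdot>\<^bsub>D\<^esub> AMap F f)"

definition naturally_isomorphic ::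
  "('o, 'm, 'y) cat_scheme \<Rightarrow> ('p, 'n, 'z) cat_scheme \<Rightarrow>
     ('o, 'm, 'p, 'n) ftr \<Rightarrow> ('o, 'm, 'p, 'n) ftr \<Rightarrow> bool" where
  "naturally_isomorphic C D F G \<longleftrightarrow>
     (\<exists>t. (\<forall>A\<in>Obj C. t A \<in> hom D (OMap F A) (OMap G A) \<and> is_iso D (t A)) \<and>
          (\<forall>f\<in>Arr C. t (Cod C f) \<cdot>\<^bsub>D\<^esub> AMap F f = AMap G f \<cdot>\<^bsub>D\<^esub> t (Dom C f)))"

definition is_equivalence ::
  "('o, 'm, 'y) cat_scheme \<Rightarrow> ('p, 'n, 'z) cat_scheme \<Rightarrow> ('o, 'm, 'p, 'n) ftr \<Rightarrow> bool" where
  "is_equivalence C D F \<longleftrightarrow> is_functor C D F \<and>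
     (\<exists>K. is_functor D C K \<and>
        naturally_isomorphic C C (comp_ftr K F) id_ftr \<and>
        naturally_isomorphic D D (comp_ftr F K) id_ftr)"

definition is_cat_isomorphism ::
  "('o, 'm, 'y) cat_scheme \<Rightarrow> ('p, 'n, 'z) cat_scheme \<Rightarrow> ('o, 'm, 'p, 'n) ftr \<Rightarrow> bool" where
  "is_cat_isomorphism C D F \<longleftrightarrow> is_functor C D F \<and>
     bij_betw (OMap F) (Obj C) (Obj D) \<and> bij_betw (AMap F) (Arr C) (Arr D)"


section \<open>Chosen finite limits\<close>

text \<open>Finite limits are a property, not part of the data of a category; where the constructions
  below refer to ``the'' terminal object, product or pullback, a fixed choice is used.\<close>

definition one :: "('o, 'm, 'z) cat_scheme \<Rightarrow> 'o" where
  "one C = (SOME T. is_terminal C T)"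

definition bang :: "('o, 'm, 'z) cat_scheme \<Rightarrow> 'o \<Rightarrow> 'm" where
  "bang C A = (THE f. f \<in> hom C A (one C))"

definition prod_cone :: "('o, 'm, 'z) cat_scheme \<Rightarrow> 'o \<Rightarrow> 'o \<Rightarrow> 'o \<times> 'm \<times> 'm" where
  "prod_cone C A B = (SOME (P, p, q). is_product C A B P p q)"

definition prd :: "('o, 'm, 'z) cat_scheme \<Rightarrow> 'o \<Rightarrow> 'o \<Rightarrow> 'o" where
  "prd C A B = fst (prod_cone C A B)"

definition pr1 :: "('o, 'm, 'z) cat_scheme \<Rightarrow> 'o \<Rightarrow> 'o \<Rightarrow> 'm" where
  "pr1 C A B = fst (snd (prod_cone C A B))"

definition pr2 :: "('o, 'm, 'z) cat_scheme \<Rightarrow> 'o \<Rightarrow> 'o \<Rightarrow> 'm" where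
  "pr2 C A B = snd (snd (prod_cone C A B))"

definition pairing :: "('o, 'm, 'z) cat_scheme \<Rightarrow> 'm \<Rightarrow> 'm \<Rightarrow> 'm" where
  "pairing C f g = (THE h. h \<in> hom C (Dom C f) (prd C (Cod C f) (Cod C g)) \<and>
     pr1 C (Cod C f) (Cod C g) \<cdot>\<^bsub>C\<^esub> h = f \<and> pr2 C (Cod C f) (Cod C g) \<cdot>\<^bsub>C\<^esub> h = g)"

definition prod_map :: "('o, 'm, 'z) cat_scheme \<Rightarrow> 'm \<Rightarrow> 'm \<Rightarrow> 'm" where
  "prod_map C f g =
     pairing C (f \<cdot>\<^bsub>C\<^esub> pr1 C (Dom C f) (Dom C g)) (g \<cdot>\<^bsub>C\<^esub> pr2 C (Dom C f) (Dom C g))"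

definition pb_cone :: "('o, 'm, 'z) cat_scheme \<Rightarrow> 'm \<Rightarrow> 'm \<Rightarrow> 'o \<times> 'm \<times> 'm" where
  "pb_cone C f g = (SOME (P, p, q). is_pullback C f g P p q)"

definition pb :: "('o, 'm, 'z) cat_scheme \<Rightarrow> 'm \<Rightarrow> 'm \<Rightarrow> 'o" where
  "pb C f g = fst (pb_cone C f g)"

definition pb1 :: "('o, 'm, 'z) cat_scheme \<Rightarrow> 'm \<Rightarrow> 'm \<Rightarrow> 'm" where
  "pb1 C f g = fst (snd (pb_cone C f g))"

definition pb2 :: "('o, 'm, 'z) cat_scheme \<Rightarrow> 'm \<Rightarrow> 'm \<Rightarrow> 'm" where
  "pb2 C f g = snd (snd (pb_cone C f g))"

definition pb_pairing :: "('o, 'm, 'z) cat_scheme \<Rightarrow> 'm \<Rightarrow> 'm \<Rightarrow> 'm \<Rightarrow> 'm \<Rightarrow> 'm" where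
  "pb_pairing C f g a b = (THE h. h \<in> hom C (Dom C a) (pb C f g) \<and>
     pb1 C f g \<cdot>\<^bsub>C\<^esub> h = a \<and> pb2 C f g \<cdot>\<^bsub>C\<^esub> h = b)"


section \<open>Subobjects\<close>

text \<open>A subobject of \<open>X\<close> is a full isomorphism class of monomorphisms into \<open>X\<close>. All operations on
  subobjects are given by the set of all monomorphisms that represent the result, so that equality
  of subobjects is equality of sets.\<close>

definition sub_class :: "('o, 'm, 'z) cat_scheme \<Rightarrow> 'm \<Rightarrow> 'm set" where
  "sub_class C m = {n. is_mono C n \<and> Cod C n = Cod C m \<and>
     (\<exists>h\<in>hom C (Dom C m) (Dom C n). is_iso C h \<and> n \<cdot>\<^bsub>C\<^esub> h = m)}"

definition is_subobject :: "('o, 'm, 'z) cat_scheme \<Rightarrow> 'o \<Rightarrow> 'm set \<Rightarrow> bool" where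
  "is_subobject C X S \<longleftrightarrow> (\<exists>m. is_mono C m \<and> Cod C m = X \<and> S = sub_class C m)"

definition sub_le :: "('o, 'm, 'z) cat_scheme \<Rightarrow> 'm set \<Rightarrow> 'm set \<Rightarrow> bool" where
  "sub_le C S T \<longleftrightarrow> (\<forall>m\<in>S. \<exists>n\<in>T. \<exists>h\<in>hom C (Dom C m) (Dom C n). n \<cdot>\<^bsub>C\<^esub> h = m)"

definition sub_preimage :: "('o, 'm, 'z) cat_scheme \<Rightarrow> 'm \<Rightarrow> 'm set \<Rightarrow> 'm set" where
  "sub_preimage C f S = {k. \<exists>m\<in>S. \<exists>P h. is_pullback C m f P h k}"

definition sub_inter :: "('o, 'm, 'z) cat_scheme \<Rightarrow> 'm set \<Rightarrow> 'm set \<Rightarrow> 'm set" where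
  "sub_inter C S T = {m \<cdot>\<^bsub>C\<^esub> p | m n P p q. m \<in> S \<and> n \<in> T \<and> is_pullback C m n P p q}"

definition is_image :: "('o, 'm, 'z) cat_scheme \<Rightarrow> 'm \<Rightarrow> 'm \<Rightarrow> bool" where
  "is_image C f k \<longleftrightarrow> is_mono C k \<and>
     (\<exists>e\<in>hom C (Dom C f) (Dom C k). regular_epi C e \<and> k \<cdot>\<^bsub>C\<^esub> e = f)"


section \<open>Relations\<close>

text \<open>Arrows of the categories built below: some data \<open>tmap\<close> together with its domain and
  codomain.\<close>

record ('x, 'd) tarr =
  tdom :: 'x
  tcod :: 'x
  tmap :: 'd

type_synonym ('o, 'm) relation = "('o, 'm set) tarr"

definition is_relation :: "('o, 'm, 'z) cat_scheme \<Rightarrow> ('o, 'm) relation \<Rightarrow> bool" where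
  "is_relation C R \<longleftrightarrow> tdom R \<in> Obj C \<and> tcod R \<in> Obj C \<and>
     is_subobject C (prd C (tdom R) (tcod R)) (tmap R)"

definition leg1 :: "('o, 'm, 'z) cat_scheme \<Rightarrow> ('o, 'm) relation \<Rightarrow> 'm \<Rightarrow> 'm" where
  "leg1 C R r = pr1 C (tdom R) (tcod R) \<cdot>\<^bsub>C\<^esub> r"

definition leg2 :: "('o, 'm, 'z) cat_scheme \<Rightarrow> ('o, 'm) relation \<Rightarrow> 'm \<Rightarrow> 'm" where
  "leg2 C R r = pr2 C (tdom R) (tcod R) \<cdot>\<^bsub>C\<^esub> r"

text \<open>The relation given by a jointly monic span \<open>A \<leftarrow> X \<rightarrow> B\<close>.\<close>

definition span_rel :: "('o, 'm, 'z) cat_scheme \<Rightarrow> 'm \<Rightarrow> 'm \<Rightarrow> ('o, 'm) relation" where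
  "span_rel C f g = \<lparr>tdom = Cod C f, tcod = Cod C g, tmap = sub_class C (pairing C f g)\<rparr>"

definition graph_rel :: "('o, 'm, 'z) cat_scheme \<Rightarrow> 'm \<Rightarrow> ('o, 'm) relation" where
  "graph_rel C f = span_rel C (Ident C (Dom C f)) f"

definition rel_ident :: "('o, 'm, 'z) cat_scheme \<Rightarrow> 'o \<Rightarrow> ('o, 'm) relation" where
  "rel_ident C A = span_rel C (Ident C A) (Ident C A)"

definition rel_comp ::
  "('o, 'm, 'z) cat_scheme \<Rightarrow> ('o, 'm) relation \<Rightarrow> ('o, 'm) relation \<Rightarrow> ('o, 'm) relation" where
  "rel_comp C S R = \<lparr>tdom = tdom R, tcod = tcod S,
     tmap = {k. \<exists>r\<in>tmap R. \<exists>s\<in>tmap S. \<exists>P p q.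
       is_pullback C (leg2 C R r) (leg1 C S s) P p q \<and>
       is_image C (pairing C (leg1 C R r \<cdot>\<^bsub>C\<^esub> p) (leg2 C S s \<cdot>\<^bsub>C\<^esub> q)) k}\<rparr>"

definition rel_dagger :: "('o, 'm, 'z) cat_scheme \<Rightarrow> ('o, 'm) relation \<Rightarrow> ('o, 'm) relation" where
  "rel_dagger C R = \<lparr>tdom = tcod R, tcod = tdom R,
     tmap = (\<lambda>r. pairing C (leg2 C R r) (leg1 C R r)) ` tmap R\<rparr>"

definition rel_tensor ::
  "('o, 'm, 'z) cat_scheme \<Rightarrow> ('o, 'm) relation \<Rightarrow> ('o, 'm) relation \<Rightarrow> ('o, 'm) relation" where
  "rel_tensor C R S = \<lparr>tdom = prd C (tdom R) (tdom S), tcod = prd C (tcod R) (tcod S),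
     tmap = {pairing C (pairing C (leg1 C R r \<cdot>\<^bsub>C\<^esub> p) (leg1 C S s \<cdot>\<^bsub>C\<^esub> q))
                       (pairing C (leg2 C R r \<cdot>\<^bsub>C\<^esub> p) (leg2 C S s \<cdot>\<^bsub>C\<^esub> q)) | r s P p q.
       r \<in> tmap R \<and> s \<in> tmap S \<and> is_product C (Dom C r) (Dom C s) P p q}\<rparr>"

definition reflexive_rel :: "('o, 'm, 'z) cat_scheme \<Rightarrow> ('o, 'm) relation \<Rightarrow> bool" where
  "reflexive_rel C R \<longleftrightarrow> sub_le C (tmap (rel_ident C (tdom R))) (tmap R)"

definition symmetric_rel :: "('o, 'm, 'z) cat_scheme \<Rightarrow> ('o, 'm) relation \<Rightarrow> bool" where
  "symmetric_rel C R \<longleftrightarrow> sub_le C (tmap R) (tmap (rel_dagger C R))"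

text \<open>Transitivity is stated without images: \<open>R \<times>\<^bsub>A\<^esub> R \<rightarrow> A \<times> A\<close> factors through \<open>R\<close>.\<close>

definition transitive_rel :: "('o, 'm, 'z) cat_scheme \<Rightarrow> ('o, 'm) relation \<Rightarrow> bool" where
  "transitive_rel C R \<longleftrightarrow> (\<forall>r\<in>tmap R. \<forall>P p q.
     is_pullback C (leg2 C R r) (leg1 C R r) P p q \<longrightarrow>
     (\<exists>h\<in>hom C P (Dom C r). r \<cdot>\<^bsub>C\<^esub> h = pairing C (leg1 C R r \<cdot>\<^bsub>C\<^esub> p) (leg2 C R r \<cdot>\<^bsub>C\<^esub> q)))"

definition malcev :: "('o, 'm, 'z) cat_scheme \<Rightarrow> bool" where
  "malcev C \<longleftrightarrow> is_category C \<and> has_finite_limits C \<and>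
     (\<forall>R. is_relation C R \<and> tdom R = tcod R \<and> reflexive_rel C R \<longrightarrow>
        symmetric_rel C R \<and> transitive_rel C R)"


section \<open>Dagger monoidal categories, Frobenius structures and the CP construction\<close>

text \<open>\<open>Assoc A B C : (A \<otimes> B) \<otimes> C \<rightarrow> A \<otimes> (B \<otimes> C)\<close>, \<open>LUnit A : I \<otimes> A \<rightarrow> A\<close> and
  \<open>RUnit A : A \<otimes> I \<rightarrow> A\<close>.\<close>

record ('o, 'm) dmcat = "('o, 'm) cat" +
  TensO :: "'o \<Rightarrow> 'o \<Rightarrow> 'o"
  TensA :: "'m \<Rightarrow> 'm \<Rightarrow> 'm"
  UnitO :: "'o"
  Assoc :: "'o \<Rightarrow> 'o \<Rightarrow> 'o \<Rightarrow> 'm"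
  LUnit :: "'o \<Rightarrow> 'm"
  RUnit :: "'o \<Rightarrow> 'm"
  Dag :: "'m \<Rightarrow> 'm"

definition positive :: "('o, 'm, 'z) dmcat_scheme \<Rightarrow> 'm \<Rightarrow> bool" where
  "positive D h \<longleftrightarrow> (\<exists>g\<in>Arr D. Dom D g = Dom D h \<and> h = Dag D g \<cdot>\<^bsub>D\<^esub> g)"

record ('o, 'm) frob =
  carr :: 'o
  mult :: 'm
  unt :: 'm

text \<open>The coherence isomorphisms, suppressed in the usual formulas, are inserted; the inverse of an
  associator is its dagger.\<close>

definition special_dagger_frobenius ::
  "('o, 'm, 'z) dmcat_scheme \<Rightarrow> ('o, 'm) frob \<Rightarrow> bool" where
  "special_dagger_frobenius D F \<longleftrightarrow>
     (let A = carr F; \<mu> = mult F; \<eta> = unt F; i = Ident D A; \<alpha> = Assoc D A A A in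
       A \<in> Obj D \<and> \<mu> \<in> hom D (TensO D A A) A \<and> \<eta> \<in> hom D (UnitO D) A \<and>
       \<mu> \<cdot>\<^bsub>D\<^esub> TensA D i \<eta> = RUnit D A \<and>
       \<mu> \<cdot>\<^bsub>D\<^esub> TensA D \<eta> i = LUnit D A \<and>
       \<mu> \<cdot>\<^bsub>D\<^esub> TensA D \<mu> i = \<mu> \<cdot>\<^bsub>D\<^esub> TensA D i \<mu> \<cdot>\<^bsub>D\<^esub> \<alpha> \<and>
       \<mu> \<cdot>\<^bsub>D\<^esub> Dag D \<mu> = i \<and>
       TensA D \<mu> i \<cdot>\<^bsub>D\<^esub> Dag D \<alpha> \<cdot>\<^bsub>D\<^esub> TensA D i (Dag D \<mu>) =
         TensA D i \<mu> \<cdot>\<^bsub>D\<^esub> \<alpha> \<cdot>\<^bsub>D\<^esub> TensA D (Dag D \<mu>) i)"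

definition choi ::
  "('o, 'm, 'z) dmcat_scheme \<Rightarrow> ('o, 'm) frob \<Rightarrow> ('o, 'm) frob \<Rightarrow> 'm \<Rightarrow> 'm" where
  "choi D F G f =
     (let A = carr F; B = carr G in
       TensA D (Ident D A) (mult G) \<cdot>\<^bsub>D\<^esub> Assoc D A B B \<cdot>\<^bsub>D\<^esub>
       TensA D (TensA D (Ident D A) f) (Ident D B) \<cdot>\<^bsub>D\<^esub> TensA D (Dag D (mult F)) (Ident D B))"

definition CP :: "('o, 'm, 'z) dmcat_scheme \<Rightarrow> (('o, 'm) frob, (('o, 'm) frob, 'm) tarr) cat" where
  "CP D = \<lparr>Obj = {F. special_dagger_frobenius D F},
     Arr = {f. special_dagger_frobenius D (tdom f) \<and> special_dagger_frobenius D (tcod f) \<and>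
               tmap f \<in> hom D (carr (tdom f)) (carr (tcod f)) \<and>
               positive D (choi D (tdom f) (tcod f) (tmap f))},
     Dom = tdom, Cod = tcod,
     Ident = (\<lambda>F. \<lparr>tdom = F, tcod = F, tmap = Ident D (carr F)\<rparr>),
     Cmp = (\<lambda>g f. \<lparr>tdom = tdom f, tcod = tcod g, tmap = tmap g \<cdot>\<^bsub>D\<^esub> tmap f\<rparr>)\<rparr>"


section \<open>The category of relations\<close>

definition prod_assoc :: "('o, 'm, 'z) cat_scheme \<Rightarrow> 'o \<Rightarrow> 'o \<Rightarrow> 'o \<Rightarrow> 'm" where
  "prod_assoc C X Y Z =
     (let p = pr1 C (prd C X Y) Z; q = pr2 C (prd C X Y) Z in
       pairing C (pr1 C X Y \<cdot>\<^bsub>C\<^esub> p) (pairing C (pr2 C X Y \<cdot>\<^bsub>C\<^esub> p) q))"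

definition Rel :: "('o, 'm, 'z) cat_scheme \<Rightarrow> ('o, ('o, 'm) relation) dmcat" where
  "Rel C = \<lparr>Obj = Obj C, Arr = {R. is_relation C R}, Dom = tdom, Cod = tcod,
     Ident = rel_ident C, Cmp = rel_comp C,
     TensO = prd C, TensA = rel_tensor C, UnitO = one C,
     Assoc = (\<lambda>X Y Z. graph_rel C (prod_assoc C X Y Z)),
     LUnit = (\<lambda>X. graph_rel C (pr2 C (one C) X)),
     RUnit = (\<lambda>X. graph_rel C (pr1 C X (one C))),
     Dag = rel_dagger C\<rparr>"

definition positively_regular :: "('o, 'm, 'z) cat_scheme \<Rightarrow> bool" where
  "positively_regular C \<longleftrightarrow> regular C \<and>
     (\<forall>R. is_relation C R \<and> tdom R = tcod R \<and> reflexive_rel C R \<and> symmetric_rel C R \<longrightarrow>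
        positive (Rel C) R)"

text \<open>The action on relations of a functor \<open>F\<close> that preserves jointly monic pairs: a subobject
  \<open>R\<close> of \<open>A \<times> B\<close> goes to the subobject of \<open>F A \<times> F B\<close> given by the span \<open>F A \<leftarrow> F R \<rightarrow> F B\<close>.\<close>

definition rel_ftr ::
  "('o, 'm, 'y) cat_scheme \<Rightarrow> ('p, 'n, 'z) cat_scheme \<Rightarrow> ('o, 'm, 'p, 'n) ftr \<Rightarrow>
     ('o, ('o, 'm) relation, 'p, ('p, 'n) relation) ftr" where
  "rel_ftr C D F = \<lparr>OMap = OMap F,
     AMap = (\<lambda>R. \<lparr>tdom = OMap F (tdom R), tcod = OMap F (tcod R),
       tmap = (\<Union>r\<in>tmap R.
         sub_class D (pairing D (AMap F (leg1 C R r)) (AMap F (leg2 C R r))))\<rparr>)\<rparr>"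


section \<open>Internal categories and groupoids\<close>

record ('o, 'm) icat =
  iObj :: 'o
  iArr :: 'o
  iSrc :: 'm
  iTgt :: 'm
  iUnit :: 'm
  iComp :: 'm

record ('o, 'm) igpd = "('o, 'm) icat" +
  iInv :: 'm

text \<open>The object of composable pairs consists of the \<open>(g, f)\<close> with \<open>s g = t f\<close>, and \<open>iComp\<close> takes
  \<open>(g, f)\<close> to ``g after f''.\<close>

definition comp_pairs :: "('o, 'm, 'z) cat_scheme \<Rightarrow> ('o, 'm, 'w) icat_scheme \<Rightarrow> 'o" where
  "comp_pairs C A = pb C (iSrc A) (iTgt A)"

definition cp1 :: "('o, 'm, 'z) cat_scheme \<Rightarrow> ('o, 'm, 'w) icat_scheme \<Rightarrow> 'm" where
  "cp1 C A = pb1 C (iSrc A) (iTgt A)"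

definition cp2 :: "('o, 'm, 'z) cat_scheme \<Rightarrow> ('o, 'm, 'w) icat_scheme \<Rightarrow> 'm" where
  "cp2 C A = pb2 C (iSrc A) (iTgt A)"

definition icomp :: "('o, 'm, 'z) cat_scheme \<Rightarrow> ('o, 'm, 'w) icat_scheme \<Rightarrow> 'm \<Rightarrow> 'm \<Rightarrow> 'm" where
  "icomp C A g f = iComp A \<cdot>\<^bsub>C\<^esub> pb_pairing C (iSrc A) (iTgt A) g f"

text \<open>Associativity is an equation on the object of composable triples \<open>(h, g, f)\<close>, the pullback
  of \<open>cp2\<close> along \<open>cp1\<close>, whose projections are \<open>(h, g)\<close> and \<open>(g, f)\<close>.\<close>

definition internal_category ::
  "('o, 'm, 'z) cat_scheme \<Rightarrow> ('o, 'm, 'w) icat_scheme \<Rightarrow> bool" where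
  "internal_category C A \<longleftrightarrow>
     (let s = iSrc A; t = iTgt A; u = iUnit A; m = iComp A;
          p = cp1 C A; q = cp2 C A; hg = pb1 C q p; gf = pb2 C q p in
       iObj A \<in> Obj C \<and> iArr A \<in> Obj C \<and>
       s \<in> hom C (iArr A) (iObj A) \<and> t \<in> hom C (iArr A) (iObj A) \<and>
       u \<in> hom C (iObj A) (iArr A) \<and> m \<in> hom C (comp_pairs C A) (iArr A) \<and>
       s \<cdot>\<^bsub>C\<^esub> u = Ident C (iObj A) \<and> t \<cdot>\<^bsub>C\<^esub> u = Ident C (iObj A) \<and>
       s \<cdot>\<^bsub>C\<^esub> m = s \<cdot>\<^bsub>C\<^esub> q \<and> t \<cdot>\<^bsub>C\<^esub> m = t \<cdot>\<^bsub>C\<^esub> p \<and>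
       icomp C A (Ident C (iArr A)) (u \<cdot>\<^bsub>C\<^esub> s) = Ident C (iArr A) \<and>
       icomp C A (u \<cdot>\<^bsub>C\<^esub> t) (Ident C (iArr A)) = Ident C (iArr A) \<and>
       icomp C A (m \<cdot>\<^bsub>C\<^esub> hg) (q \<cdot>\<^bsub>C\<^esub> gf) = icomp C A (p \<cdot>\<^bsub>C\<^esub> hg) (m \<cdot>\<^bsub>C\<^esub> gf))"

definition internal_groupoid ::
  "('o, 'm, 'z) cat_scheme \<Rightarrow> ('o, 'm, 'w) igpd_scheme \<Rightarrow> bool" where
  "internal_groupoid C A \<longleftrightarrow> internal_category C A \<and>
     iInv A \<in> hom C (iArr A) (iArr A) \<and>
     iSrc A \<cdot>\<^bsub>C\<^esub> iInv A = iTgt A \<and> iTgt A \<cdot>\<^bsub>C\<^esub> iInv A = iSrc A \<and>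
     icomp C A (iInv A) (Ident C (iArr A)) = iUnit A \<cdot>\<^bsub>C\<^esub> iSrc A \<and>
     icomp C A (Ident C (iArr A)) (iInv A) = iUnit A \<cdot>\<^bsub>C\<^esub> iTgt A"

definition internal_functor ::
  "('o, 'm, 'z) cat_scheme \<Rightarrow> ('o, 'm, 'w) icat_scheme \<Rightarrow> ('o, 'm, 'w) icat_scheme \<Rightarrow>
     'm \<times> 'm \<Rightarrow> bool" where
  "internal_functor C A B f \<longleftrightarrow>
     (case f of (f0, f1) \<Rightarrow>
       f0 \<in> hom C (iObj A) (iObj B) \<and> f1 \<in> hom C (iArr A) (iArr B) \<and>
       iSrc B \<cdot>\<^bsub>C\<^esub> f1 = f0 \<cdot>\<^bsub>C\<^esub> iSrc A \<and> iTgt B \<cdot>\<^bsub>C\<^esub> f1 = f0 \<cdot>\<^bsub>C\<^esub> iTgt A \<and>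
       f1 \<cdot>\<^bsub>C\<^esub> iUnit A = iUnit B \<cdot>\<^bsub>C\<^esub> f0 \<and>
       f1 \<cdot>\<^bsub>C\<^esub> iComp A = icomp C B (f1 \<cdot>\<^bsub>C\<^esub> cp1 C A) (f1 \<cdot>\<^bsub>C\<^esub> cp2 C A))"

definition ifun_ident ::
  "('o, 'm, 'z) cat_scheme \<Rightarrow> ('o, 'm, 'w) icat_scheme \<Rightarrow>
     (('o, 'm, 'w) icat_scheme, 'm \<times> 'm) tarr" where
  "ifun_ident C A = \<lparr>tdom = A, tcod = A, tmap = (Ident C (iObj A), Ident C (iArr A))\<rparr>"

definition ifun_comp ::
  "('o, 'm, 'z) cat_scheme \<Rightarrow> ('x, 'm \<times> 'm) tarr \<Rightarrow> ('x, 'm \<times> 'm) tarr \<Rightarrow>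
     ('x, 'm \<times> 'm) tarr" where
  "ifun_comp C G F = \<lparr>tdom = tdom F, tcod = tcod G,
     tmap = (fst (tmap G) \<cdot>\<^bsub>C\<^esub> fst (tmap F), snd (tmap G) \<cdot>\<^bsub>C\<^esub> snd (tmap F))\<rparr>"

definition Cat ::
  "('o, 'm, 'z) cat_scheme \<Rightarrow> (('o, 'm) icat, (('o, 'm) icat, 'm \<times> 'm) tarr) cat" where
  "Cat C = \<lparr>Obj = {A. internal_category C A},
     Arr = {F. internal_category C (tdom F) \<and> internal_category C (tcod F) \<and>
               internal_functor C (tdom F) (tcod F) (tmap F)},
     Dom = tdom, Cod = tcod, Ident = ifun_ident C, Cmp = ifun_comp C\<rparr>"

definition Gpd ::
  "('o, 'm, 'z) cat_scheme \<Rightarrow> (('o, 'm) igpd, (('o, 'm) igpd, 'm \<times> 'm) tarr) cat" where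
  "Gpd C = \<lparr>Obj = {A. internal_groupoid C A},
     Arr = {F. internal_groupoid C (tdom F) \<and> internal_groupoid C (tcod F) \<and>
               internal_functor C (tdom F) (tcod F) (tmap F) \<and>
               snd (tmap F) \<cdot>\<^bsub>C\<^esub> iInv (tdom F) = iInv (tcod F) \<cdot>\<^bsub>C\<^esub> snd (tmap F)},
     Dom = tdom, Cod = tcod, Ident = ifun_ident C, Cmp = ifun_comp C\<rparr>"

definition gpd_to_cat ::
  "(('o, 'm) igpd, (('o, 'm) igpd, 'm \<times> 'm) tarr,
    ('o, 'm) icat, (('o, 'm) icat, 'm \<times> 'm) tarr) ftr" where
  "gpd_to_cat = \<lparr>OMap = icat.truncate,
     AMap = (\<lambda>F. \<lparr>tdom = icat.truncate (tdom F), tcod = icat.truncate (tcod F),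
                  tmap = tmap F\<rparr>)\<rparr>"

definition arrows_ftr ::
  "(('o, 'm) igpd, (('o, 'm) igpd, 'm \<times> 'm) tarr, 'o, 'm) ftr" where
  "arrows_ftr = \<lparr>OMap = iArr, AMap = (\<lambda>F. snd (tmap F))\<rparr>"


section \<open>Relations respecting inverses\<close>

text \<open>Implication is inclusion of subobjects of \<open>A\<^sub>1 \<times> B\<^sub>1\<close>, conjunction is intersection, and
  \<open>R(a\<^sup>-\<^sup>1, b\<^sup>-\<^sup>1)\<close> is the preimage of \<open>R\<close> under the product of the two inversions.\<close>

definition respects_inverses ::
  "('o, 'm, 'z) cat_scheme \<Rightarrow> ('o, 'm) igpd \<Rightarrow> ('o, 'm) igpd \<Rightarrow> ('o, 'm) relation \<Rightarrow> bool" where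
  "respects_inverses C A B R \<longleftrightarrow>
     sub_le C (tmap R)
       (sub_inter C
         (sub_preimage C (prod_map C (iInv A) (iInv B)) (tmap R))
         (sub_preimage C
           (prod_map C (iUnit A \<cdot>\<^bsub>C\<^esub> iSrc A) (iUnit B \<cdot>\<^bsub>C\<^esub> iSrc B)) (tmap R)))"

definition GRel ::
  "('o, 'm, 'z) cat_scheme \<Rightarrow>
     (('o, 'm) igpd, (('o, 'm) igpd, ('o, 'm) relation) tarr) cat" where
  "GRel C = \<lparr>Obj = {A. internal_groupoid C A},
     Arr = {R. internal_groupoid C (tdom R) \<and> internal_groupoid C (tcod R) \<and>
               tmap R \<in> hom (Rel C) (iArr (tdom R)) (iArr (tcod R)) \<and>
               respects_inverses C (tdom R) (tcod R) (tmap R)},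
     Dom = tdom, Cod = tcod,
     Ident = (\<lambda>A. \<lparr>tdom = A, tcod = A, tmap = rel_ident C (iArr A)\<rparr>),
     Cmp = (\<lambda>S R. \<lparr>tdom = tdom R, tcod = tcod S, tmap = rel_comp C (tmap S) (tmap R)\<rparr>)\<rparr>"

text \<open>The Frobenius structure of an internal groupoid: the multiplication is the span
  \<open>A\<^sub>1 \<times> A\<^sub>1 \<leftarrow> A\<^sub>1 \<times>\<^bsub>A\<^sub>0\<^esub> A\<^sub>1 \<rightarrow> A\<^sub>1\<close>, the unit the span \<open>1 \<leftarrow> A\<^sub>0 \<rightarrow> A\<^sub>1\<close>.\<close>

definition gpd_frob ::
  "('o, 'm, 'z) cat_scheme \<Rightarrow> ('o, 'm) igpd \<Rightarrow> ('o, ('o, 'm) relation) frob" where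
  "gpd_frob C A = \<lparr>carr = iArr A,
     mult = span_rel C (pairing C (cp1 C A) (cp2 C A)) (iComp A),
     unt = span_rel C (bang C (iObj A)) (iUnit A)\<rparr>"

text \<open>Only this direction of the equivalence of \<open>CP (Rel C)\<close> and \<open>GRel C\<close> is free of choices: the
  other one has to choose an object of objects representing the unit of a Frobenius structure.\<close>

definition GRel_to_CP ::
  "('o, 'm, 'z) cat_scheme \<Rightarrow>
     (('o, 'm) igpd, (('o, 'm) igpd, ('o, 'm) relation) tarr,
      ('o, ('o, 'm) relation) frob, (('o, ('o, 'm) relation) frob, ('o, 'm) relation) tarr) ftr"
  where
  "GRel_to_CP C = \<lparr>OMap = gpd_frob C,
     AMap = (\<lambda>R. \<lparr>tdom = gpd_frob C (tdom R), tcod = gpd_frob C (tcod R), tmap = tmap R\<rparr>)\<rparr>"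

definition RelGpd_to_GRel ::
  "('o, 'm, 'z) cat_scheme \<Rightarrow>
     (('o, 'm) igpd, (('o, 'm) igpd, (('o, 'm) igpd, 'm \<times> 'm) tarr) relation,
      ('o, 'm) igpd, (('o, 'm) igpd, ('o, 'm) relation) tarr) ftr" where
  "RelGpd_to_GRel C = \<lparr>OMap = (\<lambda>A. A),
     AMap = (\<lambda>R. \<lparr>tdom = tdom R, tcod = tcod R,
                  tmap = AMap (rel_ftr (Gpd C) C arrows_ftr) R\<rparr>)\<rparr>"

end

theory Submission
  imports Defs
begin

text \<open>The internal logic of a regular category \<open>C\<close> is replaced by ordinary elements. A \<^emph>\<open>model\<close> of \<open>C\<close> is a
functor to sets that preserves finite limits and turns regular epimorphisms into surjections. For
every object \<open>X\<close> there is a model with a generic element of \<open>X\<close>, two arrows out of \<open>X\<close> being equal as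
soon as they agree at it (\<open>henkin_model\<close>, \<open>generic_eq\<close>). Hence equality of arrows, factorization
through a subobject and equality of relations may be tested on the elements of all models
(\<open>arr_eqI\<close>, \<open>mono_factorI\<close>, \<open>relation_eqI\<close>), where composition of relations is literally
\<open>\<exists>b. R a b \<and> S b c\<close>; conversely, an elementwise functional relation is the graph of an arrow
(\<open>functional_relation\<close>).

In a Mal'cev category a reflexive relation \<open>R\<close> is an equivalence relation, so that \<open>R = R\<^sup>\<dagger> \<circ> R\<close> is
positive; this is the first claim.

For the equivalence of \<open>CP (Rel C)\<close> with \<open>GRel C\<close>: a special dagger Frobenius structure is, element by
element, the composition of a groupoid, and the groupoid can be recovered in \<open>C\<close> because source,
target, composition and inversion are functional relations (\<open>frobenius_gpd_ex\<close>). The Choi matrix of \<open>R\<close>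
relates \<open>(a' y, b)\<close> to \<open>(a', z b)\<close> for \<open>R y z\<close>. If \<open>C\<close> is positively regular, it is positive iff it is
symmetric and reflexive on its support, which says that \<open>R\<close> is closed under inverses and
identities (\<open>positive_choi_iff\<close>).

The Mal'cev property enters the second part as difunctionality: if a span contains \<open>(a, b)\<close>, \<open>(c, b)\<close>
and \<open>(c, d)\<close> then it contains \<open>(a, d)\<close> (\<open>malcev_difunctional\<close>). Applied to suitable spans of composable
pairs, it gives that internal categories are groupoids, that morphisms of reflexive graphs preserve
composition, and that reflexive subgraphs are subcategories. So regularity of \<open>Gpd C\<close> is inherited from
\<open>C\<close> on arrows, a model of \<open>C\<close> yields a model of \<open>Gpd C\<close> on arrows, and a subobject of \<open>A \<times> B\<close> in \<open>Gpd C\<close>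
is the same thing as a relation between the objects of arrows that respects inverses.

Conversely, let \<open>R\<close> be any relation and \<open>T\<close> the relation \<open>R(a, b') \<and> R(a', b)\<close> between the points \<open>(a, b)\<close> and
\<open>(a', b')\<close> of \<open>R\<close>. As a relation between the indiscrete groupoid on the points of \<open>R\<close> and the terminal
groupoid it respects inverses. If it comes from a relation of groupoids then it is a
subgroupoid, so \<open>T\<close> is transitive and \<open>R\<close> is difunctional; a reflexive difunctional relation is an
equivalence relation (\<open>RelGpd_surjective_malcev\<close>).\<close>

section \<open>Elementary category theory\<close>

locale category =
 fixes C :: "('o, 'm, 'z) cat_scheme" (structure)
 assumes is_cat: "is_category C"
begin

lemma Dom_Obj [simp]: "f : Arr C ==> Dom C f : Obj C"
 and Cod_Obj [simp]: "f : Arr C ==> Cod C f : Obj C"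
 and Ident_Arr [simp]: "A : Obj C ==> Ident C A : Arr C"
 and Dom_Ident [simp]: "A : Obj C ==> Dom C (Ident C A) = A"
 and Cod_Ident [simp]: "A : Obj C ==> Cod C (Ident C A) = A"
 and Cmp_Arr [simp]: "[|f : Arr C; g : Arr C; Cod C f = Dom C g|] ==> g \<cdot> f : Arr C"
 and Dom_Cmp [simp]: "[|f : Arr C; g : Arr C; Cod C f = Dom C g|] ==> Dom C (g \<cdot> f) = Dom C f"
 and Cod_Cmp [simp]: "[|f : Arr C; g : Arr C; Cod C f = Dom C g|] ==> Cod C (g \<cdot> f) = Cod C g"
 and Cmp_Ident [simp]: "[|f : Arr C; Dom C f = A|] ==> f \<cdot> Ident C A = f"
 and Ident_Cmp [simp]: "[|f : Arr C; Cod C f = A|] ==> Ident C A \<cdot> f = f"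
 using is_cat by (auto simp: is_category_def hom_def)

lemma Cmp_assoc:
 "[|f : Arr C; g : Arr C; h : Arr C; Cod C f = Dom C g; Cod C g = Dom C h|]
  ==> (h \<cdot> g) \<cdot> f = h \<cdot> (g \<cdot> f)"
 using is_cat by (auto simp: is_category_def hom_def)

lemma hom_Obj: "f : hom C A B ==> A : Obj C" "f : hom C A B ==> B : Obj C"
 by (auto simp: hom_def)

lemma coequalizer_facts:
 assumes "is_coequalizer C f g e"
 shows "f : Arr C" "g : Arr C" "e : Arr C" "Dom C g = Dom C f" "Cod C g = Cod C f"
  "Dom C e = Cod C f" "e \<cdot> f = e \<cdot> g"
 using assms by (simp_all add: is_coequalizer_def)

lemma coequalizer_factor:
 assumes "is_coequalizer C f g e" and "h : Arr C" "Dom C h = Dom C e" "h \<cdot> f = h \<cdot> g"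
 obtains k where "k : Arr C" "Dom C k = Cod C e" "Cod C k = Cod C h" "k \<cdot> e = h"
proof -
 have "h : hom C (Cod C f) (Cod C h)"
  using assms coequalizer_facts[OF assms(1)] by (simp add: hom_def)
 moreover have "\<forall>X. \<forall>h\<in>hom C (Cod C f) X. h \<cdot> f = h \<cdot> g \<longrightarrow>
   (\<exists>!k. k : hom C (Cod C e) X \<and> k \<cdot> e = h)"
  using assms(1) unfolding is_coequalizer_def by (elim conjE)
 ultimately obtain k where "k : hom C (Cod C e) (Cod C h)" "k \<cdot> e = h"
  using assms(4) by metis
 then show ?thesis using that by (auto simp: hom_def)
qed

lemma coequalizer_epi:
 assumes "regular_epi C e" "f : Arr C" "g : Arr C" "Dom C f = Cod C e" "Dom C g = Cod C e"
  and "f \<cdot> e = g \<cdot> e"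
 shows "f = g"
proof -
 obtain a b where ab: "is_coequalizer C a b e" using assms by (auto simp: regular_epi_def)
 then have e: "e : Arr C" "a : Arr C" "b : Arr C" "Dom C e = Cod C a" "Cod C a = Cod C b"
  "Dom C a = Dom C b" "e \<cdot> a = e \<cdot> b" by (auto simp: is_coequalizer_def)
 have "Cod C (f \<cdot> e) = Cod C (g \<cdot> e)" using assms(6) by (rule arg_cong)
 then have cod: "Cod C f = Cod C g" using assms(2-5) e(1) by simp
 have "(f \<cdot> e) \<cdot> a = (f \<cdot> e) \<cdot> b" using assms(2-5) e by (simp add: Cmp_assoc)
 moreover have "f \<cdot> e : hom C (Cod C a) (Cod C f)" using assms(2-5) e by (simp add: hom_def)
 moreover have "\<forall>X. \<forall>h\<in>hom C (Cod C a) X. h \<cdot> a = h \<cdot> b \<longrightarrow>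
   (\<exists>!k. k : hom C (Cod C e) X \<and> k \<cdot> e = h)"
  using ab unfolding is_coequalizer_def by (elim conjE)
 ultimately have u: "\<exists>!k. k : hom C (Cod C e) (Cod C f) \<and> k \<cdot> e = f \<cdot> e"
  by blast
 have "f : hom C (Cod C e) (Cod C f)" "g : hom C (Cod C e) (Cod C f)"
  using assms(2-5) cod by (simp_all add: hom_def)
 then show ?thesis using u assms(6) by metis
qed

lemma is_monoD:
 "[|is_mono C m; f : Arr C; g : Arr C; Dom C f = Dom C g; Cod C f = Dom C m; Cod C g = Dom C m;
  m \<cdot> f = m \<cdot> g|] ==> f = g"
 by (auto simp: is_mono_def hom_def)

lemma regular_epi_Arr: "regular_epi C e ==> e : Arr C"
 by (auto simp: regular_epi_def is_coequalizer_def)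

lemma is_mono_Arr: "is_mono C m ==> m : Arr C"
 by (simp add: is_mono_def)

text \<open>A regular epimorphism is orthogonal to monomorphisms.\<close>

lemma regular_epi_mono_lift:
 assumes e: "regular_epi C e" and m: "is_mono C m" and f: "f : Arr C" "Dom C f = Cod C e"
  "Cod C f = Cod C m" and h: "h : Arr C" "Dom C h = Dom C e" "Cod C h = Dom C m" "m \<cdot> h = f \<cdot> e"
 shows "\<exists>k\<in>hom C (Cod C e) (Dom C m). m \<cdot> k = f"
proof -
 obtain a b where ab: "is_coequalizer C a b e" using e by (auto simp: regular_epi_def)
 then have ea: "e : Arr C" "a : Arr C" "b : Arr C" "Dom C e = Cod C a" "Cod C a = Cod C b"
  "Dom C a = Dom C b" "e \<cdot> a = e \<cdot> b" by (auto simp: is_coequalizer_def)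
 note mA = is_mono_Arr[OF m]
 have "(m \<cdot> h) \<cdot> a = (m \<cdot> h) \<cdot> b"
  unfolding h(4) using ea f by (simp add: Cmp_assoc)
 then have "m \<cdot> (h \<cdot> a) = m \<cdot> (h \<cdot> b)"
  using h(1-3) ea(1-6) mA by (simp add: Cmp_assoc)
 then have hab: "h \<cdot> a = h \<cdot> b"
  by (intro is_monoD[OF m, of "h \<cdot> a" "h \<cdot> b"]) (use h(1-3) ea(1-6) mA in simp_all)
 obtain k where k: "k : Arr C" "Dom C k = Cod C e" "Cod C k = Cod C h" "k \<cdot> e = h"
  using coequalizer_factor[OF ab h(1,2) hab] .
 have "(m \<cdot> k) \<cdot> e = f \<cdot> e"
  using k h ea(1) mA by (simp add: Cmp_assoc)
 then have "m \<cdot> k = f"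
  by (intro coequalizer_epi[OF e, of "m \<cdot> k" f]) (use k(1-3) h(1-3) f mA in simp_all)
 then show ?thesis using k h(3) by (auto simp: hom_def)
qed

lemma pullback_facts:
 assumes "is_pullback C f g P p q"
 shows "f : Arr C" "g : Arr C" "Cod C g = Cod C f" "P : Obj C" "p : Arr C" "q : Arr C"
  "Dom C p = P" "Dom C q = P" "Cod C p = Dom C f" "Cod C q = Dom C g" "f \<cdot> p = g \<cdot> q"
 using assms by (simp_all add: is_pullback_def hom_def)

lemma pullback_ex1:
 assumes "is_pullback C f g P p q" and "a : Arr C" "b : Arr C" "Dom C a = Dom C b"
  "Cod C a = Dom C f" "Cod C b = Dom C g" "f \<cdot> a = g \<cdot> b"
 shows "\<exists>!h. h : hom C (Dom C a) P \<and> p \<cdot> h = a \<and> q \<cdot> h = b"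
proof -
 have "\<forall>X. \<forall>a\<in>hom C X (Dom C f). \<forall>b\<in>hom C X (Dom C g). f \<cdot> a = g \<cdot> b \<longrightarrow>
   (\<exists>!h. h : hom C X P \<and> p \<cdot> h = a \<and> q \<cdot> h = b)"
  using assms(1) unfolding is_pullback_def by (elim conjE)
 moreover have "a : hom C (Dom C a) (Dom C f)" "b : hom C (Dom C a) (Dom C g)"
  using assms(2-6) by (simp_all add: hom_def)
 ultimately show ?thesis using assms(7) by blast
qed

lemma product_ex1:
 assumes "is_product C A B P p q" and "a : Arr C" "b : Arr C" "Dom C a = Dom C b"
  "Cod C a = A" "Cod C b = B"
 shows "\<exists>!h. h : hom C (Dom C a) P \<and> p \<cdot> h = a \<and> q \<cdot> h = b"
proof -
 have "\<forall>X. \<forall>a\<in>hom C X A. \<forall>b\<in>hom C X B. \<exists>!h. h : hom C X P \<and> p \<cdot> h = a \<and> q \<cdot> h = b"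
  using assms(1) unfolding is_product_def by (elim conjE)
 moreover have "a : hom C (Dom C a) A" "b : hom C (Dom C a) B"
  using assms(2-6) by (simp_all add: hom_def)
 ultimately show ?thesis by blast
qed

end

locale regular_category = category C for C :: "('o, 'm, 'z) cat_scheme" (structure) +
 assumes regular: "regular C"
begin

lemma terminal_one: "is_terminal C (one C)"
proof -
 obtain T where "is_terminal C T"
  using regular by (auto simp: regular_def has_finite_limits_def)
 then show ?thesis unfolding one_def by (rule someI)
qed

lemma one_Obj [simp]: "one C : Obj C"
 using terminal_one by (simp add: is_terminal_def)

lemma bang_hom: "A : Obj C ==> bang C A : hom C A (one C)"
 using terminal_one unfolding is_terminal_def bang_def by (metis theI')

lemma bang_simps [simp]:
 "A : Obj C ==> bang C A : Arr C" "A : Obj C ==> Dom C (bang C A) = A"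
 "A : Obj C ==> Cod C (bang C A) = one C"
 using bang_hom by (auto simp: hom_def)

lemma terminal_unique:
 "[|f : Arr C; g : Arr C; Dom C f = Dom C g; Cod C f = one C; Cod C g = one C|] ==> f = g"
proof -
 assume a: "f : Arr C" "g : Arr C" "Dom C f = Dom C g" "Cod C f = one C" "Cod C g = one C"
 then have "\<exists>!k. k : hom C (Dom C f) (one C)"
  using terminal_one by (auto simp: is_terminal_def)
 then show ?thesis using a by (auto simp: hom_def)
qed

lemma pullback_ex:
 "[|f : Arr C; g : Arr C; Cod C f = Cod C g|] ==> \<exists>P p q. is_pullback C f g P p q"
 using regular by (auto simp: regular_def has_finite_limits_def)

lemma pb_pullback:
 assumes "f : Arr C" "g : Arr C" "Cod C f = Cod C g"
 shows "is_pullback C f g (pb C f g) (pb1 C f g) (pb2 C f g)"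
proof -
 from pullback_ex[OF assms] have "\<exists>x. (case x of (P, p, q) => is_pullback C f g P p q)" by auto
 from someI_ex[OF this] show ?thesis
  by (simp add: pb_def pb1_def pb2_def pb_cone_def split_def)
qed

lemma pb_simps [simp]:
 assumes "f : Arr C" "g : Arr C" "Cod C f = Cod C g"
 shows "pb C f g : Obj C" "pb1 C f g : Arr C" "pb2 C f g : Arr C"
  "Dom C (pb1 C f g) = pb C f g" "Dom C (pb2 C f g) = pb C f g"
  "Cod C (pb1 C f g) = Dom C f" "Cod C (pb2 C f g) = Dom C g"
 using pullback_facts[OF pb_pullback[OF assms]] by simp_all

lemma pb_commutes:
 assumes "f : Arr C" "g : Arr C" "Cod C f = Cod C g"
 shows "f \<cdot> pb1 C f g = g \<cdot> pb2 C f g"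
 using pullback_facts[OF pb_pullback[OF assms]] by simp

lemma pb_pairing_props:
 assumes "f : Arr C" "g : Arr C" "Cod C f = Cod C g" and "a : Arr C" "b : Arr C"
  "Dom C a = Dom C b" "Cod C a = Dom C f" "Cod C b = Dom C g" "f \<cdot> a = g \<cdot> b"
 shows "pb_pairing C f g a b : hom C (Dom C a) (pb C f g) \<and>
  pb1 C f g \<cdot> pb_pairing C f g a b = a \<and> pb2 C f g \<cdot> pb_pairing C f g a b = b"
 unfolding pb_pairing_def by (rule theI'[OF pullback_ex1[OF pb_pullback[OF assms(1-3)] assms(4-)]])

lemma pb_pairing_simps [simp]:
 assumes "f : Arr C" "g : Arr C" "Cod C f = Cod C g" and "a : Arr C" "b : Arr C"
  "Dom C a = Dom C b" "Cod C a = Dom C f" "Cod C b = Dom C g" "f \<cdot> a = g \<cdot> b"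
 shows "pb_pairing C f g a b : Arr C" "Dom C (pb_pairing C f g a b) = Dom C a"
  "Cod C (pb_pairing C f g a b) = pb C f g"
  "pb1 C f g \<cdot> pb_pairing C f g a b = a" "pb2 C f g \<cdot> pb_pairing C f g a b = b"
 using pb_pairing_props[OF assms] by (auto simp: hom_def)

lemma product_iff_pullback:
 assumes "A : Obj C" "B : Obj C"
 shows "is_product C A B P p q \<longleftrightarrow> is_pullback C (bang C A) (bang C B) P p q"
proof -
 have "bang C A \<cdot> a = bang C B \<cdot> b" if "a : hom C X A" "b : hom C X B" for a b X
  by (rule terminal_unique) (use that assms in "simp_all add: hom_def")
 then have "(\<forall>X. \<forall>a\<in>hom C X A. \<forall>b\<in>hom C X B. bang C A \<cdot> a = bang C B \<cdot> b \<longrightarrow> Q X a b) \<longleftrightarrow>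
   (\<forall>X. \<forall>a\<in>hom C X A. \<forall>b\<in>hom C X B. Q X a b)" for Q
  by blast
 moreover have "bang C A \<cdot> p = bang C B \<cdot> q" if "p : hom C P A" "q : hom C P B"
  by (rule terminal_unique) (use that assms in "simp_all add: hom_def")
 ultimately show ?thesis
  unfolding is_product_def is_pullback_def using assms by auto
qed

lemma prd_product:
 assumes "A : Obj C" "B : Obj C"
 shows "is_product C A B (prd C A B) (pr1 C A B) (pr2 C A B)"
proof -
 have "\<exists>P p q. is_product C A B P p q"
  using assms pullback_ex[of "bang C A" "bang C B"] by (simp add: product_iff_pullback)
 then have "\<exists>x. (case x of (P, p, q) => is_product C A B P p q)" by auto
 from someI_ex[OF this] show ?thesis
  by (simp add: prd_def pr1_def pr2_def prod_cone_def split_def)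
qed

lemma prd_simps [simp]:
 assumes "A : Obj C" "B : Obj C"
 shows "prd C A B : Obj C" "pr1 C A B : Arr C" "pr2 C A B : Arr C"
  "Dom C (pr1 C A B) = prd C A B" "Dom C (pr2 C A B) = prd C A B"
  "Cod C (pr1 C A B) = A" "Cod C (pr2 C A B) = B"
 using prd_product[OF assms] by (simp_all add: is_product_def hom_def)

lemma pairing_props:
 assumes "f : Arr C" "g : Arr C" "Dom C f = Dom C g"
 shows "pairing C f g : hom C (Dom C f) (prd C (Cod C f) (Cod C g)) \<and>
   pr1 C (Cod C f) (Cod C g) \<cdot> pairing C f g = f \<and> pr2 C (Cod C f) (Cod C g) \<cdot> pairing C f g = g"
 unfolding pairing_def
 by (rule theI'[OF product_ex1[OF prd_product]]) (use assms in simp_all)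

lemma pairing_simps [simp]:
 assumes "f : Arr C" "g : Arr C" "Dom C f = Dom C g"
 shows "pairing C f g : Arr C" "Dom C (pairing C f g) = Dom C f"
  "Cod C (pairing C f g) = prd C (Cod C f) (Cod C g)"
  "[|A = Cod C f; B = Cod C g|] ==> pr1 C A B \<cdot> pairing C f g = f"
  "[|A = Cod C f; B = Cod C g|] ==> pr2 C A B \<cdot> pairing C f g = g"
 using pairing_props[OF assms] by (auto simp: hom_def)

lemma pairing_unique:
 assumes "h : Arr C" "k : Arr C" "A : Obj C" "B : Obj C" "Dom C h = Dom C k"
  "Cod C h = prd C A B" "Cod C k = prd C A B"
  "pr1 C A B \<cdot> h = pr1 C A B \<cdot> k" "pr2 C A B \<cdot> h = pr2 C A B \<cdot> k"
 shows "h = k"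
proof -
 have "\<exists>!l. l : hom C (Dom C (pr1 C A B \<cdot> h)) (prd C A B) \<and> pr1 C A B \<cdot> l = pr1 C A B \<cdot> h \<and>
   pr2 C A B \<cdot> l = pr2 C A B \<cdot> h"
  by (rule product_ex1[OF prd_product]) (use assms in simp_all)
 moreover have "h : hom C (Dom C (pr1 C A B \<cdot> h)) (prd C A B)"
  "k : hom C (Dom C (pr1 C A B \<cdot> h)) (prd C A B)"
  using assms(1-7) by (simp_all add: hom_def)
 ultimately show ?thesis using assms(8,9) by metis
qed

lemma pairing_Cmp:
 assumes "f : Arr C" "g : Arr C" "Dom C f = Dom C g" "h : Arr C" "Cod C h = Dom C f"
 shows "pairing C f g \<cdot> h = pairing C (f \<cdot> h) (g \<cdot> h)"
 by (rule pairing_unique[of _ _ "Cod C f" "Cod C g"]) (use assms in "simp_all flip: Cmp_assoc")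

section \<open>Covers and images\<close>

text \<open>Composites of regular epimorphisms. They are the covers of a Grothendieck topology, and the
 only properties that matter below are stability under pullback and composition, and
 orthogonality to monomorphisms; that they are again regular epimorphisms need not be known in
 advance.\<close>

inductive cover :: "'m => bool" where
 cover_Ident: "A : Obj C ==> cover (Ident C A)"
| cover_Cmp_regular: "[|cover c; regular_epi C e; Cod C e = Dom C c|] ==> cover (c \<cdot> e)"

lemma cover_Arr [simp]: "cover c ==> c : Arr C"
 by (induction rule: cover.induct) (simp_all add: regular_epi_Arr)

lemma regular_epi_cover: "regular_epi C e ==> cover e"
 using cover_Cmp_regular[OF cover_Ident[of "Cod C e"], of e] by (simp add: regular_epi_Arr)

lemma cover_Cmp: "[|cover d; cover c; Cod C d = Dom C c|] ==> cover (c \<cdot> d)"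
proof (induction rule: cover.induct)
 case (cover_Cmp_regular d e)
 then have "cover ((c \<cdot> d) \<cdot> e)"
  by (intro cover.cover_Cmp_regular[of "c \<cdot> d" e]) (simp_all add: regular_epi_Arr)
 then show ?case using cover_Cmp_regular by (simp add: Cmp_assoc regular_epi_Arr)
qed simp

lemma cover_epi:
 "[|cover c; f : Arr C; g : Arr C; Dom C f = Cod C c; Dom C g = Cod C c; f \<cdot> c = g \<cdot> c|] ==> f = g"
proof (induction rule: cover.induct)
 case (cover_Cmp_regular c e)
 note e = regular_epi_Arr[OF cover_Cmp_regular(2)]
 have "f \<cdot> c = g \<cdot> c"
  by (intro coequalizer_epi[of e "f \<cdot> c" "g \<cdot> c"]) (use cover_Cmp_regular e in "simp_all add: Cmp_assoc")
 then show ?case using cover_Cmp_regular e by simp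
qed simp

lemma cover_mono_lift:
 "[|cover c; is_mono C m; f : Arr C; Dom C f = Cod C c; Cod C f = Cod C m;
  h : Arr C; Dom C h = Dom C c; Cod C h = Dom C m; m \<cdot> h = f \<cdot> c|]
  ==> \<exists>k\<in>hom C (Dom C f) (Dom C m). m \<cdot> k = f"
proof (induction arbitrary: h rule: cover.induct)
 case (cover_Ident A)
 then show ?case by (auto simp: hom_def)
next
 case (cover_Cmp_regular c e)
 note e = regular_epi_Arr[OF cover_Cmp_regular(2)]
 have "\<exists>k\<in>hom C (Cod C e) (Dom C m). m \<cdot> k = f \<cdot> c"
  by (rule regular_epi_mono_lift[where h = h]) (use cover_Cmp_regular e in "simp_all add: Cmp_assoc")
 then show ?case using cover_Cmp_regular e by (auto simp: hom_def)
qed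

lemma cover_pullback:
 "[|cover c; f : Arr C; Cod C f = Cod C c|]
  ==> \<exists>d g. cover d \<and> Cod C d = Dom C f \<and> g : hom C (Dom C d) (Dom C c) \<and> c \<cdot> g = f \<cdot> d"
proof (induction rule: cover.induct)
 case (cover_Ident A)
 then show ?case
  by (intro exI[of _ "Ident C (Dom C f)"] exI[of _ f]) (auto simp: hom_def intro: cover.cover_Ident)
next
 case (cover_Cmp_regular c e)
 note e = regular_epi_Arr[OF cover_Cmp_regular(2)]
 from cover_Cmp_regular e obtain d g where d: "cover d" "Cod C d = Dom C f"
  "g : Arr C" "Dom C g = Dom C d" "Cod C g = Dom C c" "c \<cdot> g = f \<cdot> d" by (auto simp: hom_def)
 have P: "is_pullback C e g (pb C e g) (pb1 C e g) (pb2 C e g)"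
  using d e cover_Cmp_regular by (intro pb_pullback) auto
 then have "regular_epi C (pb2 C e g)"
  using cover_Cmp_regular regular unfolding regular_def by blast
 then have "cover (d \<cdot> pb2 C e g)"
  using d e cover_Cmp_regular by (intro cover.cover_Cmp_regular) auto
 moreover have "(c \<cdot> e) \<cdot> pb1 C e g = f \<cdot> (d \<cdot> pb2 C e g)"
 proof -
  have "(c \<cdot> e) \<cdot> pb1 C e g = c \<cdot> (g \<cdot> pb2 C e g)"
   using d e cover_Cmp_regular pb_commutes[of e g] by (simp add: Cmp_assoc)
  also have "\<dots> = (f \<cdot> d) \<cdot> pb2 C e g"
   using d e cover_Cmp_regular by (simp flip: Cmp_assoc)
  finally show ?thesis using d e cover_Cmp_regular by (simp add: Cmp_assoc)
 qed
 ultimately show ?case using d e cover_Cmp_regular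
  by (intro exI[of _ "d \<cdot> pb2 C e g"] exI[of _ "pb1 C e g"]) (simp add: hom_def)
qed

text \<open>The image of \<open>f\<close> is the coequalizer \<open>e\<close> of its kernel pair. That the induced \<open>k\<close> with
 \<open>k \<cdot> e = f\<close> is monic is checked after lifting two competing arrows along \<open>e\<close> on a common cover.\<close>

lemma image_ex:
 assumes f: "f : Arr C"
 shows "\<exists>k. is_image C f k"
proof -
 let ?p = "pb1 C f f" and ?q = "pb2 C f f"
 have P: "is_pullback C f f (pb C f f) ?p ?q" using f by (intro pb_pullback) auto
 then obtain e where ce: "is_coequalizer C ?p ?q e" using regular unfolding regular_def by blast
 then have e: "e : Arr C" "Dom C e = Dom C f" "e \<cdot> ?p = e \<cdot> ?q"
  using f by (auto simp: is_coequalizer_def)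
 have re: "regular_epi C e" using ce by (auto simp: regular_epi_def)
 obtain k where k: "k : Arr C" "Dom C k = Cod C e" "Cod C k = Cod C f" "k \<cdot> e = f"
  using coequalizer_factor[OF ce f _ pb_commutes[of f f]] f e by auto
 have "a = b" if ab: "a : Arr C" "b : Arr C" "Dom C a = Dom C b" "Cod C a = Cod C e"
   "Cod C b = Cod C e" and eq: "k \<cdot> a = k \<cdot> b" for a b
 proof -
  obtain c a' where c: "cover c" "Cod C c = Dom C a" "a' : Arr C" "Dom C a' = Dom C c"
   "Cod C a' = Dom C e" "e \<cdot> a' = a \<cdot> c"
   using cover_pullback[OF regular_epi_cover[OF re], of a] ab by (auto simp: hom_def)
  obtain d b' where d: "cover d" "Cod C d = Dom C c" "b' : Arr C" "Dom C b' = Dom C d"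
   "Cod C b' = Dom C e" "e \<cdot> b' = (b \<cdot> c) \<cdot> d"
   using cover_pullback[OF regular_epi_cover[OF re], of "b \<cdot> c"] ab c by (auto simp: hom_def)
  define a'' where "a'' = a' \<cdot> d"
  have a'': "a'' : Arr C" "Dom C a'' = Dom C d" "Cod C a'' = Dom C e" "e \<cdot> a'' = (a \<cdot> c) \<cdot> d"
   using c d e ab unfolding a''_def by (simp_all flip: Cmp_assoc)
  have fe: "f \<cdot> x = k \<cdot> (e \<cdot> x)" if "x : Arr C" "Cod C x = Dom C e" for x
   using that k e by (simp flip: Cmp_assoc)
  have "f \<cdot> a'' = f \<cdot> b'"
   using fe[of a''] fe[of b'] a'' d e f ab c k
   by (simp flip: Cmp_assoc) (simp add: eq)
  then obtain h where h: "h : Arr C" "Dom C h = Dom C d" "Cod C h = pb C f f"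
   "?p \<cdot> h = a''" "?q \<cdot> h = b'"
   using that[of "pb_pairing C f f a'' b'"] a''(1-3) d(1-5) e(2) f by simp
  have "(e \<cdot> ?p) \<cdot> h = (e \<cdot> ?q) \<cdot> h" using e(3) by simp
  then have "e \<cdot> a'' = e \<cdot> b'"
   using h e(1,2) f by (simp add: Cmp_assoc)
  then have "(a \<cdot> c) \<cdot> d = (b \<cdot> c) \<cdot> d" using a'' d by simp
  then have "a \<cdot> c = b \<cdot> c"
   by (intro cover_epi[of d "a \<cdot> c" "b \<cdot> c"]) (use ab c d in simp_all)
  then show "a = b" by (intro cover_epi[of c a b]) (use ab c in simp_all)
 qed
 then have "is_mono C k" using k by (auto simp: is_mono_def hom_def)
 then have "is_image C f k"
  unfolding is_image_def using k e re by (intro conjI bexI[of _ e]) (simp_all add: hom_def)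
 then show ?thesis ..
qed

end

section \<open>Regular functors to sets\<close>

text \<open>A regular functor from \<open>C\<close> to sets. The elements of all objects share one type, \<open>N A\<close> being the set of
elements of \<open>A\<close>; only the values of \<open>ap f\<close> on the elements of the domain matter.\<close>

locale model = regular_category C for C :: "('o, 'm, 'z) cat_scheme" (structure) +
 fixes N :: "'o => 'a set" and ap :: "'m => 'a => 'a"
 assumes ap_in: "[|f : Arr C; x : N (Dom C f)|] ==> ap f x : N (Cod C f)"
  and ap_Ident: "[|A : Obj C; x : N A|] ==> ap (Ident C A) x = x"
  and ap_Cmp: "[|f : Arr C; g : Arr C; Cod C f = Dom C g; x : N (Dom C f)|]
   ==> ap (g \<cdot> f) x = ap g (ap f x)"
  and ap_terminal: "is_terminal C T ==> \<exists>!x. x : N T"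
  and ap_pullback: "[|is_pullback C f g P p q; x : N (Dom C f); y : N (Dom C g); ap f x = ap g y|]
   ==> \<exists>!z. z : N P \<and> ap p z = x \<and> ap q z = y"
  and ap_regular_epi: "[|regular_epi C e; y : N (Cod C e)|] ==> \<exists>x\<in>N (Dom C e). ap e x = y"

text \<open>Names for elements: the generic element of an object \<open>X\<close>, the value of an arrow, and a
 witness \<open>z\<close> for \<open>\<exists>z. p z = x \<and> q z = y\<close>.\<close>

datatype 'm tm = Gen | App 'm "'m tm" | Wit 'm 'm "'m tm" "'m tm"

primrec children :: "'m tm => 'm tm set" where
 "children Gen = {}"
| "children (App f s) = {s}"
| "children (Wit p q s t) = {s, t}"

primrec subterms :: "'m tm => 'm tm set" where
 "subterms Gen = {Gen}"
| "subterms (App f s) = insert (App f s) (subterms s)"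
| "subterms (Wit p q s t) = insert (Wit p q s t) (subterms s \<union> subterms t)"

lemma subterms_refl: "t : subterms t"
 by (cases t) simp_all

lemma finite_subterms: "finite (subterms t)"
 by (induction t) simp_all

lemma children_subterms: "s : subterms t ==> children s \<subseteq> subterms t"
 by (induction t) (auto simp: subterms_refl)

lemma children_smaller: "s : children t ==> size s < size t"
 by (cases t) auto

context regular_category
begin

text \<open>\<open>\<exists>z. p z = a \<and> q z = b\<close> in the internal logic: it holds at the stage \<open>Y\<close> if there is a
 witness on some cover of \<open>Y\<close>.\<close>

definition locally_ex :: "'o => 'm => 'm => 'm => 'm => bool" where
 "locally_ex Y p q a b \<longleftrightarrow> p : Arr C \<and> q : Arr C \<and> Dom C p = Dom C q \<and>
   Cod C p = Cod C a \<and> Cod C q = Cod C b \<and>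
   (\<exists>c h. cover c \<and> Cod C c = Y \<and> h : hom C (Dom C c) (Dom C p) \<and> p \<cdot> h = a \<cdot> c \<and> q \<cdot> h = b \<cdot> c)"

text \<open>The axiom belonging to a name, for a partial interpretation \<open>\<rho>\<close> of names by arrows
 out of \<open>Y\<close>.\<close>

fun henkin :: "'o => ('m tm => 'm option) => 'm tm => bool" where
 "henkin Y \<rho> Gen = True"
| "henkin Y \<rho> (App f s) = (\<forall>a. \<rho> s = Some a \<longrightarrow> f : Arr C \<longrightarrow> Cod C a = Dom C f \<longrightarrow>
   \<rho> (App f s) = Some (f \<cdot> a))"
| "henkin Y \<rho> (Wit p q s t) = (\<forall>a b. \<rho> s = Some a \<longrightarrow> \<rho> t = Some b \<longrightarrow> locally_ex Y p q a b \<longrightarrow>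
   (\<exists>h\<in>hom C Y (Dom C p). \<rho> (Wit p q s t) = Some h \<and> p \<cdot> h = a \<and> q \<cdot> h = b))"

text \<open>An interpretation at the stage \<open>Y\<close> with an element of \<open>X\<close> as value of the generic name that satisfies
the axioms of all names in \<open>J\<close>.\<close>

definition sat :: "'o => 'm tm set => 'o => ('m tm => 'm option) => bool" where
 "sat X J Y \<rho> \<longleftrightarrow> Y : Obj C \<and> (\<exists>x\<in>hom C Y X. \<rho> Gen = Some x) \<and>
   (\<forall>t a. \<rho> t = Some a \<longrightarrow> a : Arr C \<and> Dom C a = Y) \<and> (\<forall>t\<in>J. henkin Y \<rho> t)"

text \<open>Entailment with compactness built in: the property holds in all interpretations that satisfy some
finite set of axioms. As every finite set of axioms is satisfiable on a cover of \<open>X\<close>, what is forced is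
true locally.\<close>

definition forced :: "'o => ('o => ('m tm => 'm option) => bool) => bool" where
 "forced X P \<longleftrightarrow> (\<exists>J. finite J \<and> (\<forall>Y \<rho>. sat X J Y \<rho> \<longrightarrow> P Y \<rho>))"

lemma henkin_cong:
 assumes "\<rho>' t = \<rho> t" and "\<And>s. s : children t ==> \<rho>' s = \<rho> s"
 shows "henkin Y \<rho>' t = henkin Y \<rho> t"
 using assms by (cases t) auto

lemma locally_ex_refl:
 assumes "h : hom C Y (Dom C p)" "p : Arr C" "q : Arr C" "Dom C q = Dom C p"
 shows "locally_ex Y p q (p \<cdot> h) (q \<cdot> h)"
proof -
 have "Y : Obj C" using assms by (auto simp: hom_def)
 then show ?thesis unfolding locally_ex_def using assms
  by (intro conjI exI[of _ "Ident C Y"] exI[of _ h]) (simp_all add: hom_def cover_Ident)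
qed

lemma locally_ex_cover:
 assumes "locally_ex (Dom C d) p q (a \<cdot> d) (b \<cdot> d)" and "cover d" and "a : Arr C" "b : Arr C"
  "Dom C a = Cod C d" "Dom C b = Cod C d"
 shows "locally_ex (Cod C d) p q a b"
proof -
 obtain c h where c: "cover c" "Cod C c = Dom C d" "h : hom C (Dom C c) (Dom C p)"
  "p \<cdot> h = (a \<cdot> d) \<cdot> c" "q \<cdot> h = (b \<cdot> d) \<cdot> c"
  using assms(1) unfolding locally_ex_def by blast
 have "cover (d \<cdot> c)" using c assms by (intro cover_Cmp)
 moreover have "p \<cdot> h = a \<cdot> (d \<cdot> c)" "q \<cdot> h = b \<cdot> (d \<cdot> c)"
  using c assms by (simp_all add: Cmp_assoc)
 moreover have "h : hom C (Dom C (d \<cdot> c)) (Dom C p)" "Cod C (d \<cdot> c) = Cod C d"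
  using c assms by simp_all
 moreover have "p : Arr C" "q : Arr C" "Dom C p = Dom C q" "Cod C p = Cod C a" "Cod C q = Cod C b"
  using assms unfolding locally_ex_def by simp_all
 ultimately show ?thesis unfolding locally_ex_def by blast
qed

lemma sat_restrict:
 assumes "sat X J Y \<rho>" "cover d" "Cod C d = Y"
 shows "sat X J (Dom C d) (\<lambda>t. map_option (\<lambda>f. f \<cdot> d) (\<rho> t))"
proof -
 let ?r = "\<lambda>t. map_option (\<lambda>f. f \<cdot> d) (\<rho> t)"
 have ty: "a : Arr C \<and> Dom C a = Cod C d" if "\<rho> t = Some a" for t a
  using assms that unfolding sat_def by blast
 have "henkin (Dom C d) ?r t" if "t : J" for t
 proof -
  have h: "henkin Y \<rho> t" using assms that by (simp add: sat_def)
  show ?thesis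
  proof (cases t)
   case (App f s)
   show ?thesis unfolding App henkin.simps
   proof (intro allI impI)
    fix a' assume "?r s = Some a'" and f: "f : Arr C" "Cod C a' = Dom C f"
    then obtain a where a: "\<rho> s = Some a" "a' = a \<cdot> d" by auto
    then have "Cod C a = Dom C f" using f ty[of s a] assms(2) by simp
    then show "?r (App f s) = Some (f \<cdot> a')"
     using h a f ty[of s a] assms(2) unfolding App by (simp add: Cmp_assoc)
   qed
  next
   case (Wit p q s u)
   show ?thesis unfolding Wit henkin.simps
   proof (intro allI impI)
    fix a' b' assume a': "?r s = Some a'" "?r u = Some b'" and l: "locally_ex (Dom C d) p q a' b'"
    then obtain a b where ab: "\<rho> s = Some a" "\<rho> u = Some b" "a' = a \<cdot> d" "b' = b \<cdot> d" by auto
    then have "locally_ex Y p q a b"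
     using locally_ex_cover[of d p q a b] l assms ty by auto
    then obtain h where "h : hom C Y (Dom C p)" "\<rho> (Wit p q s u) = Some h" "p \<cdot> h = a" "q \<cdot> h = b"
     "p : Arr C" "q : Arr C" "Dom C p = Dom C q"
     using h ab unfolding Wit henkin.simps locally_ex_def by blast
    then show "\<exists>h\<in>hom C (Dom C d) (Dom C p). ?r (Wit p q s u) = Some h \<and> p \<cdot> h = a' \<and> q \<cdot> h = b'"
     using ab assms by (intro bexI[of _ "h \<cdot> d"]) (auto simp: hom_def simp flip: Cmp_assoc)
   qed
  qed simp
 qed
 moreover have "\<exists>x\<in>hom C (Dom C d) X. ?r Gen = Some x"
  using assms unfolding sat_def by (auto simp: hom_def)
 ultimately show ?thesis using assms ty unfolding sat_def by auto
qed

text \<open>A finite set of axioms can be satisfied after passing to a cover: the names are interpreted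
 one after the other, and each witness costs one further cover.\<close>

lemma sat_ex:
 assumes X: "X : Obj C"
 shows "[|finite J; \<And>t. t : J ==> children t \<subseteq> J|]
  ==> \<exists>Y \<rho> c. sat X J Y \<rho> \<and> \<rho> Gen = Some c \<and> cover c \<and> Cod C c = X"
proof (induction "card J" arbitrary: J)
 case 0
 then have "J = {}" by simp
 have "sat X J X [Gen \<mapsto> Ident C X]"
  using X \<open>J = {}\<close> by (auto simp: sat_def hom_def split: if_splits)
 then show ?case using X
  by (intro exI[of _ X] exI[of _ "[Gen \<mapsto> Ident C X]"] exI[of _ "Ident C X"])
   (simp add: cover_Ident del: fun_upd_apply, simp)
next
 case (Suc n)
 then have "J \<noteq> {}" by auto
 then have "Max (size ` J) : size ` J" using Suc.prems(1) by (intro Max_in) auto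
 then obtain t where t: "t : J" "size t = Max (size ` J)" by auto
 have tmax: "size s \<le> size t" if "s : J" for s
  unfolding t(2) using Suc.prems(1) that by (intro Max_ge) auto
 let ?J = "J - {t}"
 have cl: "children s \<subseteq> ?J" if "s : J" for s
  using Suc.prems(2)[OF that] children_smaller[of t s] tmax[OF that] by auto
 have "n = card ?J" using Suc.hyps(2) t Suc.prems(1) by simp
 then obtain Y \<rho> c where IH: "sat X ?J Y \<rho>" "\<rho> Gen = Some c" "cover c" "Cod C c = X"
  using Suc.hyps(1)[of ?J] Suc.prems(1) cl by blast
 have J: "sat X J Y \<rho>'" if "sat X ?J Y \<rho>'" "henkin Y \<rho>' t" for Y \<rho>'
  using that by (auto simp: sat_def)
 have upd: "sat X J Y (\<rho>'(t \<mapsto> a))"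
  if "sat X ?J Y \<rho>'" "henkin Y (\<rho>'(t \<mapsto> a)) t" "a : Arr C" "Dom C a = Y" "t \<noteq> Gen" for Y \<rho>' a
 proof (rule J)
  have "henkin Y (\<rho>'(t \<mapsto> a)) s" if "s : ?J" for s
  proof -
   have "henkin Y (\<rho>'(t \<mapsto> a)) s = henkin Y \<rho>' s"
    using that cl[of s] by (intro henkin_cong) auto
   then show ?thesis using \<open>sat X ?J Y \<rho>'\<close> that by (simp add: sat_def)
  qed
  then show "sat X ?J Y (\<rho>'(t \<mapsto> a))" using that unfolding sat_def by auto
 qed fact
 have cn: "s \<noteq> t" if "s : children t" for s using that children_smaller by blast
 show ?case
 proof (cases "henkin Y \<rho> t")
  case True
  then show ?thesis using J IH by blast
 next
  case False
  show ?thesis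
  proof (cases t)
   case Gen
   then show ?thesis using False by simp
  next
   case (App f s)
   then obtain a where a: "\<rho> s = Some a" "f : Arr C" "Cod C a = Dom C f" using False by auto
   then have "a : Arr C" "Dom C a = Y" using IH(1) unfolding sat_def by blast+
   then have "sat X J Y (\<rho>(t \<mapsto> f \<cdot> a))"
    using a App cn by (intro upd[OF IH(1)]) auto
   then show ?thesis using IH App by fastforce
  next
   case (Wit p q s u)
   then obtain a b where ab: "\<rho> s = Some a" "\<rho> u = Some b" "locally_ex Y p q a b"
    using False by auto
   then obtain d h where d: "cover d" "Cod C d = Y" "h : hom C (Dom C d) (Dom C p)"
    "p \<cdot> h = a \<cdot> d" "q \<cdot> h = b \<cdot> d" unfolding locally_ex_def by blast
   let ?r = "\<lambda>t. map_option (\<lambda>f. f \<cdot> d) (\<rho> t)"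
   have "sat X J (Dom C d) (?r(t \<mapsto> h))"
    using Wit ab d cn by (intro upd[OF sat_restrict[OF IH(1) d(1,2)]]) (auto simp: hom_def)
   moreover have "Dom C c = Y" using IH unfolding sat_def by (auto simp: hom_def)
   then have "cover (c \<cdot> d)" "Cod C (c \<cdot> d) = X" using IH d by (auto intro: cover_Cmp)
   ultimately show ?thesis using IH Wit
    by (intro exI[of _ "Dom C d"] exI[of _ "?r(t \<mapsto> h)"] exI[of _ "c \<cdot> d"]) simp
  qed
 qed
qed

lemma forcedD:
 assumes "X : Obj C" "forced X P"
 shows "\<exists>Y \<rho> c. P Y \<rho> \<and> sat X {} Y \<rho> \<and> \<rho> Gen = Some c \<and> cover c \<and> Cod C c = X \<and> Dom C c = Y"
proof -
 obtain J where J: "finite J" "\<And>Y \<rho>. sat X J Y \<rho> ==> P Y \<rho>"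
  using assms(2) by (auto simp: forced_def)
 let ?J = "\<Union> (subterms ` J)"
 have "finite ?J" using J finite_subterms by blast
 moreover have "children t \<subseteq> ?J" if "t : ?J" for t using that children_subterms by blast
 ultimately obtain Y \<rho> c where s: "sat X ?J Y \<rho>" "\<rho> Gen = Some c" "cover c" "Cod C c = X"
  using sat_ex[OF assms(1), of ?J] by blast
 then have "sat X J Y \<rho>" "sat X {} Y \<rho>" "Dom C c = Y"
  using subterms_refl unfolding sat_def by blast+
 then show ?thesis using J s by blast
qed

lemma forced_mp:
 assumes "forced X P" "forced X Q" "\<And>Y \<rho>. [|sat X {} Y \<rho>; P Y \<rho>; Q Y \<rho>|] ==> R Y \<rho>"
 shows "forced X R"
proof -
 obtain J K where "finite J" "finite K" "\<And>Y \<rho>. sat X J Y \<rho> ==> P Y \<rho>" "\<And>Y \<rho>. sat X K Y \<rho> ==> Q Y \<rho>"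
  using assms(1,2) unfolding forced_def by blast
 moreover have "sat X J Y \<rho>" "sat X K Y \<rho>" "sat X {} Y \<rho>" if "sat X (J \<union> K) Y \<rho>" for Y \<rho>
  using that by (auto simp: sat_def)
 ultimately show ?thesis using assms(3) unfolding forced_def by (intro exI[of _ "J \<union> K"]) blast
qed

lemma forced_imp:
 assumes "forced X P" "\<And>Y \<rho>. [|sat X {} Y \<rho>; P Y \<rho>|] ==> R Y \<rho>"
 shows "forced X R"
 using forced_mp[OF assms(1) assms(1)] assms(2) by blast

lemma forced_henkin: "forced X (\<lambda>Y \<rho>. henkin Y \<rho> t)"
 unfolding forced_def by (intro exI[of _ "{t}"]) (simp add: sat_def)

lemma forced_triv: "(\<And>Y \<rho>. sat X {} Y \<rho> ==> P Y \<rho>) ==> forced X P"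
 unfolding forced_def by (intro exI[of _ "{}"]) simp

definition eqt :: "'o => 'm tm => 'm tm => bool" where
 "eqt X s t \<longleftrightarrow> forced X (\<lambda>Y \<rho>. \<rho> s = \<rho> t)"

definition elt :: "'o => 'o => 'm tm => bool" where
 "elt X B t \<longleftrightarrow> forced X (\<lambda>Y \<rho>. \<exists>a\<in>hom C Y B. \<rho> t = Some a)"

text \<open>Elements of the model are names up to provable equality; \<open>elt X B\<close> collects the names that provably
denote elements of \<open>B\<close>.\<close>

definition cls :: "'o => 'm tm => 'm tm set" where
 "cls X t = {s. eqt X t s}"

definition henkin_carrier :: "'o => 'o => 'm tm set set" where
 "henkin_carrier X B = {cls X t | t. elt X B t}"

definition henkin_ap :: "'o => 'm => 'm tm set => 'm tm set" where
 "henkin_ap X f c = {u. \<exists>s\<in>c. eqt X (App f s) u}"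

lemma eqt_refl: "eqt X s s" unfolding eqt_def by (rule forced_triv) simp
lemma eqt_sym: "eqt X s t ==> eqt X t s" unfolding eqt_def by (erule forced_imp) simp
lemma eqt_trans: "[|eqt X s t; eqt X t u|] ==> eqt X s u" unfolding eqt_def by (erule (1) forced_mp) simp

lemma cls_eq_iff: "cls X s = cls X t \<longleftrightarrow> eqt X s t"
 unfolding cls_def using eqt_refl eqt_sym eqt_trans by blast

lemma forced_App:
 assumes "f : Arr C" "elt X (Dom C f) s"
 shows "forced X (\<lambda>Y \<rho>. \<exists>a\<in>hom C Y (Dom C f). \<rho> s = Some a \<and> \<rho> (App f s) = Some (f \<cdot> a))"
 using assms(2) forced_henkin[of X "App f s"] unfolding elt_def
 by (rule forced_mp) (use assms(1) in "auto simp: hom_def")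

lemma elt_App: "[|f : Arr C; elt X (Dom C f) s|] ==> elt X (Cod C f) (App f s)"
 unfolding elt_def[of X "Cod C f"] by (rule forced_imp[OF forced_App]) (auto simp: hom_def)

lemma eqt_App:
 assumes "f : Arr C" "elt X (Dom C f) s" "eqt X s t"
 shows "eqt X (App f s) (App f t)"
proof -
 have "elt X (Dom C f) t"
  using assms(2,3) unfolding elt_def eqt_def by (rule forced_mp) auto
 note t = forced_App[OF assms(1) this]
 have "forced X (\<lambda>Y \<rho>. \<exists>a. \<rho> s = Some a \<and> \<rho> t = Some a \<and> \<rho> (App f s) = Some (f \<cdot> a))"
  by (rule forced_mp[OF forced_App[OF assms(1,2)] assms(3)[unfolded eqt_def]]) auto
 then show ?thesis unfolding eqt_def by (rule forced_mp[OF _ t]) auto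
qed

lemma henkin_ap_cls:
 assumes "f : Arr C" "elt X (Dom C f) s"
 shows "henkin_ap X f (cls X s) = cls X (App f s)"
 unfolding henkin_ap_def cls_def using eqt_App[OF assms] eqt_refl eqt_trans by blast

lemma Wit_props:
 assumes "p : Arr C" "q : Arr C"
  and "forced X (\<lambda>Y \<rho>. \<exists>a b. \<rho> s = Some a \<and> \<rho> t = Some b \<and> locally_ex Y p q a b)"
 shows "elt X (Dom C p) (Wit p q s t)" "elt X (Dom C q) (Wit p q s t)"
  "eqt X (App p (Wit p q s t)) s" "eqt X (App q (Wit p q s t)) t"
proof -
 let ?W = "Wit p q s t"
 have W: "forced X (\<lambda>Y \<rho>. Dom C p = Dom C q \<and> (\<exists>h\<in>hom C Y (Dom C p). \<rho> ?W = Some h \<and>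
   \<rho> s = Some (p \<cdot> h) \<and> \<rho> t = Some (q \<cdot> h)))"
  using assms(3) forced_henkin[of X ?W]
  by (rule forced_mp) (force simp: locally_ex_def)
 show e: "elt X (Dom C p) ?W" unfolding elt_def by (rule forced_imp[OF W]) auto
 show e': "elt X (Dom C q) ?W" unfolding elt_def by (rule forced_imp[OF W]) auto
 show "eqt X (App p ?W) s" unfolding eqt_def
  by (rule forced_mp[OF W forced_App[OF assms(1) e]]) auto
 show "eqt X (App q ?W) t" unfolding eqt_def
  by (rule forced_mp[OF W forced_App[OF assms(2) e']]) auto
qed

lemma eqt_jointly:
 assumes P: "is_pullback C f g P p q" and "elt X P s" "elt X P t"
  and "eqt X (App p s) (App p t)" "eqt X (App q s) (App q t)"
 shows "eqt X s t"
proof -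
 note pf = pullback_facts[OF P]
 have F: "forced X (\<lambda>Y \<rho>. \<exists>a\<in>hom C Y P. \<rho> s = Some a \<and> \<rho> (App p s) = Some (p \<cdot> a) \<and>
   \<rho> (App q s) = Some (q \<cdot> a))" if "elt X P s" for s
  by (rule forced_mp[OF forced_App[of p X s] forced_App[of q X s]]) (use pf that in auto)
 have "forced X (\<lambda>Y \<rho>. \<exists>a\<in>hom C Y P. \<rho> s = Some a \<and> \<rho> (App p t) = Some (p \<cdot> a) \<and>
   \<rho> (App q s) = Some (q \<cdot> a))"
  by (rule forced_mp[OF F[OF assms(2)] assms(4)[unfolded eqt_def]]) auto
 then have "forced X (\<lambda>Y \<rho>. \<exists>a\<in>hom C Y P. \<rho> s = Some a \<and> \<rho> (App p t) = Some (p \<cdot> a) \<and>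
   \<rho> (App q t) = Some (q \<cdot> a))"
  by (rule forced_mp[OF _ assms(5)[unfolded eqt_def]]) auto
 then have "forced X (\<lambda>Y \<rho>. \<exists>a b. a : hom C Y P \<and> b : hom C Y P \<and> \<rho> s = Some a \<and> \<rho> t = Some b \<and>
   p \<cdot> a = p \<cdot> b \<and> q \<cdot> a = q \<cdot> b)"
  by (rule forced_mp[OF _ F[OF assms(3)]]) auto
 then show ?thesis unfolding eqt_def
 proof (rule forced_imp, elim exE conjE)
  fix Y \<rho> a b
  assume ab: "a : hom C Y P" "b : hom C Y P" "p \<cdot> a = p \<cdot> b" "q \<cdot> a = q \<cdot> b"
   and s: "\<rho> s = Some a" "\<rho> t = Some b"
  have "\<exists>!h. h : hom C (Dom C (p \<cdot> a)) P \<and> p \<cdot> h = p \<cdot> a \<and> q \<cdot> h = q \<cdot> a"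
   using ab(1) pf by (intro pullback_ex1[OF P]) (auto simp: hom_def simp flip: Cmp_assoc)
  moreover have "Dom C (p \<cdot> a) = Y" using ab(1) pf by (auto simp: hom_def)
  ultimately have "a = b" using ab by metis
  then show "\<rho> s = \<rho> t" using s by simp
 qed
qed

text \<open>The witnesses make regular epimorphisms surjective, and pullbacks are preserved because a witness
for a pullback is unique up to provable equality.\<close>

theorem henkin_model:
 assumes X: "X : Obj C"
 shows "model C (henkin_carrier X) (henkin_ap X)"
proof (unfold_locales, goal_cases)
 case (1 f x)
 then show ?case by (auto simp: henkin_carrier_def henkin_ap_cls intro: elt_App)
next
 case (2 A x)
 then obtain t where t: "elt X A t" "x = cls X t" by (auto simp: henkin_carrier_def)
 have "eqt X (App (Ident C A) t) t" unfolding eqt_def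
  by (rule forced_imp[OF forced_App[of "Ident C A"]]) (use 2 t in "auto simp: hom_def")
 then show ?case using t 2 by (simp add: henkin_ap_cls cls_eq_iff)
next
 case (3 f g x)
 then obtain t where t: "elt X (Dom C f) t" "x = cls X t" by (auto simp: henkin_carrier_def)
 have e: "elt X (Dom C g) (App f t)" using elt_App[OF 3(1) t(1)] 3 by simp
 have "forced X (\<lambda>Y \<rho>. \<exists>a\<in>hom C Y (Dom C f). \<rho> t = Some a \<and> \<rho> (App g (App f t)) = Some (g \<cdot> (f \<cdot> a)))"
  by (rule forced_mp[OF forced_App[OF 3(1) t(1)] forced_App[OF 3(2) e]]) auto
 then have "eqt X (App (g \<cdot> f) t) (App g (App f t))" unfolding eqt_def
  by (rule forced_mp[OF _ forced_App[of "g \<cdot> f"]]) (use 3 t in "auto simp: hom_def Cmp_assoc")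
 then show ?case using 3 t e by (simp add: henkin_ap_cls cls_eq_iff)
next
 case (4 T)
 then have T: "T : Obj C" "\<And>A. A : Obj C ==> \<exists>!f. f : hom C A T"
  by (auto simp: is_terminal_def)
 obtain f where f: "f : hom C X T" using T(2)[OF X] by blast
 have "elt X X Gen" unfolding elt_def by (rule forced_triv) (auto simp: sat_def)
 then have "elt X T (App f Gen)" using elt_App[of f X Gen] f by (simp add: hom_def)
 moreover have "cls X s = cls X t" if "elt X T s" "elt X T t" for s t
  unfolding cls_eq_iff eqt_def
 proof (rule forced_mp[OF that[unfolded elt_def]], elim bexE)
  fix Y \<rho> a b
  assume "sat X {} Y \<rho>" "a : hom C Y T" "\<rho> s = Some a" "b : hom C Y T" "\<rho> t = Some b"
  then show "\<rho> s = \<rho> t" using T(2)[of Y] by (auto simp: sat_def)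
 qed
 ultimately show ?case unfolding henkin_carrier_def by blast
next
 case (5 f g P p q x y)
 note pf = pullback_facts[OF 5(1)]
 obtain s t where s: "elt X (Dom C f) s" "x = cls X s" and t: "elt X (Dom C g) t" "y = cls X t"
  using 5 by (auto simp: henkin_carrier_def)
 have eq: "eqt X (App f s) (App g t)" using 5(4) s t pf by (simp add: henkin_ap_cls cls_eq_iff)
 have "forced X (\<lambda>Y \<rho>. \<exists>a b. a : hom C Y (Dom C f) \<and> b : hom C Y (Dom C g) \<and> \<rho> s = Some a \<and>
   \<rho> t = Some b \<and> \<rho> (App f s) = Some (f \<cdot> a) \<and> \<rho> (App g t) = Some (g \<cdot> b))"
  by (rule forced_mp[OF forced_App[OF pf(1) s(1)] forced_App[OF pf(2) t(1)]]) auto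
 then have "forced X (\<lambda>Y \<rho>. \<exists>a b. \<rho> s = Some a \<and> \<rho> t = Some b \<and> locally_ex Y p q a b)"
 proof (rule forced_mp[OF _ eq[unfolded eqt_def]], elim exE conjE)
  fix Y \<rho> a b
  assume ab: "a : hom C Y (Dom C f)" "b : hom C Y (Dom C g)" "\<rho> s = Some a" "\<rho> t = Some b"
   "\<rho> (App f s) = Some (f \<cdot> a)" "\<rho> (App g t) = Some (g \<cdot> b)" "\<rho> (App f s) = \<rho> (App g t)"
  have "\<exists>!h. h : hom C (Dom C a) P \<and> p \<cdot> h = a \<and> q \<cdot> h = b"
   using ab pf by (intro pullback_ex1[OF 5(1)]) (auto simp: hom_def)
  then obtain h where "h : hom C Y P" "p \<cdot> h = a" "q \<cdot> h = b" using ab by (auto simp: hom_def)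
  then have "locally_ex Y p q a b"
   using locally_ex_refl[of h Y p q] pf by simp
  then show "\<exists>a b. \<rho> s = Some a \<and> \<rho> t = Some b \<and> locally_ex Y p q a b" using ab by blast
 qed
 note W = Wit_props[OF pf(5,6) this]
 have "cls X (Wit p q s t) : henkin_carrier X P"
  using W(1) pf by (auto simp: henkin_carrier_def)
 moreover have "henkin_ap X p (cls X (Wit p q s t)) = x" "henkin_ap X q (cls X (Wit p q s t)) = y"
  using W pf s t by (simp_all add: henkin_ap_cls cls_eq_iff)
 moreover have "u = v" if "u : henkin_carrier X P" "v : henkin_carrier X P"
  "henkin_ap X p u = henkin_ap X p v" "henkin_ap X q u = henkin_ap X q v" for u v
 proof -
  note uv = that
  obtain r r' where "elt X P r" "u = cls X r" "elt X P r'" "v = cls X r'"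
   using uv(1,2) pf by (auto simp: henkin_carrier_def)
  then show ?thesis using uv(3,4) pf eqt_jointly[OF 5(1), of X r r']
   by (simp add: henkin_ap_cls cls_eq_iff)
 qed
 ultimately show ?case by blast
next
 case (6 e y)
 have e: "e : Arr C" using 6 by (simp add: regular_epi_Arr)
 obtain t where t: "elt X (Cod C e) t" "y = cls X t" using 6 by (auto simp: henkin_carrier_def)
 have "forced X (\<lambda>Y \<rho>. \<exists>a b. \<rho> t = Some a \<and> \<rho> t = Some b \<and> locally_ex Y e e a b)"
 proof (rule forced_imp[OF t(1)[unfolded elt_def]], elim bexE)
  fix Y \<rho> a assume a: "a : hom C Y (Cod C e)" "\<rho> t = Some a"
  have "\<exists>d g. cover d \<and> Cod C d = Dom C a \<and> g : hom C (Dom C d) (Dom C e) \<and> e \<cdot> g = a \<cdot> d"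
   using cover_pullback[OF regular_epi_cover[OF 6(1)], of a] a by (auto simp: hom_def)
  then have "locally_ex Y e e a a" unfolding locally_ex_def using e a by (auto simp: hom_def)
  then show "\<exists>a b. \<rho> t = Some a \<and> \<rho> t = Some b \<and> locally_ex Y e e a b" using a by blast
 qed
 note W = Wit_props[OF e e this]
 have "cls X (Wit e e t t) : henkin_carrier X (Dom C e)" using W(1) by (auto simp: henkin_carrier_def)
 moreover have "henkin_ap X e (cls X (Wit e e t t)) = y"
  using W e t by (simp add: henkin_ap_cls cls_eq_iff)
 ultimately show ?case by blast
qed

text \<open>What holds at the generic element of \<open>X\<close> holds on a cover of \<open>X\<close>, and covers are epimorphisms
 orthogonal to monomorphisms. Hence the model reflects equality of arrows out of \<open>X\<close> and their
 factorization through a monomorphism.\<close>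

lemma generic_elt: "elt X X Gen"
 unfolding elt_def by (rule forced_triv) (auto simp: sat_def)

lemma generic_carrier: "cls X Gen : henkin_carrier X X"
 using generic_elt by (auto simp: henkin_carrier_def)

lemma generic_eq:
 assumes f: "f : Arr C" "g : Arr C" "Dom C f = X" "Dom C g = X"
  and "henkin_ap X f (cls X Gen) = henkin_ap X g (cls X Gen)"
 shows "f = g"
proof -
 have X: "X : Obj C" using f by auto
 have eq: "eqt X (App f Gen) (App g Gen)" using assms generic_elt by (simp add: henkin_ap_cls cls_eq_iff)
 have gen: "elt X (Dom C f) Gen" "elt X (Dom C g) Gen" using generic_elt f by simp_all
 have "forced X (\<lambda>Y \<rho>. \<exists>a. \<rho> Gen = Some a \<and> \<rho> (App g Gen) = Some (f \<cdot> a))"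
  by (rule forced_mp[OF eq[unfolded eqt_def] forced_App[OF f(1) gen(1)]]) auto
 then have "forced X (\<lambda>Y \<rho>. \<exists>a. \<rho> Gen = Some a \<and> f \<cdot> a = g \<cdot> a)"
  by (rule forced_mp[OF _ forced_App[OF f(2) gen(2)]]) auto
 then obtain c where "cover c" "Cod C c = X" "f \<cdot> c = g \<cdot> c" using forcedD[OF X] by force
 then show ?thesis using cover_epi[of c f g] f by simp
qed

lemma generic_mono:
 assumes f: "f : Arr C" "Dom C f = X" "Cod C f = Cod C m" and m: "is_mono C m"
  and z: "z : henkin_carrier X (Dom C m)" "henkin_ap X m z = henkin_ap X f (cls X Gen)"
 shows "\<exists>k\<in>hom C X (Dom C m). m \<cdot> k = f"
proof -
 note mA = is_mono_Arr[OF m]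
 have X: "X : Obj C" using f by auto
 obtain t where t: "elt X (Dom C m) t" "z = cls X t" using z by (auto simp: henkin_carrier_def)
 have eq: "eqt X (App m t) (App f Gen)"
  using z t f mA generic_elt by (simp add: henkin_ap_cls cls_eq_iff)
 have gen: "elt X (Dom C f) Gen" using generic_elt f by simp
 have "forced X (\<lambda>Y \<rho>. \<exists>a. \<rho> Gen = Some a \<and> \<rho> (App m t) = Some (f \<cdot> a))"
  by (rule forced_mp[OF eq[unfolded eqt_def] forced_App[OF f(1) gen]]) auto
 then have "forced X (\<lambda>Y \<rho>. \<exists>a. \<exists>b\<in>hom C Y (Dom C m). \<rho> Gen = Some a \<and> m \<cdot> b = f \<cdot> a)"
  by (rule forced_mp[OF _ forced_App[OF mA t(1)]]) auto
 then obtain c b where "cover c" "Cod C c = X" "b : hom C (Dom C c) (Dom C m)" "m \<cdot> b = f \<cdot> c"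
  using forcedD[OF X] by force
 then show ?thesis using cover_mono_lift[of c m f b] f m by (auto simp: hom_def)
qed

end

section \<open>Elements of finite limits and relations\<close>

context model
begin

lemma ap_in_cod [simp]: "[|f : Arr C; x : N (Dom C f); Cod C f = B|] ==> ap f x : N B"
 using ap_in by blast

declare ap_Cmp [simp] ap_Ident [simp]

lemma ap_product:
 assumes P: "is_product C A B P p q" and AB: "A : Obj C" "B : Obj C" and "a : N A" "b : N B"
 shows "\<exists>!z. z : N P \<and> ap p z = a \<and> ap q z = b"
proof -
 have "is_pullback C (bang C A) (bang C B) P p q" using P product_iff_pullback[OF AB] by simp
 moreover have "ap (bang C A) a = ap (bang C B) b"
  using ap_terminal[OF terminal_one] ap_in[of "bang C A" a] ap_in[of "bang C B" b] assms by auto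
 ultimately show ?thesis using ap_pullback[of "bang C A" "bang C B" P p q a b] assms by simp
qed

lemma one_elt: "\<exists>!x. x : N (one C)"
 using ap_terminal[OF terminal_one] .

lemma one_eq: "[|x : N (one C); y : N (one C)|] ==> x = y"
 using one_elt by blast

definition pp :: "'o => 'o => 'a => 'a => 'a" where
 "pp A B a b = (THE z. z : N (prd C A B) \<and> ap (pr1 C A B) z = a \<and> ap (pr2 C A B) z = b)"

lemma pp_props:
 assumes "A : Obj C" "B : Obj C" "a : N A" "b : N B"
 shows "pp A B a b : N (prd C A B) \<and> ap (pr1 C A B) (pp A B a b) = a \<and> ap (pr2 C A B) (pp A B a b) = b"
 unfolding pp_def by (rule theI'[OF ap_product[OF prd_product]]) (use assms in auto)

lemma pp_simps [simp]:
 assumes "A : Obj C" "B : Obj C" "a : N A" "b : N B"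
 shows "pp A B a b : N (prd C A B)" "ap (pr1 C A B) (pp A B a b) = a" "ap (pr2 C A B) (pp A B a b) = b"
 using pp_props[OF assms] by auto

lemma prd_elt_eq:
 assumes "A : Obj C" "B : Obj C" "z : N (prd C A B)" "w : N (prd C A B)"
  "ap (pr1 C A B) z = ap (pr1 C A B) w" "ap (pr2 C A B) z = ap (pr2 C A B) w"
 shows "z = w"
proof -
 have "\<exists>!v. v : N (prd C A B) \<and> ap (pr1 C A B) v = ap (pr1 C A B) z \<and> ap (pr2 C A B) v = ap (pr2 C A B) z"
  using assms by (intro ap_product[OF prd_product]) auto
 then show ?thesis using assms by metis
qed

lemma pp_eta: "[|A : Obj C; B : Obj C; z : N (prd C A B)|]
  ==> pp A B (ap (pr1 C A B) z) (ap (pr2 C A B) z) = z"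
 by (rule prd_elt_eq[of A B]) simp_all

lemma pp_eq_iff [simp]:
 "[|A : Obj C; B : Obj C; a : N A; b : N B; a' : N A; b' : N B|]
  ==> pp A B a b = pp A B a' b' \<longleftrightarrow> a = a' \<and> b = b'"
 by (metis pp_simps(2,3))

lemma Bex_prd:
 "[|A : Obj C; B : Obj C|] ==> (\<exists>z\<in>N (prd C A B). P z) \<longleftrightarrow> (\<exists>a\<in>N A. \<exists>b\<in>N B. P (pp A B a b))"
proof -
 assume AB: "A : Obj C" "B : Obj C"
 have "\<exists>a\<in>N A. \<exists>b\<in>N B. P (pp A B a b)" if "z : N (prd C A B)" "P z" for z
  using pp_eta[OF AB that(1)] AB that
  by (intro bexI[of _ "ap (pr1 C A B) z"] bexI[of _ "ap (pr2 C A B) z"]) simp_all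
 then show ?thesis using AB pp_simps(1) by blast
qed

lemma Ball_prd:
 "[|A : Obj C; B : Obj C|] ==> (\<forall>z\<in>N (prd C A B). P z) \<longleftrightarrow> (\<forall>a\<in>N A. \<forall>b\<in>N B. P (pp A B a b))"
 using Bex_prd[of A B "\<lambda>z. \<not> P z"] by blast

lemma ap_pairing [simp]:
 assumes "f : Arr C" "g : Arr C" "Dom C f = Dom C g" "x : N (Dom C g)"
 shows "ap (pairing C f g) x = pp (Cod C f) (Cod C g) (ap f x) (ap g x)"
proof (rule prd_elt_eq[of "Cod C f" "Cod C g"])
 let ?p = "pr1 C (Cod C f) (Cod C g)" and ?q = "pr2 C (Cod C f) (Cod C g)"
 have "ap ?p (ap (pairing C f g) x) = ap (?p \<cdot> pairing C f g) x" using assms by (subst ap_Cmp) simp_all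
 then show "ap ?p (ap (pairing C f g) x) = ap ?p (pp (Cod C f) (Cod C g) (ap f x) (ap g x))"
  using assms by simp
 have "ap ?q (ap (pairing C f g) x) = ap (?q \<cdot> pairing C f g) x" using assms by (subst ap_Cmp) simp_all
 then show "ap ?q (ap (pairing C f g) x) = ap ?q (pp (Cod C f) (Cod C g) (ap f x) (ap g x))"
  using assms by simp
qed (use assms in simp_all)

definition pbe :: "'m => 'm => 'a => 'a => 'a" where
 "pbe f g a b = (THE z. z : N (pb C f g) \<and> ap (pb1 C f g) z = a \<and> ap (pb2 C f g) z = b)"

lemma pbe_props:
 assumes "f : Arr C" "g : Arr C" "Cod C f = Cod C g" "a : N (Dom C f)" "b : N (Dom C g)"
  "ap f a = ap g b"
 shows "pbe f g a b : N (pb C f g) \<and> ap (pb1 C f g) (pbe f g a b) = a \<and> ap (pb2 C f g) (pbe f g a b) = b"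
 unfolding pbe_def by (rule theI'[OF ap_pullback[OF pb_pullback]]) (use assms in auto)

lemma pbe_simps [simp]:
 assumes "f : Arr C" "g : Arr C" "Cod C f = Cod C g" "a : N (Dom C f)" "b : N (Dom C g)"
  "ap f a = ap g b"
 shows "pbe f g a b : N (pb C f g)" "ap (pb1 C f g) (pbe f g a b) = a" "ap (pb2 C f g) (pbe f g a b) = b"
 using pbe_props[OF assms] by auto

lemma pullback_elt_eq:
 assumes P: "is_pullback C f g P p q" and "z : N P" "w : N P" "ap p z = ap p w" "ap q z = ap q w"
 shows "z = w"
proof -
 note pf = pullback_facts[OF P]
 have "ap f (ap p z) = ap g (ap q z)"
  using pf assms(2) by (metis ap_Cmp)
 then have "\<exists>!v. v : N P \<and> ap p v = ap p z \<and> ap q v = ap q z"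
  using pf assms by (intro ap_pullback[OF P]) auto
 then show ?thesis using assms by metis
qed

lemma pb_elt_commutes:
 assumes "f : Arr C" "g : Arr C" "Cod C f = Cod C g" "z : N (pb C f g)"
 shows "ap f (ap (pb1 C f g) z) = ap g (ap (pb2 C f g) z)"
 using pb_commutes[OF assms(1-3)] assms by (metis ap_Cmp pb_simps)

lemma pb_elt_eq:
 assumes "f : Arr C" "g : Arr C" "Cod C f = Cod C g" "z : N (pb C f g)" "w : N (pb C f g)"
  "ap (pb1 C f g) z = ap (pb1 C f g) w" "ap (pb2 C f g) z = ap (pb2 C f g) w"
 shows "z = w"
 using pullback_elt_eq[OF pb_pullback[OF assms(1-3)] assms(4-7)] .

lemma ap_pb_pairing [simp]:
 assumes "f : Arr C" "g : Arr C" "Cod C f = Cod C g" and "a : Arr C" "b : Arr C"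
  "Dom C a = Dom C b" "Cod C a = Dom C f" "Cod C b = Dom C g" "f \<cdot> a = g \<cdot> b" "x : N (Dom C b)"
 shows "ap (pb_pairing C f g a b) x = pbe f g (ap a x) (ap b x)"
proof (rule pb_elt_eq[of f g])
 let ?h = "pb_pairing C f g a b"
 note h = pb_pairing_simps[OF assms(1-9)]
 have e: "ap f (ap a x) = ap g (ap b x)" using assms by (metis ap_Cmp)
 have "ap (pb1 C f g) (ap ?h x) = ap (pb1 C f g \<cdot> ?h) x"
  using assms(1-8,10) h(1-3) by (subst ap_Cmp) simp_all
 then show "ap (pb1 C f g) (ap ?h x) = ap (pb1 C f g) (pbe f g (ap a x) (ap b x))"
  using assms e h by simp
 have "ap (pb2 C f g) (ap ?h x) = ap (pb2 C f g \<cdot> ?h) x"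
  using assms(1-8,10) h(1-3) by (subst ap_Cmp) simp_all
 then show "ap (pb2 C f g) (ap ?h x) = ap (pb2 C f g) (pbe f g (ap a x) (ap b x))"
  using assms e h by simp
 show "ap ?h x : N (pb C f g)" using h(1-3) assms by simp
 show "pbe f g (ap a x) (ap b x) : N (pb C f g)" using e assms by simp
qed (use assms in simp_all)

lemma mono_elt_eq:
 assumes m: "is_mono C m" and xy: "x : N (Dom C m)" "y : N (Dom C m)" "ap m x = ap m y"
 shows "x = y"
proof -
 note mA = is_mono_Arr[OF m]
 let ?i = "Ident C (Dom C m)"
 have "is_pullback C m m (Dom C m) ?i ?i"
  unfolding is_pullback_def
 proof (intro conjI allI ballI impI)
  fix X a b assume ab: "a : hom C X (Dom C m)" "b : hom C X (Dom C m)" "m \<cdot> a = m \<cdot> b"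
  from ab have "b = a" by (intro is_monoD[OF m, of b a]) (simp_all add: hom_def)
  show "\<exists>!h. h : hom C X (Dom C m) \<and> ?i \<cdot> h = a \<and> ?i \<cdot> h = b"
   unfolding \<open>b = a\<close> using ab(1) by (intro ex1I[of _ a]) (simp_all add: hom_def, metis Ident_Cmp)
 qed (use mA in "simp_all add: hom_def")
 from this have "\<exists>!z. z : N (Dom C m) \<and> ap ?i z = x \<and> ap ?i z = y"
  using xy by (rule ap_pullback)
 then obtain z where "z : N (Dom C m)" "ap ?i z = x" "ap ?i z = y" by blast
 then show ?thesis by simp
qed

definition img :: "'m => 'a set" where
 "img m = ap m ` N (Dom C m)"

lemma img_Cmp_subset: "[|f : Arr C; g : Arr C; Cod C f = Dom C g|] ==> img (g \<cdot> f) \<subseteq> img g"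
 by (auto simp: img_def)

end

lemma (in category) is_isoD:
 assumes "is_iso C i"
 obtains j where "i : Arr C" "j : Arr C" "Dom C j = Cod C i" "Cod C j = Dom C i"
  "j \<cdot> i = Ident C (Dom C i)" "i \<cdot> j = Ident C (Cod C i)"
 using assms unfolding is_iso_def hom_def by auto

context regular_category
begin

text \<open>Equality of arrows, factorization through a monomorphism, and the exactness notions of the
 category can be tested on elements. The models constructed above suffice for this, and fixing their
 type of elements avoids a quantification over types.\<close>

abbreviation canon :: "('o => 'm tm set set) => ('m => 'm tm set => 'm tm set) => bool" where
 "canon \<equiv> model C"
abbreviation img_at where "img_at N ap \<equiv> model.img C N ap"
abbreviation pp_at where "pp_at N ap \<equiv> model.pp C N ap"

lemma arr_eqI:
 assumes "f : Arr C" "g : Arr C" "Dom C f = Dom C g"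
  and "\<And>N ap x. [|canon N ap; x : N (Dom C g)|] ==> ap f x = ap g x"
 shows "f = g"
proof (rule generic_eq[OF assms(1,2) _ refl])
 show "henkin_ap (Dom C g) f (cls (Dom C g) Gen) = henkin_ap (Dom C g) g (cls (Dom C g) Gen)"
  using assms(2) by (intro assms(4)[OF henkin_model] generic_carrier) simp
qed (use assms in simp)

lemma mono_factorI:
 assumes "is_mono C m" "f : Arr C" "Cod C f = Cod C m"
  and "\<And>N ap x. [|canon N ap; x : N (Dom C f)|] ==> ap f x : img_at N ap m"
 obtains h where "h : Arr C" "Dom C h = Dom C f" "Cod C h = Dom C m" "m \<cdot> h = f"
proof -
 let ?X = "Dom C f" and ?g = "cls (Dom C f) Gen"
 have m: "model C (henkin_carrier ?X) (henkin_ap ?X)" using assms(2) by (intro henkin_model) simp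
 from assms(4)[OF m generic_carrier]
 obtain z where "z : henkin_carrier ?X (Dom C m)" "henkin_ap ?X m z = henkin_ap ?X f ?g"
  by (auto simp: model.img_def[OF m])
 from generic_mono[OF assms(2) refl assms(3,1) this] that show ?thesis by (auto simp: hom_def)
qed

lemma is_monoI:
 assumes "m : Arr C"
  and "\<And>N ap x y. [|canon N ap; x : N (Dom C m); y : N (Dom C m); ap m x = ap m y|] ==> x = y"
 shows "is_mono C m"
 unfolding is_mono_def
proof (intro conjI allI ballI impI)
 fix X f g assume fg: "f : hom C X (Dom C m)" "g : hom C X (Dom C m)" "m \<cdot> f = m \<cdot> g"
 show "f = g"
 proof (rule arr_eqI)
  fix N ap x assume N: "canon N ap" and x: "x : N (Dom C g)"
  interpret model C N ap by fact
  have "ap (m \<cdot> f) x = ap (m \<cdot> g) x" using fg by simp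
  then have "ap m (ap f x) = ap m (ap g x)" using fg(1,2) x assms(1) by (simp add: hom_def)
  then show "ap f x = ap g x"
   using fg x by (intro assms(2)[OF N, of "ap f x" "ap g x"]) (simp_all add: hom_def)
 qed (use fg in "auto simp: hom_def")
qed fact

text \<open>The inverse of an arrow that is bijective on elements comes from factoring the identity.\<close>

lemma is_isoI:
 assumes f: "f : Arr C"
  and "\<And>N ap x y. [|canon N ap; x : N (Dom C f); y : N (Dom C f); ap f x = ap f y|] ==> x = y"
  and "\<And>N ap y. [|canon N ap; y : N (Cod C f)|] ==> y : img_at N ap f"
 shows "is_iso C f"
proof -
 have m: "is_mono C f" using assms(1,2) by (rule is_monoI)
 obtain h where h: "h : Arr C" "Dom C h = Cod C f" "Cod C h = Dom C f" "f \<cdot> h = Ident C (Cod C f)"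
 proof (rule mono_factorI[OF m, of "Ident C (Cod C f)"])
  fix N ap x assume N: "canon N ap" and x: "x : N (Dom C (Ident C (Cod C f)))"
  interpret model C N ap by fact
  show "ap (Ident C (Cod C f)) x : img f" using f x assms(3)[OF N] by simp
 qed (use f in auto)
 have "h \<cdot> f = Ident C (Dom C f)"
  using f h by (intro is_monoD[OF m, of "h \<cdot> f" "Ident C (Dom C f)"]) (simp_all flip: Cmp_assoc)
 then show ?thesis using f h unfolding is_iso_def hom_def by auto
qed

lemma regular_epi_iso_Cmp:
 assumes e: "regular_epi C e" and i: "is_iso C i" "Dom C i = Cod C e"
 shows "regular_epi C (i \<cdot> e)"
proof -
 obtain f g where fg: "is_coequalizer C f g e" using e by (auto simp: regular_epi_def)
 obtain j where j: "i : Arr C" "j : Arr C" "Dom C j = Cod C i" "Cod C j = Dom C i"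
  "j \<cdot> i = Ident C (Dom C i)" "i \<cdot> j = Ident C (Cod C i)" using i(1) by (rule is_isoD)
 note ef = coequalizer_facts[OF fg]
 have ie: "i \<cdot> e : Arr C" "Dom C (i \<cdot> e) = Cod C f" "Cod C (i \<cdot> e) = Cod C i" using i ef j by simp_all
 have "is_coequalizer C f g (i \<cdot> e)"
  unfolding is_coequalizer_def
 proof (intro conjI allI ballI impI)
  show "(i \<cdot> e) \<cdot> f = (i \<cdot> e) \<cdot> g" using ef i j by (simp add: Cmp_assoc)
  fix X h assume h: "h : hom C (Cod C f) X" "h \<cdot> f = h \<cdot> g"
  obtain k where k: "k : Arr C" "Dom C k = Cod C e" "Cod C k = Cod C h" "k \<cdot> e = h"
   using coequalizer_factor[OF fg, of h] h ef by (auto simp: hom_def)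
  show "\<exists>!k. k : hom C (Cod C (i \<cdot> e)) X \<and> k \<cdot> (i \<cdot> e) = h"
  proof (rule ex1I[of _ "k \<cdot> j"])
   have "(k \<cdot> j) \<cdot> (i \<cdot> e) = k \<cdot> ((j \<cdot> i) \<cdot> e)" using k(1-3) j(1-4) ef(3) i(2) by (simp add: Cmp_assoc)
   then show "k \<cdot> j : hom C (Cod C (i \<cdot> e)) X \<and> (k \<cdot> j) \<cdot> (i \<cdot> e) = h"
    using k j ie h ef(3) i(2) by (simp add: hom_def)
  next
   fix l assume l: "l : hom C (Cod C (i \<cdot> e)) X \<and> l \<cdot> (i \<cdot> e) = h"
   then have "(l \<cdot> i) \<cdot> e = k \<cdot> e" using j ef(3) i(2) ie k by (auto simp: hom_def Cmp_assoc)
   then have "l \<cdot> i = k"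
    using l j k ie i(2) by (intro coequalizer_epi[OF e, of "l \<cdot> i" k]) (auto simp: hom_def)
   then have "(l \<cdot> i) \<cdot> j = k \<cdot> j" by simp
   then show "l = k \<cdot> j" using l j ie by (auto simp: hom_def Cmp_assoc)
  qed
 qed (use ef ie in simp_all)
 then show ?thesis by (auto simp: regular_epi_def)
qed

text \<open>Conversely to the defining property of models, an arrow that is surjective on elements is a regular
epimorphism, since the monomorphism of its image factorization is bijective on elements.\<close>

lemma regular_epiI:
 assumes f: "f : Arr C"
  and "\<And>N ap y. [|canon N ap; y : N (Cod C f)|] ==> y : img_at N ap f"
 shows "regular_epi C f"
proof -
 obtain k e where k: "is_mono C k" "regular_epi C e" "e : Arr C" "Dom C e = Dom C f" "Cod C e = Dom C k" "k \<cdot> e = f"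
  using image_ex[OF f] unfolding is_image_def hom_def by auto
 note kA = is_mono_Arr[OF k(1)]
 have "is_iso C k"
 proof (rule is_isoI[OF kA])
  fix N ap y assume N: "canon N ap" and y: "y : N (Cod C k)"
  interpret model C N ap by fact
  have "y : img f" using assms(2)[OF N] y k kA by auto
  then show "y : img k" using img_Cmp_subset[of e k] k kA by auto
 next
  fix N ap x y
  assume "canon N ap" and xy: "x : N (Dom C k)" "y : N (Dom C k)" "ap k x = ap k y"
  then interpret model C N ap by simp
  show "x = y" using mono_elt_eq[OF k(1) xy] .
 qed
 then show ?thesis using regular_epi_iso_Cmp[of e k] k by simp
qed

lemma is_mono_img_factor:
 assumes "is_mono C m" "is_mono C n" "Cod C m = Cod C n"
  and "\<And>N ap. canon N ap ==> img_at N ap m \<subseteq> img_at N ap n"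
 obtains h where "h : Arr C" "Dom C h = Dom C m" "Cod C h = Dom C n" "n \<cdot> h = m"
proof (rule mono_factorI[OF assms(2) is_mono_Arr[OF assms(1)] assms(3)])
 fix N ap x assume N: "canon N ap" and x: "x : N (Dom C m)"
 then show "ap m x : img_at N ap n" using assms(4)[OF N] by (auto simp: model.img_def[OF N])
qed (rule that)

lemma mutual_factor_iso:
 assumes "is_mono C m" "is_mono C n" "h : Arr C" "Dom C h = Dom C m" "Cod C h = Dom C n" "n \<cdot> h = m"
  "k : Arr C" "Dom C k = Dom C n" "Cod C k = Dom C m" "m \<cdot> k = n"
 shows "is_iso C h"
proof -
 note A = is_mono_Arr[OF assms(1)] is_mono_Arr[OF assms(2)]
 have "m \<cdot> (k \<cdot> h) = m" using assms A by (simp flip: Cmp_assoc)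
 then have "k \<cdot> h = Ident C (Dom C h)"
  using A assms by (intro is_monoD[OF assms(1), of "k \<cdot> h" "Ident C (Dom C h)"]) simp_all
 moreover have "n \<cdot> (h \<cdot> k) = n" using assms A by (simp flip: Cmp_assoc)
 then have "h \<cdot> k = Ident C (Cod C h)"
  using A assms by (intro is_monoD[OF assms(2), of "h \<cdot> k" "Ident C (Cod C h)"]) simp_all
 ultimately show ?thesis using assms unfolding is_iso_def hom_def by auto
qed

lemma sub_class_iff:
 assumes m: "is_mono C m"
 shows "n : sub_class C m \<longleftrightarrow> is_mono C n \<and> Cod C n = Cod C m \<and>
  (\<forall>N ap. canon N ap \<longrightarrow> img_at N ap n = img_at N ap m)"
proof (intro iffI conjI allI impI)
 assume n: "n : sub_class C m"
 then show "is_mono C n" "Cod C n = Cod C m" by (simp_all add: sub_class_def)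
 fix N ap assume "canon N ap"
 then interpret model C N ap .
 obtain h where h: "h : Arr C" "Dom C h = Dom C m" "Cod C h = Dom C n" "is_iso C h" "n \<cdot> h = m"
  using n by (auto simp: sub_class_def hom_def)
 obtain j where j: "j : Arr C" "Dom C j = Cod C h" "Cod C j = Dom C h" "h \<cdot> j = Ident C (Cod C h)"
  using h(4) by (rule is_isoD)
 have nA: "n : Arr C" using n by (simp add: sub_class_def is_mono_def)
 have "m \<cdot> j = n \<cdot> (h \<cdot> j)" using h j nA by (metis Cmp_assoc)
 then have "m \<cdot> j = n" using j(4) h nA by simp
 then show "img n = img m"
  using img_Cmp_subset[of h n] img_Cmp_subset[of j m] h j nA is_mono_Arr[OF m] by auto
next
 assume a: "is_mono C n \<and> Cod C n = Cod C m \<and>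
  (\<forall>N ap. canon N ap \<longrightarrow> img_at N ap n = img_at N ap m)"
 obtain h where h: "h : Arr C" "Dom C h = Dom C m" "Cod C h = Dom C n" "n \<cdot> h = m"
  using is_mono_img_factor[OF m, of n] a by auto
 obtain k where k: "k : Arr C" "Dom C k = Dom C n" "Cod C k = Dom C m" "m \<cdot> k = n"
  using is_mono_img_factor[of n m] a m by auto
 show "n : sub_class C m"
  using a h mutual_factor_iso[OF m _ h k] by (auto simp: sub_class_def hom_def)
qed

lemma sub_class_self: "is_mono C m ==> m : sub_class C m"
 by (simp add: sub_class_iff)

lemma sub_class_eqI:
 assumes "is_mono C m" "n : sub_class C m"
 shows "sub_class C n = sub_class C m"
proof -
 have n: "is_mono C n" using assms by (simp add: sub_class_iff)
 have "k : sub_class C n \<longleftrightarrow> k : sub_class C m" for k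
  using assms(2) unfolding sub_class_iff[OF n] sub_class_iff[OF assms(1)] by force
 then show ?thesis by blast
qed

text \<open>Two members with the same elements differ by an isomorphism, so that closure under precomposition
with isomorphisms makes the set a full isomorphism class.\<close>

lemma is_subobjectI:
 assumes "m : S" and S: "\<And>n. n : S ==> is_mono C n \<and> Cod C n = X"
  and eq: "\<And>n N ap. [|n : S; canon N ap|] ==> img_at N ap n = img_at N ap m"
  and iso: "\<And>n i. [|n : S; is_iso C i; i : Arr C; Cod C i = Dom C n|] ==> n \<cdot> i : S"
 shows "is_subobject C X S"
proof -
 have m: "is_mono C m" "Cod C m = X" using assms by auto
 have "S = sub_class C m"
 proof (rule set_eqI)
  fix n show "n : S \<longleftrightarrow> n : sub_class C m"
  proof
   assume "n : S" then show "n : sub_class C m" using S eq m by (simp add: sub_class_iff)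
  next
   assume "n : sub_class C m"
   then obtain h where n: "is_mono C n" and h: "h : Arr C" "Dom C h = Dom C m" "Cod C h = Dom C n"
    "is_iso C h" "n \<cdot> h = m"
    by (auto simp: sub_class_def hom_def)
   obtain j where j: "j : Arr C" "Dom C j = Cod C h" "Cod C j = Dom C h" "h \<cdot> j = Ident C (Cod C h)"
    "j \<cdot> h = Ident C (Dom C h)"
    using h(4) by (rule is_isoD)
   have "is_iso C j" unfolding is_iso_def using h j by (auto simp: hom_def intro!: bexI[of _ h])
   then have "m \<cdot> j : S" using iso[OF assms(1), of j] j h by simp
   moreover have "m \<cdot> j = n \<cdot> (h \<cdot> j)" using h j is_mono_Arr[OF n] by (metis Cmp_assoc)
   then have "m \<cdot> j = n" using j(4) h is_mono_Arr[OF n] by simp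
   ultimately show "n : S" by simp
  qed
 qed
 then show ?thesis using m by (auto simp: is_subobject_def)
qed

lemma relationD:
 assumes "is_relation C R"
 shows "tdom R : Obj C" "tcod R : Obj C"
  "r : tmap R ==> is_mono C r" "r : tmap R ==> r : Arr C"
  "r : tmap R ==> Cod C r = prd C (tdom R) (tcod R)"
  "r : tmap R ==> leg1 C R r : Arr C" "r : tmap R ==> leg2 C R r : Arr C"
  "r : tmap R ==> Dom C (leg1 C R r) = Dom C r" "r : tmap R ==> Dom C (leg2 C R r) = Dom C r"
  "r : tmap R ==> Cod C (leg1 C R r) = tdom R" "r : tmap R ==> Cod C (leg2 C R r) = tcod R"
  "r : tmap R ==> tmap R = sub_class C r"
proof -
 show o: "tdom R : Obj C" "tcod R : Obj C" using assms by (auto simp: is_relation_def)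
 obtain m where m: "is_mono C m" "Cod C m = prd C (tdom R) (tcod R)" "tmap R = sub_class C m"
  using assms by (auto simp: is_relation_def is_subobject_def)
 assume r: "r : tmap R"
 then show "is_mono C r" "Cod C r = prd C (tdom R) (tcod R)" using m by (auto simp: sub_class_iff)
 then show "r : Arr C" "leg1 C R r : Arr C" "leg2 C R r : Arr C" "Dom C (leg1 C R r) = Dom C r"
  "Dom C (leg2 C R r) = Dom C r" "Cod C (leg1 C R r) = tdom R" "Cod C (leg2 C R r) = tcod R"
  using o by (auto simp: leg1_def leg2_def is_mono_Arr)
 show "tmap R = sub_class C r" using sub_class_eqI[OF m(1)] r m by simp
qed

lemma relation_ex: "is_relation C R ==> \<exists>r. r : tmap R"
 by (auto simp: is_relation_def is_subobject_def intro: sub_class_self)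

end

context model
begin

definition rel :: "('o, 'm) relation => 'a => 'a => bool" where
 "rel R a b \<longleftrightarrow> (\<exists>r\<in>tmap R. \<exists>z\<in>N (Dom C r). ap (leg1 C R r) z = a \<and> ap (leg2 C R r) z = b)"

lemma rel_rep:
 assumes R: "is_relation C R" and r: "r : tmap R"
 shows "rel R a b \<longleftrightarrow> (\<exists>z\<in>N (Dom C r). ap (leg1 C R r) z = a \<and> ap (leg2 C R r) z = b)"
proof
 note D = relationD[OF R]
 assume "rel R a b"
 then obtain s z where s: "s : tmap R" "z : N (Dom C s)" "ap (leg1 C R s) z = a" "ap (leg2 C R s) z = b"
  by (auto simp: rel_def)
 from s(1) D(12)[OF r] D(12)[OF s(1)] r have "r : sub_class C s" by simp
 then obtain h where "h : Arr C" "Dom C h = Dom C s" "Cod C h = Dom C r" "r \<cdot> h = s"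
  by (auto simp: sub_class_def hom_def)
 moreover from this have "leg1 C R r \<cdot> h = leg1 C R s" "leg2 C R r \<cdot> h = leg2 C R s"
  using D(1,2) D(4,5)[OF r] by (simp_all add: leg1_def leg2_def Cmp_assoc)
 ultimately show "\<exists>z\<in>N (Dom C r). ap (leg1 C R r) z = a \<and> ap (leg2 C R r) z = b"
  using s D(6-11)[OF r] by (intro bexI[of _ "ap h z"]) (auto simp flip: ap_Cmp)
qed (use r in "auto simp: rel_def")

lemma rel_img:
 assumes R: "is_relation C R" and r: "r : tmap R" and ab: "a : N (tdom R)" "b : N (tcod R)"
 shows "rel R a b \<longleftrightarrow> pp (tdom R) (tcod R) a b : img r"
proof -
 note D = relationD[OF R]
 have "pp (tdom R) (tcod R) a b = ap r z \<longleftrightarrow> ap (leg1 C R r) z = a \<and> ap (leg2 C R r) z = b"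
  if "z : N (Dom C r)" for z
 proof
  assume e: "pp (tdom R) (tcod R) a b = ap r z"
  have "ap (pr1 C (tdom R) (tcod R)) (ap r z) = a" "ap (pr2 C (tdom R) (tcod R)) (ap r z) = b"
   unfolding e[symmetric] using D(1,2) ab by simp_all
  then show "ap (leg1 C R r) z = a \<and> ap (leg2 C R r) z = b"
   unfolding leg1_def leg2_def using D(1,2) D(4,5)[OF r] that by simp
 next
  assume "ap (leg1 C R r) z = a \<and> ap (leg2 C R r) z = b"
  then show "pp (tdom R) (tcod R) a b = ap r z"
   unfolding leg1_def leg2_def using pp_eta[of "tdom R" "tcod R" "ap r z"] D(1,2) D(4,5)[OF r] that
   by auto
 qed
 then show ?thesis unfolding rel_rep[OF R r] img_def image_iff by auto
qed

lemma rel_in: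
 assumes R: "is_relation C R" and "rel R a b"
 shows "a : N (tdom R)" "b : N (tcod R)"
 using relationD[OF R] assms(2) by (auto simp: rel_def)

end

context regular_category
begin

abbreviation rel_at where "rel_at N ap \<equiv> model.rel C N ap"

lemma relation_factor:
 assumes R: "is_relation C R" and S: "is_relation C S" and eq: "tdom R = tdom S" "tcod R = tcod S"
  and le: "\<And>N ap a b. [|canon N ap; rel_at N ap R a b|] ==> rel_at N ap S a b"
  and rs: "r : tmap R" "s : tmap S"
 obtains h where "h : Arr C" "Dom C h = Dom C r" "Cod C h = Dom C s" "s \<cdot> h = r"
proof (rule is_mono_img_factor[of r s, OF _ _ _ _ that])
 note DR = relationD[OF R] and DS = relationD[OF S]
 show "is_mono C r" "is_mono C s" "Cod C r = Cod C s"
  using DR(3,5)[OF rs(1)] DS(3,5)[OF rs(2)] eq by auto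
 fix N ap assume N: "canon N ap"
 interpret model C N ap by fact
 show "img r \<subseteq> img s"
 proof
  fix c assume c: "c : img r"
  then have "c : N (prd C (tdom R) (tcod R))" using DR(4,5)[OF rs(1)] by (auto simp: img_def)
  then obtain a b where ab: "a : N (tdom R)" "b : N (tcod R)" "c = pp (tdom R) (tcod R) a b"
   using Bex_prd[of "tdom R" "tcod R" "\<lambda>z. c = z"] DR(1,2) by auto
  then have "rel S a b" using c rel_img[OF R rs(1)] le[OF N, of a b] by auto
  then show "c : img s" using rel_img[OF S rs(2)] ab eq by auto
 qed
qed

lemma relation_leI:
 assumes R: "is_relation C R" and S: "is_relation C S" and eq: "tdom R = tdom S" "tcod R = tcod S"
  and le: "\<And>N ap a b. [|canon N ap; rel_at N ap R a b|] ==> rel_at N ap S a b"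
 shows "sub_le C (tmap R) (tmap S)"
 unfolding sub_le_def
proof
 fix r assume r: "r : tmap R"
 obtain s where s: "s : tmap S" using relation_ex[OF S] ..
 show "\<exists>n\<in>tmap S. \<exists>h\<in>hom C (Dom C r) (Dom C n). n \<cdot> h = r"
  by (rule relation_factor[OF assms r s]) (use s in "auto simp: hom_def")
qed

lemma relation_eqI:
 assumes R: "is_relation C R" and S: "is_relation C S" and eq: "tdom R = tdom S" "tcod R = tcod S"
  and rel: "\<And>N ap a b. canon N ap ==> rel_at N ap R a b = rel_at N ap S a b"
 shows "R = S"
proof -
 obtain r where r: "r : tmap R" using relation_ex[OF R] ..
 obtain s where s: "s : tmap S" using relation_ex[OF S] ..
 obtain h where h: "h : Arr C" "Dom C h = Dom C r" "Cod C h = Dom C s" "s \<cdot> h = r"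
  using relation_factor[OF R S eq _ r s] rel by blast
 obtain k where k: "k : Arr C" "Dom C k = Dom C s" "Cod C k = Dom C r" "r \<cdot> k = s"
  using relation_factor[OF S R _ _ _ s r] eq rel by metis
 note DR = relationD(3,5,12)[OF R r] and DS = relationD(3,5,12)[OF S s]
 have "s : sub_class C r"
  using mutual_factor_iso[OF DR(1) DS(1) h k] h DR(2) DS eq by (auto simp: sub_class_def hom_def)
 then have "tmap R = tmap S" using sub_class_eqI[OF DR(1)] DR DS by simp
 then show ?thesis using eq by (cases R; cases S) simp
qed

end

context model
begin

lemma sub_le_rel:
 assumes R: "is_relation C R" and S: "is_relation C S" and eq: "tdom R = tdom S" "tcod R = tcod S"
  and "sub_le C (tmap R) (tmap S)" "rel R a b"
 shows "rel S a b"
proof -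
 obtain r where r: "r : tmap R" using relation_ex[OF R] ..
 obtain s h where s: "s : tmap S" "h : hom C (Dom C r) (Dom C s)" "s \<cdot> h = r"
  using assms(5) r unfolding sub_le_def by blast
 have "img r \<subseteq> img s"
  using img_Cmp_subset[of h s] s relationD(4)[OF S s(1)] by (auto simp: hom_def)
 moreover have ab: "a : N (tdom R)" "b : N (tcod R)" using rel_in[OF R assms(6)] .
 ultimately have "pp (tdom R) (tcod R) a b : img s" using rel_img[OF R r ab] assms(6) by blast
 then show ?thesis using rel_img[OF S s(1), of a b] ab eq by simp
qed

end

section \<open>The category of relations on elements\<close>

context regular_category
begin

lemma iso_is_mono: "is_iso C i ==> is_mono C i"
proof -
 assume "is_iso C i"
 then obtain j where j: "i : Arr C" "j : Arr C" "Dom C j = Cod C i" "Cod C j = Dom C i"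
  "j \<cdot> i = Ident C (Dom C i)" by (rule is_isoD)
 show ?thesis
 proof (rule is_monoI[OF j(1)])
  fix N ap x y
  assume "canon N ap" and xy: "x : N (Dom C i)" "y : N (Dom C i)" and e: "ap i x = ap i y"
  then interpret model C N ap by simp
  have "ap j (ap i x) = ap j (ap i y)" using e by simp
  then have "ap (j \<cdot> i) x = ap (j \<cdot> i) y" using j(1-4) xy by simp
  then show "x = y" unfolding j(5) using xy j(1) by simp
 qed
qed

lemma mono_Cmp:
 assumes m: "is_mono C m" "is_mono C n" "Cod C n = Dom C m"
 shows "is_mono C (m \<cdot> n)"
proof -
 note A = is_mono_Arr[OF m(1)] is_mono_Arr[OF m(2)]
 show ?thesis
 proof (rule is_monoI)
  fix N ap x y
  assume "canon N ap" and xy: "x : N (Dom C (m \<cdot> n))" "y : N (Dom C (m \<cdot> n))"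
   and e: "ap (m \<cdot> n) x = ap (m \<cdot> n) y"
  then interpret model C N ap by simp
  have "ap m (ap n x) = ap m (ap n y)" using A m xy e by simp
  then have "ap n x = ap n y" by (rule mono_elt_eq[OF m(1), rotated 2]) (use A m xy in simp_all)
  then show "x = y" by (rule mono_elt_eq[OF m(2), rotated 2]) (use A m xy in simp_all)
 qed (use A m in simp)
qed

lemma product_iso:
 assumes P: "is_product C A B P p q" and i: "is_iso C i" "Cod C i = P"
 shows "is_product C A B (Dom C i) (p \<cdot> i) (q \<cdot> i)"
proof -
 obtain j where j: "i : Arr C" "j : Arr C" "Dom C j = Cod C i" "Cod C j = Dom C i"
  "j \<cdot> i = Ident C (Dom C i)" "i \<cdot> j = Ident C (Cod C i)" using i(1) by (rule is_isoD)
 have pq: "p : hom C P A" "q : hom C P B" using P by (simp_all add: is_product_def)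
 show ?thesis unfolding is_product_def
 proof (intro conjI allI ballI)
  fix X f g assume f: "f : hom C X A" "g : hom C X B"
  then obtain h where h: "h : hom C X P" "p \<cdot> h = f" "q \<cdot> h = g"
   and u: "\<And>h'. h' : hom C X P ==> p \<cdot> h' = f ==> q \<cdot> h' = g ==> h' = h"
   using P unfolding is_product_def by meson
  have "i \<cdot> (j \<cdot> h) = (i \<cdot> j) \<cdot> h" using h(1) j(1-4) i(2) by (simp add: hom_def Cmp_assoc)
  then have ijh: "i \<cdot> (j \<cdot> h) = h" unfolding j(6) using h(1) i(2) by (simp add: hom_def)
  show "\<exists>!h. h : hom C X (Dom C i) \<and> (p \<cdot> i) \<cdot> h = f \<and> (q \<cdot> i) \<cdot> h = g"
  proof (rule ex1I[of _ "j \<cdot> h"])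
   show "j \<cdot> h : hom C X (Dom C i) \<and> (p \<cdot> i) \<cdot> (j \<cdot> h) = f \<and> (q \<cdot> i) \<cdot> (j \<cdot> h) = g"
    using h j(1-4) i(2) pq ijh by (simp add: hom_def Cmp_assoc)
  next
   fix l assume l: "l : hom C X (Dom C i) \<and> (p \<cdot> i) \<cdot> l = f \<and> (q \<cdot> i) \<cdot> l = g"
   then have "i \<cdot> l = h" using pq i(2) j(1) by (intro u) (auto simp: hom_def Cmp_assoc)
   then have "j \<cdot> h = (j \<cdot> i) \<cdot> l" using l j(1-4) by (auto simp: hom_def Cmp_assoc)
   then show "l = j \<cdot> h" using l j by (simp add: hom_def)
  qed
 qed (use pq i j in "simp_all add: hom_def")
qed

lemma product_facts:
 assumes "is_product C A B P p q"
 shows "P : Obj C" "A : Obj C" "B : Obj C" "p : Arr C" "q : Arr C" "Dom C p = P" "Dom C q = P"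
  "Cod C p = A" "Cod C q = B"
proof -
 have "p : hom C P A" "q : hom C P B" "P : Obj C" using assms by (simp_all add: is_product_def)
 then show "P : Obj C" "A : Obj C" "B : Obj C" "p : Arr C" "q : Arr C" "Dom C p = P" "Dom C q = P"
  "Cod C p = A" "Cod C q = B" by (auto simp: hom_def)
qed

end

context model
begin

lemma rel_legs_inj:
 assumes R: "is_relation C R" and r: "r : tmap R" and z: "z : N (Dom C r)" "w : N (Dom C r)"
  and "ap (leg1 C R r) z = ap (leg1 C R r) w" "ap (leg2 C R r) z = ap (leg2 C R r) w"
 shows "z = w"
proof (rule mono_elt_eq[OF relationD(3)[OF R r] z])
 show "ap r z = ap r w"
  by (rule prd_elt_eq[of "tdom R" "tcod R"])
   (use relationD(1,2)[OF R] relationD(4,5)[OF R r] z assms(5,6) in "simp_all add: leg1_def leg2_def")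
qed

lemma img_eqI_prd:
 assumes "m : Arr C" "n : Arr C" "Cod C m = prd C A B" "Cod C n = prd C A B" "A : Obj C" "B : Obj C"
  and "\<And>a b. [|a : N A; b : N B|] ==> pp A B a b : img n \<longleftrightarrow> pp A B a b : img m"
 shows "img n = img m"
proof -
 have "c : img n \<longleftrightarrow> c : img m" if c: "c : N (prd C A B)" for c
  using assms(7)[of "ap (pr1 C A B) c" "ap (pr2 C A B) c"] pp_eta[OF assms(5,6) c] assms(5,6) c by simp
 moreover have "img n \<subseteq> N (prd C A B)" "img m \<subseteq> N (prd C A B)" using assms by (auto simp: img_def)
 ultimately show ?thesis by blast
qed

lemma Cmp_iso_img:
 assumes "m : Arr C" "is_iso C i" "Cod C i = Dom C m"
 shows "img (m \<cdot> i) = img m"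
proof -
 obtain j where j: "i : Arr C" "j : Arr C" "Dom C j = Cod C i" "Cod C j = Dom C i"
  "i \<cdot> j = Ident C (Cod C i)" using assms(2) by (rule is_isoD)
 have "(m \<cdot> i) \<cdot> j = m \<cdot> (i \<cdot> j)" using j(1-4) assms by (simp add: Cmp_assoc)
 then have "(m \<cdot> i) \<cdot> j = m" using j assms by simp
 then show ?thesis using img_Cmp_subset[of i m] img_Cmp_subset[of j "m \<cdot> i"] j assms by auto
qed

lemma dagger_img:
 assumes R: "is_relation C R" and r: "r : tmap R" and "a : N (tdom R)" "b : N (tcod R)"
 shows "pp (tcod R) (tdom R) b a : img (pairing C (leg2 C R r) (leg1 C R r)) \<longleftrightarrow> rel R a b"
 unfolding rel_rep[OF R r] img_def image_iff
 using relationD[OF R] r assms(3,4) by auto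

lemma comp_img:
 assumes R: "is_relation C R" and S: "is_relation C S" and "tcod R = tdom S"
  and k: "k : tmap (rel_comp C S R)" and ac: "a : N (tdom R)" "c : N (tcod S)"
 shows "pp (tdom R) (tcod S) a c : img k \<longleftrightarrow> (\<exists>b. rel R a b \<and> rel S b c)"
proof -
 obtain r s P p q e where rs: "r : tmap R" "s : tmap S"
  and P: "is_pullback C (leg2 C R r) (leg1 C S s) P p q"
  and e: "k : Arr C" "e : Arr C" "Dom C e = Dom C (pairing C (leg1 C R r \<cdot> p) (leg2 C S s \<cdot> q))"
   "Cod C e = Dom C k" "regular_epi C e" "k \<cdot> e = pairing C (leg1 C R r \<cdot> p) (leg2 C S s \<cdot> q)"
  using k by (auto simp: rel_comp_def is_image_def is_mono_def hom_def)
 let ?f = "pairing C (leg1 C R r \<cdot> p) (leg2 C S s \<cdot> q)"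
 note DR = relationD(1,2)[OF R] relationD(4-11)[OF R rs(1)]
 note DS = relationD(1,2)[OF S] relationD(4-11)[OF S rs(2)]
 note pf = pullback_facts[OF P]
 have D: "Dom C e = P" "Cod C ?f = prd C (tdom R) (tcod S)" using e(3) DR DS pf by simp_all
 have "img k = img ?f"
 proof
  show "img k \<subseteq> img ?f"
  proof
   fix y assume "y : img k"
   then obtain x where x: "x : N (Dom C k)" "y = ap k x" by (auto simp: img_def)
   then obtain w where w: "w : N P" "ap e w = x" using ap_regular_epi[OF e(5)] e(4) D by auto
   then have "y = ap ?f w" unfolding e(6)[symmetric] using x e(1-4) D by simp
   then show "y : img ?f" using w D e(3) by (simp add: img_def)
  qed
  show "img ?f \<subseteq> img k" using img_Cmp_subset[of e k] e(1-4) unfolding e(6) by simp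
 qed
 also have "pp (tdom R) (tcod S) a c : img ?f \<longleftrightarrow>
   (\<exists>w\<in>N P. ap (leg1 C R r) (ap p w) = a \<and> ap (leg2 C S s) (ap q w) = c)"
  using DR DS pf ac unfolding img_def image_iff by auto
 also have "\<dots> \<longleftrightarrow> (\<exists>b. rel R a b \<and> rel S b c)"
 proof
  assume "\<exists>w\<in>N P. ap (leg1 C R r) (ap p w) = a \<and> ap (leg2 C S s) (ap q w) = c"
  then obtain w where w: "w : N P" "ap (leg1 C R r) (ap p w) = a" "ap (leg2 C S s) (ap q w) = c" by blast
  have "ap (leg2 C R r \<cdot> p) w = ap (leg1 C S s \<cdot> q) w" using pf(11) by simp
  then have "ap (leg2 C R r) (ap p w) = ap (leg1 C S s) (ap q w)" using pf(1-10) w DR DS by simp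
  then have "rel R a (ap (leg2 C R r) (ap p w))" "rel S (ap (leg2 C R r) (ap p w)) c"
   unfolding rel_rep[OF R rs(1)] rel_rep[OF S rs(2)] using w pf(1-10) DR DS
   by (auto intro: bexI[of _ "ap p w"] bexI[of _ "ap q w"])
  then show "\<exists>b. rel R a b \<and> rel S b c" by blast
 next
  assume "\<exists>b. rel R a b \<and> rel S b c"
  then obtain x y where "x : N (Dom C r)" "ap (leg1 C R r) x = a" "y : N (Dom C s)"
   "ap (leg2 C S s) y = c" "ap (leg2 C R r) x = ap (leg1 C S s) y"
   unfolding rel_rep[OF R rs(1)] rel_rep[OF S rs(2)] by metis
  then show "\<exists>w\<in>N P. ap (leg1 C R r) (ap p w) = a \<and> ap (leg2 C S s) (ap q w) = c"
   using ap_pullback[OF P, of x y] DR DS by auto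
 qed
 finally show ?thesis .
qed

lemma tensor_img:
 assumes R: "is_relation C R" and S: "is_relation C S" and rs: "r : tmap R" "s : tmap S"
  and P: "is_product C (Dom C r) (Dom C s) P p q"
  and "a : N (tdom R)" "a' : N (tdom S)" "b : N (tcod R)" "b' : N (tcod S)"
 shows "pp (prd C (tdom R) (tdom S)) (prd C (tcod R) (tcod S))
   (pp (tdom R) (tdom S) a a') (pp (tcod R) (tcod S) b b') \<in>
   img (pairing C (pairing C (leg1 C R r \<cdot> p) (leg1 C S s \<cdot> q)) (pairing C (leg2 C R r \<cdot> p) (leg2 C S s \<cdot> q)))
  \<longleftrightarrow> rel R a b \<and> rel S a' b'"
  (is "?c : img ?f \<longleftrightarrow> ?rhs")
proof -
 note DR = relationD(1,2)[OF R] relationD(4-11)[OF R rs(1)]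
 note DS = relationD(1,2)[OF S] relationD(4-11)[OF S rs(2)]
 note pf = product_facts[OF P]
 have "?c : img ?f \<longleftrightarrow> (\<exists>w\<in>N P. ap (leg1 C R r) (ap p w) = a \<and> ap (leg2 C R r) (ap p w) = b \<and>
   ap (leg1 C S s) (ap q w) = a' \<and> ap (leg2 C S s) (ap q w) = b')"
  using DR DS pf assms(6-9) unfolding img_def image_iff by auto
 also have "\<dots> \<longleftrightarrow> ?rhs"
  unfolding rel_rep[OF R rs(1)] rel_rep[OF S rs(2)]
 proof safe
  fix x y assume "x : N (Dom C r)" "y : N (Dom C s)"
  then obtain w where "w : N P" "ap p w = x" "ap q w = y"
   using ap_product[OF P, of x y] pf by auto
  then show "\<exists>w\<in>N P. ap (leg1 C R r) (ap p w) = ap (leg1 C R r) x \<and> ap (leg2 C R r) (ap p w) = ap (leg2 C R r) x \<and>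
   ap (leg1 C S s) (ap q w) = ap (leg1 C S s) y \<and> ap (leg2 C S s) (ap q w) = ap (leg2 C S s) y" by auto
 next
  fix w assume "w : N P"
  then show "\<exists>z\<in>N (Dom C r). ap (leg1 C R r) z = ap (leg1 C R r) (ap p w) \<and> ap (leg2 C R r) z = ap (leg2 C R r) (ap p w)"
   "\<exists>z\<in>N (Dom C s). ap (leg1 C S s) z = ap (leg1 C S s) (ap q w) \<and> ap (leg2 C S s) z = ap (leg2 C S s) (ap q w)"
   using pf by auto
 qed
 finally show ?thesis .
qed

end

context regular_category
begin

lemma pairing_monoI:
 assumes "f : Arr C" "g : Arr C" "Dom C f = Dom C g"
  and "\<And>N ap x y. [|canon N ap; x : N (Dom C g); y : N (Dom C g);
   ap f x = ap f y; ap g x = ap g y|] ==> x = y"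
 shows "is_mono C (pairing C f g)"
proof (rule is_monoI)
 fix N ap x y
 assume N: "canon N ap" and xy: "x : N (Dom C (pairing C f g))" "y : N (Dom C (pairing C f g))"
  and e: "ap (pairing C f g) x = ap (pairing C f g) y"
 interpret model C N ap by fact
 show "x = y" by (rule assms(4)[OF N]) (use assms(1-3) xy e in simp_all)
qed (use assms in simp)

lemma is_relation_span [simp]:
 "[|is_mono C (pairing C f g); f : Arr C; g : Arr C; Dom C f = Dom C g|] ==> is_relation C (span_rel C f g)"
 by (auto simp: is_relation_def span_rel_def is_subobject_def)

lemma is_relation_dagger [simp]:
 assumes R: "is_relation C R"
 shows "is_relation C (rel_dagger C R)"
proof -
 note D = relationD[OF R]
 have ty: "pairing C (leg2 C R r) (leg1 C R r) : Arr C"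
  "Dom C (pairing C (leg2 C R r) (leg1 C R r)) = Dom C r"
  "Cod C (pairing C (leg2 C R r) (leg1 C R r)) = prd C (tcod R) (tdom R)" if "r : tmap R" for r
  using D that by simp_all
 obtain r where r: "r : tmap R" using relation_ex[OF R] ..
 let ?S = "(\<lambda>r. pairing C (leg2 C R r) (leg1 C R r)) ` tmap R"
 have "is_subobject C (prd C (tcod R) (tdom R)) ?S"
 proof (rule is_subobjectI[of "pairing C (leg2 C R r) (leg1 C R r)"])
  fix n assume "n : ?S"
  then obtain s where s: "s : tmap R" "n = pairing C (leg2 C R s) (leg1 C R s)" by auto
  have "is_mono C n" unfolding s(2)
  proof (rule pairing_monoI)
   fix N ap x y
   assume N: "canon N ap" and xy: "x : N (Dom C (leg1 C R s))" "y : N (Dom C (leg1 C R s))"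
    "ap (leg2 C R s) x = ap (leg2 C R s) y" "ap (leg1 C R s) x = ap (leg1 C R s) y"
   interpret model C N ap by fact
   show "x = y" using rel_legs_inj[OF R s(1)] xy D(8)[OF s(1)] by simp
  qed (use D s in simp_all)
  then show "is_mono C n \<and> Cod C n = prd C (tcod R) (tdom R)" using ty s by simp
  fix i assume i: "is_iso C i" "i : Arr C" "Cod C i = Dom C n"
  have ci: "Cod C i = Dom C s" using i s ty by simp
  have "s \<cdot> i : tmap R"
  proof -
   have "is_mono C (s \<cdot> i)" using mono_Cmp[OF D(3)[OF s(1)] iso_is_mono[OF i(1)] ci] .
   then have "s \<cdot> i : sub_class C s"
    unfolding sub_class_iff[OF D(3)[OF s(1)]]
    using i(2) ci D(4)[OF s(1)] by (simp add: model.Cmp_iso_img[OF _ D(4)[OF s(1)] i(1) ci])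
   then show ?thesis using D(12)[OF s(1)] by simp
  qed
  moreover have "n \<cdot> i = pairing C (leg2 C R (s \<cdot> i)) (leg1 C R (s \<cdot> i))"
   unfolding s(2) using D(1,2) D(4-11)[OF s(1)] i(2) ci
   by (simp add: pairing_Cmp) (simp add: leg1_def leg2_def Cmp_assoc)
  ultimately show "n \<cdot> i : ?S" by blast
 next
  fix n and N ap assume "n : ?S" and N: "canon N ap"
  then obtain s where s: "s : tmap R" "n = pairing C (leg2 C R s) (leg1 C R s)" by auto
  interpret model C N ap by fact
  show "img n = img (pairing C (leg2 C R r) (leg1 C R r))"
   unfolding s(2)
   by (rule img_eqI_prd[of _ _ "tcod R" "tdom R"])
    (use ty r s D(1,2) dagger_img[OF R] in simp_all)
 qed (use r in simp)
 then show ?thesis using D(1,2) by (simp add: is_relation_def rel_dagger_def)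
qed

lemma tdom_tcod_simps [simp]:
 "tdom (span_rel C f g) = Cod C f" "tcod (span_rel C f g) = Cod C g"
 "tdom (rel_dagger C R) = tcod R" "tcod (rel_dagger C R) = tdom R"
 "tdom (rel_comp C S R) = tdom R" "tcod (rel_comp C S R) = tcod S"
 "tdom (rel_tensor C R S) = prd C (tdom R) (tdom S)" "tcod (rel_tensor C R S) = prd C (tcod R) (tcod S)"
 by (simp_all add: span_rel_def rel_dagger_def rel_comp_def rel_tensor_def)

lemma is_relation_comp [simp]:
 assumes R: "is_relation C R" and S: "is_relation C S" and RS: "tcod R = tdom S"
 shows "is_relation C (rel_comp C S R)"
proof -
 note DR = relationD[OF R] and DS = relationD[OF S]
 obtain r where r: "r : tmap R" using relation_ex[OF R] ..
 obtain s where s: "s : tmap S" using relation_ex[OF S] ..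
 obtain P p q where P: "is_pullback C (leg2 C R r) (leg1 C S s) P p q"
  using pullback_ex[of "leg2 C R r" "leg1 C S s"] r s DR DS RS by auto
 have cod: "Cod C (pairing C (leg1 C R r \<cdot> p) (leg2 C S s \<cdot> q)) = prd C (tdom R) (tcod S)"
  "pairing C (leg1 C R r \<cdot> p) (leg2 C S s \<cdot> q) : Arr C"
  if "r : tmap R" "s : tmap S" "is_pullback C (leg2 C R r) (leg1 C S s) P p q" for r s P p q
  using pullback_facts[OF that(3)] relationD(1,2)[OF R] relationD(3-12)[OF R, of r] relationD(1,2)[OF S] relationD(3-12)[OF S, of s] that by simp_all
 obtain k where "is_image C (pairing C (leg1 C R r \<cdot> p) (leg2 C S s \<cdot> q)) k"
  using image_ex[OF cod(2)[OF r s P]] ..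
 then have k: "k : tmap (rel_comp C S R)" unfolding rel_comp_def using r s P by (simp, blast)
 have m: "is_mono C n \<and> Cod C n = prd C (tdom R) (tcod S)" if "n : tmap (rel_comp C S R)" for n
 proof -
  obtain r s P p q e where a: "r : tmap R" "s : tmap S" "is_pullback C (leg2 C R r) (leg1 C S s) P p q"
   "is_mono C n" "e : Arr C" "Cod C e = Dom C n"
   "n \<cdot> e = pairing C (leg1 C R r \<cdot> p) (leg2 C S s \<cdot> q)"
   using \<open>n : _\<close> by (auto simp: rel_comp_def is_image_def hom_def)
  have "Cod C (n \<cdot> e) = prd C (tdom R) (tcod S)" unfolding a(7) using cod a by blast
  moreover have "Cod C (n \<cdot> e) = Cod C n" using a(5,6) is_mono_Arr[OF a(4)] by simp
  ultimately show ?thesis using a(4) by simp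
 qed
 have "is_subobject C (prd C (tdom R) (tcod S)) (tmap (rel_comp C S R))"
 proof (rule is_subobjectI[OF k m])
  fix n and N ap assume n: "n : tmap (rel_comp C S R)" and N: "canon N ap"
  interpret model C N ap by fact
  show "img n = img k"
   by (rule img_eqI_prd[of _ _ "tdom R" "tcod S"])
    (use m[OF k] m[OF n] is_mono_Arr DR(1) DS(2) comp_img[OF R S RS k] comp_img[OF R S RS n] in simp_all)
 next
  fix n i assume n: "n : tmap (rel_comp C S R)" and i: "is_iso C i" "i : Arr C" "Cod C i = Dom C n"
  obtain r s P p q e where a: "r : tmap R" "s : tmap S" "is_pullback C (leg2 C R r) (leg1 C S s) P p q"
   "is_mono C n" "e : Arr C" "Cod C e = Dom C n" "regular_epi C e"
   "Dom C e = Dom C (pairing C (leg1 C R r \<cdot> p) (leg2 C S s \<cdot> q))"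
   "n \<cdot> e = pairing C (leg1 C R r \<cdot> p) (leg2 C S s \<cdot> q)"
   using n by (auto simp: rel_comp_def is_image_def hom_def)
  obtain j where j: "j : Arr C" "Dom C j = Cod C i" "Cod C j = Dom C i"
   "j \<cdot> i = Ident C (Dom C i)" "i \<cdot> j = Ident C (Cod C i)" using i(1) by (rule is_isoD)
  have "is_iso C j" unfolding is_iso_def using i(2) j by (auto simp: hom_def intro!: bexI[of _ i])
  then have "regular_epi C (j \<cdot> e)" using regular_epi_iso_Cmp[OF a(7)] j i a by simp
  moreover have "(n \<cdot> i) \<cdot> (j \<cdot> e) = n \<cdot> ((i \<cdot> j) \<cdot> e)"
   using a(5,6) is_mono_Arr[OF a(4)] i j(1-3) by (simp add: Cmp_assoc)
  then have "(n \<cdot> i) \<cdot> (j \<cdot> e) = n \<cdot> e" using j(5) a i by simp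
  ultimately have "is_image C (pairing C (leg1 C R r \<cdot> p) (leg2 C S s \<cdot> q)) (n \<cdot> i)"
   unfolding is_image_def
   using mono_Cmp[OF a(4) iso_is_mono[OF i(1)] i(3)] a i j is_mono_Arr[OF a(4)]
   by (intro conjI bexI[of _ "j \<cdot> e"]) (simp_all add: hom_def)
  then show "n \<cdot> i : tmap (rel_comp C S R)" unfolding rel_comp_def using a(1-3) by (simp, blast)
 qed
 then show ?thesis using DR(1) DS(2) by (simp add: is_relation_def)
qed

lemma is_relation_tensor [simp]:
 assumes R: "is_relation C R" and S: "is_relation C S"
 shows "is_relation C (rel_tensor C R S)"
proof -
 let ?f = "\<lambda>r s p q. pairing C (pairing C (leg1 C R r \<cdot> p) (leg1 C S s \<cdot> q)) (pairing C (leg2 C R r \<cdot> p) (leg2 C S s \<cdot> q))"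
 note DR = relationD[OF R] and DS = relationD[OF S]
 obtain r where r: "r : tmap R" using relation_ex[OF R] ..
 obtain s where s: "s : tmap S" using relation_ex[OF S] ..
 have P: "is_product C (Dom C r) (Dom C s) (prd C (Dom C r) (Dom C s)) (pr1 C (Dom C r) (Dom C s)) (pr2 C (Dom C r) (Dom C s))"
  by (rule prd_product) (use r s DR DS in simp_all)
 have T: "n : tmap (rel_tensor C R S) \<longleftrightarrow> (\<exists>r s P p q. n = ?f r s p q \<and> r : tmap R \<and> s : tmap S \<and>
   is_product C (Dom C r) (Dom C s) P p q)" for n
  by (simp add: rel_tensor_def)
 have ty: "?f r s p q : Arr C" "Dom C (?f r s p q) = P"
  "Cod C (?f r s p q) = prd C (prd C (tdom R) (tdom S)) (prd C (tcod R) (tcod S))"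
  if "r : tmap R" "s : tmap S" "is_product C (Dom C r) (Dom C s) P p q" for r s P p q
  using product_facts[OF that(3)] relationD(1,2)[OF R] relationD(3-12)[OF R, of r] relationD(1,2)[OF S] relationD(3-12)[OF S, of s] that by simp_all
 have k: "?f r s (pr1 C (Dom C r) (Dom C s)) (pr2 C (Dom C r) (Dom C s)) : tmap (rel_tensor C R S)"
  unfolding T using r s P by blast
 have "is_subobject C (prd C (tdom (rel_tensor C R S)) (tcod (rel_tensor C R S))) (tmap (rel_tensor C R S))"
 proof (rule is_subobjectI[OF k])
  fix n assume "n : tmap (rel_tensor C R S)"
  then obtain r s P p q where a: "n = ?f r s p q" "r : tmap R" "s : tmap S" "is_product C (Dom C r) (Dom C s) P p q"
   unfolding T by blast
  note pf = product_facts[OF a(4)] and D = relationD(1,2)[OF R] relationD(3-12)[OF R, of r] relationD(1,2)[OF S] relationD(3-12)[OF S, of s]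
  have "is_mono C n" unfolding a(1)
  proof (rule pairing_monoI)
   fix N ap x y
   assume N: "canon N ap" and
    xy: "x : N (Dom C (pairing C (leg2 C R r \<cdot> p) (leg2 C S s \<cdot> q)))"
    "y : N (Dom C (pairing C (leg2 C R r \<cdot> p) (leg2 C S s \<cdot> q)))"
    "ap (pairing C (leg1 C R r \<cdot> p) (leg1 C S s \<cdot> q)) x = ap (pairing C (leg1 C R r \<cdot> p) (leg1 C S s \<cdot> q)) y"
    "ap (pairing C (leg2 C R r \<cdot> p) (leg2 C S s \<cdot> q)) x = ap (pairing C (leg2 C R r \<cdot> p) (leg2 C S s \<cdot> q)) y"
   interpret model C N ap by fact
   have P: "x : N P" "y : N P" using xy(1,2) pf D a(2,3) by simp_all
   have "ap p x = ap p y"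
    by (rule rel_legs_inj[OF R a(2)]) (use xy(3,4) P pf D a(2,3) in simp_all)
   moreover have "ap q x = ap q y"
    by (rule rel_legs_inj[OF S a(3)]) (use xy(3,4) P pf D a(2,3) in simp_all)
   moreover have "\<exists>!z. z : N P \<and> ap p z = ap p y \<and> ap q z = ap q y"
    by (rule ap_product[OF a(4)]) (use P pf in simp_all)
   ultimately show "x = y" using P by metis
  qed (use pf D a(2,3) in simp_all)
  then show "is_mono C n \<and> Cod C n = prd C (tdom (rel_tensor C R S)) (tcod (rel_tensor C R S))"
   using ty a by simp
  fix i assume i: "is_iso C i" "i : Arr C" "Cod C i = Dom C n"
  have "n \<cdot> i = ?f r s (p \<cdot> i) (q \<cdot> i)"
   unfolding a(1) using pf D a(2,3) i(2,3) ty(2)[OF a(2-4)]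
   by (simp add: pairing_Cmp Cmp_assoc a(1))
  moreover have "is_product C (Dom C r) (Dom C s) (Dom C i) (p \<cdot> i) (q \<cdot> i)"
   using product_iso[OF a(4) i(1)] i(3) ty(2)[OF a(2-4)] a(1) by simp
  ultimately show "n \<cdot> i : tmap (rel_tensor C R S)" unfolding T using a by blast
 next
  fix n and N ap assume "n : tmap (rel_tensor C R S)" and N: "canon N ap"
  then obtain r' s' P' p q where a: "n = ?f r' s' p q" "r' : tmap R" "s' : tmap S" "is_product C (Dom C r') (Dom C s') P' p q"
   unfolding T by blast
  interpret model C N ap by fact
  show "img n = img (?f r s (pr1 C (Dom C r) (Dom C s)) (pr2 C (Dom C r) (Dom C s)))"
  proof (rule img_eqI_prd[of _ _ "prd C (tdom R) (tdom S)" "prd C (tcod R) (tcod S)"])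
   fix c d assume "c : N (prd C (tdom R) (tdom S))" "d : N (prd C (tcod R) (tcod S))"
   then obtain c1 c2 d1 d2 where "c1 : N (tdom R)" "c2 : N (tdom S)" "c = pp (tdom R) (tdom S) c1 c2"
     "d1 : N (tcod R)" "d2 : N (tcod S)" "d = pp (tcod R) (tcod S) d1 d2"
    using Bex_prd[of "tdom R" "tdom S" "\<lambda>z. c = z"] Bex_prd[of "tcod R" "tcod S" "\<lambda>z. d = z"] DR(1,2) DS(1,2) by auto
   then show "pp (prd C (tdom R) (tdom S)) (prd C (tcod R) (tcod S)) c d : img n \<longleftrightarrow>
    pp (prd C (tdom R) (tdom S)) (prd C (tcod R) (tcod S)) c d : img (?f r s (pr1 C (Dom C r) (Dom C s)) (pr2 C (Dom C r) (Dom C s)))"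
    unfolding a(1) using tensor_img[OF R S a(2-4)] tensor_img[OF R S r s P] by simp
  qed (use ty[OF r s P] ty[OF a(2-4)] a(1) DR(1,2) DS(1,2) in simp_all)
 qed
 then show ?thesis using DR(1,2) DS(1,2) by (simp add: is_relation_def)
qed

lemma is_relation_graph [simp]:
 assumes "f : Arr C"
 shows "is_relation C (graph_rel C f)"
proof -
 have "is_mono C (pairing C (Ident C (Dom C f)) f)"
 proof (rule pairing_monoI)
  fix N ap x y
  assume N: "canon N ap" and xy: "x : N (Dom C f)" "y : N (Dom C f)"
    "ap (Ident C (Dom C f)) x = ap (Ident C (Dom C f)) y"
  interpret model C N ap by fact
  show "x = y" using xy assms by simp
 qed (use assms in simp_all)
 then show ?thesis using assms by (simp add: graph_rel_def)
qed

lemma rel_ident_graph: "A : Obj C ==> rel_ident C A = graph_rel C (Ident C A)"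
 by (simp add: rel_ident_def graph_rel_def)

lemma is_relation_ident [simp]: "A : Obj C ==> is_relation C (rel_ident C A)"
 by (simp add: rel_ident_graph)

lemma tdom_tcod_graph [simp]:
 "f : Arr C ==> tdom (graph_rel C f) = Dom C f" "tcod (graph_rel C f) = Cod C f"
 "A : Obj C ==> tdom (rel_ident C A) = A" "A : Obj C ==> tcod (rel_ident C A) = A"
 by (simp_all add: graph_rel_def rel_ident_def)

end

context model
begin

lemma rel_span [simp]:
 assumes "is_mono C (pairing C f g)" "f : Arr C" "g : Arr C" "Dom C f = Dom C g"
 shows "rel (span_rel C f g) a b \<longleftrightarrow> (\<exists>z\<in>N (Dom C f). ap f z = a \<and> ap g z = b)"
proof -
 have "pairing C f g : tmap (span_rel C f g)" by (simp add: span_rel_def sub_class_self assms)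
 from rel_rep[OF is_relation_span[OF assms] this] show ?thesis
  using assms by (simp add: leg1_def leg2_def)
qed

lemma rel_dagger [simp]:
 assumes R: "is_relation C R"
 shows "rel (rel_dagger C R) b a \<longleftrightarrow> rel R a b"
proof -
 obtain r where r: "r : tmap R" using relation_ex[OF R] ..
 have d: "pairing C (leg2 C R r) (leg1 C R r) : tmap (rel_dagger C R)" using r by (simp add: rel_dagger_def)
 show ?thesis
 proof (cases "a : N (tdom R) \<and> b : N (tcod R)")
  case True
  then show ?thesis
   using dagger_img[OF R r, of a b] rel_img[OF is_relation_dagger[OF R] d, of b a] by simp
 next
  case False
  then show ?thesis using rel_in[OF R, of a b] rel_in[OF is_relation_dagger[OF R], of b a] by auto
 qed
qed

lemma rel_comp [simp]:
 assumes R: "is_relation C R" and S: "is_relation C S" and RS: "tcod R = tdom S"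
 shows "rel (rel_comp C S R) a c \<longleftrightarrow> (\<exists>b\<in>N (tcod R). rel R a b \<and> rel S b c)"
proof -
 have SR: "is_relation C (rel_comp C S R)" using assms by simp
 obtain k where k: "k : tmap (rel_comp C S R)" using relation_ex[OF SR] ..
 have "rel (rel_comp C S R) a c \<longleftrightarrow> (\<exists>b. rel R a b \<and> rel S b c)"
 proof (cases "a : N (tdom R) \<and> c : N (tcod S)")
  case True
  then show ?thesis using comp_img[OF R S RS k, of a c] rel_img[OF SR k, of a c] by simp
 next
  case False
  then show ?thesis using rel_in[OF R, of a] rel_in[OF S, of _ c] rel_in[OF SR, of a c] by auto
 qed
 then show ?thesis using rel_in(2)[OF R, of a] by blast
qed

lemma rel_tensor [simp]:
 assumes R: "is_relation C R" and S: "is_relation C S"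
  and e: "a : N (tdom R)" "a' : N (tdom S)" "b : N (tcod R)" "b' : N (tcod S)"
  and ty: "A = tdom R" "A' = tdom S" "B = tcod R" "B' = tcod S"
 shows "rel (rel_tensor C R S) (pp A A' a a') (pp B B' b b') \<longleftrightarrow> rel R a b \<and> rel S a' b'"
proof -
 obtain r where r: "r : tmap R" using relation_ex[OF R] ..
 obtain s where s: "s : tmap S" using relation_ex[OF S] ..
 note DR = relationD[OF R] and DS = relationD[OF S]
 have P: "is_product C (Dom C r) (Dom C s) (prd C (Dom C r) (Dom C s)) (pr1 C (Dom C r) (Dom C s)) (pr2 C (Dom C r) (Dom C s))"
  by (rule prd_product) (use r s DR DS in simp_all)
 have k: "pairing C (pairing C (leg1 C R r \<cdot> pr1 C (Dom C r) (Dom C s)) (leg1 C S s \<cdot> pr2 C (Dom C r) (Dom C s)))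
   (pairing C (leg2 C R r \<cdot> pr1 C (Dom C r) (Dom C s)) (leg2 C S s \<cdot> pr2 C (Dom C r) (Dom C s))) : tmap (rel_tensor C R S)"
  unfolding rel_tensor_def using r s P by (simp del: pairing_simps) blast
 show ?thesis unfolding ty
  using rel_img[OF is_relation_tensor[OF R S] k] tensor_img[OF R S r s P e] e DR(1,2) DS(1,2) by simp
qed

lemma rel_graph [simp]:
 assumes "f : Arr C"
 shows "rel (graph_rel C f) a b \<longleftrightarrow> a : N (Dom C f) \<and> b = ap f a"
proof -
 have "is_mono C (pairing C (Ident C (Dom C f)) f)"
 proof (rule pairing_monoI)
  fix N ap x y
  assume N: "canon N ap" and xy: "x : N (Dom C f)" "y : N (Dom C f)"
    "ap (Ident C (Dom C f)) x = ap (Ident C (Dom C f)) y"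
  interpret M: model C N ap by fact
  show "x = y" using xy assms by simp
 qed (use assms in simp_all)
 then show ?thesis using assms by (auto simp: graph_rel_def)
qed

lemma rel_rel_ident [simp]: "A : Obj C ==> rel (rel_ident C A) a b \<longleftrightarrow> a : N A \<and> b = a"
 by (auto simp: rel_ident_graph)

end

context regular_category
begin

lemma Rel_simps [simp]:
 "Obj (Rel C) = Obj C" "R : Arr (Rel C) \<longleftrightarrow> is_relation C R" "Dom (Rel C) = tdom" "Cod (Rel C) = tcod"
 "Ident (Rel C) = rel_ident C" "Cmp (Rel C) = rel_comp C" "TensO (Rel C) = prd C"
 "TensA (Rel C) = rel_tensor C" "UnitO (Rel C) = one C" "Dag (Rel C) = rel_dagger C"
 "Assoc (Rel C) X Y Z = graph_rel C (prod_assoc C X Y Z)" "LUnit (Rel C) X = graph_rel C (pr2 C (one C) X)"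
 "RUnit (Rel C) X = graph_rel C (pr1 C X (one C))"
 by (simp_all add: Rel_def)

lemma hom_Rel: "R : hom (Rel C) A B \<longleftrightarrow> is_relation C R \<and> tdom R = A \<and> tcod R = B"
 by (auto simp: hom_def)

theorem is_category_Rel: "is_category (Rel C)"
 unfolding is_category_def
proof (intro conjI ballI impI)
 fix R assume "R : Arr (Rel C)"
 then have R: "is_relation C R" by simp
 note D = relationD(1,2)[OF R]
 show "Dom (Rel C) R : Obj (Rel C)" "Cod (Rel C) R : Obj (Rel C)" using D by simp_all
 show "R \<cdot>\<^bsub>Rel C\<^esub> Ident (Rel C) (Dom (Rel C) R) = R"
 proof (rule relation_eqI)
  fix N ap a b assume "canon N ap"
  then interpret model C N ap .
  show "rel (R \<cdot>\<^bsub>Rel C\<^esub> Ident (Rel C) (Dom (Rel C) R)) a b = rel R a b"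
   using R D rel_in[OF R, of a b] by auto
 qed (use R D in simp_all)
 show "Ident (Rel C) (Cod (Rel C) R) \<cdot>\<^bsub>Rel C\<^esub> R = R"
 proof (rule relation_eqI)
  fix N ap a b assume "canon N ap"
  then interpret model C N ap .
  show "rel (Ident (Rel C) (Cod (Rel C) R) \<cdot>\<^bsub>Rel C\<^esub> R) a b = rel R a b"
   using R D rel_in[OF R, of a b] by auto
 qed (use R D in simp_all)
 fix S assume "S : Arr (Rel C)" "Cod (Rel C) R = Dom (Rel C) S"
 then have S: "is_relation C S" "tcod R = tdom S" by simp_all
 then show "S \<cdot>\<^bsub>Rel C\<^esub> R : hom (Rel C) (Dom (Rel C) R) (Cod (Rel C) S)" using R by (simp add: hom_Rel)
 fix T assume "T : Arr (Rel C)" "Cod (Rel C) S = Dom (Rel C) T"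
 then have T: "is_relation C T" "tcod S = tdom T" by simp_all
 show "T \<cdot>\<^bsub>Rel C\<^esub> S \<cdot>\<^bsub>Rel C\<^esub> R = (T \<cdot>\<^bsub>Rel C\<^esub> S) \<cdot>\<^bsub>Rel C\<^esub> R"
 proof (rule relation_eqI)
  fix N ap a b assume "canon N ap"
  then interpret model C N ap .
  show "rel (T \<cdot>\<^bsub>Rel C\<^esub> S \<cdot>\<^bsub>Rel C\<^esub> R) a b = rel ((T \<cdot>\<^bsub>Rel C\<^esub> S) \<cdot>\<^bsub>Rel C\<^esub> R) a b"
   using R S T by auto
 qed (use R S T in simp_all)
next
 fix A assume "A : Obj (Rel C)"
 then show "Ident (Rel C) A : hom (Rel C) A A" by (simp add: hom_Rel)
qed

text \<open>The subobject of the points \<open>z\<close> with \<open>R (f z) (g z)\<close> is the pullback of \<open>R\<close> along the pairing of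
 \<open>f\<close> and \<open>g\<close>.\<close>

lemma comprehension:
 assumes R: "is_relation C R" and fg: "f : Arr C" "g : Arr C" "Dom C f = Dom C g" "Cod C f = tdom R" "Cod C g = tcod R"
 obtains j where "is_mono C j" "j : Arr C" "Cod C j = Dom C g"
  "\<And>N ap z. [|canon N ap; z : N (Dom C g)|]
   ==> z : img_at N ap j \<longleftrightarrow> rel_at N ap R (ap f z) (ap g z)"
proof -
 obtain r where r: "r : tmap R" using relation_ex[OF R] ..
 note D = relationD[OF R]
 let ?h = "pairing C f g" and ?j = "pb2 C r (pairing C f g)"
 have h: "r : Arr C" "?h : Arr C" "Cod C r = Cod C ?h" using D r fg by simp_all
 note pb = pb_simps[OF h]
 show ?thesis
 proof (rule that[of ?j])
  show "is_mono C ?j"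
  proof (rule is_monoI)
   fix N ap x y
   assume N: "canon N ap" and xy: "x : N (Dom C ?j)" "y : N (Dom C ?j)" "ap ?j x = ap ?j y"
   interpret model C N ap by fact
   show "x = y"
   proof (rule pb_elt_eq[OF h _ _ _ xy(3)])
    show "ap (pb1 C r ?h) x = ap (pb1 C r ?h) y"
     by (rule mono_elt_eq[OF D(3)[OF r]])
      (use xy pb h pb_elt_commutes[OF h, of x] pb_elt_commutes[OF h, of y] in simp_all)
   qed (use xy pb in simp_all)
  qed (use pb in simp)
  fix N ap z
  assume N: "canon N ap" and z: "z : N (Dom C g)"
  interpret model C N ap by fact
  have "z : img ?j \<longleftrightarrow> ap ?h z : img r"
  proof
   assume "z : img ?j"
   then obtain w where w: "w : N (pb C r ?h)" "z = ap ?j w" using pb by (auto simp: img_def)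
   then show "ap ?h z : img r" using pb_elt_commutes[OF h w(1)] pb by (auto simp: img_def intro: image_eqI[of _ _ "ap (pb1 C r ?h) w"])
  next
   assume "ap ?h z : img r"
   then obtain x where x: "x : N (Dom C r)" "ap r x = ap ?h z" by (auto simp: img_def)
   have "pbe r ?h x z : N (Dom C ?j)" "ap ?j (pbe r ?h x z) = z" using pbe_simps[OF h x(1) _ x(2)] z fg pb by auto
   then show "z : img ?j" by (auto simp: img_def image_iff intro!: bexI[of _ "pbe r ?h x z"])
  qed
  also have "\<dots> \<longleftrightarrow> rel R (ap f z) (ap g z)"
   using rel_img[OF R r, of "ap f z" "ap g z"] z fg by simp
  finally show "z : img ?j \<longleftrightarrow> rel R (ap f z) (ap g z)" .
 qed (use pb fg in simp_all)
qed

text \<open>A relation that is a function on the elements of every model is the graph of an arrow: its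
 first projection is bijective on elements.\<close>

lemma functional_relation:
 assumes R: "is_relation C R" and AB: "A : Obj C" "B : Obj C"
  and fg: "f : Arr C" "g : Arr C" "Dom C f = prd C A B" "Dom C g = prd C A B" "Cod C f = tdom R" "Cod C g = tcod R"
  and ex1: "\<And>N ap a. [|canon N ap; a : N A|]
   ==> \<exists>!b. b : N B \<and> rel_at N ap R (ap f (pp_at N ap A B a b)) (ap g (pp_at N ap A B a b))"
 obtains k where "k : Arr C" "Dom C k = A" "Cod C k = B"
  "\<And>N ap a b. [|canon N ap; a : N A; b : N B|]
   ==> rel_at N ap R (ap f (pp_at N ap A B a b)) (ap g (pp_at N ap A B a b)) \<longleftrightarrow> b = ap k a"
proof -
 obtain j where j: "is_mono C j" "j : Arr C" "Cod C j = prd C A B"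
  "\<And>N ap z. [|canon N ap; z : N (prd C A B)|]
   ==> z : img_at N ap j \<longleftrightarrow> rel_at N ap R (ap f z) (ap g z)"
  using comprehension[OF R fg(1,2)] fg by (metis (no_types, lifting))
 let ?p = "pr1 C A B \<cdot> j"
 have p: "?p : Arr C" "Dom C ?p = Dom C j" "Cod C ?p = A" using j AB by simp_all
 have jimg: "\<exists>b. b : N B \<and> ap j x = pp_at N ap A B (ap ?p x) b \<and>
   rel_at N ap R (ap f (ap j x)) (ap g (ap j x))"
  if N: "canon N ap" and x: "x : N (Dom C j)" for N ap x
 proof -
  interpret model C N ap by fact
  have "ap j x : img j" using x by (simp add: img_def)
  then have "rel R (ap f (ap j x)) (ap g (ap j x))" using j(2,3) j(4)[OF N, of "ap j x"] x by simp
  then show ?thesis using pp_eta[OF AB, of "ap j x"] x j(2,3) AB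
   by (intro exI[of _ "ap (pr2 C A B) (ap j x)"]) simp
 qed
 have "is_iso C ?p"
 proof (rule is_isoI[OF p(1)])
  fix N ap x y
  assume N: "canon N ap" and xy: "x : N (Dom C ?p)" "y : N (Dom C ?p)" "ap ?p x = ap ?p y"
  interpret model C N ap by fact
  have "ap j x = ap j y"
   using jimg[OF N, of x] jimg[OF N, of y] ex1[OF N, of "ap ?p x"] xy p by (metis ap_in_cod)
  then show "x = y" using mono_elt_eq[OF j(1)] xy p by simp
 next
  fix N ap a
  assume N: "canon N ap" and a: "a : N (Cod C ?p)"
  interpret model C N ap by fact
  obtain b where b: "b : N B" "rel R (ap f (pp A B a b)) (ap g (pp A B a b))"
   using ex1[OF N, of a] a p by auto
  then have "pp A B a b : img j" using j(4)[OF N, of "pp A B a b"] a p AB by simp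
  then obtain x where "x : N (Dom C j)" "ap j x = pp A B a b" by (auto simp: img_def)
  then show "a : img ?p" using a b p j(2,3) AB by (auto simp: img_def image_iff intro!: bexI[of _ x])
 qed
 then obtain h where h: "h : Arr C" "Dom C h = A" "Cod C h = Dom C j" "?p \<cdot> h = Ident C A"
  using is_isoD[of ?p] p by metis
 let ?k = "pr2 C A B \<cdot> (j \<cdot> h)"
 show ?thesis
 proof (rule that[of ?k])
  fix N ap a b
  assume N: "canon N ap" and ab: "a : N A" "b : N B"
  interpret model C N ap by fact
  have "ap (?p \<cdot> h) a = a" unfolding h(4) using ab AB by simp
  then have ph: "ap ?p (ap h a) = a" using h(1-3) p ab by (metis ap_Cmp)
  obtain b' where b': "b' : N B" "ap j (ap h a) = pp A B a b'" "rel R (ap f (pp A B a b')) (ap g (pp A B a b'))"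
   using jimg[OF N, of "ap h a"] ab h ph by auto
  then have "ap ?k a = b'" using ab h j(2,3) AB by simp
  then show "rel R (ap f (pp A B a b)) (ap g (pp A B a b)) \<longleftrightarrow> b = ap ?k a"
   using ex1[OF N ab(1)] b' ab by auto
 qed (use h j AB in simp_all)
qed

lemma equalizer_ex:
 assumes "f : Arr C" "g : Arr C" "Dom C f = Dom C g" "Cod C f = Cod C g"
 obtains j where "is_mono C j" "j : Arr C" "Cod C j = Dom C g"
  "\<And>N ap z. [|canon N ap; z : N (Dom C g)|]
   ==> z : img_at N ap j \<longleftrightarrow> ap f z = ap g z"
proof -
 have R: "is_relation C (rel_ident C (Cod C f))" "Cod C f = tdom (rel_ident C (Cod C f))"
  "Cod C g = tcod (rel_ident C (Cod C f))" using assms by simp_all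
 obtain j where
  j: "is_mono C j" "j : Arr C" "Cod C j = Dom C g" and
  J: "\<And>N ap z. [|canon N ap; z : N (Dom C g)|]
   ==> z : img_at N ap j \<longleftrightarrow> rel_at N ap (rel_ident C (Cod C f)) (ap f z) (ap g z)"
  using comprehension[OF R(1) assms(1-3) R(2,3)] by (metis (no_types, lifting))
 show ?thesis
 proof (rule that[OF j])
  fix N ap z
  assume N: "canon N ap" and z: "z : N (Dom C g)"
  interpret model C N ap by fact
  show "z : img j \<longleftrightarrow> ap f z = ap g z" using J[OF N z] z assms by auto
 qed
qed

lemma span_image_ex:
 assumes "p : Arr C" "q : Arr C" "Dom C p = Dom C q"
 obtains R where "is_relation C R" "tdom R = Cod C p" "tcod R = Cod C q"
  "\<And>N ap a b. canon N ap
   ==> rel_at N ap R a b \<longleftrightarrow> (\<exists>z\<in>N (Dom C q). ap p z = a \<and> ap q z = b)"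
proof (rule that[of "rel_comp C (graph_rel C q) (rel_dagger C (graph_rel C p))"])
 fix N ap a b
 assume N: "canon N ap"
 interpret model C N ap by fact
 show "rel (rel_comp C (graph_rel C q) (rel_dagger C (graph_rel C p))) a b \<longleftrightarrow>
   (\<exists>z\<in>N (Dom C q). ap p z = a \<and> ap q z = b)"
  using assms by auto
qed (use assms in simp_all)

section \<open>Mal'cev categories\<close>

lemma malcev_symmetric:
 assumes "malcev C" and T: "is_relation C T" "tdom T = tcod T"
  and refl: "\<And>N ap a. [|canon N ap; a : N (tcod T)|] ==> rel_at N ap T a a"
  and N: "canon N ap" and "rel_at N ap T a b"
 shows "rel_at N ap T b a"
proof -
 note D = relationD(1,2)[OF T(1)]
 have "reflexive_rel C T"
  unfolding reflexive_rel_def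
 proof (rule relation_leI)
  fix N ap a b
  assume N: "canon N ap" and "rel_at N ap (rel_ident C (tdom T)) a b"
  interpret model C N ap by fact
  show "rel T a b" using \<open>rel (rel_ident C (tdom T)) a b\<close> refl[OF N] D T by simp
 qed (use T D in simp_all)
 then have "symmetric_rel C T" using assms(1) T unfolding malcev_def by blast
 then have le: "sub_le C (tmap T) (tmap (rel_dagger C T))" unfolding symmetric_rel_def .
 have "rel_at N ap (rel_dagger C T) a b"
  by (rule model.sub_le_rel[OF N T(1) is_relation_dagger[OF T(1)] _ _ le assms(6)]) (use T in simp_all)
 then show ?thesis using model.rel_dagger[OF N T(1)] by simp
qed

text \<open>In a Mal'cev category every span is difunctional. The relation \<open>p z \<sim> q w\<close> between points
 \<open>z\<close> and \<open>w\<close> of the span itself is reflexive, hence symmetric.\<close>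

lemma malcev_difunctional:
 assumes mal: "malcev C" and pq: "p : Arr C" "q : Arr C" "Dom C p = Dom C q"
  and N: "canon N ap"
  and z: "z1 : N (Dom C q)" "z2 : N (Dom C q)" "z3 : N (Dom C q)"
  and eq: "ap q z1 = ap q z2" "ap p z2 = ap p z3"
 shows "\<exists>z\<in>N (Dom C q). ap p z = ap p z1 \<and> ap q z = ap q z3"
proof -
 obtain R where R: "is_relation C R" "tdom R = Cod C p" "tcod R = Cod C q" and
  Rel: "\<And>N ap a b. canon N ap
   ==> rel_at N ap R a b \<longleftrightarrow> (\<exists>z\<in>N (Dom C q). ap p z = a \<and> ap q z = b)"
  using span_image_ex[OF pq] by (metis (no_types, lifting))
 define T where "T = rel_comp C (rel_dagger C (graph_rel C q)) (rel_comp C R (graph_rel C p))"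
 have T: "is_relation C T" "tdom T = Dom C q" "tcod T = Dom C q" using R pq by (simp_all add: T_def)
 have relT: "rel_at N ap T z w \<longleftrightarrow> z : N (Dom C q) \<and> w : N (Dom C q) \<and>
   (\<exists>v\<in>N (Dom C q). ap p v = ap p z \<and> ap q v = ap q w)"
  if N: "canon N ap" for N ap z w
 proof -
  interpret model C N ap by fact
  show ?thesis using R pq Rel[OF N] by (auto simp: T_def)
 qed
 have "rel_at N ap T z3 z1" unfolding relT[OF N] using z eq by metis
 then have "rel_at N ap T z1 z3"
  by (rule malcev_symmetric[OF mal _ _ _ N, rotated -1]) (use T relT in auto)
 then show ?thesis unfolding relT[OF N] by blast
qed

end

section \<open>Internal categories on elements\<close>

locale set_cat =
 fixes G0 :: "'x set" and G1 :: "'y set" and s t :: "'y => 'x" and u :: "'x => 'y"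
  and c :: "'y => 'y => 'y"
 assumes s_in [simp]: "a : G1 ==> s a : G0" and t_in [simp]: "a : G1 ==> t a : G0"
  and u_in [simp]: "x : G0 ==> u x : G1"
  and c_in [simp]: "[|g : G1; f : G1; s g = t f|] ==> c g f : G1"
  and s_u [simp]: "x : G0 ==> s (u x) = x" and t_u [simp]: "x : G0 ==> t (u x) = x"
  and s_c [simp]: "[|g : G1; f : G1; s g = t f|] ==> s (c g f) = s f"
  and t_c [simp]: "[|g : G1; f : G1; s g = t f|] ==> t (c g f) = t g"
  and c_u_right [simp]: "a : G1 ==> c a (u (s a)) = a"
  and c_u_left [simp]: "a : G1 ==> c (u (t a)) a = a"
  and c_assoc: "[|h : G1; g : G1; f : G1; s h = t g; s g = t f|] ==> c (c h g) f = c h (c g f)"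

locale set_gpd = set_cat G0 G1 s t u c for G0 :: "'x set" and G1 :: "'y set" and s t u c +
 fixes i :: "'y => 'y"
 assumes i_in [simp]: "a : G1 ==> i a : G1"
  and s_i [simp]: "a : G1 ==> s (i a) = t a" and t_i [simp]: "a : G1 ==> t (i a) = s a"
  and c_i_left [simp]: "a : G1 ==> c (i a) a = u (s a)"
  and c_i_right [simp]: "a : G1 ==> c a (i a) = u (t a)"
begin

lemma c_i_cancel [simp]:
 "[|a : G1; b : G1; s a = t b|] ==> c (i a) (c a b) = b"
 "[|a : G1; b : G1; t a = t b|] ==> c a (c (i a) b) = b"
 "[|a : G1; b : G1; s a = t b|] ==> c (c a b) (i b) = a"
 "[|a : G1; b : G1; s a = s b|] ==> c (c a (i b)) b = a"
proof -
 show "c (i a) (c a b) = b" if "a : G1" "b : G1" "s a = t b"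
  using that c_assoc[of "i a" a b] by simp
 show "c a (c (i a) b) = b" if "a : G1" "b : G1" "t a = t b"
  using that c_assoc[of a "i a" b] by simp
 show "c (c a b) (i b) = a" if "a : G1" "b : G1" "s a = t b"
  using that c_assoc[of a b "i b"] by (simp flip: that(3))
 show "c (c a (i b)) b = a" if "a : G1" "b : G1" "s a = s b"
  using that c_assoc[of a "i b" b] by (simp flip: that(3))
qed

lemma i_unique: "[|a : G1; b : G1; s b = t a; c b a = u (s a)|] ==> b = i a"
 by (metis c_i_cancel(3) c_u_left i_in t_i)

lemma i_unique': "[|a : G1; b : G1; s a = t b; c a b = u (t a)|] ==> b = i a"
 by (metis c_i_cancel(1) c_u_right i_in s_i)

lemma i_i [simp]: "a : G1 ==> i (i a) = a"
 by (metis i_unique c_i_right i_in s_i t_i)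

end

context regular_category
begin

lemma internal_category_typing [simp]:
 assumes "internal_category C A"
 shows "iObj A : Obj C" "iArr A : Obj C" "iSrc A : Arr C" "iTgt A : Arr C" "iUnit A : Arr C" "iComp A : Arr C"
  "Dom C (iSrc A) = iArr A" "Cod C (iSrc A) = iObj A" "Dom C (iTgt A) = iArr A" "Cod C (iTgt A) = iObj A"
  "Dom C (iUnit A) = iObj A" "Cod C (iUnit A) = iArr A"
  "Dom C (iComp A) = pb C (iSrc A) (iTgt A)" "Cod C (iComp A) = iArr A"
 using assms by (simp_all add: internal_category_def Let_def hom_def comp_pairs_def)

lemma internal_groupoid_category [simp]: "internal_groupoid C A ==> internal_category C A"
 by (simp add: internal_groupoid_def)

lemma internal_groupoid_typing [simp]:
 assumes "internal_groupoid C A"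
 shows "iInv A : Arr C" "Dom C (iInv A) = iArr A" "Cod C (iInv A) = iArr A"
 using assms by (simp_all add: internal_groupoid_def hom_def)

end

context model
begin

definition mcomp :: "('o, 'm, 'w) icat_scheme => 'a => 'a => 'a" where
 "mcomp A g f = ap (iComp A) (pbe (iSrc A) (iTgt A) g f)"

abbreviation elt_cat :: "('o, 'm, 'w) icat_scheme => bool" where
 "elt_cat A \<equiv> set_cat (N (iObj A)) (N (iArr A)) (ap (iSrc A)) (ap (iTgt A)) (ap (iUnit A)) (mcomp A)"

abbreviation elt_gpd :: "('o, 'm, 'w) igpd_scheme => bool" where
 "elt_gpd A \<equiv> set_gpd (N (iObj A)) (N (iArr A)) (ap (iSrc A)) (ap (iTgt A)) (ap (iUnit A)) (mcomp A)
   (ap (iInv A))"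

lemma ap_icomp:
 assumes "iSrc A : Arr C" "iTgt A : Arr C" "iComp A : Arr C" "Cod C (iSrc A) = Cod C (iTgt A)"
  "Dom C (iComp A) = pb C (iSrc A) (iTgt A)"
  "g : Arr C" "f : Arr C" "Dom C g = Dom C f" "Cod C g = Dom C (iSrc A)" "Cod C f = Dom C (iTgt A)"
  "iSrc A \<cdot> g = iTgt A \<cdot> f" "x : N (Dom C f)"
 shows "ap (icomp C A g f) x = mcomp A (ap g x) (ap f x)"
 unfolding icomp_def mcomp_def using assms by simp

lemma internal_category_elts:
 assumes A: "internal_category C A"
 shows "elt_cat A"
proof -
 let ?s = "iSrc A" and ?t = "iTgt A" and ?u = "iUnit A" and ?m = "iComp A"
 let ?p = "pb1 C ?s ?t" and ?q = "pb2 C ?s ?t"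
 note T = internal_category_typing[OF A]
 have eqs: "?s \<cdot> ?u = Ident C (iObj A)" "?t \<cdot> ?u = Ident C (iObj A)" "?s \<cdot> ?m = ?s \<cdot> ?q" "?t \<cdot> ?m = ?t \<cdot> ?p"
  "icomp C A (Ident C (iArr A)) (?u \<cdot> ?s) = Ident C (iArr A)"
  "icomp C A (?u \<cdot> ?t) (Ident C (iArr A)) = Ident C (iArr A)"
  "icomp C A (?m \<cdot> pb1 C ?q ?p) (?q \<cdot> pb2 C ?q ?p) = icomp C A (?p \<cdot> pb1 C ?q ?p) (?m \<cdot> pb2 C ?q ?p)"
  using A unfolding internal_category_def Let_def cp1_def cp2_def by blast+
 have pq: "?p : Arr C" "?q : Arr C" "Dom C ?p = pb C ?s ?t" "Dom C ?q = pb C ?s ?t" "Cod C ?p = iArr A" "Cod C ?q = iArr A"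
  using T by simp_all
 have su: "ap ?s (ap ?u x) = x" "ap ?t (ap ?u x) = x" if "x : N (iObj A)" for x
 proof -
  have "ap (?s \<cdot> ?u) x = x" "ap (?t \<cdot> ?u) x = x" unfolding eqs using T that by simp_all
  then show "ap ?s (ap ?u x) = x" "ap ?t (ap ?u x) = x" using T that by simp_all
 qed
 have sm: "ap ?s (mcomp A g f) = ap ?s f \<and> ap ?t (mcomp A g f) = ap ?t g \<and> mcomp A g f : N (iArr A)"
  if "g : N (iArr A)" "f : N (iArr A)" "ap ?s g = ap ?t f" for g f
 proof -
  have z: "pbe ?s ?t g f : N (pb C ?s ?t)" "ap ?p (pbe ?s ?t g f) = g" "ap ?q (pbe ?s ?t g f) = f"
   using T that by simp_all
  have "ap (?s \<cdot> ?m) (pbe ?s ?t g f) = ap (?s \<cdot> ?q) (pbe ?s ?t g f)"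
   "ap (?t \<cdot> ?m) (pbe ?s ?t g f) = ap (?t \<cdot> ?p) (pbe ?s ?t g f)" using eqs by simp_all
  then show ?thesis using T z pq unfolding mcomp_def by simp
 qed
 show ?thesis
 proof
  fix a assume a: "a : N (iArr A)"
  have "?s \<cdot> (?u \<cdot> ?s) = ?s" "?t \<cdot> (?u \<cdot> ?s) = ?s" "?s \<cdot> (?u \<cdot> ?t) = ?t"
   using T eqs(1,2) by (simp_all flip: Cmp_assoc)
  then have "ap (icomp C A (Ident C (iArr A)) (?u \<cdot> ?s)) a = mcomp A a (ap ?u (ap ?s a))"
   "ap (icomp C A (?u \<cdot> ?t) (Ident C (iArr A))) a = mcomp A (ap ?u (ap ?t a)) a"
   using T a by (subst ap_icomp; simp)+
  then show "mcomp A a (ap ?u (ap ?s a)) = a" "mcomp A (ap ?u (ap ?t a)) a = a"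
   unfolding eqs using a T by simp_all
 next
  fix h g f
  assume e: "h : N (iArr A)" "g : N (iArr A)" "f : N (iArr A)" "ap ?s h = ap ?t g" "ap ?s g = ap ?t f"
  let ?hg = "pb1 C ?q ?p" and ?gf = "pb2 C ?q ?p"
  have P: "?q : Arr C" "?p : Arr C" "Cod C ?q = Cod C ?p" using pq by simp_all
  note pb = pb_simps[OF P] and pbc = pb_commutes[OF P]
  define x where "x = pbe ?q ?p (pbe ?s ?t h g) (pbe ?s ?t g f)"
  have x: "x : N (pb C ?q ?p)" "ap ?hg x = pbe ?s ?t h g" "ap ?gf x = pbe ?s ?t g f"
   unfolding x_def using P pq T e by simp_all
  have "?s \<cdot> (?m \<cdot> ?hg) = (?s \<cdot> ?m) \<cdot> ?hg" using T pb pq by (simp add: Cmp_assoc)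
  also have "\<dots> = ?s \<cdot> (?q \<cdot> ?hg)" unfolding eqs using T pb pq by (simp add: Cmp_assoc)
  also have "\<dots> = (?s \<cdot> ?p) \<cdot> ?gf" unfolding pbc using T pb pq by (simp add: Cmp_assoc)
  also have "\<dots> = ?t \<cdot> (?q \<cdot> ?gf)" using pb_commutes[of ?s ?t] T pb pq by (simp add: Cmp_assoc)
  finally have c1: "?s \<cdot> (?m \<cdot> ?hg) = ?t \<cdot> (?q \<cdot> ?gf)" .
  have "?t \<cdot> (?m \<cdot> ?gf) = (?t \<cdot> ?m) \<cdot> ?gf" using T pb pq by (simp add: Cmp_assoc)
  also have "\<dots> = ?t \<cdot> (?p \<cdot> ?gf)" unfolding eqs using T pb pq by (simp add: Cmp_assoc)
  also have "\<dots> = (?t \<cdot> ?q) \<cdot> ?hg" unfolding pbc[symmetric] using T pb pq by (simp add: Cmp_assoc)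
  also have "\<dots> = (?s \<cdot> ?p) \<cdot> ?hg" using pb_commutes[of ?s ?t] T by simp
  also have "\<dots> = ?s \<cdot> (?p \<cdot> ?hg)" using T pb pq by (simp add: Cmp_assoc)
  finally have c2: "?s \<cdot> (?p \<cdot> ?hg) = ?t \<cdot> (?m \<cdot> ?gf)" by simp
  have "ap (icomp C A (?m \<cdot> ?hg) (?q \<cdot> ?gf)) x = mcomp A (mcomp A h g) f"
   using T pq pb x e c1 by (subst ap_icomp) (simp_all add: mcomp_def)
  moreover have "ap (icomp C A (?p \<cdot> ?hg) (?m \<cdot> ?gf)) x = mcomp A h (mcomp A g f)"
   using T pq pb x e c2 by (subst ap_icomp) (simp_all add: mcomp_def)
  ultimately show "mcomp A (mcomp A h g) f = mcomp A h (mcomp A g f)" using eqs(7) by simp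
 qed (use T su sm in auto)
qed

lemma internal_groupoid_elts:
 assumes A: "internal_groupoid C A"
 shows "elt_gpd A"
proof -
 interpret set_cat "N (iObj A)" "N (iArr A)" "ap (iSrc A)" "ap (iTgt A)" "ap (iUnit A)" "mcomp A"
  using A by (intro internal_category_elts) simp
 let ?s = "iSrc A" and ?t = "iTgt A" and ?u = "iUnit A" and ?i = "iInv A"
 note T = internal_groupoid_typing[OF A] internal_category_typing[OF internal_groupoid_category[OF A]]
 have eqs: "?s \<cdot> ?i = ?t" "?t \<cdot> ?i = ?s" "icomp C A ?i (Ident C (iArr A)) = ?u \<cdot> ?s"
  "icomp C A (Ident C (iArr A)) ?i = ?u \<cdot> ?t"
  using A unfolding internal_groupoid_def by blast+
 show ?thesis
 proof
  fix a assume a: "a : N (iArr A)"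
  show "ap ?i a : N (iArr A)" using T a by simp
  have "ap (?s \<cdot> ?i) a = ap ?t a" "ap (?t \<cdot> ?i) a = ap ?s a" unfolding eqs by simp_all
  then show "ap ?s (ap ?i a) = ap ?t a" "ap ?t (ap ?i a) = ap ?s a" using T a by simp_all
  have "ap (icomp C A ?i (Ident C (iArr A))) a = mcomp A (ap ?i a) a"
   "ap (icomp C A (Ident C (iArr A)) ?i) a = mcomp A a (ap ?i a)"
   using T eqs a by (subst ap_icomp; simp)+
  then show "mcomp A (ap ?i a) a = ap ?u (ap ?s a)" "mcomp A a (ap ?i a) = ap ?u (ap ?t a)"
   unfolding eqs using T a by simp_all
 qed
qed

end

text \<open>In a model, internal categories and groupoids are small categories and groupoids.\<close>

locale cat_elts = model C N ap for C :: "('o, 'm, 'z) cat_scheme" (structure) and N :: "'o => 'a set" and ap +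
 fixes A :: "('o, 'm, 'w) icat_scheme"
 assumes cat: "internal_category C A"

sublocale cat_elts \<subseteq> set_cat "N (iObj A)" "N (iArr A)" "ap (iSrc A)" "ap (iTgt A)" "ap (iUnit A)" "mcomp A"
 by (rule internal_category_elts[OF cat])

locale gpd_elts = model C N ap for C :: "('o, 'm, 'z) cat_scheme" (structure) and N :: "'o => 'a set" and ap +
 fixes A :: "('o, 'm, 'w) igpd_scheme"
 assumes gpd: "internal_groupoid C A"

sublocale gpd_elts \<subseteq> set_gpd "N (iObj A)" "N (iArr A)" "ap (iSrc A)" "ap (iTgt A)" "ap (iUnit A)" "mcomp A" "ap (iInv A)"
 by (rule internal_groupoid_elts[OF gpd])

context regular_category
begin

abbreviation mcomp_at where "mcomp_at N ap \<equiv> model.mcomp C N ap"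

text \<open>The defining equations of an internal category are equations between arrows, and each is tested on
elements; the converse of \<open>internal_category_elts\<close>.\<close>

lemma internal_categoryI:
 assumes T: "iSrc A : Arr C" "iTgt A : Arr C" "iUnit A : Arr C" "iComp A : Arr C"
  "Dom C (iSrc A) = iArr A" "Cod C (iSrc A) = iObj A" "Dom C (iTgt A) = iArr A" "Cod C (iTgt A) = iObj A"
  "Dom C (iUnit A) = iObj A" "Cod C (iUnit A) = iArr A"
  "Dom C (iComp A) = pb C (iSrc A) (iTgt A)" "Cod C (iComp A) = iArr A"
  and elts: "\<And>N ap. canon N ap ==> model.elt_cat C N ap A"
 shows "internal_category C A"
proof -
 let ?s = "iSrc A" and ?t = "iTgt A" and ?u = "iUnit A" and ?m = "iComp A"
 let ?p = "pb1 C ?s ?t" and ?q = "pb2 C ?s ?t"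
 let ?hg = "pb1 C ?q ?p" and ?gf = "pb2 C ?q ?p"
 have O: "iObj A : Obj C" "iArr A : Obj C" using T Dom_Obj[of ?u] Dom_Obj[of ?s] by simp_all
 have st: "?s : Arr C" "?t : Arr C" "Cod C ?s = Cod C ?t" using T by simp_all
 have pq: "?p : Arr C" "?q : Arr C" "Dom C ?p = pb C ?s ?t" "Dom C ?q = pb C ?s ?t" "Cod C ?p = iArr A" "Cod C ?q = iArr A"
  using T by simp_all
 have P: "?q : Arr C" "?p : Arr C" "Cod C ?q = Cod C ?p" using pq by simp_all
 note pb = pb_simps[OF P]
 have su: "?s \<cdot> ?u = Ident C (iObj A)"
 proof (rule arr_eqI)
  fix N ap x assume N: "canon N ap" and x: "x : N (Dom C (Ident C (iObj A)))"
  interpret model C N ap by fact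
  interpret set_cat "N (iObj A)" "N (iArr A)" "ap ?s" "ap ?t" "ap ?u" "mcomp A" by (rule elts[OF N])
  show "ap (?s \<cdot> ?u) x = ap (Ident C (iObj A)) x" using x O T by simp
 qed (use T O in simp_all)
 have tu: "?t \<cdot> ?u = Ident C (iObj A)"
 proof (rule arr_eqI)
  fix N ap x assume N: "canon N ap" and x: "x : N (Dom C (Ident C (iObj A)))"
  interpret model C N ap by fact
  interpret set_cat "N (iObj A)" "N (iArr A)" "ap ?s" "ap ?t" "ap ?u" "mcomp A" by (rule elts[OF N])
  show "ap (?t \<cdot> ?u) x = ap (Ident C (iObj A)) x" using x O T by simp
 qed (use T O in simp_all)
 have m: "\<exists>g f. g : N (iArr A) \<and> f : N (iArr A) \<and> ap ?s g = ap ?t f \<and> ap ?p x = g \<and> ap ?q x = f \<and>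
   ap ?m x = mcomp_at N ap A g f" if N: "canon N ap" and x: "x : N (pb C ?s ?t)"
  for N ap x
 proof -
  interpret model C N ap by fact
  have e: "ap ?s (ap ?p x) = ap ?t (ap ?q x)" using pb_elt_commutes[OF st x] .
  have "pbe ?s ?t (ap ?p x) (ap ?q x) = x"
   by (rule pb_elt_eq[OF st]) (use e x T pq in simp_all)
  then show ?thesis using e x pq unfolding mcomp_def by auto
 qed
 have sm: "?s \<cdot> ?m = ?s \<cdot> ?q"
 proof (rule arr_eqI)
  fix N ap x assume N: "canon N ap" and x: "x : N (Dom C (?s \<cdot> ?q))"
  interpret model C N ap by fact
  interpret set_cat "N (iObj A)" "N (iArr A)" "ap ?s" "ap ?t" "ap ?u" "mcomp A" by (rule elts[OF N])
  show "ap (?s \<cdot> ?m) x = ap (?s \<cdot> ?q) x" using m[OF N, of x] x T pq by auto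
 qed (use T pq in simp_all)
 have tm: "?t \<cdot> ?m = ?t \<cdot> ?p"
 proof (rule arr_eqI)
  fix N ap x assume N: "canon N ap" and x: "x : N (Dom C (?t \<cdot> ?p))"
  interpret model C N ap by fact
  interpret set_cat "N (iObj A)" "N (iArr A)" "ap ?s" "ap ?t" "ap ?u" "mcomp A" by (rule elts[OF N])
  show "ap (?t \<cdot> ?m) x = ap (?t \<cdot> ?p) x" using m[OF N, of x] x T pq by auto
 qed (use T pq in simp_all)
 have ty: "icomp C A g f : Arr C" "Dom C (icomp C A g f) = Dom C g" "Cod C (icomp C A g f) = iArr A"
  if "g : Arr C" "f : Arr C" "Dom C g = Dom C f" "Cod C g = iArr A" "Cod C f = iArr A" "?s \<cdot> g = ?t \<cdot> f" for g f
  unfolding icomp_def using that T by simp_all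
 have e1: "?s \<cdot> Ident C (iArr A) = ?t \<cdot> (?u \<cdot> ?s)" "?s \<cdot> (?u \<cdot> ?t) = ?t \<cdot> Ident C (iArr A)"
  using T su tu by (simp_all flip: Cmp_assoc)
 have c_right: "icomp C A (Ident C (iArr A)) (?u \<cdot> ?s) = Ident C (iArr A)"
 proof (rule arr_eqI)
  fix N ap x assume N: "canon N ap" and x: "x : N (Dom C (Ident C (iArr A)))"
  interpret model C N ap by fact
  interpret set_cat "N (iObj A)" "N (iArr A)" "ap ?s" "ap ?t" "ap ?u" "mcomp A" by (rule elts[OF N])
  show "ap (icomp C A (Ident C (iArr A)) (?u \<cdot> ?s)) x = ap (Ident C (iArr A)) x"
   using T O e1 x by (subst ap_icomp) simp_all
 qed (use T O e1 ty[of "Ident C (iArr A)" "?u \<cdot> ?s"] in simp_all)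
 have c_left: "icomp C A (?u \<cdot> ?t) (Ident C (iArr A)) = Ident C (iArr A)"
 proof (rule arr_eqI)
  fix N ap x assume N: "canon N ap" and x: "x : N (Dom C (Ident C (iArr A)))"
  interpret model C N ap by fact
  interpret set_cat "N (iObj A)" "N (iArr A)" "ap ?s" "ap ?t" "ap ?u" "mcomp A" by (rule elts[OF N])
  show "ap (icomp C A (?u \<cdot> ?t) (Ident C (iArr A))) x = ap (Ident C (iArr A)) x"
   using T O e1 x by (subst ap_icomp) simp_all
 qed (use T O e1 ty[of "?u \<cdot> ?t" "Ident C (iArr A)"] in simp_all)
 have trip: "\<exists>h g f. h : N (iArr A) \<and> g : N (iArr A) \<and> f : N (iArr A) \<and> ap ?s h = ap ?t g \<and> ap ?s g = ap ?t f \<and>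
   ap ?p (ap ?hg x) = h \<and> ap ?q (ap ?gf x) = f \<and>
   ap ?m (ap ?hg x) = mcomp_at N ap A h g \<and> ap ?m (ap ?gf x) = mcomp_at N ap A g f"
  if N: "canon N ap" and x: "x : N (pb C ?q ?p)"
  for N ap x
 proof -
  interpret model C N ap by fact
  have "ap ?q (ap ?hg x) = ap ?p (ap ?gf x)" using pb_elt_commutes[OF P x] .
  moreover have "ap ?hg x : N (pb C ?s ?t)" "ap ?gf x : N (pb C ?s ?t)" using x pb pq by simp_all
  ultimately show ?thesis using m[OF N, of "ap ?hg x"] m[OF N, of "ap ?gf x"] by auto
 qed
 have c1: "?s \<cdot> (?m \<cdot> ?hg) = ?t \<cdot> (?q \<cdot> ?gf)"
 proof (rule arr_eqI)
  fix N ap x assume N: "canon N ap" and x: "x : N (Dom C (?t \<cdot> (?q \<cdot> ?gf)))"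
  interpret model C N ap by fact
  interpret set_cat "N (iObj A)" "N (iArr A)" "ap ?s" "ap ?t" "ap ?u" "mcomp A" by (rule elts[OF N])
  show "ap (?s \<cdot> (?m \<cdot> ?hg)) x = ap (?t \<cdot> (?q \<cdot> ?gf)) x" using trip[OF N, of x] x T pq pb by auto
 qed (use T pq pb in simp_all)
 have c2: "?s \<cdot> (?p \<cdot> ?hg) = ?t \<cdot> (?m \<cdot> ?gf)"
 proof (rule arr_eqI)
  fix N ap x assume N: "canon N ap" and x: "x : N (Dom C (?t \<cdot> (?m \<cdot> ?gf)))"
  interpret model C N ap by fact
  interpret set_cat "N (iObj A)" "N (iArr A)" "ap ?s" "ap ?t" "ap ?u" "mcomp A" by (rule elts[OF N])
  show "ap (?s \<cdot> (?p \<cdot> ?hg)) x = ap (?t \<cdot> (?m \<cdot> ?gf)) x" using trip[OF N, of x] x T pq pb by auto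
 qed (use T pq pb in simp_all)
 have assoc: "icomp C A (?m \<cdot> ?hg) (?q \<cdot> ?gf) = icomp C A (?p \<cdot> ?hg) (?m \<cdot> ?gf)"
 proof (rule arr_eqI)
  fix N ap x assume N: "canon N ap" and "x : N (Dom C (icomp C A (?p \<cdot> ?hg) (?m \<cdot> ?gf)))"
  then have x: "x : N (pb C ?q ?p)" using ty[of "?p \<cdot> ?hg" "?m \<cdot> ?gf"] c2 pb pq T by simp
  interpret model C N ap by fact
  interpret set_cat "N (iObj A)" "N (iArr A)" "ap ?s" "ap ?t" "ap ?u" "mcomp A" by (rule elts[OF N])
  have "ap (icomp C A (?m \<cdot> ?hg) (?q \<cdot> ?gf)) x = mcomp A (ap ?m (ap ?hg x)) (ap ?q (ap ?gf x))"
   using T pq pb x c1 by (subst ap_icomp) simp_all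
  moreover have "ap (icomp C A (?p \<cdot> ?hg) (?m \<cdot> ?gf)) x = mcomp A (ap ?p (ap ?hg x)) (ap ?m (ap ?gf x))"
   using T pq pb x c2 by (subst ap_icomp) simp_all
  ultimately show "ap (icomp C A (?m \<cdot> ?hg) (?q \<cdot> ?gf)) x = ap (icomp C A (?p \<cdot> ?hg) (?m \<cdot> ?gf)) x"
   using trip[OF N x] c_assoc by auto
 qed (use T pq pb c1 c2 ty[of "?m \<cdot> ?hg" "?q \<cdot> ?gf"] ty[of "?p \<cdot> ?hg" "?m \<cdot> ?gf"] in simp_all)
 show ?thesis
  unfolding internal_category_def Let_def cp1_def cp2_def comp_pairs_def
  using T O su tu sm tm c_right c_left assoc by (simp add: hom_def)
qed

lemma internal_groupoidI:
 assumes A: "internal_category C A"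
  and T: "iInv A : Arr C" "Dom C (iInv A) = iArr A" "Cod C (iInv A) = iArr A"
  and elts: "\<And>N ap. canon N ap ==> model.elt_gpd C N ap A"
 shows "internal_groupoid C A"
proof -
 let ?s = "iSrc A" and ?t = "iTgt A" and ?u = "iUnit A" and ?i = "iInv A"
 note TA = internal_category_typing[OF A] T
 have si: "?s \<cdot> ?i = ?t" "?t \<cdot> ?i = ?s"
 proof -
  have e: "ap (?s \<cdot> ?i) x = ap ?t x \<and> ap (?t \<cdot> ?i) x = ap ?s x"
   if N: "canon N ap" and x: "x : N (iArr A)" for N ap x
  proof -
   interpret model C N ap by fact
   interpret set_gpd "N (iObj A)" "N (iArr A)" "ap ?s" "ap ?t" "ap ?u" "mcomp A" "ap ?i" by (rule elts[OF N])
   show ?thesis using x TA by simp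
  qed
  show "?s \<cdot> ?i = ?t" by (rule arr_eqI) (use TA e in simp_all)
  show "?t \<cdot> ?i = ?s" by (rule arr_eqI) (use TA e in simp_all)
 qed
 have ty: "icomp C A g f : Arr C" "Dom C (icomp C A g f) = Dom C g"
  if "g : Arr C" "f : Arr C" "Dom C g = Dom C f" "Cod C g = iArr A" "Cod C f = iArr A" "?s \<cdot> g = ?t \<cdot> f" for g f
  unfolding icomp_def using that TA by simp_all
 have e: "ap (icomp C A ?i (Ident C (iArr A))) x = ap (?u \<cdot> ?s) x \<and>
    ap (icomp C A (Ident C (iArr A)) ?i) x = ap (?u \<cdot> ?t) x"
   if N: "canon N ap" and x: "x : N (iArr A)" for N ap x
 proof
  interpret model C N ap by fact
  interpret set_gpd "N (iObj A)" "N (iArr A)" "ap ?s" "ap ?t" "ap ?u" "mcomp A" "ap ?i" by (rule elts[OF N])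
  show "ap (icomp C A ?i (Ident C (iArr A))) x = ap (?u \<cdot> ?s) x"
   using x TA si by (subst ap_icomp) simp_all
  show "ap (icomp C A (Ident C (iArr A)) ?i) x = ap (?u \<cdot> ?t) x"
   using x TA si by (subst ap_icomp) simp_all
 qed
 have t1: "icomp C A ?i (Ident C (iArr A)) : Arr C" by (rule ty) (use TA si(1) in simp_all)
 have t1': "Dom C (icomp C A ?i (Ident C (iArr A))) = Dom C ?i" by (rule ty) (use TA si(1) in simp_all)
 have t2: "icomp C A (Ident C (iArr A)) ?i : Arr C" by (rule ty) (use TA si(2) in simp_all)
 have t2': "Dom C (icomp C A (Ident C (iArr A)) ?i) = Dom C (Ident C (iArr A))" by (rule ty) (use TA si(2) in simp_all)
 have "icomp C A ?i (Ident C (iArr A)) = ?u \<cdot> ?s"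
 proof (rule arr_eqI)
  fix N ap x assume "canon N ap" "x : N (Dom C (?u \<cdot> ?s))"
  moreover from this have "x : N (iArr A)" using TA by simp
  ultimately show "ap (icomp C A ?i (Ident C (iArr A))) x = ap (?u \<cdot> ?s) x" using e[of N ap x] by blast
 qed (use TA t1 t1' in simp_all)
 moreover have "icomp C A (Ident C (iArr A)) ?i = ?u \<cdot> ?t"
 proof (rule arr_eqI)
  fix N ap x assume "canon N ap" "x : N (Dom C (?u \<cdot> ?t))"
  moreover from this have "x : N (iArr A)" using TA by simp
  ultimately show "ap (icomp C A (Ident C (iArr A)) ?i) x = ap (?u \<cdot> ?t) x" using e[of N ap x] by blast
 qed (use TA t2 t2' in simp_all)
 ultimately show ?thesis unfolding internal_groupoid_def hom_def using A T si by blast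
qed

end

section \<open>Relations respecting inverses\<close>

context model
begin

lemma preimage_img:
 assumes P: "is_pullback C m f P h k" and z: "z : N (Dom C f)"
 shows "z : img k \<longleftrightarrow> ap f z : img m"
proof
 note pf = pullback_facts[OF P]
 assume "z : img k"
 then obtain w where w: "w : N P" "z = ap k w" using pf by (auto simp: img_def)
 have "ap (m \<cdot> h) w = ap (f \<cdot> k) w" using pf(11) by simp
 then have "ap f z = ap m (ap h w)" using w pf(1-10) by simp
 then show "ap f z : img m" using w pf by (simp add: img_def)
next
 note pf = pullback_facts[OF P]
 assume "ap f z : img m"
 then obtain x where x: "x : N (Dom C m)" "ap m x = ap f z" by (auto simp: img_def)
 from ap_pullback[OF P x(1) z x(2)] obtain w where "w : N P" "ap k w = z" by blast
 then show "z : img k" using pf by (auto simp: img_def)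
qed

lemma inter_img:
 assumes P: "is_pullback C m n P p q"
 shows "img (m \<cdot> p) = img m \<inter> img n"
proof -
 note pf = pullback_facts[OF P]
 have "z : img (m \<cdot> p) \<longleftrightarrow> z : img m \<and> z : img n" for z
 proof
  assume "z : img (m \<cdot> p)"
  then show "z : img m \<and> z : img n"
   using img_Cmp_subset[of p m] img_Cmp_subset[of q n] pf(1-10) pf(11) by auto
 next
  assume "z : img m \<and> z : img n"
  then obtain x y where x: "x : N (Dom C m)" "y : N (Dom C n)" "z = ap m x" "ap m x = ap n y"
   by (auto simp: img_def)
  from ap_pullback[OF P x(1,2,4)] obtain w where "w : N P" "ap p w = x" by blast
  then show "z : img (m \<cdot> p)" using pf(1-10) x by (auto simp: img_def image_iff intro!: bexI[of _ w])
 qed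
 then show ?thesis by blast
qed

end

context regular_category
begin

lemma pullback_mono:
 assumes P: "is_pullback C m f P h k" and m: "is_mono C m"
 shows "is_mono C k"
proof (rule is_monoI)
 note pf = pullback_facts[OF P]
 fix N ap x y
 assume N: "canon N ap" and xy: "x : N (Dom C k)" "y : N (Dom C k)" "ap k x = ap k y"
 interpret model C N ap by fact
 have "ap (m \<cdot> h) x = ap (f \<cdot> k) x" "ap (m \<cdot> h) y = ap (f \<cdot> k) y" using pf(11) by simp_all
 then have "ap m (ap h x) = ap m (ap h y)" using xy pf(1-10) by simp
 then have "ap h x = ap h y" using mono_elt_eq[OF m] xy pf by simp
 then show "x = y" using pullback_elt_eq[OF P, of x y] xy pf by simp
qed (use pullback_facts[OF P] in simp)

lemma is_pullback_swap:
 assumes "is_pullback C f g P p q"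
 shows "is_pullback C g f P q p"
 unfolding is_pullback_def
proof (intro conjI allI ballI impI)
 note pf = pullback_facts[OF assms]
 fix X a b assume ab: "a : hom C X (Dom C g)" "b : hom C X (Dom C f)" "g \<cdot> a = f \<cdot> b"
 have "\<exists>!h. h : hom C (Dom C b) P \<and> p \<cdot> h = b \<and> q \<cdot> h = a"
  using ab by (intro pullback_ex1[OF assms]) (simp_all add: hom_def)
 moreover have "Dom C b = X" using ab by (simp add: hom_def)
 ultimately show "\<exists>!h. h : hom C X P \<and> q \<cdot> h = a \<and> p \<cdot> h = b" by metis
qed (use pullback_facts[OF assms] in "simp_all add: hom_def")

lemma prod_map_simps [simp]:
 assumes "f : Arr C" "g : Arr C"
 shows "prod_map C f g : Arr C" "Dom C (prod_map C f g) = prd C (Dom C f) (Dom C g)"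
  "Cod C (prod_map C f g) = prd C (Cod C f) (Cod C g)"
 using assms by (simp_all add: prod_map_def)

lemma (in model) ap_prod_map [simp]:
 assumes "f : Arr C" "g : Arr C" "a : N (Dom C f)" "b : N (Dom C g)" "A = Dom C f" "B = Dom C g"
 shows "ap (prod_map C f g) (pp A B a b) = pp (Cod C f) (Cod C g) (ap f a) (ap g b)"
 using assms by (simp add: prod_map_def)

definition inverse_closed :: "('o => 'a set) => ('m => 'a => 'a) => ('o, 'm) igpd => ('o, 'm) igpd =>
  ('o, 'm) relation => bool" where
 "inverse_closed N ap A B R \<longleftrightarrow> (\<forall>a b. rel_at N ap R a b \<longrightarrow>
   rel_at N ap R (ap (iInv A) a) (ap (iInv B) b) \<and>
   rel_at N ap R (ap (iUnit A) (ap (iSrc A) a)) (ap (iUnit B) (ap (iSrc B) b)))"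

text \<open>Preimages and intersections of subobjects are computed on elements.\<close>

lemma respects_inverses_iff:
 assumes A: "internal_groupoid C A" and B: "internal_groupoid C B"
  and R: "is_relation C R" "tdom R = iArr A" "tcod R = iArr B"
 shows "respects_inverses C A B R \<longleftrightarrow>
  (\<forall>N ap. canon N ap \<longrightarrow> inverse_closed N ap A B R)"
proof -
 let ?f = "prod_map C (iInv A) (iInv B)" and ?X = "prd C (iArr A) (iArr B)"
 let ?g = "prod_map C (iUnit A \<cdot> iSrc A) (iUnit B \<cdot> iSrc B)"
 have ty: "?f : Arr C" "Dom C ?f = ?X" "Cod C ?f = ?X" "?g : Arr C" "Dom C ?g = ?X" "Cod C ?g = ?X"
  using A B by simp_all
 note D = relationD[OF R(1), unfolded R(2,3)]
 obtain r where r: "r : tmap R" using relation_ex[OF R(1)] ..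
 let ?S = "sub_inter C (sub_preimage C ?f (tmap R)) (sub_preimage C ?g (tmap R))"
 have S: "is_mono C k \<and> Cod C k = ?X \<and> (\<forall>N ap. canon N ap \<longrightarrow>
   (\<forall>z\<in>N ?X. z : img_at N ap k \<longleftrightarrow> ap ?f z : img_at N ap r \<and> ap ?g z : img_at N ap r))"
  if kS: "k : ?S" for k
 proof -
  obtain m n P p q where k: "k = m \<cdot> p" "is_pullback C m n P p q"
   and "m : sub_preimage C ?f (tmap R)" "n : sub_preimage C ?g (tmap R)"
   using kS unfolding sub_inter_def by blast
  then obtain r1 r2 P1 h1 P2 h2 where m: "r1 : tmap R" "is_pullback C r1 ?f P1 h1 m"
   and n: "r2 : tmap R" "is_pullback C r2 ?g P2 h2 n" by (auto simp: sub_preimage_def)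
  note pf = pullback_facts[OF k(2)] pullback_facts[OF m(2)] pullback_facts[OF n(2)]
  have mono: "is_mono C m" "is_mono C n" "is_mono C p"
   using pullback_mono[OF m(2) D(3)[OF m(1)]] pullback_mono[OF n(2) D(3)[OF n(1)]]
    pullback_mono[OF is_pullback_swap[OF k(2)]] by simp_all
  have "is_mono C k" unfolding k(1) using mono pf by (intro mono_Cmp) simp_all
  moreover have r12: "img_at N ap r1 = img_at N ap r" "img_at N ap r2 = img_at N ap r"
   if "canon N ap" for N ap
   using D(3,12)[OF r] m(1) n(1) that sub_class_iff by auto
  moreover have "z : img_at N ap k \<longleftrightarrow> ap ?f z : img_at N ap r \<and> ap ?g z : img_at N ap r"
   if N: "canon N ap" and z: "z : N ?X" for N ap z
  proof -
   interpret model C N ap by fact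
   have r12: "img r1 = img r" "img r2 = img r" using r12 N by blast+
   have "z : img m \<longleftrightarrow> ap ?f z : img r" "z : img n \<longleftrightarrow> ap ?g z : img r"
    using preimage_img[OF m(2), of z] preimage_img[OF n(2), of z] z ty(2,5) unfolding r12 by simp_all
   then show ?thesis unfolding k(1) inter_img[OF k(2)] by simp
  qed
  moreover have "Cod C k = ?X" unfolding k(1) using pf(1-10) pf(12-21) ty by simp
  ultimately show ?thesis by blast
 qed
 have ex: "\<exists>k. k : ?S"
 proof -
  obtain P1 h1 m where m: "is_pullback C r ?f P1 h1 m" using pullback_ex[of r ?f] D(4,5)[OF r] ty by auto
  obtain P2 h2 n where n: "is_pullback C r ?g P2 h2 n" using pullback_ex[of r ?g] D(4,5)[OF r] ty by auto
  obtain P p q where "is_pullback C m n P p q"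
   using pullback_ex[of m n] pullback_facts[OF m] pullback_facts[OF n] ty by auto
  moreover have "m : sub_preimage C ?f (tmap R)" "n : sub_preimage C ?g (tmap R)"
   using m n r by (auto simp: sub_preimage_def)
  ultimately show ?thesis unfolding sub_inter_def by blast
 qed
 have pt: "ap ?f (pp_at N ap (iArr A) (iArr B) a b) : img_at N ap r \<and>
   ap ?g (pp_at N ap (iArr A) (iArr B) a b) : img_at N ap r \<longleftrightarrow>
   rel_at N ap R (ap (iInv A) a) (ap (iInv B) b) \<and>
   rel_at N ap R (ap (iUnit A) (ap (iSrc A) a)) (ap (iUnit B) (ap (iSrc B) b))"
  if N: "canon N ap" and ab: "a : N (iArr A)" "b : N (iArr B)" for N ap a b
 proof -
  interpret model C N ap by fact
  show ?thesis using A B ab R(2,3) by (simp add: rel_img[OF R(1) r])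
 qed
 show ?thesis
 proof (intro iffI allI impI)
  fix N ap
  assume le: "respects_inverses C A B R" and N: "canon N ap"
  interpret model C N ap by fact
  obtain k h where k: "k : ?S" "h : hom C (Dom C r) (Dom C k)" "k \<cdot> h = r"
   using le r unfolding respects_inverses_def sub_le_def by blast
  have sub: "img r \<subseteq> img k" using img_Cmp_subset[of h k] k(2) S[OF k(1)] is_mono_Arr[of k] k(3) by (auto simp: hom_def)
  show "inverse_closed N ap A B R"
   unfolding inverse_closed_def
  proof (intro allI impI)
   fix a b assume ab: "rel R a b"
   then have e: "a : N (iArr A)" "b : N (iArr B)" using rel_in[OF R(1)] R by auto
   then have "pp (iArr A) (iArr B) a b : img k" using ab sub rel_img[OF R(1) r, of a b] R by auto
   moreover have "pp (iArr A) (iArr B) a b : N ?X" using A B e by simp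
   ultimately show "rel R (ap (iInv A) a) (ap (iInv B) b) \<and>
    rel R (ap (iUnit A) (ap (iSrc A) a)) (ap (iUnit B) (ap (iSrc B) b))"
    using S[OF k(1)] pt[OF N e] N by blast
  qed
 next
  assume cl: "\<forall>N ap. canon N ap \<longrightarrow> inverse_closed N ap A B R"
  obtain k where k: "k : ?S" using ex ..
  have "\<exists>h. h : hom C (Dom C m) (Dom C k) \<and> k \<cdot> h = m" if m: "m : tmap R" for m
  proof -
   have "is_mono C k" "Cod C m = Cod C k" using S[OF k] D(5)[OF m] by simp_all
   then obtain h where "h : Arr C" "Dom C h = Dom C m" "Cod C h = Dom C k" "k \<cdot> h = m"
   proof (rule is_mono_img_factor[OF D(3)[OF m]])
    fix N ap assume N: "canon N ap"
    interpret model C N ap by fact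
    have im: "img m = img r" using D(3,12)[OF r] m N sub_class_iff by auto
    show "img m \<subseteq> img k"
    proof
     fix z assume z: "z : img m"
     then have zX: "z : N ?X" using D(4,5)[OF m] by (auto simp: img_def)
     then obtain a b where ab: "a : N (iArr A)" "b : N (iArr B)" "z = pp (iArr A) (iArr B) a b"
      using Bex_prd[of "iArr A" "iArr B" "\<lambda>w. z = w"] D(1,2) by auto
     then have "rel R a b" using rel_img[OF R(1) m, of a b] z R by simp
     then show "z : img k" using cl N pt[OF N ab(1,2)] S[OF k] zX ab unfolding inverse_closed_def by blast
    qed
   qed
   then show ?thesis by (auto simp: hom_def)
  qed
  then show "respects_inverses C A B R"
   unfolding respects_inverses_def sub_le_def using k by blast
 qed
qed

end

section \<open>Special dagger Frobenius structures on elements\<close>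

text \<open>A special dagger Frobenius structure in the category of sets and relations; \<open>m x y z\<close>
 means that \<open>z\<close> is a product of \<open>x\<close> and \<open>y\<close>.\<close>

locale set_frob =
 fixes G :: "'x set" and m :: "'x => 'x => 'x => bool" and E :: "'x set"
 assumes E_sub: "E \<subseteq> G"
  and unit_right: "[|a : G; b : G|] ==> (\<exists>e\<in>E. m a e b) \<longleftrightarrow> b = a"
  and unit_left: "[|a : G; b : G|] ==> (\<exists>e\<in>E. m e a b) \<longleftrightarrow> b = a"
  and assoc: "[|a : G; b : G; c : G; d : G|] ==> (\<exists>x\<in>G. m a b x \<and> m x c d) \<longleftrightarrow> (\<exists>x\<in>G. m b c x \<and> m a x d)"
  and special: "[|a : G; b : G|] ==> (\<exists>x\<in>G. \<exists>y\<in>G. m x y a \<and> m x y b) \<longleftrightarrow> b = a"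
  and frobenius: "[|a : G; b : G; c : G; d : G|] ==>
   (\<exists>x\<in>G. m x d b \<and> m a x c) \<longleftrightarrow> (\<exists>x\<in>G. m c x a \<and> m x b d)"
begin

lemma EG: "e : E ==> e : G"
 using E_sub by blast

lemma m_fun: "[|m x y a; m x y b; x : G; y : G; a : G; b : G|] ==> a = b"
 using special[of a b] by blast

lemma right_unit_ex1: "a : G ==> \<exists>!e. e : E \<and> m a e a"
proof -
 assume a: "a : G"
 then obtain e where e: "e : E" "m a e a" using unit_right by blast
 have "e' = e" if e': "e' : E" "m a e' a" for e'
 proof -
  from assoc[of a e e' a] obtain x where x: "x : G" "m e e' x" using a e e' EG by blast
  then have "x = e" "x = e'" using unit_right[of e x] unit_left[of e' x] e e' EG by blast+
  then show ?thesis by simp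
 qed
 then show ?thesis using e by blast
qed

lemma left_unit_ex1: "a : G ==> \<exists>!e. e : E \<and> m e a a"
proof -
 assume a: "a : G"
 then obtain e where e: "e : E" "m e a a" using unit_left by blast
 have "e' = e" if e': "e' : E" "m e' a a" for e'
 proof -
  from assoc[of e' e a a] obtain x where x: "x : G" "m e' e x" using a e e' EG by blast
  then have "x = e" "x = e'" using unit_right[of e' x] unit_left[of e x] e e' EG by blast+
  then show ?thesis by simp
 qed
 then show ?thesis using e by blast
qed

definition src :: "'x => 'x" where "src a = (THE e. e : E \<and> m a e a)"
definition tgt :: "'x => 'x" where "tgt a = (THE e. e : E \<and> m e a a)"

lemma src: "a : G ==> src a : E" "a : G ==> m a (src a) a"
 using theI'[OF right_unit_ex1] unfolding src_def by blast+

lemma tgt: "a : G ==> tgt a : E" "a : G ==> m (tgt a) a a"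
 using theI'[OF left_unit_ex1] unfolding tgt_def by blast+

lemma src_eq: "[|a : G; e : E; m a e b; b : G|] ==> src a = e"
 using unit_right[of a b] right_unit_ex1[of a] src[of a] by blast

lemma tgt_eq: "[|a : G; e : E; m e a b; b : G|] ==> tgt a = e"
 using unit_left[of a b] left_unit_ex1[of a] tgt[of a] by blast

lemma unit_idem: "e : E ==> m e e e"
 using src[of e] unit_left[of "src e" e] EG by metis

lemma src_unit: "e : E ==> src e = e" and tgt_unit: "e : E ==> tgt e = e"
 using unit_idem src_eq tgt_eq EG by blast+

text \<open>An inverse arises by reading the pair \<open>(t a, a)\<close> through both sides of the Frobenius law.\<close>

lemma inverse_ex: "a : G ==> \<exists>x\<in>G. m x a (src a) \<and> m a x (tgt a)"
 using frobenius[of "tgt a" a a "src a"] src[of a] tgt[of a] EG by blast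

lemma composable_iff: "[|a : G; b : G|] ==> (\<exists>c\<in>G. m a b c) \<longleftrightarrow> src a = tgt b"
proof
 assume ab: "a : G" "b : G"
 {
  assume "\<exists>c\<in>G. m a b c"
  then obtain c where c: "c : G" "m a b c" by blast
  from assoc[of a "src a" b c] obtain x where x: "x : G" "m (src a) b x"
   using ab c src[of a] EG by blast
  then show "src a = tgt b" using tgt_eq[of b "src a" x] ab src by simp
 next
  assume e: "src a = tgt b"
  obtain x where x: "x : G" "m x a (src a)" using inverse_ex ab by blast
  from assoc[of x a b b] obtain y where "y : G" "m a b y" using x ab e tgt[of b] EG by metis
  then show "\<exists>c\<in>G. m a b c" by blast
 }
qed

lemma src_m: "[|a : G; b : G; c : G; m a b c|] ==> src c = src b"
proof -
 assume a: "a : G" "b : G" "c : G" "m a b c"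
 from assoc[of a b "src b" c] obtain x where "x : G" "m a b x" "m x (src b) c"
  using a src[of b] EG by blast
 then show "src c = src b" using src_eq[of c "src b" c] a src m_fun by blast
qed

lemma tgt_m: "[|a : G; b : G; c : G; m a b c|] ==> tgt c = tgt a"
proof -
 assume a: "a : G" "b : G" "c : G" "m a b c"
 from assoc[of "tgt a" a b c] obtain x where "x : G" "m a b x" "m (tgt a) x c"
  using a tgt[of a] EG by blast
 then show "tgt c = tgt a" using tgt_eq[of c "tgt a" c] a tgt m_fun by blast
qed

lemma left_inverse_unique: "[|a : G; x : G; y : G; m x a (src a); m y a (src a)|] ==> x = y"
proof -
 assume a: "a : G" "x : G" "y : G" "m x a (src a)" "m y a (src a)"
 obtain z where z: "z : G" "m a z (tgt a)" using inverse_ex a by blast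
 have sz: "tgt z = src a" using composable_iff[OF a(1) z(1)] z(2) EG[OF tgt(1)[OF a(1)]] by auto
 have "v = z" if v: "v : G" "m v a (src a)" for v
 proof -
  have "m (src a) z z" using tgt(2)[of z] z sz by simp
  then have "\<exists>x\<in>G. m v a x \<and> m x z z" using v(2) src[of a] EG a(1) by blast
  then have "\<exists>x\<in>G. m a z x \<and> m v x z" using assoc[of v a z z] v(1) a(1) z(1) by simp
  then obtain w where w: "w : G" "m a z w" "m v w z" by blast
  have "tgt a : G" using tgt(1)[OF a(1)] EG by simp
  then have "w = tgt a" using m_fun[OF w(2) z(2)] a(1) z(1) w(1) by simp
  then have "\<exists>e\<in>E. m v e z" using w(3) tgt(1)[OF a(1)] by blast
  then show "v = z" using unit_right[of v z] v z by simp
 qed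
 then show ?thesis using a by blast
qed

end

lemma set_frob_iff:
 "E \<subseteq> G ==> set_frob G m E \<longleftrightarrow>
  (\<forall>a\<in>G. \<forall>b\<in>G. (\<exists>e\<in>E. m a e b) \<longleftrightarrow> b = a) \<and>
  (\<forall>a\<in>G. \<forall>b\<in>G. (\<exists>e\<in>E. m e a b) \<longleftrightarrow> b = a) \<and>
  (\<forall>a\<in>G. \<forall>b\<in>G. \<forall>c\<in>G. \<forall>d\<in>G.
   (\<exists>x\<in>G. m a b x \<and> m x c d) \<longleftrightarrow> (\<exists>x\<in>G. m b c x \<and> m a x d)) \<and>
  (\<forall>a\<in>G. \<forall>b\<in>G. (\<exists>x\<in>G. \<exists>y\<in>G. m x y a \<and> m x y b) \<longleftrightarrow> b = a) \<and>
  (\<forall>a\<in>G. \<forall>b\<in>G. \<forall>c\<in>G. \<forall>d\<in>G.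
   (\<exists>x\<in>G. m x d b \<and> m a x c) \<longleftrightarrow> (\<exists>x\<in>G. m c x a \<and> m x b d))"
 (is "_ ==> _ \<longleftrightarrow> ?r")
proof
 assume "set_frob G m E"
 then interpret set_frob G m E .
 show ?r by (intro conjI ballI unit_right unit_left assoc special frobenius)
next
 assume "E \<subseteq> G" and r: ?r
 note h = r[THEN conjunct1, rule_format] r[THEN conjunct2, THEN conjunct1, rule_format]
  r[THEN conjunct2, THEN conjunct2, THEN conjunct1, rule_format]
  r[THEN conjunct2, THEN conjunct2, THEN conjunct2, THEN conjunct1, rule_format]
  r[THEN conjunct2, THEN conjunct2, THEN conjunct2, THEN conjunct2, rule_format]
 show "set_frob G m E"
  by (rule set_frob.intro[OF \<open>E \<subseteq> G\<close> h]) assumption+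
qed

lemma image_ex1:
 assumes "\<exists>!e. e : f ` S \<and> P e" and "\<And>x y. [|x : S; y : S; f x = f y|] ==> x = y"
 shows "\<exists>!b. b : S \<and> P (f b)"
proof -
 obtain b where "b : S" "P (f b)" using assms(1) by blast
 moreover have "y = b" if "y : S" "P (f y)" for y
  using assms(1) calculation that by (intro assms(2)) blast+
 ultimately show ?thesis by blast
qed

context set_gpd
begin

lemma set_frob: "set_frob G1 (\<lambda>g f h. s g = t f \<and> h = c g f) (u ` G0)"
proof
 fix a b assume ab: "a : G1" "b : G1"
 show "(\<exists>e\<in>u ` G0. s a = t e \<and> b = c a e) \<longleftrightarrow> b = a"
  using ab by (auto intro!: bexI[of _ "s a"])
 show "(\<exists>e\<in>u ` G0. s e = t a \<and> b = c e a) \<longleftrightarrow> b = a"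
  using ab by (auto intro!: bexI[of _ "t a"])
 show "(\<exists>x\<in>G1. \<exists>y\<in>G1. (s x = t y \<and> a = c x y) \<and> s x = t y \<and> b = c x y) \<longleftrightarrow> b = a"
 proof
  assume "b = a"
  then show "\<exists>x\<in>G1. \<exists>y\<in>G1. (s x = t y \<and> a = c x y) \<and> s x = t y \<and> b = c x y"
   using ab by (intro bexI[of _ "u (t a)"] bexI[of _ a]) simp_all
 qed blast
 fix e d assume ed: "e : G1" "d : G1"
 show "(\<exists>x\<in>G1. (s a = t b \<and> x = c a b) \<and> s x = t e \<and> d = c x e) \<longleftrightarrow>
    (\<exists>x\<in>G1. (s b = t e \<and> x = c b e) \<and> s a = t x \<and> d = c a x)"
  using ab ed by (auto simp: c_assoc)
 show "(\<exists>x\<in>G1. (s x = t d \<and> b = c x d) \<and> s a = t x \<and> e = c a x) \<longleftrightarrow>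
    (\<exists>x\<in>G1. (s e = t x \<and> a = c e x) \<and> s x = t b \<and> d = c x b)" (is "?l \<longleftrightarrow> ?r")
 proof
  assume ?l
  then obtain x where "x : G1" "s x = t d" "b = c x d" "s a = t x" "e = c a x" by blast
  then show ?r using ab ed by (intro bexI[of _ "i x"]) auto
 next
  assume ?r
  then obtain x where "x : G1" "s e = t x" "a = c e x" "s x = t b" "d = c x b" by blast
  then show ?l using ab ed by (intro bexI[of _ "i x"]) auto
 qed
qed auto

end

context model
begin

lemma ap_prod_assoc [simp]:
 assumes "X : Obj C" "Y : Obj C" "Z : Obj C" "x : N X" "y : N Y" "z : N Z"
 shows "ap (prod_assoc C X Y Z) (pp (prd C X Y) Z (pp X Y x y) z) = pp X (prd C Y Z) x (pp Y Z y z)"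
 using assms by (simp add: prod_assoc_def Let_def)

definition unit_elts :: "('o, 'm) relation => 'a set" where
 "unit_elts \<eta> = {e : N (tcod \<eta>). \<exists>x\<in>N (one C). rel \<eta> x e}"

end

context regular_category
begin

lemma prod_assoc_simps [simp]:
 assumes "X : Obj C" "Y : Obj C" "Z : Obj C"
 shows "prod_assoc C X Y Z : Arr C" "Dom C (prod_assoc C X Y Z) = prd C (prd C X Y) Z"
  "Cod C (prod_assoc C X Y Z) = prd C X (prd C Y Z)"
 using assms by (simp_all add: prod_assoc_def Let_def)

lemma relation_eq_iff:
 assumes "is_relation C R" "is_relation C S" "tdom R = tdom S" "tcod R = tcod S"
 shows "R = S \<longleftrightarrow> (\<forall>N ap. canon N ap \<longrightarrow>
  (\<forall>a\<in>N (tdom S). \<forall>b\<in>N (tcod S). rel_at N ap R a b \<longleftrightarrow> rel_at N ap S a b))"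
proof
 assume *: "\<forall>N ap. canon N ap \<longrightarrow>
  (\<forall>a\<in>N (tdom S). \<forall>b\<in>N (tcod S). rel_at N ap R a b \<longleftrightarrow> rel_at N ap S a b)"
 show "R = S"
 proof (rule relation_eqI[OF assms])
  fix N ap a b assume N: "canon N ap"
  interpret model C N ap by fact
  show "rel R a b = rel S a b"
   using * N rel_in[OF assms(1), of a b] rel_in[OF assms(2), of a b] assms(3,4) by metis
 qed
qed simp

context
 fixes A \<mu> \<eta>
 assumes A: "A : Obj C" and mu: "is_relation C \<mu>" "tdom \<mu> = prd C A A" "tcod \<mu> = A"
  and eta: "is_relation C \<eta>" "tdom \<eta> = one C" "tcod \<eta> = A"
begin

lemma frob_unit_right_iff:
 "rel_comp C \<mu> (rel_tensor C (rel_ident C A) \<eta>) = graph_rel C (pr1 C A (one C)) \<longleftrightarrow>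
  (\<forall>N ap. canon N ap \<longrightarrow> (\<forall>a\<in>N A. \<forall>b\<in>N A.
   (\<exists>e\<in>model.unit_elts C N ap \<eta>. rel_at N ap \<mu> (pp_at N ap A A a e) b) \<longleftrightarrow> b = a))"
proof -
 have "(\<forall>a\<in>N (prd C A (one C)). \<forall>b\<in>N A. rel_at N ap (rel_comp C \<mu> (rel_tensor C (rel_ident C A) \<eta>)) a b \<longleftrightarrow>
   rel_at N ap (graph_rel C (pr1 C A (one C))) a b) \<longleftrightarrow> (\<forall>a\<in>N A. \<forall>b\<in>N A.
   (\<exists>e\<in>model.unit_elts C N ap \<eta>. rel_at N ap \<mu> (pp_at N ap A A a e) b) \<longleftrightarrow> b = a)"
  if N: "canon N ap" for N ap
 proof -
  interpret model C N ap by fact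
  obtain x where x: "N (one C) = {x}" using one_elt by blast
  have "rel (rel_comp C \<mu> (rel_tensor C (rel_ident C A) \<eta>)) (pp A (one C) a x) b \<longleftrightarrow>
    (\<exists>e\<in>unit_elts \<eta>. rel \<mu> (pp A A a e) b)" if "a : N A" "b : N A" for a b
   using A mu eta x that by (simp add: Bex_prd unit_elts_def) blast
  then show ?thesis using A mu eta x by (simp add: Ball_prd)
 qed
 then show ?thesis using A mu eta by (subst relation_eq_iff) simp_all
qed

lemma frob_unit_left_iff:
 "rel_comp C \<mu> (rel_tensor C \<eta> (rel_ident C A)) = graph_rel C (pr2 C (one C) A) \<longleftrightarrow>
  (\<forall>N ap. canon N ap \<longrightarrow> (\<forall>a\<in>N A. \<forall>b\<in>N A.
   (\<exists>e\<in>model.unit_elts C N ap \<eta>. rel_at N ap \<mu> (pp_at N ap A A e a) b) \<longleftrightarrow> b = a))"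
proof -
 have "(\<forall>a\<in>N (prd C (one C) A). \<forall>b\<in>N A. rel_at N ap (rel_comp C \<mu> (rel_tensor C \<eta> (rel_ident C A))) a b \<longleftrightarrow>
   rel_at N ap (graph_rel C (pr2 C (one C) A)) a b) \<longleftrightarrow> (\<forall>a\<in>N A. \<forall>b\<in>N A.
   (\<exists>e\<in>model.unit_elts C N ap \<eta>. rel_at N ap \<mu> (pp_at N ap A A e a) b) \<longleftrightarrow> b = a)"
  if N: "canon N ap" for N ap
 proof -
  interpret model C N ap by fact
  obtain x where x: "N (one C) = {x}" using one_elt by blast
  have "rel (rel_comp C \<mu> (rel_tensor C \<eta> (rel_ident C A))) (pp (one C) A x a) b \<longleftrightarrow>
    (\<exists>e\<in>unit_elts \<eta>. rel \<mu> (pp A A e a) b)" if "a : N A" "b : N A" for a b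
   using A mu eta x that by (simp add: Bex_prd unit_elts_def) blast
  then show ?thesis using A mu eta x by (simp add: Ball_prd)
 qed
 then show ?thesis using A mu eta by (subst relation_eq_iff) simp_all
qed

lemma frob_special_iff:
 "rel_comp C \<mu> (rel_dagger C \<mu>) = rel_ident C A \<longleftrightarrow>
  (\<forall>N ap. canon N ap \<longrightarrow> (\<forall>a\<in>N A. \<forall>b\<in>N A.
   (\<exists>x\<in>N A. \<exists>y\<in>N A. rel_at N ap \<mu> (pp_at N ap A A x y) a \<and>
    rel_at N ap \<mu> (pp_at N ap A A x y) b) \<longleftrightarrow> b = a))"
proof -
 have "(\<forall>a\<in>N A. \<forall>b\<in>N A. rel_at N ap (rel_comp C \<mu> (rel_dagger C \<mu>)) a b \<longleftrightarrow>
   rel_at N ap (rel_ident C A) a b) \<longleftrightarrow> (\<forall>a\<in>N A. \<forall>b\<in>N A.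
   (\<exists>x\<in>N A. \<exists>y\<in>N A. rel_at N ap \<mu> (pp_at N ap A A x y) a \<and>
    rel_at N ap \<mu> (pp_at N ap A A x y) b) \<longleftrightarrow> b = a)"
  if N: "canon N ap" for N ap
 proof -
  interpret model C N ap by fact
  show ?thesis using A mu by (simp add: Bex_prd)
 qed
 then show ?thesis using A mu by (subst relation_eq_iff) simp_all
qed

lemma frob_assoc_iff:
 "rel_comp C \<mu> (rel_tensor C \<mu> (rel_ident C A)) =
   rel_comp C \<mu> (rel_comp C (rel_tensor C (rel_ident C A) \<mu>) (graph_rel C (prod_assoc C A A A))) \<longleftrightarrow>
  (\<forall>N ap. canon N ap \<longrightarrow> (\<forall>a\<in>N A. \<forall>b\<in>N A. \<forall>c\<in>N A. \<forall>d\<in>N A.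
   (\<exists>x\<in>N A. rel_at N ap \<mu> (pp_at N ap A A a b) x \<and> rel_at N ap \<mu> (pp_at N ap A A x c) d) \<longleftrightarrow>
   (\<exists>x\<in>N A. rel_at N ap \<mu> (pp_at N ap A A b c) x \<and> rel_at N ap \<mu> (pp_at N ap A A a x) d)))"
proof -
 have "(\<forall>p\<in>N (prd C (prd C A A) A). \<forall>d\<in>N A. rel_at N ap (rel_comp C \<mu> (rel_tensor C \<mu> (rel_ident C A))) p d \<longleftrightarrow>
   rel_at N ap (rel_comp C \<mu> (rel_comp C (rel_tensor C (rel_ident C A) \<mu>) (graph_rel C (prod_assoc C A A A)))) p d)
  \<longleftrightarrow> (\<forall>a\<in>N A. \<forall>b\<in>N A. \<forall>c\<in>N A. \<forall>d\<in>N A.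
   (\<exists>x\<in>N A. rel_at N ap \<mu> (pp_at N ap A A a b) x \<and> rel_at N ap \<mu> (pp_at N ap A A x c) d) \<longleftrightarrow>
   (\<exists>x\<in>N A. rel_at N ap \<mu> (pp_at N ap A A b c) x \<and> rel_at N ap \<mu> (pp_at N ap A A a x) d))"
  if N: "canon N ap" for N ap
 proof -
  interpret model C N ap by fact
  show ?thesis using A mu by (simp add: Bex_prd Ball_prd)
 qed
 then show ?thesis using A mu by (subst relation_eq_iff) simp_all
qed

lemma frob_frobenius_iff:
 "rel_comp C (rel_tensor C \<mu> (rel_ident C A)) (rel_comp C (rel_dagger C (graph_rel C (prod_assoc C A A A)))
   (rel_tensor C (rel_ident C A) (rel_dagger C \<mu>))) =
  rel_comp C (rel_tensor C (rel_ident C A) \<mu>) (rel_comp C (graph_rel C (prod_assoc C A A A))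
   (rel_tensor C (rel_dagger C \<mu>) (rel_ident C A))) \<longleftrightarrow>
  (\<forall>N ap. canon N ap \<longrightarrow> (\<forall>a\<in>N A. \<forall>b\<in>N A. \<forall>c\<in>N A. \<forall>d\<in>N A.
   (\<exists>x\<in>N A. rel_at N ap \<mu> (pp_at N ap A A x d) b \<and> rel_at N ap \<mu> (pp_at N ap A A a x) c) \<longleftrightarrow>
   (\<exists>x\<in>N A. rel_at N ap \<mu> (pp_at N ap A A c x) a \<and> rel_at N ap \<mu> (pp_at N ap A A x b) d)))"
 (is "?L = ?R \<longleftrightarrow> ?rhs")
proof -
 have "(\<forall>p\<in>N (prd C A A). \<forall>q\<in>N (prd C A A). rel_at N ap ?L p q \<longleftrightarrow> rel_at N ap ?R p q)
  \<longleftrightarrow> (\<forall>a\<in>N A. \<forall>b\<in>N A. \<forall>c\<in>N A. \<forall>d\<in>N A.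
   (\<exists>x\<in>N A. rel_at N ap \<mu> (pp_at N ap A A x d) b \<and> rel_at N ap \<mu> (pp_at N ap A A a x) c) \<longleftrightarrow>
   (\<exists>x\<in>N A. rel_at N ap \<mu> (pp_at N ap A A c x) a \<and> rel_at N ap \<mu> (pp_at N ap A A x b) d))"
  if N: "canon N ap" for N ap
 proof -
  interpret model C N ap by fact
  have L: "rel ?L (pp A A a b) (pp A A c d) \<longleftrightarrow> (\<exists>x\<in>N A. rel \<mu> (pp A A x d) b \<and> rel \<mu> (pp A A a x) c)"
   if "a : N A" "b : N A" "c : N A" "d : N A" for a b c d
   using A mu that by (simp add: Bex_prd) blast
  have R: "rel ?R (pp A A a b) (pp A A c d) \<longleftrightarrow> (\<exists>x\<in>N A. rel \<mu> (pp A A c x) a \<and> rel \<mu> (pp A A x b) d)"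
   if "a : N A" "b : N A" "c : N A" "d : N A" for a b c d
   using A mu that by (simp add: Bex_prd) blast
  show ?thesis using A by (simp add: Ball_prd L R)
 qed
 then show ?thesis using A mu by (subst relation_eq_iff) simp_all
qed

text \<open>Each equation between composites in \<open>Rel C\<close> unfolds to an equivalence of formulas about elements; the
coherence isomorphisms disappear.\<close>

lemma frobenius_iff:
 "special_dagger_frobenius (Rel C) \<lparr>carr = A, mult = \<mu>, unt = \<eta>\<rparr> \<longleftrightarrow>
  (\<forall>N ap. canon N ap \<longrightarrow>
   set_frob (N A) (\<lambda>x y z. rel_at N ap \<mu> (pp_at N ap A A x y) z) (model.unit_elts C N ap \<eta>))"
proof -
 have E: "model.unit_elts C N ap \<eta> \<subseteq> N A" if N: "canon N ap" for N ap
  using eta(3) by (auto simp: model.unit_elts_def[OF N])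
 have "special_dagger_frobenius (Rel C) \<lparr>carr = A, mult = \<mu>, unt = \<eta>\<rparr> \<longleftrightarrow>
  rel_comp C \<mu> (rel_tensor C (rel_ident C A) \<eta>) = graph_rel C (pr1 C A (one C)) \<and>
  rel_comp C \<mu> (rel_tensor C \<eta> (rel_ident C A)) = graph_rel C (pr2 C (one C) A) \<and>
  rel_comp C \<mu> (rel_tensor C \<mu> (rel_ident C A)) =
   rel_comp C \<mu> (rel_comp C (rel_tensor C (rel_ident C A) \<mu>) (graph_rel C (prod_assoc C A A A))) \<and>
  rel_comp C \<mu> (rel_dagger C \<mu>) = rel_ident C A \<and>
  rel_comp C (rel_tensor C \<mu> (rel_ident C A)) (rel_comp C (rel_dagger C (graph_rel C (prod_assoc C A A A)))
   (rel_tensor C (rel_ident C A) (rel_dagger C \<mu>))) =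
  rel_comp C (rel_tensor C (rel_ident C A) \<mu>) (rel_comp C (graph_rel C (prod_assoc C A A A))
   (rel_tensor C (rel_dagger C \<mu>) (rel_ident C A)))"
  unfolding special_dagger_frobenius_def Let_def using A mu eta by (simp add: hom_Rel)
 also have "\<dots> \<longleftrightarrow> (\<forall>N ap. canon N ap \<longrightarrow>
   set_frob (N A) (\<lambda>x y z. rel_at N ap \<mu> (pp_at N ap A A x y) z) (model.unit_elts C N ap \<eta>))"
  unfolding frob_unit_right_iff frob_unit_left_iff frob_special_iff frob_assoc_iff frob_frobenius_iff
  by (simp add: set_frob_iff E all_conj_distrib imp_conjR)
 finally show ?thesis .
qed

end

section \<open>Internal groupoids are the special dagger Frobenius structures\<close>

lemma gpd_frob_typing:
 assumes A: "internal_groupoid C A"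
 shows "carr (gpd_frob C A) = iArr A" "is_relation C (mult (gpd_frob C A))"
  "tdom (mult (gpd_frob C A)) = prd C (iArr A) (iArr A)" "tcod (mult (gpd_frob C A)) = iArr A"
  "is_relation C (unt (gpd_frob C A))" "tdom (unt (gpd_frob C A)) = one C" "tcod (unt (gpd_frob C A)) = iArr A"
  "is_mono C (pairing C (pairing C (cp1 C A) (cp2 C A)) (iComp A))"
  "is_mono C (pairing C (bang C (iObj A)) (iUnit A))"
proof -
 show 1: "is_mono C (pairing C (pairing C (cp1 C A) (cp2 C A)) (iComp A))"
 proof (rule pairing_monoI)
  fix N ap x y
  assume N: "canon N ap" and xy: "x : N (Dom C (iComp A))" "y : N (Dom C (iComp A))"
   and e: "ap (pairing C (cp1 C A) (cp2 C A)) x = ap (pairing C (cp1 C A) (cp2 C A)) y"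
  interpret model C N ap by fact
  show "x = y"
   by (rule pb_elt_eq[of "iSrc A" "iTgt A"]) (use A xy e in "simp_all add: cp1_def cp2_def")
 qed (use A in "simp_all add: cp1_def cp2_def")
 show 2: "is_mono C (pairing C (bang C (iObj A)) (iUnit A))"
 proof (rule pairing_monoI)
  fix N ap x y
  assume N: "canon N ap" and xy: "x : N (Dom C (iUnit A))" "y : N (Dom C (iUnit A))"
   and e: "ap (iUnit A) x = ap (iUnit A) y"
  interpret model C N ap by fact
  interpret cat_elts C N ap A by unfold_locales (use A in simp)
  show "x = y" using s_u[of x] s_u[of y] e xy A by simp
 qed (use A in simp_all)
 show "carr (gpd_frob C A) = iArr A" "is_relation C (mult (gpd_frob C A))"
  "tdom (mult (gpd_frob C A)) = prd C (iArr A) (iArr A)" "tcod (mult (gpd_frob C A)) = iArr A"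
  "is_relation C (unt (gpd_frob C A))" "tdom (unt (gpd_frob C A)) = one C" "tcod (unt (gpd_frob C A)) = iArr A"
  using A 1 2 by (simp_all add: gpd_frob_def cp1_def cp2_def)
qed

lemma (in model) rel_gpd_mult:
 assumes A: "internal_groupoid C A" and e: "g : N (iArr A)" "f : N (iArr A)"
 shows "rel (mult (gpd_frob C A)) (pp (iArr A) (iArr A) g f) h \<longleftrightarrow>
  ap (iSrc A) g = ap (iTgt A) f \<and> h = mcomp A g f"
proof -
 note T = gpd_frob_typing[OF A]
 have "rel (mult (gpd_frob C A)) (pp (iArr A) (iArr A) g f) h \<longleftrightarrow>
  (\<exists>z\<in>N (pb C (iSrc A) (iTgt A)). ap (pb1 C (iSrc A) (iTgt A)) z = g \<and> ap (pb2 C (iSrc A) (iTgt A)) z = f \<and> ap (iComp A) z = h)"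
  using T(8) A e by (simp add: gpd_frob_def cp1_def cp2_def conj_assoc)
 also have "\<dots> \<longleftrightarrow> ap (iSrc A) g = ap (iTgt A) f \<and> h = mcomp A g f"
 proof
  assume "\<exists>z\<in>N (pb C (iSrc A) (iTgt A)). ap (pb1 C (iSrc A) (iTgt A)) z = g \<and> ap (pb2 C (iSrc A) (iTgt A)) z = f \<and> ap (iComp A) z = h"
  then obtain z where z: "z : N (pb C (iSrc A) (iTgt A))" "ap (pb1 C (iSrc A) (iTgt A)) z = g" "ap (pb2 C (iSrc A) (iTgt A)) z = f"
   "ap (iComp A) z = h" by blast
  have st: "ap (iSrc A) g = ap (iTgt A) f" using pb_elt_commutes[of "iSrc A" "iTgt A" z] z A by simp
  have "pbe (iSrc A) (iTgt A) g f = z"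
   by (rule pb_elt_eq[of "iSrc A" "iTgt A"]) (use st z A e in simp_all)
  then show "ap (iSrc A) g = ap (iTgt A) f \<and> h = mcomp A g f" using st z by (simp add: mcomp_def)
 next
  assume "ap (iSrc A) g = ap (iTgt A) f \<and> h = mcomp A g f"
  then show "\<exists>z\<in>N (pb C (iSrc A) (iTgt A)). ap (pb1 C (iSrc A) (iTgt A)) z = g \<and> ap (pb2 C (iSrc A) (iTgt A)) z = f \<and> ap (iComp A) z = h"
   using A e by (intro bexI[of _ "pbe (iSrc A) (iTgt A) g f"]) (simp_all add: mcomp_def)
 qed
 finally show ?thesis .
qed

lemma (in model) unit_elts_gpd:
 assumes A: "internal_groupoid C A"
 shows "unit_elts (unt (gpd_frob C A)) = ap (iUnit A) ` N (iObj A)"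
proof -
 note T = gpd_frob_typing[OF A]
 obtain x where x: "N (one C) = {x}" using one_elt by blast
 have b: "ap (bang C (iObj A)) z = x" if "z : N (iObj A)" for z
  using x ap_in[of "bang C (iObj A)" z] A that by simp
 then show ?thesis
  unfolding unit_elts_def using T(7,9) x A by (auto simp: gpd_frob_def)
qed

theorem gpd_frob_frobenius:
 assumes A: "internal_groupoid C A"
 shows "special_dagger_frobenius (Rel C) (gpd_frob C A)"
proof -
 note T = gpd_frob_typing[OF A]
 have eq: "gpd_frob C A = \<lparr>carr = iArr A, mult = mult (gpd_frob C A), unt = unt (gpd_frob C A)\<rparr>"
  by (simp add: gpd_frob_def)
 have "set_frob (N (iArr A)) (\<lambda>x y z. rel_at N ap (mult (gpd_frob C A)) (pp_at N ap (iArr A) (iArr A) x y) z)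
   (model.unit_elts C N ap (unt (gpd_frob C A)))" if N: "canon N ap" for N ap
 proof -
  interpret model C N ap by fact
  interpret gpd_elts C N ap A by unfold_locales (rule A)
  show ?thesis
   using set_frob rel_gpd_mult[OF A] unfolding unit_elts_gpd[OF A] set_frob_def by (simp cong: bex_cong)
 qed
 then show ?thesis
  by (subst eq, subst frobenius_iff) (use A T in simp_all)
qed

text \<open>Conversely, the data of the groupoid are obtained from functional relations: \<open>s a\<close> is the
 unique unit with \<open>a \<cdot> s a = a\<close>, and the inverse of \<open>a\<close> is the unique \<open>x\<close> with \<open>x \<cdot> a = s a\<close>.\<close>

theorem frobenius_gpd_ex:
 assumes F: "special_dagger_frobenius (Rel C) F"
 shows "\<exists>A :: ('o, 'm) igpd. internal_groupoid C A \<and> gpd_frob C A = F"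
proof -
 obtain A \<mu> \<eta> where FA: "F = \<lparr>carr = A, mult = \<mu>, unt = \<eta>\<rparr>" by (cases F)
 have T: "A : Obj C" "is_relation C \<mu>" "tdom \<mu> = prd C A A" "tcod \<mu> = A" "is_relation C \<eta>" "tdom \<eta> = one C" "tcod \<eta> = A"
  using F unfolding FA special_dagger_frobenius_def Let_def by (simp_all add: hom_Rel)
 have sf: "set_frob (N A) (\<lambda>x y z. rel_at N ap \<mu> (pp_at N ap A A x y) z) (model.unit_elts C N ap \<eta>)"
  if "canon N ap" for N ap
  using F that unfolding FA frobenius_iff[OF T] by blast
 obtain e where e: "e : tmap \<eta>" using relation_ex[OF T(5)] ..
 note D = relationD[OF T(5), unfolded T(6,7)]
 define E u where "E = Dom C e" and "u = leg2 C \<eta> e"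
 have u: "u : Arr C" "Dom C u = E" "Cod C u = A" "E : Obj C" using D e by (auto simp: E_def u_def)
 have u_inj: "x = y" if N: "canon N ap" "x : N E" "y : N E" "ap u x = ap u y" for N ap x y
 proof -
  interpret model C N ap by fact
  have "ap (leg1 C \<eta> e) x = ap (leg1 C \<eta> e) y"
   by (rule one_eq) (use N D e in "simp_all add: E_def")
  then show ?thesis using rel_legs_inj[OF T(5) e, of x y] N by (simp add: E_def u_def)
 qed
 have u_img: "model.unit_elts C N ap \<eta> = ap u ` N E" if "canon N ap" for N ap
 proof -
  interpret model C N ap by fact
  show ?thesis unfolding unit_elts_def rel_rep[OF T(5) e] T(7) using D e by (auto simp: E_def u_def)
 qed
 obtain s where s: "s : Arr C" "Dom C s = A" "Cod C s = E"
  and S: "\<And>N ap a b. [|canon N ap; a : N A; b : N E|] ==>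
   rel_at N ap \<mu> (ap (pairing C (pr1 C A E) (u \<cdot> pr2 C A E)) (pp_at N ap A E a b)) (ap (pr1 C A E) (pp_at N ap A E a b)) \<longleftrightarrow> b = ap s a"
 proof (rule functional_relation[OF T(2) T(1) u(4), of "pairing C (pr1 C A E) (u \<cdot> pr2 C A E)" "pr1 C A E"])
  fix N ap a assume N: "canon N ap" and a: "a : N A"
  interpret model C N ap by fact
  interpret set_frob "N A" "\<lambda>x y z. rel \<mu> (pp A A x y) z" "unit_elts \<eta>" by (rule sf[OF N])
  have "\<exists>!b. b : N E \<and> rel \<mu> (pp A A a (ap u b)) a"
   using right_unit_ex1[OF a] u_inj[OF N] unfolding u_img[OF N] by (rule image_ex1)
  moreover have "ap (pairing C (pr1 C A E) (u \<cdot> pr2 C A E)) (pp A E a b) = pp A A a (ap u b)" "ap (pr1 C A E) (pp A E a b) = a"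
   if "b : N E" for b using T u a that by simp_all
  ultimately show "\<exists>!b. b : N E \<and> rel \<mu> (ap (pairing C (pr1 C A E) (u \<cdot> pr2 C A E)) (pp A E a b)) (ap (pr1 C A E) (pp A E a b))"
   by (simp cong: conj_cong)
 qed (use T u that in simp_all)
 obtain t where t: "t : Arr C" "Dom C t = A" "Cod C t = E"
  and T': "\<And>N ap a b. [|canon N ap; a : N A; b : N E|] ==>
   rel_at N ap \<mu> (ap (pairing C (u \<cdot> pr2 C A E) (pr1 C A E)) (pp_at N ap A E a b)) (ap (pr1 C A E) (pp_at N ap A E a b)) \<longleftrightarrow> b = ap t a"
 proof (rule functional_relation[OF T(2) T(1) u(4), of "pairing C (u \<cdot> pr2 C A E) (pr1 C A E)" "pr1 C A E"])
  fix N ap a assume N: "canon N ap" and a: "a : N A"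
  interpret model C N ap by fact
  interpret set_frob "N A" "\<lambda>x y z. rel \<mu> (pp A A x y) z" "unit_elts \<eta>" by (rule sf[OF N])
  have "\<exists>!b. b : N E \<and> rel \<mu> (pp A A (ap u b) a) a"
   using left_unit_ex1[OF a] u_inj[OF N] unfolding u_img[OF N] by (rule image_ex1)
  moreover have "ap (pairing C (u \<cdot> pr2 C A E) (pr1 C A E)) (pp A E a b) = pp A A (ap u b) a" "ap (pr1 C A E) (pp A E a b) = a"
   if "b : N E" for b using T u a that by simp_all
  ultimately show "\<exists>!b. b : N E \<and> rel \<mu> (ap (pairing C (u \<cdot> pr2 C A E) (pr1 C A E)) (pp A E a b)) (ap (pr1 C A E) (pp A E a b))"
   by (simp cong: conj_cong)
 qed (use T u that in simp_all)
 have usrc: "ap u (ap s a) = set_frob.src (\<lambda>x y z. rel_at N ap \<mu> (pp_at N ap A A x y) z) (model.unit_elts C N ap \<eta>) a"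
   "ap u (ap t a) = set_frob.tgt (\<lambda>x y z. rel_at N ap \<mu> (pp_at N ap A A x y) z) (model.unit_elts C N ap \<eta>) a"
  if N: "canon N ap" "a : N A" for N ap a
 proof -
  interpret model C N ap by fact
  interpret set_frob "N A" "\<lambda>x y z. rel \<mu> (pp A A x y) z" "unit_elts \<eta>" by (rule sf[OF N(1)])
  have "rel \<mu> (pp A A a (ap u (ap s a))) a"
   using S[OF N, of "ap s a"] T(1) u s N(2) by simp
  then show "ap u (ap s a) = src a" using src_eq[of a "ap u (ap s a)" a] N(2) s u u_img[OF N(1)] by simp
  have "rel \<mu> (pp A A (ap u (ap t a)) a) a"
   using T'[OF N, of "ap t a"] T(1) u t N(2) by simp
  then show "ap u (ap t a) = tgt a" using tgt_eq[of a "ap u (ap t a)" a] N(2) t u u_img[OF N(1)] by simp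
 qed
 let ?P = "pb C s t" and ?p = "pb1 C s t" and ?q = "pb2 C s t"
 have st: "s : Arr C" "t : Arr C" "Cod C s = Cod C t" using s t by simp_all
 note pb = pb_simps[OF st]
 have comp: "rel_at N ap \<mu> (pp_at N ap A A a b) c ==> ap s a = ap t b"
  "ap s a = ap t b ==> \<exists>!c. c : N A \<and> rel_at N ap \<mu> (pp_at N ap A A a b) c"
  if N: "canon N ap" and ab: "a : N A" "b : N A" for N ap a b c
 proof -
  interpret model C N ap by fact
  interpret set_frob "N A" "\<lambda>x y z. rel \<mu> (pp A A x y) z" "unit_elts \<eta>" by (rule sf[OF N])
  {
   assume r: "rel \<mu> (pp A A a b) c"
   then have "c : N A" using rel_in(2)[OF T(2) r] T(4) by simp
   then have "src a = tgt b" using r composable_iff[OF ab] by blast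
   then show "ap s a = ap t b"
    using usrc(1)[OF N ab(1)] usrc(2)[OF N ab(2)] u_inj[OF N, of "ap s a" "ap t b"] ab s t by simp
  next
   assume "ap s a = ap t b"
   then have "src a = tgt b" using usrc(1)[OF N ab(1)] usrc(2)[OF N ab(2)] by simp
   then show "\<exists>!c. c : N A \<and> rel \<mu> (pp A A a b) c" using composable_iff[OF ab] m_fun ab by blast
  }
 qed
 obtain m where m: "m : Arr C" "Dom C m = ?P" "Cod C m = A"
  and M: "\<And>N ap z c. [|canon N ap; z : N ?P; c : N A|] ==>
   rel_at N ap \<mu> (ap (pairing C (?p \<cdot> pr1 C ?P A) (?q \<cdot> pr1 C ?P A)) (pp_at N ap ?P A z c)) (ap (pr2 C ?P A) (pp_at N ap ?P A z c)) \<longleftrightarrow> c = ap m z"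
 proof (rule functional_relation[OF T(2) pb(1) T(1), of "pairing C (?p \<cdot> pr1 C ?P A) (?q \<cdot> pr1 C ?P A)" "pr2 C ?P A"])
  fix N ap z assume N: "canon N ap" and z: "z : N ?P"
  interpret model C N ap by fact
  have "\<exists>!c. c : N A \<and> rel \<mu> (pp A A (ap ?p z) (ap ?q z)) c"
   using comp(2)[OF N, of "ap ?p z" "ap ?q z"] pb_elt_commutes[OF st z] z pb s t by simp
  moreover have "ap (pairing C (?p \<cdot> pr1 C ?P A) (?q \<cdot> pr1 C ?P A)) (pp ?P A z c) = pp A A (ap ?p z) (ap ?q z)" "ap (pr2 C ?P A) (pp ?P A z c) = c"
   if "c : N A" for c using T pb s t z that by simp_all
  ultimately show "\<exists>!c. c : N A \<and> rel \<mu> (ap (pairing C (?p \<cdot> pr1 C ?P A) (?q \<cdot> pr1 C ?P A)) (pp ?P A z c)) (ap (pr2 C ?P A) (pp ?P A z c))"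
   by (simp cong: conj_cong)
 qed (use T s t pb that in simp_all)
 obtain i where i: "i : Arr C" "Dom C i = A" "Cod C i = A"
  and I: "\<And>N ap a x. [|canon N ap; a : N A; x : N A|] ==>
   rel_at N ap \<mu> (ap (pairing C (pr2 C A A) (pr1 C A A)) (pp_at N ap A A a x)) (ap (u \<cdot> (s \<cdot> pr1 C A A)) (pp_at N ap A A a x)) \<longleftrightarrow> x = ap i a"
 proof (rule functional_relation[OF T(2) T(1) T(1), of "pairing C (pr2 C A A) (pr1 C A A)" "u \<cdot> (s \<cdot> pr1 C A A)"])
  fix N ap a assume N: "canon N ap" and a: "a : N A"
  interpret model C N ap by fact
  interpret set_frob "N A" "\<lambda>x y z. rel \<mu> (pp A A x y) z" "unit_elts \<eta>" by (rule sf[OF N])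
  have "\<exists>!x. x : N A \<and> rel \<mu> (pp A A x a) (ap u (ap s a))"
   using inverse_ex[OF a] left_inverse_unique[OF a] unfolding usrc(1)[OF N a] by blast
  moreover have "ap (pairing C (pr2 C A A) (pr1 C A A)) (pp A A a x) = pp A A x a" "ap (u \<cdot> (s \<cdot> pr1 C A A)) (pp A A a x) = ap u (ap s a)"
   if "x : N A" for x using T a s u that by simp_all
  ultimately show "\<exists>!x. x : N A \<and> rel \<mu> (ap (pairing C (pr2 C A A) (pr1 C A A)) (pp A A a x)) (ap (u \<cdot> (s \<cdot> pr1 C A A)) (pp A A a x))"
   by (simp cong: conj_cong)
 qed (use T s u that in simp_all)
 define G :: "('o, 'm) igpd" where "G = \<lparr>iObj = E, iArr = A, iSrc = s, iTgt = t, iUnit = u, iComp = m, iInv = i\<rparr>"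
 have G: "iObj G = E" "iArr G = A" "iSrc G = s" "iTgt G = t" "iUnit G = u" "iComp G = m" "iInv G = i"
  by (simp_all add: G_def)
 have mu_m: "rel_at N ap \<mu> (pp_at N ap A A g f) h \<longleftrightarrow> ap s g = ap t f \<and> h = mcomp_at N ap G g f"
  if N: "canon N ap" and gf: "g : N A" "f : N A" for N ap g f h
 proof -
  interpret model C N ap by fact
  have *: "rel \<mu> (pp A A g f) h \<longleftrightarrow> h = mcomp G g f" if e: "ap s g = ap t f" "h : N A" for h
  proof -
   have z: "pbe s t g f : N ?P" "ap ?p (pbe s t g f) = g" "ap ?q (pbe s t g f) = f" using gf e s t by simp_all
   show ?thesis unfolding mcomp_def G using M[OF N z(1) e(2)] z T pb s t e by simp
  qed
  have "mcomp G g f : N A" if e: "ap s g = ap t f"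
   unfolding mcomp_def G using e gf s t m by simp
  then show ?thesis using * comp(1)[OF N gf, of h] rel_in(2)[OF T(2), of _ h] T(4) by blast
 qed
 have gpd: "model.elt_gpd C N ap G" if N: "canon N ap" for N ap
 proof -
  interpret model C N ap by fact
  interpret set_frob "N A" "\<lambda>x y z. rel \<mu> (pp A A x y) z" "unit_elts \<eta>" by (rule sf[OF N])
  let ?c = "mcomp G"
  note mu = mu_m[OF N] and srcs = usrc[OF N] and inj = u_inj[OF N]
  have uE: "ap u x : unit_elts \<eta>" if "x : N E" for x using that u_img[OF N] by blast
  have cin: "?c g f : N A" "rel \<mu> (pp A A g f) (?c g f)" if "g : N A" "f : N A" "ap s g = ap t f" for g f
   using mu[of g f "?c g f"] rel_in(2)[OF T(2), of "pp A A g f" "?c g f"] that T(4) by simp_all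
  have sin: "ap s a : N E" "ap t a : N E" if "a : N A" for a using that s t by simp_all
  have iin: "ap i a : N A" if "a : N A" for a using that i by simp
  have inv: "rel \<mu> (pp A A (ap i a) a) (ap u (ap s a))" if a: "a : N A" for a
   using I[OF N a, of "ap i a"] a i s u T by simp
  have si: "ap s (ap i a) = ap t a" "?c (ap i a) a = ap u (ap s a)" if a: "a : N A" for a
   using inv[OF a] mu[of "ap i a" a] a i by simp_all
  have inv': "rel \<mu> (pp A A a (ap i a)) (ap u (ap t a))" if a: "a : N A" for a
  proof -
   obtain x where x: "x : N A" "rel \<mu> (pp A A x a) (src a)" "rel \<mu> (pp A A a x) (tgt a)" using inverse_ex[OF a] by blast
   then have "x = ap i a" using left_inverse_unique[OF a x(1) iin[OF a]] inv[OF a] srcs(1)[OF a] by simp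
   then show ?thesis using x srcs(2)[OF a] by simp
  qed
  show ?thesis unfolding G
  proof
   fix a assume a: "a : N A"
   show "?c a (ap u (ap s a)) = a" "?c (ap u (ap t a)) a = a"
    using src(2)[OF a] tgt(2)[OF a] EG[OF src(1)[OF a]] EG[OF tgt(1)[OF a]] mu[of a "ap u (ap s a)" a] mu[of "ap u (ap t a)" a a] a sin[OF a] u srcs[OF a] by simp_all
   show "ap s (ap i a) = ap t a" using si[OF a] by simp
   show "ap t (ap i a) = ap s a" "?c a (ap i a) = ap u (ap t a)" using mu[of a "ap i a"] inv'[OF a] a i by simp_all
   show "?c (ap i a) a = ap u (ap s a)" using si[OF a] by simp
  next
   fix x assume x: "x : N E"
   show "ap s (ap u x) = x" "ap t (ap u x) = x"
    using src_unit[OF uE[OF x]] tgt_unit[OF uE[OF x]] srcs[of "ap u x"] inj[of "ap s (ap u x)" x] inj[of "ap t (ap u x)" x] x u sin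
    by simp_all
  next
   fix g f assume gf: "g : N A" "f : N A" "ap s g = ap t f"
   note c = cin[OF gf]
   show "ap s (?c g f) = ap s f" "ap t (?c g f) = ap t g"
    using src_m[OF gf(1,2) c] tgt_m[OF gf(1,2) c] srcs[OF c(1)] srcs(1)[OF gf(2)] srcs(2)[OF gf(1)] inj sin c gf by metis+
  next
   fix h g f assume e: "h : N A" "g : N A" "f : N A" "ap s h = ap t g" "ap s g = ap t f"
   note hg = cin[OF e(1,2,4)] and gf = cin[OF e(2,3,5)]
   have "ap s (?c h g) = ap s g"
    using src_m[OF e(1,2) hg] srcs(1)[OF hg(1)] srcs(1)[OF e(2)] inj sin hg e by metis
   then have c: "?c (?c h g) f : N A" "rel \<mu> (pp A A (?c h g) f) (?c (?c h g) f)" using cin[OF hg(1) e(3)] e by simp_all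
   then obtain x where x: "x : N A" "rel \<mu> (pp A A g f) x" "rel \<mu> (pp A A h x) (?c (?c h g) f)"
    using assoc[OF e(1-3) c(1)] hg by blast
   then have "x = ?c g f" using mu[of g f x] e by simp
   then show "?c (?c h g) f = ?c h (?c g f)" using x mu[of h x] e by simp
  qed (use s t u i cin sin in auto)
 qed
 have IG: "internal_groupoid C G"
 proof (rule internal_groupoidI)
  show "internal_category C G"
  proof (rule internal_categoryI)
   fix N ap assume "canon N ap"
   then show "model.elt_cat C N ap G" using gpd set_gpd.axioms(1) by blast
  qed (use s t u m in "simp_all add: G")
 qed (use i gpd in "simp_all add: G")
 note GT = gpd_frob_typing[OF IG, unfolded G]
 have "mult (gpd_frob C G) = \<mu>"
 proof (subst relation_eq_iff, goal_cases)
  case 5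
  then show ?case
  proof (intro allI impI ballI)
   fix N ap p h assume N: "canon N ap" and "p : N (tdom \<mu>)" "h : N (tcod \<mu>)"
   interpret model C N ap by fact
   obtain g f where "g : N A" "f : N A" "p = pp A A g f"
    using Bex_prd[of A A "\<lambda>z. p = z"] T \<open>p : N (tdom \<mu>)\<close> by auto
   then show "rel (mult (gpd_frob C G)) p h \<longleftrightarrow> rel \<mu> p h"
    using rel_gpd_mult[OF IG, of g f h] mu_m[OF N, of g f h] by (simp add: G)
  qed
 qed (use GT T in simp_all)
 moreover have "unt (gpd_frob C G) = \<eta>"
 proof (subst relation_eq_iff, goal_cases)
  case 5
  then show ?case
  proof (intro allI impI ballI)
   fix N ap x a assume N: "canon N ap" and xa: "x : N (tdom \<eta>)" "a : N (tcod \<eta>)"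
   interpret model C N ap by fact
   obtain y where y: "N (one C) = {y}" using one_elt by blast
   have "unit_elts (unt (gpd_frob C G)) = unit_elts \<eta>" unfolding unit_elts_gpd[OF IG] u_img[OF N] by (simp add: G)
   then have "a : unit_elts (unt (gpd_frob C G)) \<longleftrightarrow> a : unit_elts \<eta>" by simp
   then show "rel (unt (gpd_frob C G)) x a \<longleftrightarrow> rel \<eta> x a"
    unfolding unit_elts_def using xa T GT y by simp
  qed
 qed (use GT T in simp_all)
 ultimately have "gpd_frob C G = F" unfolding FA using GT(1) by (cases "gpd_frob C G") simp
 then show ?thesis using IG by blast
qed

end

section \<open>Equivalences of categories\<close>

text \<open>A functor that is surjective on objects and bijective on hom-sets has a choice of preimages
 as inverse.\<close>

lemma surjective_fully_faithful_equivalence: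
 assumes F: "is_functor C D F"
  and surj: "\<And>B. B : Obj D ==> \<exists>A\<in>Obj C. OMap F A = B"
  and ff: "\<And>A A'. [|A : Obj C; A' : Obj C|] ==> bij_betw (AMap F) (hom C A A') (hom D (OMap F A) (OMap F A'))"
 shows "is_equivalence C D F"
proof -
 have cats: "is_category C" "is_category D" using F by (auto simp: is_functor_def)
 interpret CC: category C by unfold_locales fact
 interpret DD: category D by unfold_locales fact
 have FO: "OMap F A : Obj D" if "A : Obj C" for A using F that by (auto simp: is_functor_def)
 have FA: "AMap F f : hom D (OMap F (Dom C f)) (OMap F (Cod C f))" if "f : Arr C" for f
  using F that by (auto simp: is_functor_def)
 have FI: "AMap F (Ident C A) = Ident D (OMap F A)" if "A : Obj C" for A using F that by (auto simp: is_functor_def)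
 have FC: "AMap F (g \<cdot>\<^bsub>C\<^esub> f) = AMap F g \<cdot>\<^bsub>D\<^esub> AMap F f" if "f : Arr C" "g : Arr C" "Cod C f = Dom C g" for f g
  using F that by (auto simp: is_functor_def)
 define k where "k B = (SOME A. A : Obj C \<and> OMap F A = B)" for B
 have k: "k B : Obj C" "OMap F (k B) = B" if "B : Obj D" for B
  using someI_ex[of "\<lambda>A. A : Obj C \<and> OMap F A = B"] surj[OF that] unfolding k_def by blast+
 define inv where "inv A A' = the_inv_into (hom C A A') (AMap F)" for A A'
 have inv: "inv A A' g : hom C A A'" "AMap F (inv A A' g) = g"
  if "A : Obj C" "A' : Obj C" "g : hom D (OMap F A) (OMap F A')" for A A' g
 proof -
  note b = ff[OF that(1,2), unfolded bij_betw_def]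
  show "AMap F (inv A A' g) = g" unfolding inv_def using b that(3) by (intro f_the_inv_into_f) auto
  show "inv A A' g : hom C A A'" unfolding inv_def using b that(3) by (intro the_inv_into_into) auto
 qed
 have inj: "f = g" if "f : hom C A A'" "g : hom C A A'" "AMap F f = AMap F g" for f g A A'
  using ff[of A A'] that CC.hom_Obj[OF that(1)] unfolding bij_betw_def inj_on_def by blast
 define K where "K = \<lparr>OMap = k, AMap = (\<lambda>g. inv (k (Dom D g)) (k (Cod D g)) g)\<rparr>"
 have KA: "AMap K g : hom C (k (Dom D g)) (k (Cod D g))" "AMap F (AMap K g) = g" if "g : Arr D" for g
  using inv[of "k (Dom D g)" "k (Cod D g)" g] k that by (auto simp: K_def hom_def)
 have KO: "OMap K = k" by (simp add: K_def)
 have K: "is_functor D C K"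
  unfolding is_functor_def KO
 proof (intro conjI ballI impI cats)
  fix B assume B: "B : Obj D"
  show "k B : Obj C" using k B by simp
  show "AMap K (Ident D B) = Ident C (k B)"
   by (rule inj[of _ "k B" "k B"]) (use KA[of "Ident D B"] B k FI in "auto simp: hom_def")
 next
  fix g assume g: "g : Arr D"
  then show "AMap K g : hom C (k (Dom D g)) (k (Cod D g))" by (rule KA)
  fix h assume h: "h : Arr D" "Cod D g = Dom D h"
  show "AMap K (h \<cdot>\<^bsub>D\<^esub> g) = AMap K h \<cdot>\<^bsub>C\<^esub> AMap K g"
   by (rule inj[of _ "k (Dom D g)" "k (Cod D h)"])
    (use KA[OF g] KA[OF h(1)] KA[of "h \<cdot>\<^bsub>D\<^esub> g"] g h FC in "auto simp: hom_def")
 qed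
 have iso: "is_iso C (inv A A' (Ident D (OMap F A)))" if A: "A : Obj C" "A' : Obj C" "OMap F A = OMap F A'" for A A'
 proof -
  have I: "Ident D (OMap F A) : hom D (OMap F A) (OMap F A')" "Ident D (OMap F A) : hom D (OMap F A') (OMap F A)"
   using FO A by (auto simp: hom_def)
  note i = inv[OF A(1,2) I(1)] and j = inv[OF A(2,1) I(2)]
  let ?i = "inv A A' (Ident D (OMap F A))" and ?j = "inv A' A (Ident D (OMap F A))"
  have "?j \<cdot>\<^bsub>C\<^esub> ?i = Ident C A"
   by (rule inj[of _ A A]) (use i j FO FI FC A in "auto simp: hom_def")
  moreover have "?i \<cdot>\<^bsub>C\<^esub> ?j = Ident C A'"
   by (rule inj[of _ A' A']) (use i j FO FI FC A in "auto simp: hom_def")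
  ultimately show ?thesis unfolding is_iso_def using i j by (auto simp: hom_def)
 qed
 have "naturally_isomorphic C C (comp_ftr K F) id_ftr"
  unfolding naturally_isomorphic_def
 proof (intro exI[of _ "\<lambda>A. inv (k (OMap F A)) A (Ident D (OMap F A))"] conjI ballI)
  fix A assume A: "A : Obj C"
  note kA = k[OF FO[OF A]]
  show "inv (k (OMap F A)) A (Ident D (OMap F A)) : hom C (OMap (comp_ftr K F) A) (OMap id_ftr A)"
   using inv[OF kA(1) A, of "Ident D (OMap F A)"] kA FO[OF A] by (simp add: comp_ftr_def id_ftr_def KO hom_def)
  show "is_iso C (inv (k (OMap F A)) A (Ident D (OMap F A)))" using iso[OF kA(1) A kA(2)] kA by simp
 next
  fix f assume f: "f : Arr C"
  let ?A = "Dom C f" and ?B = "Cod C f"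
  have AB: "?A : Obj C" "?B : Obj C" using f by simp_all
  note kA = k[OF FO[OF AB(1)]] and kB = k[OF FO[OF AB(2)]]
  have i: "inv (k (OMap F X)) X (Ident D (OMap F X)) : hom C (k (OMap F X)) X"
   "AMap F (inv (k (OMap F X)) X (Ident D (OMap F X))) = Ident D (OMap F X)" if X: "X : Obj C" for X
   using inv[OF k(1)[OF FO[OF X]] X, of "Ident D (OMap F X)"] k[OF FO[OF X]] FO[OF X] by (simp_all add: hom_def)
  have Ff: "AMap F f : Arr D" "Dom D (AMap F f) = OMap F ?A" "Cod D (AMap F f) = OMap F ?B" using FA[OF f] by (auto simp: hom_def)
  note KF = KA[OF Ff(1), unfolded Ff(2,3)]
  show "inv (k (OMap F ?B)) ?B (Ident D (OMap F ?B)) \<cdot>\<^bsub>C\<^esub> AMap (comp_ftr K F) f =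
    AMap id_ftr f \<cdot>\<^bsub>C\<^esub> inv (k (OMap F ?A)) ?A (Ident D (OMap F ?A))"
   unfolding comp_ftr_def id_ftr_def ftr.simps
   by (rule inj[of _ "k (OMap F ?A)" ?B])
    (use i[OF AB(1)] i[OF AB(2)] KF f FC Ff FO AB in "auto simp: hom_def")
 qed
 moreover have "naturally_isomorphic D D (comp_ftr F K) id_ftr"
  unfolding naturally_isomorphic_def
 proof (intro exI[of _ "Ident D"] conjI ballI)
  fix B assume B: "B : Obj D"
  show "Ident D B : hom D (OMap (comp_ftr F K) B) (OMap id_ftr B)"
   using B k by (simp add: comp_ftr_def id_ftr_def KO hom_def)
  show "is_iso D (Ident D B)" unfolding is_iso_def using B by (auto simp: hom_def intro!: bexI[of _ "Ident D B"])
 next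
  fix f assume f: "f : Arr D"
  then show "Ident D (Cod D f) \<cdot>\<^bsub>D\<^esub> AMap (comp_ftr F K) f = AMap id_ftr f \<cdot>\<^bsub>D\<^esub> Ident D (Dom D f)"
   using KA[OF f] by (simp add: comp_ftr_def id_ftr_def)
 qed
 ultimately show ?thesis unfolding is_equivalence_def using F K by blast
qed

section \<open>Positive relations\<close>

context regular_category
begin

lemma positive_Rel_iff:
 assumes "is_relation C h"
 shows "positive (Rel C) h \<longleftrightarrow> (\<exists>g. is_relation C g \<and> tdom g = tdom h \<and> h = rel_comp C (rel_dagger C g) g)"
 by (auto simp: positive_def)

lemma positive_elts:
 assumes "is_relation C h" "positive (Rel C) h"
  and N: "canon N ap" and r: "rel_at N ap h p q"
 shows "rel_at N ap h q p" "rel_at N ap h p p"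
proof -
 interpret model C N ap by fact
 obtain g where g: "is_relation C g" "h = rel_comp C (rel_dagger C g) g"
  using assms(1,2) positive_Rel_iff by blast
 have "rel h a b \<longleftrightarrow> (\<exists>x\<in>N (tcod g). rel g a x \<and> rel g b x)" for a b using g by simp
 then show "rel h q p" "rel h p p" using r by blast+
qed

text \<open>Positive regularity speaks about reflexive relations only; a symmetric relation that is
 reflexive on its support is obtained from its restriction along the inclusion of the support.\<close>

lemma positively_regular_positive:
 assumes pr: "positively_regular C" and h: "is_relation C h" "tdom h = X" "tcod h = X"
  and sym: "\<And>N ap p q. [|canon N ap; rel_at N ap h p q|] ==>
   rel_at N ap h q p \<and> rel_at N ap h p p"
 shows "positive (Rel C) h"
proof -
 have X: "X : Obj C" using relationD(1)[OF h(1)] h by simp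
 obtain j where j: "is_mono C j" "j : Arr C" "Cod C j = X" and
  J: "\<And>N ap z. [|canon N ap; z : N X|] ==> z : img_at N ap j \<longleftrightarrow> rel_at N ap h z z"
 proof (rule comprehension[OF h(1), of "Ident C X" "Ident C X"])
  fix j assume j: "is_mono C j" "j : Arr C" "Cod C j = Dom C (Ident C X)"
   "\<And>N ap z. [|canon N ap; z : N (Dom C (Ident C X))|]
    ==> z : img_at N ap j \<longleftrightarrow> rel_at N ap h (ap (Ident C X) z) (ap (Ident C X) z)"
  show ?thesis
  proof (rule that[OF j(1,2)])
   fix N ap z assume N: "canon N ap" and z: "z : N X"
   interpret model C N ap by fact
   show "z : img j \<longleftrightarrow> rel h z z" using j(4)[OF N, of z] z X by simp
  qed (use j X in simp)
 qed (use X h in simp_all)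
 define hD where "hD = rel_comp C (rel_dagger C (graph_rel C j)) (rel_comp C h (graph_rel C j))"
 have hD: "is_relation C hD" "tdom hD = Dom C j" "tcod hD = Dom C j" using h j by (simp_all add: hD_def)
 have relD: "rel_at N ap hD d e \<longleftrightarrow> d : N (Dom C j) \<and> e : N (Dom C j) \<and> rel_at N ap h (ap j d) (ap j e)"
  if N: "canon N ap" for N ap d e
 proof -
  interpret model C N ap by fact
  show ?thesis using h j by (auto simp: hD_def)
 qed
 have "reflexive_rel C hD"
  unfolding reflexive_rel_def
 proof (rule relation_leI)
  fix N ap a b assume N: "canon N ap" and r: "rel_at N ap (rel_ident C (tdom hD)) a b"
  interpret model C N ap by fact
  have ab: "a : N (Dom C j)" "b = a" using r hD j by simp_all
  then have "ap j a : img j" by (simp add: img_def)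
  then have "rel h (ap j a) (ap j a)" using J[OF N, of "ap j a"] ab j by simp
  then show "rel hD a b" using relD[OF N] ab by simp
 qed (use hD j in simp_all)
 moreover have "symmetric_rel C hD"
  unfolding symmetric_rel_def
 proof (rule relation_leI)
  fix N ap a b assume N: "canon N ap" and r: "rel_at N ap hD a b"
  interpret model C N ap by fact
  show "rel (rel_dagger C hD) a b" using relD[OF N] r sym[OF N] hD by simp
 qed (use hD in simp_all)
 ultimately have "positive (Rel C) hD" using pr hD unfolding positively_regular_def by simp
 then obtain g where g: "is_relation C g" "tdom g = Dom C j" "hD = rel_comp C (rel_dagger C g) g"
  using positive_Rel_iff[OF hD(1)] hD(2) by auto
 let ?g = "rel_comp C g (rel_dagger C (graph_rel C j))"
 have "h = rel_comp C (rel_dagger C ?g) ?g"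
 proof (rule relation_eqI)
  fix N ap p q assume N: "canon N ap"
  interpret model C N ap by fact
  have "rel (rel_comp C (rel_dagger C ?g) ?g) p q \<longleftrightarrow>
    (\<exists>d\<in>N (Dom C j). \<exists>e\<in>N (Dom C j). p = ap j d \<and> q = ap j e \<and> rel hD d e)"
   unfolding g(3) using g(1,2) j by auto
  also have "\<dots> \<longleftrightarrow> rel h p q"
  proof
   assume r: "rel h p q"
   then have "p : N X" "q : N X" using rel_in[OF h(1)] h by auto
   then have "p : img j" "q : img j" using J[OF N] sym[OF N] r by blast+
   then show "\<exists>d\<in>N (Dom C j). \<exists>e\<in>N (Dom C j). p = ap j d \<and> q = ap j e \<and> rel hD d e"
    using relD[OF N] r by (auto simp: img_def)
  qed (use relD[OF N] in auto)
  finally show "rel h p q = rel (rel_comp C (rel_dagger C ?g) ?g) p q" by simp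
 qed (use h g j in simp_all)
 then show ?thesis using positive_Rel_iff[OF h(1)] g j h by (intro iffD2[OF positive_Rel_iff[OF h(1)]] exI[of _ ?g]) simp
qed

text \<open>A reflexive relation is transitive by difunctionality and symmetric, and an equivalence relation
\<open>R\<close> satisfies \<open>R = R\<^sup>\<dagger> \<circ> R\<close>.\<close>

theorem malcev_positively_regular:
 assumes mal: "malcev C"
 shows "positively_regular C"
 unfolding positively_regular_def
proof (intro conjI allI impI regular)
 fix R assume "is_relation C R \<and> tdom R = tcod R \<and> reflexive_rel C R \<and> symmetric_rel C R"
 then have R: "is_relation C R" "tdom R = tcod R" and rs: "reflexive_rel C R" "symmetric_rel C R" by auto
 note D = relationD(1,2)[OF R(1)]
 obtain r where r: "r : tmap R" using relation_ex[OF R(1)] ..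
 have refl: "rel_at N ap R a a" if N: "canon N ap" "a : N (tcod R)" for N ap a
 proof -
  interpret model C N ap by fact
  have "rel (rel_ident C (tdom R)) a a" using D that R by simp
  moreover have "sub_le C (tmap (rel_ident C (tdom R))) (tmap R)" using rs by (simp add: reflexive_rel_def)
  ultimately show ?thesis using sub_le_rel[of "rel_ident C (tdom R)" R] R D by simp
 qed
 have sym: "rel_at N ap R b a" if N: "canon N ap" "rel_at N ap R a b" for N ap a b
  by (rule malcev_symmetric[OF mal R _ N]) (rule refl)
 have trans: "rel_at N ap R a c" if N: "canon N ap" "rel_at N ap R a b" "rel_at N ap R b c" for N ap a b c
 proof -
  interpret model C N ap by fact
  have "rel R b b" using refl[OF N(1)] rel_in[OF R(1) N(2)] by simp
  then obtain z1 z2 z3 where z: "z1 : N (Dom C r)" "z2 : N (Dom C r)" "z3 : N (Dom C r)"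
   "ap (leg1 C R r) z1 = a" "ap (leg2 C R r) z1 = b" "ap (leg1 C R r) z2 = b" "ap (leg2 C R r) z2 = b"
   "ap (leg1 C R r) z3 = b" "ap (leg2 C R r) z3 = c"
   using N(2,3) unfolding rel_rep[OF R(1) r] by blast
  have "\<exists>z\<in>N (Dom C (leg2 C R r)). ap (leg1 C R r) z = ap (leg1 C R r) z1 \<and> ap (leg2 C R r) z = ap (leg2 C R r) z3"
   by (rule malcev_difunctional[OF mal _ _ _ N(1), of _ _ z1 z2 z3]) (use relationD(6-9)[OF R(1) r] z in simp_all)
  then show ?thesis unfolding rel_rep[OF R(1) r] using z relationD(9)[OF R(1) r] by simp
 qed
 have "R = rel_comp C (rel_dagger C R) R"
 proof (rule relation_eqI)
  fix N ap a b assume N: "canon N ap"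
  interpret model C N ap by fact
  have "rel R a b \<longleftrightarrow> (\<exists>x\<in>N (tcod R). rel R a x \<and> rel R b x)"
  proof
   assume "rel R a b"
   moreover have "b : N (tcod R)" using rel_in(2)[OF R(1) calculation] .
   ultimately show "\<exists>x\<in>N (tcod R). rel R a x \<and> rel R b x" using refl[OF N] by blast
  next
   assume "\<exists>x\<in>N (tcod R). rel R a x \<and> rel R b x"
   then show "rel R a b" using sym[OF N] trans[OF N] by blast
  qed
  then show "rel R a b = rel (rel_comp C (rel_dagger C R) R) a b" using R by simp
 qed (use R in simp_all)
 then show "positive (Rel C) R" using positive_Rel_iff[OF R(1)] R by blast
qed

section \<open>Completely positive maps and relations respecting inverses\<close>

lemma choi_typing:
 assumes A: "internal_groupoid C A" and B: "internal_groupoid C B"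
  and R: "is_relation C R" "tdom R = iArr A" "tcod R = iArr B"
 shows "is_relation C (choi (Rel C) (gpd_frob C A) (gpd_frob C B) R)"
  "tdom (choi (Rel C) (gpd_frob C A) (gpd_frob C B) R) = prd C (iArr A) (iArr B)"
  "tcod (choi (Rel C) (gpd_frob C A) (gpd_frob C B) R) = prd C (iArr A) (iArr B)"
 using A B R gpd_frob_typing(1-7)[OF A] gpd_frob_typing(1-7)[OF B] by (simp_all add: choi_def Let_def)

lemma (in model) rel_choi:
 assumes A: "internal_groupoid C A" and B: "internal_groupoid C B"
  and R: "is_relation C R" "tdom R = iArr A" "tcod R = iArr B"
  and e: "a : N (iArr A)" "b : N (iArr B)" "a' : N (iArr A)" "b' : N (iArr B)"
 shows "rel (choi (Rel C) (gpd_frob C A) (gpd_frob C B) R) (pp (iArr A) (iArr B) a b) (pp (iArr A) (iArr B) a' b') \<longleftrightarrow>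
  (\<exists>y\<in>N (iArr A). \<exists>z\<in>N (iArr B). ap (iSrc A) a' = ap (iTgt A) y \<and> a = mcomp A a' y \<and> rel R y z \<and>
   ap (iSrc B) z = ap (iTgt B) b \<and> b' = mcomp B z b)"
proof -
 note TA = gpd_frob_typing(1-7)[OF A] and TB = gpd_frob_typing(1-7)[OF B]
 have "rel (choi (Rel C) (gpd_frob C A) (gpd_frob C B) R) (pp (iArr A) (iArr B) a b) (pp (iArr A) (iArr B) a' b') \<longleftrightarrow>
  (\<exists>y\<in>N (iArr A). \<exists>z\<in>N (iArr B). rel (mult (gpd_frob C A)) (pp (iArr A) (iArr A) a' y) a \<and> rel R y z \<and>
   rel (mult (gpd_frob C B)) (pp (iArr B) (iArr B) z b) b')"
  unfolding choi_def Let_def using A B R TA TB e by (simp add: Bex_prd) blast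
 then show ?thesis using rel_gpd_mult[OF A] rel_gpd_mult[OF B] e by (simp cong: bex_cong)
qed

text \<open>Symmetry of the Choi matrix is closure of \<open>R\<close> under inverses, and reflexivity on its support is closure
under identities: apply both to the pairs related by composing with identities.\<close>

lemma positive_choi_iff:
 assumes pr: "positively_regular C" and A: "internal_groupoid C A" and B: "internal_groupoid C B"
  and R: "is_relation C R" "tdom R = iArr A" "tcod R = iArr B"
 shows "positive (Rel C) (choi (Rel C) (gpd_frob C A) (gpd_frob C B) R) \<longleftrightarrow> respects_inverses C A B R"
  (is "positive _ ?h \<longleftrightarrow> _")
proof
 note h = choi_typing[OF assms(2-)]
 assume pos: "positive (Rel C) ?h"
 have "inverse_closed N ap A B R" if N: "canon N ap" for N ap
  unfolding inverse_closed_def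
 proof (intro allI impI)
  interpret model C N ap by fact
  interpret GA: gpd_elts C N ap A by unfold_locales (rule A)
  interpret GB: gpd_elts C N ap B by unfold_locales (rule B)
  let ?uA = "\<lambda>x. ap (iUnit A) x" and ?uB = "\<lambda>x. ap (iUnit B) x"
  fix y z assume r: "rel R y z"
  then have yz: "y : N (iArr A)" "z : N (iArr B)" using rel_in[OF R(1)] R by auto
  let ?p = "pp (iArr A) (iArr B) y (?uB (ap (iSrc B) z))" and ?q = "pp (iArr A) (iArr B) (?uA (ap (iTgt A) y)) z"
  have "rel ?h ?p ?q"
   unfolding rel_choi[OF assms(2-6) yz(1) GB.u_in[OF GB.s_in[OF yz(2)]] GA.u_in[OF GA.t_in[OF yz(1)]] yz(2)]
   using r yz by (intro bexI[of _ y] bexI[of _ z]) simp_all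
  then have qp: "rel ?h ?q ?p" and pp: "rel ?h ?p ?p" using positive_elts[OF h(1) pos N] by blast+
  from qp obtain y' z' where q: "y' : N (iArr A)" "z' : N (iArr B)" "ap (iSrc A) y = ap (iTgt A) y'"
   "?uA (ap (iTgt A) y) = mcomp A y y'" "rel R y' z'" "ap (iSrc B) z' = ap (iTgt B) z"
   "?uB (ap (iSrc B) z) = mcomp B z' z"
   unfolding rel_choi[OF assms(2-6) GA.u_in[OF GA.t_in[OF yz(1)]] yz(2) yz(1) GB.u_in[OF GB.s_in[OF yz(2)]]] by blast
  then have "y' = ap (iInv A) y" "z' = ap (iInv B) z"
   using GA.i_unique'[of y y'] GB.i_unique[of z z'] yz by simp_all
  then have 1: "rel R (ap (iInv A) y) (ap (iInv B) z)" using q by simp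
  from pp obtain y' z' where q: "y' : N (iArr A)" "z' : N (iArr B)" "ap (iSrc A) y = ap (iTgt A) y'"
   "y = mcomp A y y'" "rel R y' z'" "ap (iSrc B) z' = ap (iTgt B) (?uB (ap (iSrc B) z))"
   "?uB (ap (iSrc B) z) = mcomp B z' (?uB (ap (iSrc B) z))"
   unfolding rel_choi[OF assms(2-6) yz(1) GB.u_in[OF GB.s_in[OF yz(2)]] yz(1) GB.u_in[OF GB.s_in[OF yz(2)]]] by blast
  have "mcomp A (ap (iInv A) y) (mcomp A y y') = y'" using q(1,3) yz by simp
  then have "y' = ?uA (ap (iSrc A) y)" unfolding q(4)[symmetric] using yz by simp
  moreover have "mcomp B z' (?uB (ap (iSrc B) z')) = z'" using q(2) by simp
  then have "z' = ?uB (ap (iSrc B) z)" using q(6,7) yz by simp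
  ultimately have "rel R (?uA (ap (iSrc A) y)) (?uB (ap (iSrc B) z))" using q by simp
  then show "rel R (ap (iInv A) y) (ap (iInv B) z) \<and> rel R (?uA (ap (iSrc A) y)) (?uB (ap (iSrc B) z))" using 1 by simp
 qed
 then show "respects_inverses C A B R" using respects_inverses_iff[OF A B R] by blast
next
 note h = choi_typing[OF assms(2-)]
 assume "respects_inverses C A B R"
 then have cl: "inverse_closed N ap A B R" if "canon N ap" for N ap
  using respects_inverses_iff[OF A B R] that by blast
 show "positive (Rel C) ?h"
 proof (rule positively_regular_positive[OF pr h])
  fix N ap p q assume N: "canon N ap" and r: "rel_at N ap ?h p q"
  interpret model C N ap by fact
  interpret GA: gpd_elts C N ap A by unfold_locales (rule A)
  interpret GB: gpd_elts C N ap B by unfold_locales (rule B)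
  let ?uA = "\<lambda>x. ap (iUnit A) x" and ?uB = "\<lambda>x. ap (iUnit B) x"
  have "p : N (prd C (iArr A) (iArr B))" "q : N (prd C (iArr A) (iArr B))" using rel_in[OF h(1) r] h by simp_all
  then obtain a b a' b' where e: "a : N (iArr A)" "b : N (iArr B)" "a' : N (iArr A)" "b' : N (iArr B)"
   and pq: "p = pp (iArr A) (iArr B) a b" "q = pp (iArr A) (iArr B) a' b'"
   using Bex_prd[of "iArr A" "iArr B" "\<lambda>w. p = w"] Bex_prd[of "iArr A" "iArr B" "\<lambda>w. q = w"] A B by auto
  obtain y z where yz: "y : N (iArr A)" "z : N (iArr B)" "ap (iSrc A) a' = ap (iTgt A) y" "a = mcomp A a' y"
   "rel R y z" "ap (iSrc B) z = ap (iTgt B) b" "b' = mcomp B z b"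
   using r unfolding pq rel_choi[OF assms(2-6) e] by blast
  have R1: "rel R (ap (iInv A) y) (ap (iInv B) z)" "rel R (?uA (ap (iSrc A) y)) (?uB (ap (iSrc B) z))"
   using cl[OF N] yz(5) unfolding inverse_closed_def by blast+
  have "rel ?h q p"
   unfolding pq rel_choi[OF assms(2-6) e(3,4,1,2)]
   using R1(1) yz e by (intro bexI[of _ "ap (iInv A) y"] bexI[of _ "ap (iInv B) z"]) simp_all
  moreover have "rel ?h p p"
   unfolding pq rel_choi[OF assms(2-6) e(1,2,1,2)]
  proof (intro bexI conjI)
   have sa: "ap (iSrc A) y = ap (iSrc A) a" using yz(1,3,4) e by simp
   show "ap (iSrc A) a = ap (iTgt A) (?uA (ap (iSrc A) y))" "a = mcomp A a (?uA (ap (iSrc A) y))"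
    unfolding sa using e by simp_all
   show "ap (iSrc B) (?uB (ap (iSrc B) z)) = ap (iTgt B) b" "b = mcomp B (?uB (ap (iSrc B) z)) b"
    unfolding yz(6) using e by simp_all
  qed (use R1(2) yz e in simp_all)
  ultimately show "rel ?h q p \<and> rel ?h p p" by simp
 qed
qed

lemma GRel_simps [simp]:
 "A : Obj (GRel C) \<longleftrightarrow> internal_groupoid C A"
 "R : Arr (GRel C) \<longleftrightarrow> internal_groupoid C (tdom R) \<and> internal_groupoid C (tcod R) \<and>
   is_relation C (tmap R) \<and> tdom (tmap R) = iArr (tdom R) \<and> tcod (tmap R) = iArr (tcod R) \<and>
   respects_inverses C (tdom R) (tcod R) (tmap R)"
 "Dom (GRel C) = tdom" "Cod (GRel C) = tcod"
 "Ident (GRel C) A = \<lparr>tdom = A, tcod = A, tmap = rel_ident C (iArr A)\<rparr>"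
 "Cmp (GRel C) S R = \<lparr>tdom = tdom R, tcod = tcod S, tmap = rel_comp C (tmap S) (tmap R)\<rparr>"
 by (auto simp: GRel_def hom_Rel)

lemma respects_inverses_ident:
 assumes A: "internal_groupoid C A"
 shows "respects_inverses C A A (rel_ident C (iArr A))"
proof -
 have "inverse_closed N ap A A (rel_ident C (iArr A))" if N: "canon N ap" for N ap
 proof -
  interpret model C N ap by fact
  show ?thesis using A by (simp add: inverse_closed_def)
 qed
 then show ?thesis using A by (subst respects_inverses_iff) simp_all
qed

lemma respects_inverses_comp:
 assumes A: "internal_groupoid C A" and B: "internal_groupoid C B" and D: "internal_groupoid C D"
  and R: "is_relation C R" "tdom R = iArr A" "tcod R = iArr B" "respects_inverses C A B R"
  and S: "is_relation C S" "tdom S = iArr B" "tcod S = iArr D" "respects_inverses C B D S"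
 shows "respects_inverses C A D (rel_comp C S R)"
proof -
 have "inverse_closed N ap A D (rel_comp C S R)" if N: "canon N ap" for N ap
 proof -
  interpret model C N ap by fact
  have "inverse_closed N ap A B R" "inverse_closed N ap B D S"
   using R S respects_inverses_iff[OF A B R(1-3)] respects_inverses_iff[OF B D S(1-3)] N by blast+
  then show ?thesis using R(1-3) S(1-3) rel_in[OF R(1)] unfolding inverse_closed_def by (simp, metis)
 qed
 then show ?thesis using A D R S by (subst respects_inverses_iff) simp_all
qed

theorem is_category_GRel: "is_category (GRel C)"
proof -
 interpret R: category "Rel C" by unfold_locales (rule is_category_Rel)
 show ?thesis
  unfolding is_category_def
 proof (intro conjI ballI impI)
  fix A assume "A : Obj (GRel C)"
  then show "Ident (GRel C) A : hom (GRel C) A A" using respects_inverses_ident by (simp add: hom_def)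
 next
  fix f assume f: "f : Arr (GRel C)"
  then show "Dom (GRel C) f : Obj (GRel C)" "Cod (GRel C) f : Obj (GRel C)" by simp_all
  show "f \<cdot>\<^bsub>GRel C\<^esub> Ident (GRel C) (Dom (GRel C) f) = f" "Ident (GRel C) (Cod (GRel C) f) \<cdot>\<^bsub>GRel C\<^esub> f = f"
   using f R.Cmp_Ident[of "tmap f"] R.Ident_Cmp[of "tmap f"] by (cases f, simp)+
  fix g assume g: "g : Arr (GRel C)" "Cod (GRel C) f = Dom (GRel C) g"
  then show "g \<cdot>\<^bsub>GRel C\<^esub> f : hom (GRel C) (Dom (GRel C) f) (Cod (GRel C) g)"
   using f respects_inverses_comp[of "tdom f" "tcod f" "tcod g" "tmap f" "tmap g"] by (simp add: hom_def)
  fix h assume h: "h : Arr (GRel C)" "Cod (GRel C) g = Dom (GRel C) h"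
  then show "h \<cdot>\<^bsub>GRel C\<^esub> g \<cdot>\<^bsub>GRel C\<^esub> f = (h \<cdot>\<^bsub>GRel C\<^esub> g) \<cdot>\<^bsub>GRel C\<^esub> f"
   using f g R.Cmp_assoc[of "tmap f" "tmap g" "tmap h"] by simp
 qed
qed

context
 assumes pr: "positively_regular C"
begin

lemma CP_Arr_iff:
 assumes A: "internal_groupoid C A" and B: "internal_groupoid C B" and f: "tdom f = gpd_frob C A" "tcod f = gpd_frob C B"
 shows "f : Arr (CP (Rel C)) \<longleftrightarrow> is_relation C (tmap f) \<and> tdom (tmap f) = iArr A \<and> tcod (tmap f) = iArr B \<and>
  respects_inverses C A B (tmap f)"
 using positive_choi_iff[OF pr A B, of "tmap f"] gpd_frob_frobenius[OF A] gpd_frob_frobenius[OF B]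
  gpd_frob_typing(1)[OF A] gpd_frob_typing(1)[OF B] f
 by (auto simp: CP_def hom_Rel)

lemma CP_simps:
 "F : Obj (CP (Rel C)) \<longleftrightarrow> special_dagger_frobenius (Rel C) F"
 "Dom (CP (Rel C)) = tdom" "Cod (CP (Rel C)) = tcod"
 "Ident (CP (Rel C)) F = \<lparr>tdom = F, tcod = F, tmap = rel_ident C (carr F)\<rparr>"
 "Cmp (CP (Rel C)) g f = \<lparr>tdom = tdom f, tcod = tcod g, tmap = rel_comp C (tmap g) (tmap f)\<rparr>"
 by (simp_all add: CP_def)

lemma CP_Arr_gpd:
 assumes "f : Arr (CP (Rel C))"
 shows "\<exists>A B :: ('o, 'm) igpd. internal_groupoid C A \<and> internal_groupoid C B \<and> tdom f = gpd_frob C A \<and> tcod f = gpd_frob C B"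
proof -
 have "special_dagger_frobenius (Rel C) (tdom f)" "special_dagger_frobenius (Rel C) (tcod f)"
  using assms by (simp_all add: CP_def)
 then show ?thesis using frobenius_gpd_ex by metis
qed

theorem is_category_CP: "is_category (CP (Rel C))"
proof -
 interpret R: category "Rel C" by unfold_locales (rule is_category_Rel)
 show ?thesis
  unfolding is_category_def
 proof (intro conjI ballI impI)
  fix F assume "F : Obj (CP (Rel C))"
  then obtain A :: "('o, 'm) igpd" where A: "internal_groupoid C A" "gpd_frob C A = F" using frobenius_gpd_ex by (auto simp: CP_simps)
  then show "Ident (CP (Rel C)) F : hom (CP (Rel C)) F F"
   using CP_Arr_iff[OF A(1) A(1), of "Ident (CP (Rel C)) F"] respects_inverses_ident[OF A(1)] gpd_frob_typing(1)[OF A(1)]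
   by (simp add: hom_def CP_simps)
 next
  fix f assume f: "f : Arr (CP (Rel C))"
  obtain A B :: "('o, 'm) igpd" where AB: "internal_groupoid C A" "internal_groupoid C B" "tdom f = gpd_frob C A" "tcod f = gpd_frob C B"
   using CP_Arr_gpd[OF f] by blast
  note f' = f[unfolded CP_Arr_iff[OF AB]]
  show "Dom (CP (Rel C)) f : Obj (CP (Rel C))" "Cod (CP (Rel C)) f : Obj (CP (Rel C))"
   using AB gpd_frob_frobenius by (simp_all add: CP_simps)
  show "f \<cdot>\<^bsub>CP (Rel C)\<^esub> Ident (CP (Rel C)) (Dom (CP (Rel C)) f) = f" "Ident (CP (Rel C)) (Cod (CP (Rel C)) f) \<cdot>\<^bsub>CP (Rel C)\<^esub> f = f"
   using f' AB gpd_frob_typing(1)[OF AB(1)] gpd_frob_typing(1)[OF AB(2)] R.Cmp_Ident[of "tmap f"] R.Ident_Cmp[of "tmap f"]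
   by (cases f, simp add: CP_simps)+
  fix g assume g: "g : Arr (CP (Rel C))" "Cod (CP (Rel C)) f = Dom (CP (Rel C)) g"
  obtain D E :: "('o, 'm) igpd" where DE: "internal_groupoid C D" "internal_groupoid C E" "tdom g = gpd_frob C D" "tcod g = gpd_frob C E"
   using CP_Arr_gpd[OF g(1)] by blast
  have DB: "tdom g = gpd_frob C B" using g(2) AB by (simp add: CP_simps)
  note g' = g(1)[unfolded CP_Arr_iff[OF AB(2) DE(2) DB DE(4)]]
  have "g \<cdot>\<^bsub>CP (Rel C)\<^esub> f : Arr (CP (Rel C))"
   using CP_Arr_iff[OF AB(1) DE(2), of "g \<cdot>\<^bsub>CP (Rel C)\<^esub> f"] f' g' AB DE
    respects_inverses_comp[OF AB(1,2) DE(2), of "tmap f" "tmap g"] by (simp add: CP_simps)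
  then show "g \<cdot>\<^bsub>CP (Rel C)\<^esub> f : hom (CP (Rel C)) (Dom (CP (Rel C)) f) (Cod (CP (Rel C)) g)"
   by (simp add: hom_def CP_simps)
  fix h assume h: "h : Arr (CP (Rel C))" "Cod (CP (Rel C)) g = Dom (CP (Rel C)) h"
  obtain H K :: "('o, 'm) igpd" where HK: "internal_groupoid C H" "internal_groupoid C K" "tdom h = gpd_frob C H" "tcod h = gpd_frob C K"
   using CP_Arr_gpd[OF h(1)] by blast
  have "tdom h = gpd_frob C E" using h(2) DE by (simp add: CP_simps)
  note h' = h(1)[unfolded CP_Arr_iff[OF DE(2) HK(2) this HK(4)]]
  show "h \<cdot>\<^bsub>CP (Rel C)\<^esub> g \<cdot>\<^bsub>CP (Rel C)\<^esub> f = (h \<cdot>\<^bsub>CP (Rel C)\<^esub> g) \<cdot>\<^bsub>CP (Rel C)\<^esub> f"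
   using f' g' h' R.Cmp_assoc[of "tmap f" "tmap g" "tmap h"] by (simp add: CP_simps)
 qed
qed

lemma GRel_to_CP_simps:
 "OMap (GRel_to_CP C) = gpd_frob C"
 "AMap (GRel_to_CP C) R = \<lparr>tdom = gpd_frob C (tdom R), tcod = gpd_frob C (tcod R), tmap = tmap R\<rparr>"
 by (simp_all add: GRel_to_CP_def)

theorem is_functor_GRel_to_CP: "is_functor (GRel C) (CP (Rel C)) (GRel_to_CP C)"
 unfolding is_functor_def
proof (intro conjI ballI impI is_category_GRel is_category_CP)
 fix A assume "A : Obj (GRel C)"
 then show "OMap (GRel_to_CP C) A : Obj (CP (Rel C))"
  "AMap (GRel_to_CP C) (Ident (GRel C) A) = Ident (CP (Rel C)) (OMap (GRel_to_CP C) A)"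
  using gpd_frob_frobenius gpd_frob_typing(1) by (simp_all add: GRel_to_CP_simps CP_simps)
next
 fix f assume f: "f : Arr (GRel C)"
 then show "AMap (GRel_to_CP C) f : hom (CP (Rel C)) (OMap (GRel_to_CP C) (Dom (GRel C) f)) (OMap (GRel_to_CP C) (Cod (GRel C) f))"
  using CP_Arr_iff[of "tdom f" "tcod f" "AMap (GRel_to_CP C) f"] by (simp add: GRel_to_CP_simps CP_simps hom_def)
 fix g show "AMap (GRel_to_CP C) (g \<cdot>\<^bsub>GRel C\<^esub> f) = AMap (GRel_to_CP C) g \<cdot>\<^bsub>CP (Rel C)\<^esub> AMap (GRel_to_CP C) f"
  by (simp add: GRel_to_CP_simps CP_simps)
qed

lemma GRel_to_CP_surjective: "F : Obj (CP (Rel C)) ==> \<exists>A\<in>Obj (GRel C). OMap (GRel_to_CP C) A = F"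
 using frobenius_gpd_ex by (force simp: GRel_to_CP_simps CP_simps)

lemma GRel_to_CP_fully_faithful:
 assumes "A : Obj (GRel C)" "B : Obj (GRel C)"
 shows "bij_betw (AMap (GRel_to_CP C)) (hom (GRel C) A B) (hom (CP (Rel C)) (OMap (GRel_to_CP C) A) (OMap (GRel_to_CP C) B))"
proof (rule bij_betw_byWitness[where f' = "\<lambda>f. \<lparr>tdom = A, tcod = B, tmap = tmap f\<rparr>"])
 show "AMap (GRel_to_CP C) ` hom (GRel C) A B \<subseteq> hom (CP (Rel C)) (OMap (GRel_to_CP C) A) (OMap (GRel_to_CP C) B)"
  using is_functor_GRel_to_CP by (auto simp: is_functor_def hom_def)
 show "(\<lambda>f. \<lparr>tdom = A, tcod = B, tmap = tmap f\<rparr>) ` hom (CP (Rel C)) (OMap (GRel_to_CP C) A) (OMap (GRel_to_CP C) B) \<subseteq> hom (GRel C) A B"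
  using assms CP_Arr_iff[of A B] by (auto simp: hom_def CP_simps GRel_to_CP_simps)
qed (auto simp: hom_def CP_simps GRel_to_CP_simps)

theorem GRel_to_CP_equivalence: "is_equivalence (GRel C) (CP (Rel C)) (GRel_to_CP C)"
 using is_functor_GRel_to_CP GRel_to_CP_surjective GRel_to_CP_fully_faithful
 by (rule surjective_fully_faithful_equivalence)

end

end

section \<open>The category of internal groupoids\<close>

context model
begin

definition elt_functor :: "('o, 'm, 'w) icat_scheme => ('o, 'm, 'v) icat_scheme => 'm => 'm => bool" where
 "elt_functor A B f0 f1 \<longleftrightarrow>
   (\<forall>a\<in>N (iArr A). ap (iSrc B) (ap f1 a) = ap f0 (ap (iSrc A) a) \<and> ap (iTgt B) (ap f1 a) = ap f0 (ap (iTgt A) a)) \<and>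
   (\<forall>x\<in>N (iObj A). ap f1 (ap (iUnit A) x) = ap (iUnit B) (ap f0 x)) \<and>
   (\<forall>g\<in>N (iArr A). \<forall>f\<in>N (iArr A). ap (iSrc A) g = ap (iTgt A) f \<longrightarrow>
    ap f1 (mcomp A g f) = mcomp B (ap f1 g) (ap f1 f))"

lemma elt_functorD:
 assumes "elt_functor A B f0 f1"
 shows "a : N (iArr A) ==> ap (iSrc B) (ap f1 a) = ap f0 (ap (iSrc A) a)"
  "a : N (iArr A) ==> ap (iTgt B) (ap f1 a) = ap f0 (ap (iTgt A) a)"
  "x : N (iObj A) ==> ap f1 (ap (iUnit A) x) = ap (iUnit B) (ap f0 x)"
  "[|g : N (iArr A); f : N (iArr A); ap (iSrc A) g = ap (iTgt A) f|] ==>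
   ap f1 (mcomp A g f) = mcomp B (ap f1 g) (ap f1 f)"
 using assms by (simp_all add: elt_functor_def)

lemma elt_functor_inverse:
 assumes A: "internal_groupoid C A" and B: "internal_groupoid C B" and F: "elt_functor A B f0 f1"
  and f: "f0 : Arr C" "Dom C f0 = iObj A" "f1 : Arr C" "Dom C f1 = iArr A" "Cod C f1 = iArr B" and a: "a : N (iArr A)"
 shows "ap f1 (ap (iInv A) a) = ap (iInv B) (ap f1 a)"
proof -
 interpret GA: gpd_elts C N ap A by unfold_locales (rule A)
 interpret GB: gpd_elts C N ap B by unfold_locales (rule B)
 note D = elt_functorD[OF F]
 have "mcomp B (ap f1 (ap (iInv A) a)) (ap f1 a) = ap f1 (mcomp A (ap (iInv A) a) a)"
  using D(4)[of "ap (iInv A) a" a] a by simp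
 also have "\<dots> = ap (iUnit B) (ap f0 (ap (iSrc A) a))" using a D(3) by simp
 also have "\<dots> = ap (iUnit B) (ap (iSrc B) (ap f1 a))" using D(1) a by simp
 finally show ?thesis
  by (intro GB.i_unique[of "ap f1 a" "ap f1 (ap (iInv A) a)"]) (use D a f in simp_all)
qed

lemma internal_functor_elts:
 assumes A: "internal_category C A" and B: "internal_category C B" and F: "internal_functor C A B (f0, f1)"
 shows "elt_functor A B f0 f1"
proof -
 have eqs: "f0 : hom C (iObj A) (iObj B)" "f1 : hom C (iArr A) (iArr B)"
  "iSrc B \<cdot> f1 = f0 \<cdot> iSrc A" "iTgt B \<cdot> f1 = f0 \<cdot> iTgt A" "f1 \<cdot> iUnit A = iUnit B \<cdot> f0"
  "f1 \<cdot> iComp A = icomp C B (f1 \<cdot> cp1 C A) (f1 \<cdot> cp2 C A)"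
  using F unfolding internal_functor_def by auto
 note T = internal_category_typing[OF A] internal_category_typing[OF B]
 have f: "f0 : Arr C" "Dom C f0 = iObj A" "Cod C f0 = iObj B" "f1 : Arr C" "Dom C f1 = iArr A" "Cod C f1 = iArr B"
  using eqs(1,2) by (simp_all add: hom_def)
 show ?thesis unfolding elt_functor_def
 proof (intro conjI ballI impI)
  fix a assume a: "a : N (iArr A)"
  have "ap (iSrc B \<cdot> f1) a = ap (f0 \<cdot> iSrc A) a" "ap (iTgt B \<cdot> f1) a = ap (f0 \<cdot> iTgt A) a"
   unfolding eqs by simp_all
  then show "ap (iSrc B) (ap f1 a) = ap f0 (ap (iSrc A) a)" "ap (iTgt B) (ap f1 a) = ap f0 (ap (iTgt A) a)"
   using T f a by simp_all
 next
  fix x assume x: "x : N (iObj A)"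
  have "ap (f1 \<cdot> iUnit A) x = ap (iUnit B \<cdot> f0) x" unfolding eqs by simp
  then show "ap f1 (ap (iUnit A) x) = ap (iUnit B) (ap f0 x)" using T f x by simp
 next
  fix g k assume gk: "g : N (iArr A)" "k : N (iArr A)" "ap (iSrc A) g = ap (iTgt A) k"
  let ?p = "pb1 C (iSrc A) (iTgt A)" and ?q = "pb2 C (iSrc A) (iTgt A)"
  have pq: "?p : Arr C" "?q : Arr C" "Dom C ?p = pb C (iSrc A) (iTgt A)" "Dom C ?q = pb C (iSrc A) (iTgt A)"
   "Cod C ?p = iArr A" "Cod C ?q = iArr A" using T by simp_all
  have z: "pbe (iSrc A) (iTgt A) g k : N (pb C (iSrc A) (iTgt A))" "ap ?p (pbe (iSrc A) (iTgt A) g k) = g"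
   "ap ?q (pbe (iSrc A) (iTgt A) g k) = k" using gk T by simp_all
  have "iSrc B \<cdot> (f1 \<cdot> ?p) = (iSrc B \<cdot> f1) \<cdot> ?p" using T f pq by (simp add: Cmp_assoc)
  also have "\<dots> = f0 \<cdot> (iSrc A \<cdot> ?p)" unfolding eqs using T f pq by (simp add: Cmp_assoc)
  also have "\<dots> = (f0 \<cdot> iTgt A) \<cdot> ?q" using pb_commutes[of "iSrc A" "iTgt A"] T f pq by (simp add: Cmp_assoc)
  also have "\<dots> = iTgt B \<cdot> (f1 \<cdot> ?q)" unfolding eqs(4)[symmetric] using T f pq by (simp add: Cmp_assoc)
  finally have c: "iSrc B \<cdot> (f1 \<cdot> ?p) = iTgt B \<cdot> (f1 \<cdot> ?q)" .
  have "ap (icomp C B (f1 \<cdot> ?p) (f1 \<cdot> ?q)) (pbe (iSrc A) (iTgt A) g k) =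
    mcomp B (ap (f1 \<cdot> ?p) (pbe (iSrc A) (iTgt A) g k)) (ap (f1 \<cdot> ?q) (pbe (iSrc A) (iTgt A) g k))"
   by (rule ap_icomp[OF _ _ _ _ _ _ _ _ _ _ c]) (simp_all add: T f pq z(1))
  then have "ap (icomp C B (f1 \<cdot> ?p) (f1 \<cdot> ?q)) (pbe (iSrc A) (iTgt A) g k) = mcomp B (ap f1 g) (ap f1 k)"
   using f pq z by simp
  moreover have "ap (f1 \<cdot> iComp A) (pbe (iSrc A) (iTgt A) g k) = ap f1 (mcomp A g k)"
   unfolding mcomp_def using T f z by simp
  ultimately show "ap f1 (mcomp A g k) = mcomp B (ap f1 g) (ap f1 k)" using eqs(6) by (simp add: cp1_def cp2_def)
 qed
qed

end

abbreviation omap :: "('x, 'm \<times> 'm) tarr => 'm" where "omap F \<equiv> fst (tmap F)"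
abbreviation amap :: "('x, 'm \<times> 'm) tarr => 'm" where "amap F \<equiv> snd (tmap F)"

context regular_category
begin

abbreviation Gpd_Cmp (infixr "\<bullet>" 70) where "Gpd_Cmp \<equiv> Cmp (Gpd C)"

lemma icomp_arr:
 assumes A: "internal_category C A" and gf: "g : Arr C" "f : Arr C" "Dom C g = Dom C f" "Cod C g = iArr A" "Cod C f = iArr A"
  and eq: "\<And>N ap x. [|canon N ap; x : N (Dom C f)|] ==> ap (iSrc A) (ap g x) = ap (iTgt A) (ap f x)"
 shows "icomp C A g f : Arr C" "Dom C (icomp C A g f) = Dom C f" "Cod C (icomp C A g f) = iArr A"
  "[|model C (N :: 'o => 'a set) ap; x : N (Dom C f)|] ==> ap (icomp C A g f) x = mcomp_at N ap A (ap g x) (ap f x)"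
proof -
 note T = internal_category_typing[OF A]
 have e: "iSrc A \<cdot> g = iTgt A \<cdot> f"
 proof (rule arr_eqI)
  fix N ap x assume N: "canon N ap" and x: "x : N (Dom C (iTgt A \<cdot> f))"
  interpret model C N ap by fact
  show "ap (iSrc A \<cdot> g) x = ap (iTgt A \<cdot> f) x" using eq[OF N, of x] T gf x by simp
 qed (use T gf in simp_all)
 show "icomp C A g f : Arr C" "Dom C (icomp C A g f) = Dom C f" "Cod C (icomp C A g f) = iArr A"
  unfolding icomp_def using T gf e by simp_all
 assume N: "model C N ap" and x: "x : N (Dom C f)"
 show "ap (icomp C A g f) x = mcomp_at N ap A (ap g x) (ap f x)"
  by (rule model.ap_icomp[OF N]) (use T gf e x in simp_all)
qed

lemma internal_functorI:
 assumes A: "internal_category C A" and B: "internal_category C B"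
  and f: "f0 : Arr C" "Dom C f0 = iObj A" "Cod C f0 = iObj B" "f1 : Arr C" "Dom C f1 = iArr A" "Cod C f1 = iArr B"
  and elts: "\<And>N ap. canon N ap ==> model.elt_functor C N ap A B f0 f1"
 shows "internal_functor C A B (f0, f1)"
proof -
 note T = internal_category_typing[OF A] internal_category_typing[OF B]
 let ?p = "pb1 C (iSrc A) (iTgt A)" and ?q = "pb2 C (iSrc A) (iTgt A)"
 have pq: "?p : Arr C" "?q : Arr C" "Dom C ?p = pb C (iSrc A) (iTgt A)" "Dom C ?q = pb C (iSrc A) (iTgt A)"
   "Cod C ?p = iArr A" "Cod C ?q = iArr A" using T by simp_all
 have "iSrc B \<cdot> f1 = f0 \<cdot> iSrc A"
 proof (rule arr_eqI)
  fix N ap x assume N: "canon N ap" and x: "x : N (Dom C (f0 \<cdot> iSrc A))"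
  interpret model C N ap by fact
  show "ap (iSrc B \<cdot> f1) x = ap (f0 \<cdot> iSrc A) x" using elt_functorD(1)[OF elts[OF N], of x] T f x by simp
 qed (use T f in simp_all)
 moreover have "iTgt B \<cdot> f1 = f0 \<cdot> iTgt A"
 proof (rule arr_eqI)
  fix N ap x assume N: "canon N ap" and x: "x : N (Dom C (f0 \<cdot> iTgt A))"
  interpret model C N ap by fact
  show "ap (iTgt B \<cdot> f1) x = ap (f0 \<cdot> iTgt A) x" using elt_functorD(2)[OF elts[OF N], of x] T f x by simp
 qed (use T f in simp_all)
 moreover have "f1 \<cdot> iUnit A = iUnit B \<cdot> f0"
 proof (rule arr_eqI)
  fix N ap x assume N: "canon N ap" and x: "x : N (Dom C (iUnit B \<cdot> f0))"
  interpret model C N ap by fact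
  show "ap (f1 \<cdot> iUnit A) x = ap (iUnit B \<cdot> f0) x" using elt_functorD(3)[OF elts[OF N], of x] T f x by simp
 qed (use T f in simp_all)
 moreover have "f1 \<cdot> iComp A = icomp C B (f1 \<cdot> ?p) (f1 \<cdot> ?q)"
 proof -
  have st: "ap (iSrc B) (ap (f1 \<cdot> ?p) x) = ap (iTgt B) (ap (f1 \<cdot> ?q) x)"
   if N: "canon N ap" and x: "x : N (Dom C (f1 \<cdot> ?q))" for N ap x
  proof -
   interpret model C N ap by fact
   show ?thesis using elt_functorD(1,2)[OF elts[OF N]] pb_elt_commutes[of "iSrc A" "iTgt A" x] T f pq x by simp
  qed
  have ty: "f1 \<cdot> ?p : Arr C" "f1 \<cdot> ?q : Arr C" "Dom C (f1 \<cdot> ?p) = Dom C (f1 \<cdot> ?q)" "Cod C (f1 \<cdot> ?p) = iArr B" "Cod C (f1 \<cdot> ?q) = iArr B"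
   using f pq by simp_all
  note ic = icomp_arr[OF B ty st]
  show ?thesis
  proof (rule arr_eqI)
   fix N ap x assume N: "canon N ap" and "x : N (Dom C (icomp C B (f1 \<cdot> ?p) (f1 \<cdot> ?q)))"
   interpret model C N ap by fact
   have x: "x : N (Dom C (f1 \<cdot> ?q))" using ic(2) \<open>x : _\<close> by simp
   then have x': "x : N (pb C (iSrc A) (iTgt A))" using f pq by simp
   have e: "ap (iSrc A) (ap ?p x) = ap (iTgt A) (ap ?q x)" by (rule pb_elt_commutes) (use T x' in simp_all)
   have "pbe (iSrc A) (iTgt A) (ap ?p x) (ap ?q x) = x"
    by (rule pb_elt_eq[of "iSrc A" "iTgt A"]) (use T x' e pq in simp_all)
   then have m: "ap (iComp A) x = mcomp A (ap ?p x) (ap ?q x)" unfolding mcomp_def by simp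
   have "ap (icomp C B (f1 \<cdot> ?p) (f1 \<cdot> ?q)) x = mcomp B (ap f1 (ap ?p x)) (ap f1 (ap ?q x))"
    using ic(4)[OF _ _ N x] f pq x' by simp
   also have "\<dots> = ap f1 (mcomp A (ap ?p x) (ap ?q x))"
    using elt_functorD(4)[OF elts[OF N], of "ap ?p x" "ap ?q x"] e x' pq by simp
   finally show "ap (f1 \<cdot> iComp A) x = ap (icomp C B (f1 \<cdot> ?p) (f1 \<cdot> ?q)) x"
    using T f x' m by simp
  qed (use T f ic pq in simp_all)
 qed
 ultimately show ?thesis unfolding internal_functor_def using f by (simp add: hom_def cp1_def cp2_def)
qed

lemma Gpd_simps [simp]:
 "A : Obj (Gpd C) \<longleftrightarrow> internal_groupoid C A" "Dom (Gpd C) = tdom" "Cod (Gpd C) = tcod"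
 "Ident (Gpd C) A = \<lparr>tdom = A, tcod = A, tmap = (Ident C (iObj A), Ident C (iArr A))\<rparr>"
 "Cmp (Gpd C) G F = \<lparr>tdom = tdom F, tcod = tcod G, tmap = (omap G \<cdot> omap F, amap G \<cdot> amap F)\<rparr>"
 by (simp_all add: Gpd_def ifun_ident_def ifun_comp_def)

lemma Gpd_ArrD:
 assumes "F : Arr (Gpd C)"
 shows "internal_groupoid C (tdom F)" "internal_groupoid C (tcod F)"
  "omap F : Arr C" "Dom C (omap F) = iObj (tdom F)" "Cod C (omap F) = iObj (tcod F)"
  "amap F : Arr C" "Dom C (amap F) = iArr (tdom F)" "Cod C (amap F) = iArr (tcod F)"
  "model C N ap ==> model.elt_functor C N ap (tdom F) (tcod F) (omap F) (amap F)"
proof -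
 have F: "internal_groupoid C (tdom F)" "internal_groupoid C (tcod F)" "internal_functor C (tdom F) (tcod F) (tmap F)"
  using assms by (simp_all add: Gpd_def)
 then show "internal_groupoid C (tdom F)" "internal_groupoid C (tcod F)"
  "omap F : Arr C" "Dom C (omap F) = iObj (tdom F)" "Cod C (omap F) = iObj (tcod F)"
  "amap F : Arr C" "Dom C (amap F) = iArr (tdom F)" "Cod C (amap F) = iArr (tcod F)"
  by (auto simp: internal_functor_def hom_def split: prod.splits)
 assume "model C N ap"
 then interpret model C N ap .
 show "elt_functor (tdom F) (tcod F) (omap F) (amap F)"
  using F by (intro internal_functor_elts) simp_all
qed

lemma Gpd_ArrI:
 assumes A: "internal_groupoid C (tdom F)" and B: "internal_groupoid C (tcod F)"
  and f: "omap F : Arr C" "Dom C (omap F) = iObj (tdom F)" "Cod C (omap F) = iObj (tcod F)"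
  "amap F : Arr C" "Dom C (amap F) = iArr (tdom F)" "Cod C (amap F) = iArr (tcod F)"
  and elts: "\<And>N ap. canon N ap ==> model.elt_functor C N ap (tdom F) (tcod F) (omap F) (amap F)"
 shows "F : Arr (Gpd C)"
proof -
 have "internal_functor C (tdom F) (tcod F) (omap F, amap F)"
  using A B f elts by (intro internal_functorI) simp_all
 moreover have "amap F \<cdot> iInv (tdom F) = iInv (tcod F) \<cdot> amap F"
 proof (rule arr_eqI)
  fix N ap x assume N: "canon N ap" and x: "x : N (Dom C (iInv (tcod F) \<cdot> amap F))"
  interpret model C N ap by fact
  show "ap (amap F \<cdot> iInv (tdom F)) x = ap (iInv (tcod F) \<cdot> amap F) x"
   using elt_functor_inverse[OF A B elts[OF N], of x] A B f x by simp
 qed (use A B f in simp_all)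
 ultimately show ?thesis using A B by (simp add: Gpd_def)
qed

text \<open>A functor is determined by its action on arrows because an object is the source of its identity.\<close>

lemma Gpd_arr_eqI:
 assumes F: "F : Arr (Gpd C)" and G: "G : Arr (Gpd C)" and eq: "tdom F = tdom G" "tcod F = tcod G"
  and elts: "\<And>N ap x. [|canon N ap; x : N (iArr (tdom G))|] ==> ap (amap F) x = ap (amap G) x"
 shows "F = G"
proof -
 note DF = Gpd_ArrD[OF F] and DG = Gpd_ArrD[OF G]
 have "amap F = amap G"
  by (rule arr_eqI) (use DF DG eq elts in simp_all)
 moreover have "omap F = omap G"
 proof (rule arr_eqI)
  fix N ap x assume N: "canon N ap" and "x : N (Dom C (omap G))"
  then have x: "x : N (iObj (tdom G))" using DG by simp
  interpret model C N ap by fact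
  interpret GB: cat_elts C N ap "tcod G" by unfold_locales (use DG in simp)
  have "ap (iUnit (tcod G)) (ap (omap F) x) = ap (iUnit (tcod G)) (ap (omap G) x)"
   using elt_functorD(3)[OF DF(9)[OF N], of x] elt_functorD(3)[OF DG(9)[OF N], of x] x eq calculation by simp
  then have "ap (iSrc (tcod G)) (ap (iUnit (tcod G)) (ap (omap F) x)) = ap (iSrc (tcod G)) (ap (iUnit (tcod G)) (ap (omap G) x))"
   by simp
  then show "ap (omap F) x = ap (omap G) x" using x DF DG eq by simp
 qed (use DF DG eq in simp_all)
 ultimately show ?thesis using eq by (cases F; cases G; cases "tmap F"; cases "tmap G") simp
qed

theorem is_category_Gpd: "is_category (Gpd C)"
 unfolding is_category_def
proof (intro conjI ballI impI)
 fix A assume "A : Obj (Gpd C)"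
 then have A: "internal_groupoid C A" by simp
 have "Ident (Gpd C) A : Arr (Gpd C)"
 proof (rule Gpd_ArrI)
  fix N ap assume N: "canon N ap"
  interpret model C N ap by fact
  interpret GA: cat_elts C N ap A by unfold_locales (use A in simp)
  show "elt_functor (tdom (Ident (Gpd C) A)) (tcod (Ident (Gpd C) A)) (omap (Ident (Gpd C) A)) (amap (Ident (Gpd C) A))"
   using A by (simp add: elt_functor_def)
 qed (use A in simp_all)
 then show "Ident (Gpd C) A : hom (Gpd C) A A" by (simp add: hom_def)
next
 fix F assume F: "F : Arr (Gpd C)"
 note D = Gpd_ArrD[OF F]
 show "Dom (Gpd C) F : Obj (Gpd C)" "Cod (Gpd C) F : Obj (Gpd C)" using D by simp_all
 show "F \<bullet> Ident (Gpd C) (Dom (Gpd C) F) = F" "Ident (Gpd C) (Cod (Gpd C) F) \<bullet> F = F"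
  using D by (cases F, cases "tmap F", simp)+
 fix G assume G: "G : Arr (Gpd C)" "Cod (Gpd C) F = Dom (Gpd C) G"
 note E = Gpd_ArrD[OF G(1)]
 have "G \<bullet> F : Arr (Gpd C)"
 proof (rule Gpd_ArrI)
  fix N ap assume N: "canon N ap"
  interpret model C N ap by fact
  let ?A = "tdom F"
  interpret GA: cat_elts C N ap ?A by unfold_locales (use D in simp)
  note f = elt_functorD[OF D(9)[OF N]] and g = elt_functorD[OF E(9)[OF N]]
  show "elt_functor (tdom (G \<bullet> F)) (tcod (G \<bullet> F)) (omap (G \<bullet> F)) (amap (G \<bullet> F))"
   unfolding elt_functor_def using D(1-8) E(1-8) G(2) f g by simp
 qed (use D(1-8) E(1-8) G(2) in simp_all)
 then show "G \<bullet> F : hom (Gpd C) (Dom (Gpd C) F) (Cod (Gpd C) G)" by (simp add: hom_def)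
 fix H assume H: "H : Arr (Gpd C)" "Cod (Gpd C) G = Dom (Gpd C) H"
 show "H \<bullet> G \<bullet> F = (H \<bullet> G) \<bullet> F"
  using D(1-8) E(1-8) Gpd_ArrD(1-8)[OF H(1)] G(2) H(2) by (simp add: Cmp_assoc)
qed

section \<open>Finite limits of internal groupoids\<close>

lemma terminal_gpd:
 obtains T :: "('o, 'm) igpd" where "is_terminal (Gpd C) T" "iObj T = one C" "iArr T = one C"
proof -
 let ?i = "Ident C (one C)"
 define T :: "('o, 'm) igpd" where "T = \<lparr>iObj = one C, iArr = one C, iSrc = ?i, iTgt = ?i, iUnit = ?i,
   iComp = bang C (pb C ?i ?i), iInv = ?i\<rparr>"
 have T: "iObj T = one C" "iArr T = one C" "iSrc T = ?i" "iTgt T = ?i" "iUnit T = ?i"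
   "iComp T = bang C (pb C ?i ?i)" "iInv T = ?i" by (simp_all add: T_def)
 have el: "model.elt_gpd C N ap T" if N: "canon N ap" for N ap
 proof -
  interpret model C N ap by fact
  have c: "mcomp T g f : N (one C)" if gf: "g : N (one C)" "f : N (one C)" for g f
  proof -
   have "ap ?i g = ap ?i f" using one_eq[OF gf] by simp
   then show ?thesis unfolding mcomp_def T by (intro ap_in_cod) (use gf in simp_all)
  qed
  show ?thesis unfolding T
   by unfold_locales (use c in "auto intro!: one_eq")
 qed
 have "internal_category C T"
 proof (rule internal_categoryI)
  fix N ap assume "canon N ap"
  then show "model.elt_cat C N ap T" using el set_gpd.axioms(1) by blast
 qed (simp_all add: T)
 then have IT: "internal_groupoid C T"
 proof (rule internal_groupoidI)
  fix N ap assume "canon N ap"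
  then show "model.elt_gpd C N ap T" by (rule el)
 qed (simp_all add: T)
 have "is_terminal (Gpd C) T"
  unfolding is_terminal_def
 proof (intro conjI ballI)
  fix A assume "A : Obj (Gpd C)"
  then have A: "internal_groupoid C A" by simp
  let ?F = "\<lparr>tdom = A, tcod = T, tmap = (bang C (iObj A), bang C (iArr A))\<rparr>"
  have "?F : Arr (Gpd C)"
  proof (rule Gpd_ArrI)
   fix N ap assume N: "canon N ap"
   interpret model C N ap by fact
   interpret GA: cat_elts C N ap A by unfold_locales (use A in simp)
   interpret GT: set_gpd "N (iObj T)" "N (iArr T)" "ap (iSrc T)" "ap (iTgt T)" "ap (iUnit T)" "mcomp T" "ap (iInv T)"
    by (rule el[OF N])
   have m: "mcomp T g f : N (one C)" if "g : N (one C)" "f : N (one C)" for g f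
    using GT.c_in[of g f] one_eq[of g f] that T by simp
   show "elt_functor (tdom ?F) (tcod ?F) (omap ?F) (amap ?F)"
    unfolding elt_functor_def using A T by (auto intro!: one_eq m)
  qed (use A IT T in simp_all)
  moreover have "G = ?F" if G: "G : hom (Gpd C) A T" for G
  proof (rule Gpd_arr_eqI)
   fix N ap x assume N: "canon N ap" and x: "x : N (iArr (tdom ?F))"
   interpret model C N ap by fact
   show "ap (amap G) x = ap (amap ?F) x"
    by (rule one_eq) (use G Gpd_ArrD[of G] x A T in "auto simp: hom_def")
  qed (use G calculation in "auto simp: hom_def")
  ultimately show "\<exists>!F. F : hom (Gpd C) A T" by (intro ex1I[of _ ?F]) (auto simp: hom_def)
 qed (use IT in simp)
 then show ?thesis using that T by blast
qed

lemma pullback_lift_ex: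
 assumes fg: "f : Arr C" "g : Arr C" "Cod C f = Cod C g"
  and ab: "a : Arr C" "b : Arr C" "Dom C b = Dom C a" "Cod C a = Dom C f" "Cod C b = Dom C g"
  and eq: "\<And>N ap x. [|canon N ap; x : N (Dom C a)|] ==> ap f (ap a x) = ap g (ap b x)"
 shows "\<exists>h. h : Arr C \<and> Dom C h = Dom C a \<and> Cod C h = pb C f g \<and> (\<forall>N ap x. canon N ap \<longrightarrow> x : N (Dom C a) \<longrightarrow>
  ap h x : N (pb C f g) \<and> ap (pb1 C f g) (ap h x) = ap a x \<and> ap (pb2 C f g) (ap h x) = ap b x)"
proof -
 have "f \<cdot> a = g \<cdot> b"
 proof (rule arr_eqI)
  fix N ap x assume N: "canon N ap" and x: "x : N (Dom C (g \<cdot> b))"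
  interpret model C N ap by fact
  show "ap (f \<cdot> a) x = ap (g \<cdot> b) x" using eq[OF N, of x] fg ab x by simp
 qed (use fg ab in simp_all)
 note h = pb_pairing_simps[OF fg ab(1,2) ab(3)[symmetric] ab(4,5) this]
 let ?h = "pb_pairing C f g a b"
 have "ap ?h x : N (pb C f g) \<and> ap (pb1 C f g) (ap ?h x) = ap a x \<and> ap (pb2 C f g) (ap ?h x) = ap b x"
  if N: "canon N ap" and x: "x : N (Dom C a)" for N ap x
 proof -
  interpret model C N ap by fact
  have "ap (pb1 C f g \<cdot> ?h) x = ap a x" "ap (pb2 C f g \<cdot> ?h) x = ap b x" unfolding h by simp_all
  then show ?thesis using h(1-3) fg x by simp
 qed
 then show ?thesis using h(1-3) by (intro exI[of _ ?h]) simp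
qed

text \<open>Pullbacks of internal groupoids are computed on objects and on arrows.\<close>

lemma gpd_pullback_ex:
 assumes F: "F : Arr (Gpd C)" and G: "G : Arr (Gpd C)" and cod: "tcod F = tcod G"
 obtains P p q where "is_pullback (Gpd C) F G P p q"
  "iArr P = pb C (amap F) (amap G)" "amap p = pb1 C (amap F) (amap G)" "amap q = pb2 C (amap F) (amap G)"
proof -
 let ?A = "tdom F" and ?B = "tdom G" and ?D = "tcod G"
 let ?f0 = "omap F" and ?f1 = "amap F" and ?g0 = "omap G" and ?g1 = "amap G"
 note A = Gpd_ArrD(1)[OF F] and B = Gpd_ArrD(1)[OF G] and D = Gpd_ArrD(2)[OF G]
 note TA = internal_category_typing[OF internal_groupoid_category[OF A]] internal_groupoid_typing[OF A]
 note TB = internal_category_typing[OF internal_groupoid_category[OF B]] internal_groupoid_typing[OF B]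
 note f = Gpd_ArrD(3-8)[OF F, unfolded cod] and g = Gpd_ArrD(3-8)[OF G]
 have fe: "model.elt_functor C N ap ?A ?D ?f0 ?f1" "model.elt_functor C N ap ?B ?D ?g0 ?g1" if "canon N ap" for N ap
  using Gpd_ArrD(9)[OF F that] Gpd_ArrD(9)[OF G that] cod by simp_all
 let ?P0 = "pb C ?f0 ?g0" and ?p0 = "pb1 C ?f0 ?g0" and ?q0 = "pb2 C ?f0 ?g0"
 let ?P1 = "pb C ?f1 ?g1" and ?p1 = "pb1 C ?f1 ?g1" and ?q1 = "pb2 C ?f1 ?g1"
 have fg0: "?f0 : Arr C" "?g0 : Arr C" "Cod C ?f0 = Cod C ?g0" and fg1: "?f1 : Arr C" "?g1 : Arr C" "Cod C ?f1 = Cod C ?g1"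
  using f g by simp_all
 note p0 = pb_simps[OF fg0, unfolded f g] and p1 = pb_simps[OF fg1, unfolded f g]
 have com0: "ap ?f0 (ap ?p0 x) = ap ?g0 (ap ?q0 x)" if "canon N ap" "x : N ?P0" for N ap x
  by (rule model.pb_elt_commutes[OF that(1) fg0 that(2)])
 have com1: "ap ?f1 (ap ?p1 x) = ap ?g1 (ap ?q1 x)" if "canon N ap" "x : N ?P1" for N ap x
  by (rule model.pb_elt_commutes[OF that(1) fg1 that(2)])
 have pin: "ap ?p0 x : N (iObj ?A) \<and> ap ?q0 x : N (iObj ?B)" if "canon N ap" "x : N ?P0" for N ap x
  using model.ap_in_cod[OF that(1)] p0 that by simp
 have qin: "ap ?p1 x : N (iArr ?A) \<and> ap ?q1 x : N (iArr ?B)" if "canon N ap" "x : N ?P1" for N ap x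
  using model.ap_in_cod[OF that(1)] p1 that by simp
 have eq0: "x = y" if "canon N ap" "x : N ?P0" "y : N ?P0" "ap ?p0 x = ap ?p0 y" "ap ?q0 x = ap ?q0 y" for N ap x y
  using model.pb_elt_eq[OF that(1) fg0 that(2-5)] .
 have eq1: "x = y" if "canon N ap" "x : N ?P1" "y : N ?P1" "ap ?p1 x = ap ?p1 y" "ap ?q1 x = ap ?q1 y" for N ap x y
  using model.pb_elt_eq[OF that(1) fg1 that(2-5)] .
 note lift0 = pullback_lift_ex[OF fg0, unfolded f g] and lift1 = pullback_lift_ex[OF fg1, unfolded f g]
 have fs: "ap ?f0 (ap (iSrc ?A \<cdot> ?p1) x) = ap ?g0 (ap (iSrc ?B \<cdot> ?q1) x) \<and> ap ?f0 (ap (iTgt ?A \<cdot> ?p1) x) = ap ?g0 (ap (iTgt ?B \<cdot> ?q1) x) \<and>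
   ap ?f1 (ap (iInv ?A \<cdot> ?p1) x) = ap ?g1 (ap (iInv ?B \<cdot> ?q1) x)"
  if N: "canon N ap" and x: "x : N ?P1" for N ap x
 proof -
  interpret model C N ap by fact
  note c = com1[OF N x] and i = qin[OF N x]
  show ?thesis
   using x p1 TA TB i elt_functorD(1,2)[OF fe(1)[OF N], of "ap ?p1 x"] elt_functorD(1,2)[OF fe(2)[OF N], of "ap ?q1 x"]
    elt_functor_inverse[OF A D fe(1)[OF N] f(1,2,4-6), of "ap ?p1 x"] elt_functor_inverse[OF B D fe(2)[OF N] g(1,2,4-6), of "ap ?q1 x"] c
   by simp
 qed
 have fu: "ap ?f1 (ap (iUnit ?A \<cdot> ?p0) x) = ap ?g1 (ap (iUnit ?B \<cdot> ?q0) x)"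
  if N: "canon N ap" and x: "x : N ?P0" for N ap x
 proof -
  interpret model C N ap by fact
  show ?thesis
   using x p0 TA TB pin[OF N x] elt_functorD(3)[OF fe(1)[OF N], of "ap ?p0 x"] elt_functorD(3)[OF fe(2)[OF N], of "ap ?q0 x"] com0[OF N x]
   by simp
 qed
 obtain s where s: "s : Arr C" "Dom C s = ?P1" "Cod C s = ?P0" and S: "\<And>N ap x. [|canon N ap; x : N ?P1|] ==>
   ap s x : N ?P0 \<and> ap ?p0 (ap s x) = ap (iSrc ?A \<cdot> ?p1) x \<and> ap ?q0 (ap s x) = ap (iSrc ?B \<cdot> ?q1) x"
  using lift0[of "iSrc ?A \<cdot> ?p1" "iSrc ?B \<cdot> ?q1"] TA TB p1 fs by auto
 obtain t where t: "t : Arr C" "Dom C t = ?P1" "Cod C t = ?P0" and T: "\<And>N ap x. [|canon N ap; x : N ?P1|] ==>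
   ap t x : N ?P0 \<and> ap ?p0 (ap t x) = ap (iTgt ?A \<cdot> ?p1) x \<and> ap ?q0 (ap t x) = ap (iTgt ?B \<cdot> ?q1) x"
  using lift0[of "iTgt ?A \<cdot> ?p1" "iTgt ?B \<cdot> ?q1"] TA TB p1 fs by auto
 obtain i where i: "i : Arr C" "Dom C i = ?P1" "Cod C i = ?P1" and I: "\<And>N ap x. [|canon N ap; x : N ?P1|] ==>
   ap i x : N ?P1 \<and> ap ?p1 (ap i x) = ap (iInv ?A \<cdot> ?p1) x \<and> ap ?q1 (ap i x) = ap (iInv ?B \<cdot> ?q1) x"
  using lift1[of "iInv ?A \<cdot> ?p1" "iInv ?B \<cdot> ?q1"] TA TB p1 fs by auto
 obtain u where u: "u : Arr C" "Dom C u = ?P0" "Cod C u = ?P1" and U: "\<And>N ap x. [|canon N ap; x : N ?P0|] ==>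
   ap u x : N ?P1 \<and> ap ?p1 (ap u x) = ap (iUnit ?A \<cdot> ?p0) x \<and> ap ?q1 (ap u x) = ap (iUnit ?B \<cdot> ?q0) x"
  using lift1[of "iUnit ?A \<cdot> ?p0" "iUnit ?B \<cdot> ?q0"] TA TB p0 fu by auto
 have st: "s : Arr C" "t : Arr C" "Cod C s = Cod C t" using s t by simp_all
 let ?M = "pb C s t" and ?pr = "pb1 C s t" and ?qr = "pb2 C s t"
 note M = pb_simps[OF st, unfolded s t]
 have cst: "ap (iSrc ?A) (ap ?p1 g) = ap (iTgt ?A) (ap ?p1 h) \<and> ap (iSrc ?B) (ap ?q1 g) = ap (iTgt ?B) (ap ?q1 h)"
  if N: "canon N ap" and gh: "g : N ?P1" "h : N ?P1" "ap s g = ap t h" for N ap g h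
 proof -
  interpret model C N ap by fact
  show ?thesis using S[OF N gh(1)] T[OF N gh(2)] gh TA TB p1 by simp
 qed
 have cM: "ap (iSrc ?A) (ap (?p1 \<cdot> ?pr) x) = ap (iTgt ?A) (ap (?p1 \<cdot> ?qr) x) \<and> ap (iSrc ?B) (ap (?q1 \<cdot> ?pr) x) = ap (iTgt ?B) (ap (?q1 \<cdot> ?qr) x)"
  if N: "canon N ap" and x: "x : N ?M" for N ap x
 proof -
  interpret model C N ap by fact
  show ?thesis using cst[OF N, of "ap ?pr x" "ap ?qr x"] pb_elt_commutes[OF st x] M p1 x by simp
 qed
 let ?ca = "icomp C ?A (?p1 \<cdot> ?pr) (?p1 \<cdot> ?qr)" and ?cb = "icomp C ?B (?q1 \<cdot> ?pr) (?q1 \<cdot> ?qr)"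
 have ca: "?ca : Arr C" "Dom C ?ca = ?M" "Cod C ?ca = iArr ?A"
  "[|canon N ap; x : N ?M|] ==> ap ?ca x = mcomp_at N ap ?A (ap (?p1 \<cdot> ?pr) x) (ap (?p1 \<cdot> ?qr) x)" for N ap x
  using icomp_arr[OF internal_groupoid_category[OF A], of "?p1 \<cdot> ?pr" "?p1 \<cdot> ?qr"] cM p1 M by simp_all
 have cb: "?cb : Arr C" "Dom C ?cb = ?M" "Cod C ?cb = iArr ?B"
  "[|canon N ap; x : N ?M|] ==> ap ?cb x = mcomp_at N ap ?B (ap (?q1 \<cdot> ?pr) x) (ap (?q1 \<cdot> ?qr) x)" for N ap x
  using icomp_arr[OF internal_groupoid_category[OF B], of "?q1 \<cdot> ?pr" "?q1 \<cdot> ?qr"] cM p1 M by simp_all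
 have fm: "ap ?f1 (ap ?ca x) = ap ?g1 (ap ?cb x)"
  if N: "canon N ap" and x: "x : N ?M" for N ap x
 proof -
  interpret model C N ap by fact
  have gx: "ap ?pr x : N ?P1" "ap ?qr x : N ?P1" using x M by simp_all
  have eA: "ap ?f1 (mcomp ?A (ap ?p1 (ap ?pr x)) (ap ?p1 (ap ?qr x))) = mcomp ?D (ap ?f1 (ap ?p1 (ap ?pr x))) (ap ?f1 (ap ?p1 (ap ?qr x)))"
   by (rule elt_functorD(4)[OF fe(1)[OF N]]) (use cM[OF N x] qin[OF N gx(1)] qin[OF N gx(2)] x M p1 in simp_all)
  have eB: "ap ?g1 (mcomp ?B (ap ?q1 (ap ?pr x)) (ap ?q1 (ap ?qr x))) = mcomp ?D (ap ?g1 (ap ?q1 (ap ?pr x))) (ap ?g1 (ap ?q1 (ap ?qr x)))"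
   by (rule elt_functorD(4)[OF fe(2)[OF N]]) (use cM[OF N x] qin[OF N gx(1)] qin[OF N gx(2)] x M p1 in simp_all)
  show ?thesis using ca(4)[OF N x] cb(4)[OF N x] eA eB com1[OF N gx(1)] com1[OF N gx(2)] x M p1 by simp
 qed
 obtain m where m: "m : Arr C" "Dom C m = ?M" "Cod C m = ?P1" and Mm: "\<And>N ap x. [|canon N ap; x : N ?M|] ==>
   ap m x : N ?P1 \<and> ap ?p1 (ap m x) = ap ?ca x \<and> ap ?q1 (ap m x) = ap ?cb x"
  using lift1[of ?ca ?cb] ca(1-3) cb(1-3) fm by auto
 define P :: "('o, 'm) igpd" where "P = \<lparr>iObj = ?P0, iArr = ?P1, iSrc = s, iTgt = t, iUnit = u, iComp = m, iInv = i\<rparr>"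
 have P: "iObj P = ?P0" "iArr P = ?P1" "iSrc P = s" "iTgt P = t" "iUnit P = u" "iComp P = m" "iInv P = i" by (simp_all add: P_def)
 have pm: "mcomp_at N ap P g h : N ?P1 \<and> ap ?p1 (mcomp_at N ap P g h) = mcomp_at N ap ?A (ap ?p1 g) (ap ?p1 h) \<and>
   ap ?q1 (mcomp_at N ap P g h) = mcomp_at N ap ?B (ap ?q1 g) (ap ?q1 h)"
  if N: "canon N ap" and gh: "g : N ?P1" "h : N ?P1" "ap s g = ap t h" for N ap g h
 proof -
  interpret model C N ap by fact
  have z: "pbe s t g h : N ?M" "ap ?pr (pbe s t g h) = g" "ap ?qr (pbe s t g h) = h" using gh s t by simp_all
  show ?thesis unfolding mcomp_def[of P] P using Mm[OF N z(1)] ca(4)[OF N z(1)] cb(4)[OF N z(1)] z p1 M by simp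
 qed
 have el: "model.elt_gpd C N ap P" if N: "canon N ap" for N ap
 proof -
  interpret model C N ap by fact
  interpret GA: gpd_elts C N ap ?A by unfold_locales (rule A)
  interpret GB: gpd_elts C N ap ?B by unfold_locales (rule B)
  have S': "ap s x : N ?P0" "ap ?p0 (ap s x) = ap (iSrc ?A) (ap ?p1 x)" "ap ?q0 (ap s x) = ap (iSrc ?B) (ap ?q1 x)"
   "ap t x : N ?P0" "ap ?p0 (ap t x) = ap (iTgt ?A) (ap ?p1 x)" "ap ?q0 (ap t x) = ap (iTgt ?B) (ap ?q1 x)"
   "ap i x : N ?P1" "ap ?p1 (ap i x) = ap (iInv ?A) (ap ?p1 x)" "ap ?q1 (ap i x) = ap (iInv ?B) (ap ?q1 x)"
   "ap ?p1 x : N (iArr ?A)" "ap ?q1 x : N (iArr ?B)"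
   if x: "x : N ?P1" for x
  proof -
   show "ap s x : N ?P0" "ap ?p0 (ap s x) = ap (iSrc ?A) (ap ?p1 x)" "ap ?q0 (ap s x) = ap (iSrc ?B) (ap ?q1 x)"
    using S[OF N x] x TA TB p1 by simp_all
   show "ap t x : N ?P0" "ap ?p0 (ap t x) = ap (iTgt ?A) (ap ?p1 x)" "ap ?q0 (ap t x) = ap (iTgt ?B) (ap ?q1 x)"
    using T[OF N x] x TA TB p1 by simp_all
   show "ap i x : N ?P1" "ap ?p1 (ap i x) = ap (iInv ?A) (ap ?p1 x)" "ap ?q1 (ap i x) = ap (iInv ?B) (ap ?q1 x)"
    using I[OF N x] x TA TB p1 by simp_all
   show "ap ?p1 x : N (iArr ?A)" "ap ?q1 x : N (iArr ?B)" using qin[OF N x] by simp_all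
  qed
  have U': "ap u x : N ?P1" "ap ?p1 (ap u x) = ap (iUnit ?A) (ap ?p0 x)" "ap ?q1 (ap u x) = ap (iUnit ?B) (ap ?q0 x)"
   "ap ?p0 x : N (iObj ?A)" "ap ?q0 x : N (iObj ?B)"
   if "x : N ?P0" for x using U[OF N that] that TA TB p0 by simp_all
  have e: "ap (iSrc ?A) (ap ?p1 g) = ap (iTgt ?A) (ap ?p1 h)" "ap (iSrc ?B) (ap ?q1 g) = ap (iTgt ?B) (ap ?q1 h)"
   if "g : N ?P1" "h : N ?P1" "ap s g = ap t h" for g h using cst[OF N that] by simp_all
  have pm': "mcomp P g h : N ?P1" "ap ?p1 (mcomp P g h) = mcomp ?A (ap ?p1 g) (ap ?p1 h)" "ap ?q1 (mcomp P g h) = mcomp ?B (ap ?q1 g) (ap ?q1 h)"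
   if "g : N ?P1" "h : N ?P1" "ap s g = ap t h" for g h using pm[OF N that] by simp_all
  have su: "ap s (ap u x) = x" "ap t (ap u x) = x" if "x : N ?P0" for x
   by (rule eq0[OF N]; use that in "simp add: S' U'")+
  have si: "ap s (ap i a) = ap t a" "ap t (ap i a) = ap s a" if "a : N ?P1" for a
   by (rule eq0[OF N]; use that in "simp add: S'")+
  have sc: "ap s (mcomp P g h) = ap s h" "ap t (mcomp P g h) = ap t g" if gh: "g : N ?P1" "h : N ?P1" "ap s g = ap t h" for g h
   by (rule eq0[OF N]; use gh e[OF gh] pm'[OF gh] in "simp add: S'")+
  show ?thesis unfolding P
  proof
   fix a assume a: "a : N ?P1"
   show "mcomp P a (ap u (ap s a)) = a"
    by (rule eq1[OF N]) (use a su pm'[of a "ap u (ap s a)"] in "simp_all add: S' U'")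
   show "mcomp P (ap u (ap t a)) a = a"
    by (rule eq1[OF N]) (use a su pm'[of "ap u (ap t a)" a] in "simp_all add: S' U'")
   show "mcomp P (ap i a) a = ap u (ap s a)"
    by (rule eq1[OF N]) (use a si pm'[of "ap i a" a] in "simp_all add: S' U'")
   show "mcomp P a (ap i a) = ap u (ap t a)"
    by (rule eq1[OF N]) (use a si pm'[of a "ap i a"] in "simp_all add: S' U'")
  next
   fix k g h assume a: "k : N ?P1" "g : N ?P1" "h : N ?P1" "ap s k = ap t g" "ap s g = ap t h"
   show "mcomp P (mcomp P k g) h = mcomp P k (mcomp P g h)"
    by (rule eq1[OF N])
     (use a e[OF a(1,2,4)] e[OF a(2,3,5)] pm'[OF a(1,2,4)] pm'[OF a(2,3,5)] sc[OF a(1,2,4)] sc[OF a(2,3,5)]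
      pm'[of "mcomp P k g" h] pm'[of k "mcomp P g h"] in "simp_all add: S' GA.c_assoc GB.c_assoc")
  qed (use S' U' su si sc pm' in auto)
 qed
 have ICP: "internal_category C P"
 proof (rule internal_categoryI)
  fix N ap assume "canon N ap"
  then show "model.elt_cat C N ap P" using el set_gpd.axioms(1) by blast
 qed (use s t u m in "simp_all add: P")
 then have IP: "internal_groupoid C P" by (rule internal_groupoidI) (use i el in "simp_all add: P")
 define p where "p = \<lparr>tdom = P, tcod = ?A, tmap = (?p0, ?p1)\<rparr>"
 define q where "q = \<lparr>tdom = P, tcod = ?B, tmap = (?q0, ?q1)\<rparr>"
 have p: "tdom p = P" "tcod p = ?A" "tmap p = (?p0, ?p1)" and q: "tdom q = P" "tcod q = ?B" "tmap q = (?q0, ?q1)"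
  by (simp_all add: p_def q_def)
 have pa: "p : Arr (Gpd C)"
 proof (rule Gpd_ArrI)
  fix N ap assume N: "canon N ap"
  interpret model C N ap by fact
  show "elt_functor (tdom p) (tcod p) (omap p) (amap p)"
   unfolding elt_functor_def p P using S[OF N] T[OF N] U[OF N] pm[OF N] TA p0 p1 by (simp add: P)
 qed (use IP A TA p p0 p1 in "simp_all add: P")
 have qa: "q : Arr (Gpd C)"
 proof (rule Gpd_ArrI)
  fix N ap assume N: "canon N ap"
  interpret model C N ap by fact
  show "elt_functor (tdom q) (tcod q) (omap q) (amap q)"
   unfolding elt_functor_def q P using S[OF N] T[OF N] U[OF N] pm[OF N] TB p0 p1 by (simp add: P)
 qed (use IP B TB q p0 p1 in "simp_all add: P")
 interpret GG: category "Gpd C" by unfold_locales (rule is_category_Gpd)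
 have PB: "is_pullback (Gpd C) F G P p q"
  unfolding is_pullback_def
 proof (intro conjI allI ballI impI)
  show "F \<bullet> p = G \<bullet> q"
  proof (rule Gpd_arr_eqI)
   fix N ap x assume N: "canon N ap" and x: "x : N (iArr (tdom (G \<bullet> q)))"
   interpret model C N ap by fact
   show "ap (amap (F \<bullet> p)) x = ap (amap (G \<bullet> q)) x"
    using com1[OF N] x p q P p1 f g by simp
  qed (use GG.Cmp_Arr[OF pa F] GG.Cmp_Arr[OF qa G] p q cod in simp_all)
  fix X a b assume "a : hom (Gpd C) X (Dom (Gpd C) F)" "b : hom (Gpd C) X (Dom (Gpd C) G)" and ab: "F \<bullet> a = G \<bullet> b"
  then have a: "a : Arr (Gpd C)" "tdom a = X" "tcod a = ?A" and b: "b : Arr (Gpd C)" "tdom b = X" "tcod b = ?B" by (auto simp: hom_def)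
  note aD = Gpd_ArrD[OF a(1), unfolded a(2,3)] and bD = Gpd_ArrD[OF b(1), unfolded b(2,3)]
  have ab0: "?f0 \<cdot> omap a = ?g0 \<cdot> omap b" and ab1: "?f1 \<cdot> amap a = ?g1 \<cdot> amap b" using ab by simp_all
  have e0: "ap ?f0 (ap (omap a) x) = ap ?g0 (ap (omap b) x)" if N: "canon N ap" and x: "x : N (iObj X)" for N ap x
  proof -
   interpret model C N ap by fact
   have "ap (?f0 \<cdot> omap a) x = ap (?g0 \<cdot> omap b) x" using ab0 by simp
   then show ?thesis using x aD(3-5) bD(3-5) f g by simp
  qed
  have e1: "ap ?f1 (ap (amap a) x) = ap ?g1 (ap (amap b) x)" if N: "canon N ap" and x: "x : N (iArr X)" for N ap x
  proof -
   interpret model C N ap by fact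
   have "ap (?f1 \<cdot> amap a) x = ap (?g1 \<cdot> amap b) x" using ab1 by simp
   then show ?thesis using x aD(6-8) bD(6-8) f g by simp
  qed
  obtain h0 where h0: "h0 : Arr C" "Dom C h0 = iObj X" "Cod C h0 = ?P0" and H0: "\<And>N ap x. [|canon N ap; x : N (iObj X)|] ==>
   ap h0 x : N ?P0 \<and> ap ?p0 (ap h0 x) = ap (omap a) x \<and> ap ?q0 (ap h0 x) = ap (omap b) x"
   using lift0[of "omap a" "omap b"] aD(3-5) bD(3-5) e0 by auto
  obtain h1 where h1: "h1 : Arr C" "Dom C h1 = iArr X" "Cod C h1 = ?P1" and H1: "\<And>N ap x. [|canon N ap; x : N (iArr X)|] ==>
   ap h1 x : N ?P1 \<and> ap ?p1 (ap h1 x) = ap (amap a) x \<and> ap ?q1 (ap h1 x) = ap (amap b) x"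
   using lift1[of "amap a" "amap b"] aD(6-8) bD(6-8) e1 by auto
  define h where "h = \<lparr>tdom = X, tcod = P, tmap = (h0, h1)\<rparr>"
  have h: "tdom h = X" "tcod h = P" "tmap h = (h0, h1)" by (simp_all add: h_def)
  have ha: "h : Arr (Gpd C)"
  proof (rule Gpd_ArrI)
   fix N ap assume N: "canon N ap"
   interpret model C N ap by fact
   interpret GX: gpd_elts C N ap X by unfold_locales (rule aD(1))
   note fa = elt_functorD[OF aD(9)[OF N]] and fb = elt_functorD[OF bD(9)[OF N]]
   have S': "ap s x : N ?P0" "ap ?p0 (ap s x) = ap (iSrc ?A) (ap ?p1 x)" "ap ?q0 (ap s x) = ap (iSrc ?B) (ap ?q1 x)"
    "ap t x : N ?P0" "ap ?p0 (ap t x) = ap (iTgt ?A) (ap ?p1 x)" "ap ?q0 (ap t x) = ap (iTgt ?B) (ap ?q1 x)"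
    if "x : N ?P1" for x using S[OF N that] T[OF N that] that TA TB p1 by simp_all
   have U': "ap u x : N ?P1" "ap ?p1 (ap u x) = ap (iUnit ?A) (ap ?p0 x)" "ap ?q1 (ap u x) = ap (iUnit ?B) (ap ?q0 x)"
    if "x : N ?P0" for x using U[OF N that] that TA TB p0 by simp_all
   have st': "ap s (ap h1 x) = ap h0 (ap (iSrc X) x)" "ap t (ap h1 x) = ap h0 (ap (iTgt X) x)" if "x : N (iArr X)" for x
    by (rule eq0[OF N]; use that H1[OF N that] H0[OF N GX.s_in[OF that]] H0[OF N GX.t_in[OF that]]
     fa(1,2)[OF that] fb(1,2)[OF that] in "simp add: S'")+
   show "elt_functor (tdom h) (tcod h) (omap h) (amap h)"
    unfolding elt_functor_def h P fst_conv snd_conv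
   proof (intro conjI ballI impI)
    fix x assume x: "x : N (iObj X)"
    show "ap h1 (ap (iUnit X) x) = ap u (ap h0 x)"
     by (rule eq1[OF N]) (use x H1[OF N GX.u_in[OF x]] H0[OF N x] fa(3)[OF x] fb(3)[OF x] in "simp_all add: U'")
   next
    fix g k assume gk: "g : N (iArr X)" "k : N (iArr X)" "ap (iSrc X) g = ap (iTgt X) k"
    have "ap s (ap h1 g) = ap t (ap h1 k)" using st' gk by simp
    note c = pm[OF N _ _ this]
    show "ap h1 (mcomp X g k) = mcomp P (ap h1 g) (ap h1 k)"
     by (rule eq1[OF N]) (use gk c H1[OF N gk(1)] H1[OF N gk(2)] H1[OF N GX.c_in[OF gk]] fa(4)[OF gk] fb(4)[OF gk] in simp_all)
   qed (use st' in simp_all)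
  qed (use h h0 h1 aD(1) IP in "simp_all add: P")
  have "p \<bullet> h = a"
  proof (rule Gpd_arr_eqI)
   fix N ap x assume N: "canon N ap" and x: "x : N (iArr (tdom a))"
   interpret model C N ap by fact
   show "ap (amap (p \<bullet> h)) x = ap (amap a) x" using H1[OF N, of x] x a h p h1 p1 by simp
  qed (use GG.Cmp_Arr[OF ha pa] a h p in simp_all)
  moreover have "q \<bullet> h = b"
  proof (rule Gpd_arr_eqI)
   fix N ap x assume N: "canon N ap" and x: "x : N (iArr (tdom b))"
   interpret model C N ap by fact
   show "ap (amap (q \<bullet> h)) x = ap (amap b) x" using H1[OF N, of x] x b h q h1 p1 by simp
  qed (use GG.Cmp_Arr[OF ha qa] b h q in simp_all)
  moreover have "k = h" if k: "k : hom (Gpd C) X P" "p \<bullet> k = a" "q \<bullet> k = b" for k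
  proof (rule Gpd_arr_eqI)
   fix N ap x assume N: "canon N ap" and "x : N (iArr (tdom h))"
   then have x: "x : N (iArr X)" using h by simp
   interpret model C N ap by fact
   have kD: "amap k : Arr C" "Dom C (amap k) = iArr X" "Cod C (amap k) = ?P1"
    using Gpd_ArrD(6-8)[of k] k(1) P by (auto simp: hom_def)
   have "?p1 \<cdot> amap k = amap a" "?q1 \<cdot> amap k = amap b" unfolding k(2,3)[symmetric] using p q by simp_all
   then have "ap ?p1 (ap (amap k) x) = ap (amap a) x" "ap ?q1 (ap (amap k) x) = ap (amap b) x"
    using kD x p1 ap_Cmp[of "amap k" ?p1 x] ap_Cmp[of "amap k" ?q1 x] by simp_all
   note pk = this
   show "ap (amap k) x = ap (amap h) x"
    by (rule eq1[OF N]) (use pk H1[OF N x] kD x h in simp_all)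
  qed (use k ha h in "simp_all add: hom_def")
  moreover have "h : hom (Gpd C) X P" using ha h by (simp add: hom_def)
  ultimately show "\<exists>!h. h : hom (Gpd C) X P \<and> p \<bullet> h = a \<and> q \<bullet> h = b"
   by (metis (no_types, lifting))
 qed (use F G cod IP pa qa p q in "simp_all add: hom_def")
 show ?thesis using that[OF PB] P p q by simp
qed

lemma has_finite_limits_Gpd: "has_finite_limits (Gpd C)"
 unfolding has_finite_limits_def
proof (intro conjI ballI impI)
 show "\<exists>T. is_terminal (Gpd C) T" using terminal_gpd by metis
 fix F G assume "F : Arr (Gpd C)" "G : Arr (Gpd C)" "Cod (Gpd C) F = Cod (Gpd C) G"
 then show "\<exists>P p q. is_pullback (Gpd C) F G P p q" using gpd_pullback_ex[of F G] by (metis Gpd_simps(3))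
qed

lemma (in model) gpd_pullback_elts:
 assumes P: "is_pullback (Gpd C) F G P p q" and xy: "x : N (iArr (tdom F))" "y : N (iArr (tdom G))"
  and e: "ap (amap F) x = ap (amap G) y"
 shows "\<exists>!z. z : N (iArr P) \<and> ap (amap p) z = x \<and> ap (amap q) z = y"
proof -
 interpret GG: category "Gpd C" by unfold_locales (rule is_category_Gpd)
 note pf = GG.pullback_facts[OF P]
 obtain Q p' q' where Q: "is_pullback (Gpd C) F G Q p' q'" "iArr Q = pb C (amap F) (amap G)"
  "amap p' = pb1 C (amap F) (amap G)" "amap q' = pb2 C (amap F) (amap G)"
  using gpd_pullback_ex[of F G] pf by auto
 note qf = GG.pullback_facts[OF Q(1)]
 obtain h where h: "h : hom (Gpd C) (Dom (Gpd C) p') P" "p \<bullet> h = p'" "q \<bullet> h = q'"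
  using GG.pullback_ex1[OF P, of p' q'] qf by auto
 obtain k where k: "k : hom (Gpd C) (Dom (Gpd C) p) Q" "p' \<bullet> k = p" "q' \<bullet> k = q"
  using GG.pullback_ex1[OF Q(1), of p q] pf by auto
 have hk: "h \<bullet> k = Ident (Gpd C) P"
 proof -
  have "\<exists>!l. l : hom (Gpd C) (Dom (Gpd C) p) P \<and> p \<bullet> l = p \<and> q \<bullet> l = q"
   by (rule GG.pullback_ex1[OF P]) (use pf in auto)
  moreover have "p \<bullet> (h \<bullet> k) = p" "q \<bullet> (h \<bullet> k) = q"
   using GG.Cmp_assoc[of k h p] GG.Cmp_assoc[of k h q] h k pf qf by (simp_all add: hom_def del: Gpd_simps(4,5))
  moreover have "h \<bullet> k : hom (Gpd C) (Dom (Gpd C) p) P" using GG.Cmp_Arr[of k h] h(1) k(1) qf pf by (auto simp: hom_def)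
  moreover have "Ident (Gpd C) P : hom (Gpd C) (Dom (Gpd C) p) P" "p \<bullet> Ident (Gpd C) P = p" "q \<bullet> Ident (Gpd C) P = q"
   using GG.Ident_Arr[of P] GG.Cmp_Ident[of p P] GG.Cmp_Ident[of q P] pf by (simp_all add: hom_def del: Gpd_simps(4,5))
    (simp_all)
  ultimately show ?thesis by metis
 qed
 have hA: "h : Arr (Gpd C)" "tdom h = Q" "tcod h = P" and kA: "k : Arr (Gpd C)" "tdom k = P" "tcod k = Q"
  using h(1) k(1) pf(7) qf(7) by (auto simp: hom_def)
 let ?f = "amap F" and ?g = "amap G"
 let ?h = "amap h" and ?k = "amap k" and ?p = "amap p" and ?q = "amap q"
 note hD = Gpd_ArrD(6-8)[OF hA(1), unfolded hA] and kD = Gpd_ArrD(6-8)[OF kA(1), unfolded kA]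
 have FA: "F : Arr (Gpd C)" "G : Arr (Gpd C)" "p : Arr (Gpd C)" "q : Arr (Gpd C)" using pf by auto
 note ty = Gpd_ArrD(6-8)[OF FA(1)] Gpd_ArrD(6-8)[OF FA(2)] Gpd_ArrD(6-8)[OF FA(3)] Gpd_ArrD(6-8)[OF FA(4)]
 have c: "?f : Arr C" "?g : Arr C" "Cod C ?f = Cod C ?g" using ty pf(3) by simp_all
 have dp: "tdom p = P" "tdom q = P" "tcod p = tdom F" "tcod q = tdom G" using pf by auto
 have ph: "?p \<cdot> ?h = pb1 C ?f ?g" "?q \<cdot> ?h = pb2 C ?f ?g" "?h \<cdot> ?k = Ident C (iArr P)"
  "pb1 C ?f ?g \<cdot> ?k = ?p" "pb2 C ?f ?g \<cdot> ?k = ?q"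
  using arg_cong[OF h(2), of "\<lambda>F. amap F"] arg_cong[OF h(3), of "\<lambda>F. amap F"] Q(3,4)
   arg_cong[OF k(2), of "\<lambda>F. amap F"] arg_cong[OF k(3), of "\<lambda>F. amap F"] arg_cong[OF hk, of "\<lambda>F. amap F"]
  by simp_all
 let ?z = "ap ?h (pbe ?f ?g x y)"
 have z0: "pbe ?f ?g x y : N (iArr Q)" using c ty xy e Q by simp
 have "ap (?p \<cdot> ?h) (pbe ?f ?g x y) = x" "ap (?q \<cdot> ?h) (pbe ?f ?g x y) = y" unfolding ph using c ty xy e by simp_all
 then have z: "?z : N (iArr P)" "ap ?p ?z = x" "ap ?q ?z = y" using z0 hD ty dp by simp_all
 have "w = ?z" if w: "w : N (iArr P)" "ap ?p w = x" "ap ?q w = y" for w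
 proof -
  have "ap ?k w = pbe ?f ?g x y"
  proof (rule pb_elt_eq[OF c])
   have "ap (pb1 C ?f ?g \<cdot> ?k) w = x" "ap (pb2 C ?f ?g \<cdot> ?k) w = y" unfolding ph using w by simp_all
   then show "ap (pb1 C ?f ?g) (ap ?k w) = ap (pb1 C ?f ?g) (pbe ?f ?g x y)" "ap (pb2 C ?f ?g) (ap ?k w) = ap (pb2 C ?f ?g) (pbe ?f ?g x y)"
    using w kD c Q(2) ty xy e by simp_all
  qed (use w kD Q(2) z0 in simp_all)
  moreover have "ap (?h \<cdot> ?k) w = ap ?h (ap ?k w)" by (rule ap_Cmp[OF kD(1) hD(1)]) (simp_all only: w(1) hD kD)
  moreover have "ap (?h \<cdot> ?k) w = w" unfolding ph(3) by (rule ap_Ident[OF _ w(1)]) (use pf(4) in simp)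
  ultimately show ?thesis by (simp only:)
 qed
 then show ?thesis using z by (metis (no_types, lifting))
qed

end

section \<open>Internal groupoids in Mal'cev categories\<close>

context regular_category
begin

lemma preimage_ex:
 assumes r: "is_mono C r" and f: "f : Arr C" "Cod C f = Cod C r"
 obtains j where "is_mono C j" "j : Arr C" "Cod C j = Dom C f"
  "\<And>N ap z. [|canon N ap; z : N (Dom C f)|] ==> z : img_at N ap j \<longleftrightarrow> ap f z : img_at N ap r"
proof -
 have P: "is_pullback C r f (pb C r f) (pb1 C r f) (pb2 C r f)" using is_mono_Arr[OF r] f by (intro pb_pullback) simp_all
 note pf = pullback_facts[OF P]
 show ?thesis
  by (rule that[of "pb2 C r f"]) (use pullback_mono[OF P r] pf model.preimage_img[OF _ P] in simp_all)
qed

text \<open>Composition of graph morphisms: the pairs \<open>(g, f)\<close> whose composite is preserved form a span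
 that contains \<open>(id, f)\<close>, \<open>(id, id)\<close> and \<open>(g, id)\<close>.\<close>

lemma malcev_composable_pairs:
 assumes mal: "malcev C" and A: "internal_category C A"
  and j: "is_mono C j" "j : Arr C" "Cod C j = pb C (iSrc A) (iTgt A)"
  and N: "canon N ap"
  and gf: "g : N (iArr A)" "f : N (iArr A)" "ap (iSrc A) g = ap (iTgt A) f"
  and 1: "model.pbe C N ap (iSrc A) (iTgt A) (ap (iUnit A) (ap (iTgt A) f)) f : img_at N ap j"
  and 2: "model.pbe C N ap (iSrc A) (iTgt A) (ap (iUnit A) (ap (iTgt A) f)) (ap (iUnit A) (ap (iTgt A) f)) : img_at N ap j"
  and 3: "model.pbe C N ap (iSrc A) (iTgt A) g (ap (iUnit A) (ap (iTgt A) f)) : img_at N ap j"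
 shows "model.pbe C N ap (iSrc A) (iTgt A) g f : img_at N ap j"
proof -
 interpret model C N ap by fact
 interpret GA: cat_elts C N ap A by unfold_locales (rule A)
 note T = internal_category_typing[OF A]
 let ?s = "iSrc A" and ?t = "iTgt A" and ?x = "ap (iUnit A) (ap (iTgt A) f)"
 let ?p = "pb1 C ?s ?t" and ?q = "pb2 C ?s ?t"
 have st: "?s : Arr C" "?t : Arr C" "Cod C ?s = Cod C ?t" using T by simp_all
 note pq = pb_simps[OF st]
 have x: "?x : N (iArr A)" "ap ?s ?x = ap ?t f" "ap ?t ?x = ap ?t f" using gf by simp_all
 obtain z1 where z1: "z1 : N (Dom C j)" "ap j z1 = pbe ?s ?t ?x f" using 1 by (auto simp: img_def)
 obtain z2 where z2: "z2 : N (Dom C j)" "ap j z2 = pbe ?s ?t ?x ?x" using 2 by (auto simp: img_def)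
 obtain z3 where z3: "z3 : N (Dom C j)" "ap j z3 = pbe ?s ?t g ?x" using 3 by (auto simp: img_def)
 have v: "ap ?p (pbe ?s ?t ?x f) = ?x" "ap ?q (pbe ?s ?t ?x f) = f" "ap ?p (pbe ?s ?t ?x ?x) = ?x" "ap ?q (pbe ?s ?t ?x ?x) = ?x"
  "ap ?p (pbe ?s ?t g ?x) = g" "ap ?q (pbe ?s ?t g ?x) = ?x"
  using T x gf by simp_all
 have w: "ap (?p \<cdot> j) z = ap ?p (ap j z)" "ap (?q \<cdot> j) z = ap ?q (ap j z)" if "z : N (Dom C j)" for z
  using that j pq by simp_all
 have "\<exists>z\<in>N (Dom C (?p \<cdot> j)). ap (?q \<cdot> j) z = ap (?q \<cdot> j) z1 \<and> ap (?p \<cdot> j) z = ap (?p \<cdot> j) z3"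
  by (rule malcev_difunctional[OF mal _ _ _ N, of _ _ z1 z2 z3])
   (use j pq z1 z2 z3 w v in simp_all)
 then obtain z where z: "z : N (Dom C j)" "ap ?q (ap j z) = f" "ap ?p (ap j z) = g"
  using w z1 z3 v j pq by auto
 have "ap j z = pbe ?s ?t g f"
  by (rule pb_elt_eq[OF st]) (use z j gf T in simp_all)
 then show ?thesis using z(1) by (auto simp: img_def)
qed

text \<open>The composable pairs whose composite is preserved form a subobject as in the previous lemma.\<close>

lemma malcev_graph_morphism:
 assumes mal: "malcev C" and A: "internal_category C A" and B: "internal_category C B"
  and f: "f0 : Arr C" "Dom C f0 = iObj A" "Cod C f0 = iObj B" "f1 : Arr C" "Dom C f1 = iArr A" "Cod C f1 = iArr B"
  and gr: "\<And>N ap a. [|canon N ap; a : N (iArr A)|] ==>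
    ap (iSrc B) (ap f1 a) = ap f0 (ap (iSrc A) a) \<and> ap (iTgt B) (ap f1 a) = ap f0 (ap (iTgt A) a)"
   "\<And>N ap x. [|canon N ap; x : N (iObj A)|] ==> ap f1 (ap (iUnit A) x) = ap (iUnit B) (ap f0 x)"
  and N: "canon N ap"
 shows "model.elt_functor C N ap A B f0 f1"
proof -
 note TA = internal_category_typing[OF A] and TB = internal_category_typing[OF B]
 let ?s = "iSrc A" and ?t = "iTgt A"
 let ?p = "pb1 C ?s ?t" and ?q = "pb2 C ?s ?t"
 have st: "?s : Arr C" "?t : Arr C" "Cod C ?s = Cod C ?t" using TA by simp_all
 note pq = pb_simps[OF st]
 have c: "ap (iSrc B) (ap (f1 \<cdot> ?p) x) = ap (iTgt B) (ap (f1 \<cdot> ?q) x)"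
  if N: "canon N ap" and x: "x : N (Dom C (f1 \<cdot> ?q))" for N ap x
 proof -
  interpret model C N ap by fact
  have x: "x : N (pb C ?s ?t)" using x f pq TA by simp
  have i: "ap ?p x : N (iArr A)" "ap ?q x : N (iArr A)" using x pq TA by simp_all
  show ?thesis using gr(1)[OF N i(1)] gr(1)[OF N i(2)] pb_elt_commutes[OF st x] x f pq TA by simp
 qed
 have ty: "f1 \<cdot> ?p : Arr C" "f1 \<cdot> ?q : Arr C" "Dom C (f1 \<cdot> ?p) = Dom C (f1 \<cdot> ?q)" "Cod C (f1 \<cdot> ?p) = iArr B" "Cod C (f1 \<cdot> ?q) = iArr B"
   "Dom C (f1 \<cdot> ?q) = pb C ?s ?t"
  using f pq TA by simp_all
 let ?c = "icomp C B (f1 \<cdot> ?p) (f1 \<cdot> ?q)"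
 have ic: "?c : Arr C" "Dom C ?c = pb C ?s ?t" "Cod C ?c = iArr B"
  using icomp_arr(1-3)[OF B ty(1-5) c] ty(6) by auto
 have ic4: "ap ?c x = mcomp_at N ap B (ap (f1 \<cdot> ?p) x) (ap (f1 \<cdot> ?q) x)"
  if "canon N ap" "x : N (pb C ?s ?t)" for N ap x
  by (rule icomp_arr(4)[OF B ty(1-5) c that(1)]) (use that ty(6) in simp_all)
 obtain j where j: "is_mono C j" "j : Arr C" "Cod C j = pb C ?s ?t"
  and J: "\<And>N ap z. [|canon N ap; z : N (pb C ?s ?t)|] ==> z : img_at N ap j \<longleftrightarrow> ap (f1 \<cdot> iComp A) z = ap ?c z"
 proof (rule equalizer_ex[of "f1 \<cdot> iComp A" ?c])
  fix j assume "is_mono C j" "j : Arr C" "Cod C j = Dom C ?c"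
   "\<And>N ap z. [|canon N ap; z : N (Dom C ?c)|] ==> z : img_at N ap j \<longleftrightarrow> ap (f1 \<cdot> iComp A) z = ap ?c z"
  then show ?thesis using that[of j] ic(2) by simp
 qed (use f TA ic in simp_all)
 interpret model C N ap by fact
 interpret GA: cat_elts C N ap A by unfold_locales (rule A)
 interpret GB: cat_elts C N ap B by unfold_locales (rule B)
 have mem: "pbe ?s ?t g k : img j \<longleftrightarrow> ap f1 (mcomp A g k) = mcomp B (ap f1 g) (ap f1 k)"
  if gk: "g : N (iArr A)" "k : N (iArr A)" "ap ?s g = ap ?t k" for g k
 proof -
  have z: "pbe ?s ?t g k : N (pb C ?s ?t)" "ap ?p (pbe ?s ?t g k) = g" "ap ?q (pbe ?s ?t g k) = k" using gk TA by simp_all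
  have "ap (f1 \<cdot> iComp A) (pbe ?s ?t g k) = ap f1 (mcomp A g k)" unfolding mcomp_def using z(1) f TA by simp
  moreover have "ap ?c (pbe ?s ?t g k) = mcomp B (ap f1 g) (ap f1 k)" using ic4[OF N z(1)] z f pq TA by simp
  ultimately show ?thesis using J[OF N z(1)] by simp
 qed
 have "ap f1 (mcomp A g k) = mcomp B (ap f1 g) (ap f1 k)"
  if gk: "g : N (iArr A)" "k : N (iArr A)" "ap ?s g = ap ?t k" for g k
 proof -
  let ?x = "ap (iUnit A) (ap ?t k)"
  have x: "?x : N (iArr A)" "ap ?s ?x = ap ?t k" "ap ?t ?x = ap ?t k" using gk by simp_all
  have fx: "ap f1 ?x = ap (iUnit B) (ap f0 (ap ?t k))" using gr(2)[OF N, of "ap ?t k"] gk by simp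
  have fin: "ap f1 a : N (iArr B)" if "a : N (iArr A)" for a using that f by simp
  have 1: "mcomp B (ap f1 ?x) (ap f1 k) = ap f1 k"
   using GB.c_u_left[OF fin[OF gk(2)]] gr(1)[OF N gk(2)] fx by simp
  have 3: "mcomp B (ap f1 g) (ap f1 ?x) = ap f1 g"
   using GB.c_u_right[OF fin[OF gk(1)]] gr(1)[OF N gk(1)] fx gk(3) by simp
  have 2: "mcomp B (ap f1 ?x) (ap f1 ?x) = ap f1 ?x"
   using GB.c_u_left[OF fin[OF x(1)]] gr(1)[OF N x(1)] fx x by simp
  have "mcomp A ?x k = k" "mcomp A ?x ?x = ?x" "mcomp A g ?x = g"
   using GA.c_u_left[OF gk(2)] GA.c_u_left[OF x(1)] x GA.c_u_right[OF gk(1)] gk(3) by simp_all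
  then have "pbe ?s ?t g k : img j"
   using mem[of ?x k] mem[of ?x ?x] mem[of g ?x] x gk 1 2 3
   by (intro malcev_composable_pairs[OF mal A j N gk]) simp_all
  then show ?thesis using mem[OF gk] by simp
 qed
 then show ?thesis using gr[OF N] by (simp add: elt_functor_def)
qed

text \<open>A reflexive subgraph of an internal category is a subcategory, by the same argument.\<close>

lemma malcev_subgraph:
 assumes mal: "malcev C" and A: "internal_category C A" and r: "is_mono C r" "Cod C r = iArr A"
  and cl: "\<And>N ap a. [|canon N ap; a : img_at N ap r|] ==>
    ap (iUnit A) (ap (iSrc A) a) : img_at N ap r \<and> ap (iUnit A) (ap (iTgt A) a) : img_at N ap r"
  and N: "canon N ap"
  and gf: "g : img_at N ap r" "f : img_at N ap r" "ap (iSrc A) g = ap (iTgt A) f"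
 shows "mcomp_at N ap A g f : img_at N ap r"
proof -
 note T = internal_category_typing[OF A] and rA = is_mono_Arr[OF r(1)]
 let ?s = "iSrc A" and ?t = "iTgt A"
 let ?p = "pb1 C ?s ?t" and ?q = "pb2 C ?s ?t"
 have st: "?s : Arr C" "?t : Arr C" "Cod C ?s = Cod C ?t" using T by simp_all
 note pq = pb_simps[OF st]
 obtain j1 where j1: "is_mono C j1" "j1 : Arr C" "Cod C j1 = pb C ?s ?t" and
  J1: "\<And>N ap z. [|canon N ap; z : N (pb C ?s ?t)|] ==> z : img_at N ap j1 \<longleftrightarrow> ap ?p z : img_at N ap r"
  using preimage_ex[OF r(1), of ?p] pq r T by (metis (no_types, lifting))
 obtain j2 where j2: "is_mono C j2" "j2 : Arr C" "Cod C j2 = pb C ?s ?t" and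
  J2: "\<And>N ap z. [|canon N ap; z : N (pb C ?s ?t)|] ==> z : img_at N ap j2 \<longleftrightarrow> ap ?q z : img_at N ap r"
  using preimage_ex[OF r(1), of ?q] pq r T by (metis (no_types, lifting))
 obtain j3 where j3: "is_mono C j3" "j3 : Arr C" "Cod C j3 = pb C ?s ?t" and
  J3: "\<And>N ap z. [|canon N ap; z : N (pb C ?s ?t)|] ==> z : img_at N ap j3 \<longleftrightarrow> ap (iComp A) z : img_at N ap r"
  using preimage_ex[OF r(1), of "iComp A"] r T by (metis (no_types, lifting))
 have inter: "\<exists>k. is_mono C k \<and> k : Arr C \<and> Cod C k = Cod C n \<and> (\<forall>N ap. canon N ap \<longrightarrow>
   img_at N ap k = img_at N ap m \<inter> img_at N ap n)"
  if "is_mono C m" "is_mono C n" "Cod C m = Cod C n" for m n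
 proof -
  have P: "is_pullback C m n (pb C m n) (pb1 C m n) (pb2 C m n)" using that is_mono_Arr by (intro pb_pullback) simp_all
  note pf = pullback_facts[OF P]
  have "is_mono C (m \<cdot> pb1 C m n)"
   using mono_Cmp[OF that(1) pullback_mono[OF is_pullback_swap[OF P] that(2)]] pf by simp
  moreover have "\<forall>N ap. canon N ap \<longrightarrow>
    img_at N ap (m \<cdot> pb1 C m n) = img_at N ap m \<inter> img_at N ap n"
   using model.inter_img[OF _ P] by blast
  moreover have "m \<cdot> pb1 C m n : Arr C" "Cod C (m \<cdot> pb1 C m n) = Cod C n"
   using pb_simps[of m n] that(3) is_mono_Arr[OF that(1)] is_mono_Arr[OF that(2)] by simp_all
  ultimately show ?thesis by blast
 qed
 obtain k where k: "is_mono C k" "k : Arr C" "Cod C k = pb C ?s ?t" and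
  K: "\<And>N ap. canon N ap ==> img_at N ap k = img_at N ap j1 \<inter> img_at N ap j2"
  using inter[OF j1(1) j2(1)] j1 j2 by auto
 obtain j where j: "is_mono C j" "j : Arr C" "Cod C j = pb C ?s ?t" and
  J: "\<And>N ap. canon N ap ==> img_at N ap j = img_at N ap k \<inter> img_at N ap j3"
  using inter[OF k(1) j3(1)] k j3 by auto
 interpret model C N ap by fact
 interpret GA: cat_elts C N ap A by unfold_locales (rule A)
 have mem: "pbe ?s ?t g f : img j \<longleftrightarrow> g : img r \<and> f : img r \<and> mcomp A g f : img r"
  if "g : N (iArr A)" "f : N (iArr A)" "ap ?s g = ap ?t f" for g f
 proof -
  have z: "pbe ?s ?t g f : N (pb C ?s ?t)" "ap ?p (pbe ?s ?t g f) = g" "ap ?q (pbe ?s ?t g f) = f" using that T by simp_all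
  show ?thesis using J[OF N] K[OF N] J1[OF N z(1)] J2[OF N z(1)] J3[OF N z(1)] z by (auto simp: mcomp_def)
 qed
 have sub: "a : N (iArr A)" if "a : img r" for a using that r rA by (auto simp: img_def)
 note gf' = sub[OF gf(1)] sub[OF gf(2)] gf(3)
 let ?x = "ap (iUnit A) (ap ?t f)"
 have x: "?x : N (iArr A)" "ap ?s ?x = ap ?t f" "ap ?t ?x = ap ?t f" "?x : img r" using gf' cl[OF N gf(2)] by simp_all
 have m: "mcomp A ?x f = f" "mcomp A ?x ?x = ?x" "mcomp A g ?x = g"
  using GA.c_u_left[OF gf'(2)] GA.c_u_left[OF x(1)] x GA.c_u_right[OF gf'(1)] gf'(3) by simp_all
 have "pbe ?s ?t g f : img j"
  using mem[of ?x f] mem[of ?x ?x] mem[of g ?x] x gf gf' m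
  by (intro malcev_composable_pairs[OF mal A j N gf']) simp_all
 then show ?thesis using mem[OF gf'] by simp
qed

text \<open>Every arrow \<open>a\<close> of an internal category has a left inverse: the span \<open>(h, f) \<mapsto> (f, h f)\<close>
 contains the pairs \<open>(a, a)\<close>, \<open>(id, a)\<close> and \<open>(id, id)\<close>, hence \<open>(a, id)\<close>.\<close>

lemma malcev_category_groupoid:
 assumes mal: "malcev C" and A: "internal_category C A"
 shows "\<exists>i. i : Arr C \<and> Dom C i = iArr A \<and> Cod C i = iArr A \<and> (\<forall>N ap. canon N ap \<longrightarrow>
  set_gpd (N (iObj A)) (N (iArr A)) (ap (iSrc A)) (ap (iTgt A)) (ap (iUnit A)) (mcomp_at N ap A) (ap i))"
proof -
 note T = internal_category_typing[OF A]
 let ?s = "iSrc A" and ?t = "iTgt A" and ?u = "iUnit A" and ?m = "iComp A" and ?X = "iArr A"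
 let ?p = "pb1 C ?s ?t" and ?q = "pb2 C ?s ?t"
 have st: "?s : Arr C" "?t : Arr C" "Cod C ?s = Cod C ?t" using T by simp_all
 note pq = pb_simps[OF st]
 have linv: "\<exists>b\<in>N ?X. ap ?s b = ap ?t a \<and> mcomp_at N ap A b a = ap ?u (ap ?s a)"
  if N: "canon N ap" and a: "a : N ?X" for N ap a
 proof -
  interpret model C N ap by fact
  interpret GA: cat_elts C N ap A by unfold_locales (rule A)
  let ?ut = "ap ?u (ap ?t a)" and ?us = "ap ?u (ap ?s a)"
  let ?z1 = "pbe ?s ?t ?ut a" and ?z2 = "pbe ?s ?t a ?us" and ?z3 = "pbe ?s ?t ?us ?us"
  have z: "?z1 : N (pb C ?s ?t)" "?z2 : N (pb C ?s ?t)" "?z3 : N (pb C ?s ?t)"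
   "ap ?q ?z1 = a" "ap ?q ?z2 = ?us" "ap ?q ?z3 = ?us" using T a by simp_all
  have m: "ap ?m ?z1 = a" "ap ?m ?z2 = a" "ap ?m ?z3 = ?us"
   using GA.c_u_left[OF a] GA.c_u_right[OF a] GA.c_u_right[of ?us] a by (simp_all add: mcomp_def)
  have qm: "?q : Arr C" "?m : Arr C" "Dom C ?q = Dom C ?m" "Dom C ?m = pb C ?s ?t" using T pq by simp_all
  obtain z where z': "z : N (pb C ?s ?t)" "ap ?q z = a" "ap ?m z = ?us"
   using malcev_difunctional[OF mal qm(1-3) N, of ?z1 ?z2 ?z3] z m unfolding qm(4) by auto
  have e: "ap ?s (ap ?p z) = ap ?t a" using pb_elt_commutes[OF st z'(1)] z' by simp
  have pz: "ap ?p z : N ?X" using z' pq T by simp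
  have "pbe ?s ?t (ap ?p z) a = z"
   by (rule pb_elt_eq[OF st]) (use T z' e pz a in simp_all)
  then show ?thesis using z' e pz by (intro bexI[of _ "ap ?p z"]) (simp_all add: mcomp_def)
 qed
 have inv: "\<exists>!b. b : N ?X \<and> ap ?s b = ap ?t a \<and> mcomp_at N ap A b a = ap ?u (ap ?s a)"
   "[|b : N ?X; ap ?s b = ap ?t a; mcomp_at N ap A b a = ap ?u (ap ?s a)|] ==> ap ?t b = ap ?s a \<and> mcomp_at N ap A a b = ap ?u (ap ?t a)"
  if N: "canon N ap" and a: "a : N ?X" for N ap a b
 proof -
  interpret model C N ap by fact
  interpret GA: cat_elts C N ap A by unfold_locales (rule A)
  have two: "ap ?t b = ap ?s a \<and> mcomp A a b = ap ?u (ap ?t a)" if b: "b : N ?X" "ap ?s b = ap ?t a" "mcomp A b a = ap ?u (ap ?s a)" for b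
  proof -
   have tb: "ap ?t b = ap ?s a" using GA.t_c[OF b(1) a b(2)] b(3) a by simp
   obtain c where c: "c : N ?X" "ap ?s c = ap ?t b" "mcomp A c b = ap ?u (ap ?s b)" using linv[OF N b(1)] by blast
   have "c = mcomp A c (mcomp A b a)" using GA.c_u_right[OF c(1)] c(2) tb b(3) by simp
   also have "\<dots> = mcomp A (mcomp A c b) a" using GA.c_assoc[OF c(1) b(1) a] c b by simp
   also have "\<dots> = a" using GA.c_u_left[OF a] c(3) b(2) by simp
   finally show ?thesis using c(3) tb b(2) by simp
  qed
  have uniq: "b = d" if b: "b : N ?X" "ap ?s b = ap ?t a" "mcomp A b a = ap ?u (ap ?s a)" and d: "d : N ?X" "ap ?s d = ap ?t a" "mcomp A d a = ap ?u (ap ?s a)" for b d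
  proof -
   note td = two[OF d] and tb = two[OF b]
   have "b = mcomp A b (mcomp A a d)" using GA.c_u_right[OF b(1)] td b(2) by simp
   also have "\<dots> = mcomp A (mcomp A b a) d" using GA.c_assoc[OF b(1) a d(1)] b td by simp
   also have "\<dots> = d" using GA.c_u_left[OF d(1)] b(3) td by simp
   finally show ?thesis .
  qed
  show "\<exists>!b. b : N ?X \<and> ap ?s b = ap ?t a \<and> mcomp A b a = ap ?u (ap ?s a)"
   using linv[OF N a] uniq by blast
  show "[|b : N ?X; ap ?s b = ap ?t a; mcomp A b a = ap ?u (ap ?s a)|] ==> ap ?t b = ap ?s a \<and> mcomp A a b = ap ?u (ap ?t a)"
   by (rule two)
 qed
 define R where "R = rel_comp C (graph_rel C ?m) (rel_dagger C (graph_rel C (pairing C ?p ?q)))"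
 have R: "is_relation C R" "tdom R = prd C ?X ?X" "tcod R = ?X" using T pq by (simp_all add: R_def)
 have rel: "rel_at N ap R (pp_at N ap ?X ?X b a) c \<longleftrightarrow> ap ?s b = ap ?t a \<and> c = mcomp_at N ap A b a"
  if N: "canon N ap" and ab: "b : N ?X" "a : N ?X" for N ap b a c
 proof -
  interpret model C N ap by fact
  have "rel R (pp ?X ?X b a) c \<longleftrightarrow> (\<exists>z\<in>N (pb C ?s ?t). b = ap ?p z \<and> a = ap ?q z \<and> c = ap ?m z)"
   unfolding R_def using T pq ab by auto
  also have "\<dots> \<longleftrightarrow> ap ?s b = ap ?t a \<and> c = mcomp A b a"
  proof
   assume "\<exists>z\<in>N (pb C ?s ?t). b = ap ?p z \<and> a = ap ?q z \<and> c = ap ?m z"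
   then obtain z where z: "z : N (pb C ?s ?t)" "b = ap ?p z" "a = ap ?q z" "c = ap ?m z" by blast
   have e: "ap ?s b = ap ?t a" using pb_elt_commutes[OF st z(1)] z by simp
   have "pbe ?s ?t b a = z"
    by (rule pb_elt_eq[OF st]) (use T z(1) z(2,3)[symmetric] e ab in simp_all)
   then show "ap ?s b = ap ?t a \<and> c = mcomp A b a" using z(4) e by (simp add: mcomp_def)
  next
   assume "ap ?s b = ap ?t a \<and> c = mcomp A b a"
   then show "\<exists>z\<in>N (pb C ?s ?t). b = ap ?p z \<and> a = ap ?q z \<and> c = ap ?m z"
    using T ab by (intro bexI[of _ "pbe ?s ?t b a"]) (simp_all add: mcomp_def)
  qed
  finally show ?thesis .
 qed
 obtain i where i: "i : Arr C" "Dom C i = ?X" "Cod C i = ?X"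
  and I: "\<And>N ap a x. [|canon N ap; a : N ?X; x : N ?X|] ==>
   rel_at N ap R (ap (pairing C (pr2 C ?X ?X) (pr1 C ?X ?X)) (pp_at N ap ?X ?X a x)) (ap (?u \<cdot> (?s \<cdot> pr1 C ?X ?X)) (pp_at N ap ?X ?X a x)) \<longleftrightarrow> x = ap i a"
 proof (rule functional_relation[OF R(1) T(2) T(2), of "pairing C (pr2 C ?X ?X) (pr1 C ?X ?X)" "?u \<cdot> (?s \<cdot> pr1 C ?X ?X)"])
  fix N ap a assume N: "canon N ap" and a: "a : N ?X"
  interpret model C N ap by fact
  have "ap (pairing C (pr2 C ?X ?X) (pr1 C ?X ?X)) (pp ?X ?X a x) = pp ?X ?X x a" "ap (?u \<cdot> (?s \<cdot> pr1 C ?X ?X)) (pp ?X ?X a x) = ap ?u (ap ?s a)"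
   if "x : N ?X" for x using T a that by simp_all
  then show "\<exists>!x. x : N ?X \<and> rel R (ap (pairing C (pr2 C ?X ?X) (pr1 C ?X ?X)) (pp ?X ?X a x)) (ap (?u \<cdot> (?s \<cdot> pr1 C ?X ?X)) (pp ?X ?X a x))"
   using inv(1)[OF N a] rel[OF N _ a] by (metis (no_types, lifting))
 qed (use T R that in simp_all)
 have "set_gpd (N (iObj A)) (N (iArr A)) (ap (iSrc A)) (ap (iTgt A)) (ap (iUnit A)) (mcomp_at N ap A) (ap i)"
  if N: "canon N ap" for N ap
 proof -
  interpret model C N ap by fact
  interpret GA: cat_elts C N ap A by unfold_locales (rule A)
  show ?thesis
  proof
   fix a assume a: "a : N ?X"
   have ia: "ap i a : N ?X" using i a by simp
   have "rel R (pp ?X ?X (ap i a) a) (ap ?u (ap ?s a))" using I[OF N a ia] T a ia by simp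
   then have l: "ap ?s (ap i a) = ap ?t a" "mcomp A (ap i a) a = ap ?u (ap ?s a)" using rel[OF N ia a] by simp_all
   then show "ap ?s (ap i a) = ap ?t a" "mcomp A (ap i a) a = ap ?u (ap ?s a)" "ap i a : N ?X" using ia by simp_all
   show "ap ?t (ap i a) = ap ?s a" "mcomp A a (ap i a) = ap ?u (ap ?t a)" using inv(2)[OF N a ia l] by simp_all
  qed
 qed
 then show ?thesis using i by blast
qed

section \<open>Subgroupoids, images and coequalizers\<close>

text \<open>The objects of the subgroupoid are those whose identities lie in the given subobject of arrows, and
all structure arrows are obtained by factoring through the two monomorphisms.\<close>

lemma subgroupoid_ex:
 assumes B: "internal_groupoid C B" and r: "is_mono C r" "Cod C r = iArr B"
  and cl: "\<And>N ap a. [|canon N ap; a : img_at N ap r|] ==>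
    ap (iUnit B) (ap (iSrc B) a) : img_at N ap r \<and> ap (iInv B) a : img_at N ap r"
   "\<And>N ap g f. [|canon N ap; g : img_at N ap r; f : img_at N ap r; ap (iSrc B) g = ap (iTgt B) f|] ==>
    mcomp_at N ap B g f : img_at N ap r"
 obtains M where "M : Arr (Gpd C)" "tcod M = B" "amap M = r"
proof -
 note T = internal_category_typing[OF internal_groupoid_category[OF B]] internal_groupoid_typing[OF B] and rA = is_mono_Arr[OF r(1)]
 let ?s = "iSrc B" and ?t = "iTgt B" and ?u = "iUnit B" and ?i = "iInv B" and ?R = "Dom C r"
 have rin: "ap r x : img_at N ap r \<and> ap r x : N (iArr B)" if "canon N ap" "x : N ?R" for N ap x
  using that rA r model.img_def[OF that(1)] model.ap_in_cod[OF that(1), of r x] by auto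
 have utr: "ap ?u (ap ?t a) : img_at N ap r" if N: "canon N ap" and a: "a : img_at N ap r" for N ap a
 proof -
  interpret model C N ap by fact
  interpret GB: gpd_elts C N ap B by unfold_locales (rule B)
  have "a : N (iArr B)" using a r rA by (auto simp: img_def)
  then show ?thesis using cl(1)[OF N, of "ap ?i a"] cl(1)[OF N a] by simp
 qed
 have rinj: "x = y" if "canon N ap" "x : N ?R" "y : N ?R" "ap r x = ap r y" for N ap x y
  using model.mono_elt_eq[OF that(1) r(1) that(2-4)] .
 obtain j where j: "is_mono C j" "j : Arr C" "Cod C j = iObj B" and
  J: "\<And>N ap z. [|canon N ap; z : N (iObj B)|] ==> z : img_at N ap j \<longleftrightarrow> ap ?u z : img_at N ap r"
  using preimage_ex[OF r(1), of ?u] r T by (metis (no_types, lifting))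
 let ?J = "Dom C j"
 have jinj: "x = y" if "canon N ap" "x : N ?J" "y : N ?J" "ap j x = ap j y" for N ap x y
  using model.mono_elt_eq[OF that(1) j(1) that(2-4)] .
 have jin: "ap j x : N (iObj B) \<and> ap ?u (ap j x) : img_at N ap r" if N: "canon N ap" and x: "x : N ?J" for N ap x
 proof -
  interpret model C N ap by fact
  have "ap j x : img j" "ap j x : N (iObj B)" using x j by (simp_all add: img_def)
  then show ?thesis using J[OF N] by blast
 qed
 have factor: "\<exists>h. h : Arr C \<and> Dom C h = Dom C f \<and> Cod C h = Dom C m \<and> (\<forall>N ap x. canon N ap \<longrightarrow> x : N (Dom C f) \<longrightarrow>
   ap h x : N (Dom C m) \<and> ap m (ap h x) = ap f x)"
  if m: "is_mono C m" and f: "f : Arr C" "Cod C f = Cod C m" and im: "\<And>N ap x. [|canon N ap; x : N (Dom C f)|] ==> ap f x : img_at N ap m" for m f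
 proof -
  obtain h where h: "h : Arr C" "Dom C h = Dom C f" "Cod C h = Dom C m" "m \<cdot> h = f"
   using mono_factorI[OF m f im] by blast
  have "ap h x : N (Dom C m) \<and> ap m (ap h x) = ap f x" if N: "canon N ap" and x: "x : N (Dom C f)" for N ap x
  proof -
   interpret model C N ap by fact
   have "ap f x = ap m (ap h x)" unfolding h(4)[symmetric] using h(1-3) x is_mono_Arr[OF m] by simp
   then show ?thesis using h(1-3) x by simp
  qed
  then show ?thesis using h by blast
 qed
 have 1: "ap (?s \<cdot> r) x : img_at N ap j \<and> ap (?t \<cdot> r) x : img_at N ap j \<and> ap (?i \<cdot> r) x : img_at N ap r"
  if N: "canon N ap" and x: "x : N ?R" for N ap x
 proof -
  interpret model C N ap by fact
  note rx = rin[OF N x]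
  show ?thesis
   using J[OF N, of "ap ?s (ap r x)"] J[OF N, of "ap ?t (ap r x)"] cl(1)[OF N, of "ap r x"] utr[OF N, of "ap r x"] rx x T rA r by simp
 qed
 obtain s where s: "s : Arr C" "Dom C s = ?R" "Cod C s = ?J" and S: "\<And>N ap x. [|canon N ap; x : N ?R|] ==> ap s x : N ?J \<and> ap j (ap s x) = ap (?s \<cdot> r) x"
  using factor[OF j(1), of "?s \<cdot> r"] 1 T rA r j by auto
 obtain t where t: "t : Arr C" "Dom C t = ?R" "Cod C t = ?J" and Tt: "\<And>N ap x. [|canon N ap; x : N ?R|] ==> ap t x : N ?J \<and> ap j (ap t x) = ap (?t \<cdot> r) x"
  using factor[OF j(1), of "?t \<cdot> r"] 1 T rA r j by auto
 obtain i where i: "i : Arr C" "Dom C i = ?R" "Cod C i = ?R" and I: "\<And>N ap x. [|canon N ap; x : N ?R|] ==> ap i x : N ?R \<and> ap r (ap i x) = ap (?i \<cdot> r) x"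
  using factor[OF r(1), of "?i \<cdot> r"] 1 T rA r by auto
 have uj: "ap (?u \<cdot> j) x : img_at N ap r" if N: "canon N ap" and x: "x : N ?J" for N ap x
 proof -
  interpret model C N ap by fact
  show ?thesis using jin[OF N x] T j x by simp
 qed
 obtain u where u: "u : Arr C" "Dom C u = ?J" "Cod C u = ?R" and U: "\<And>N ap x. [|canon N ap; x : N ?J|] ==> ap u x : N ?R \<and> ap r (ap u x) = ap (?u \<cdot> j) x"
  using factor[OF r(1), of "?u \<cdot> j"] uj T j r by auto
 have st: "s : Arr C" "t : Arr C" "Cod C s = Cod C t" using s t by simp_all
 let ?M = "pb C s t" and ?p = "pb1 C s t" and ?q = "pb2 C s t"
 note M = pb_simps[OF st, unfolded s t]
 have rst: "ap ?s (ap r g) = ap ?t (ap r f)" if N: "canon N ap" and gf: "g : N ?R" "f : N ?R" "ap s g = ap t f" for N ap g f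
 proof -
  interpret model C N ap by fact
  have "ap (?s \<cdot> r) g = ap (?t \<cdot> r) f" using S[OF N gf(1)] Tt[OF N gf(2)] gf(3) by simp
  then show ?thesis using T rA r gf by simp
 qed
 have cM: "ap ?s (ap (r \<cdot> ?p) x) = ap ?t (ap (r \<cdot> ?q) x)" if N: "canon N ap" and x: "x : N (Dom C (r \<cdot> ?q))" for N ap x
 proof -
  interpret model C N ap by fact
  have x: "x : N ?M" using x M rA by simp
  show ?thesis using rst[OF N, of "ap ?p x" "ap ?q x"] pb_elt_commutes[OF st x] M rA x by simp
 qed
 have ty: "r \<cdot> ?p : Arr C" "r \<cdot> ?q : Arr C" "Dom C (r \<cdot> ?p) = Dom C (r \<cdot> ?q)" "Cod C (r \<cdot> ?p) = iArr B" "Cod C (r \<cdot> ?q) = iArr B" "Dom C (r \<cdot> ?q) = ?M"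
  using M rA r by simp_all
 let ?c = "icomp C B (r \<cdot> ?p) (r \<cdot> ?q)"
 have ic: "?c : Arr C" "Dom C ?c = ?M" "Cod C ?c = iArr B"
  using icomp_arr(1-3)[OF internal_groupoid_category[OF B] ty(1-5) cM] ty(6) by auto
 have ic4: "ap ?c x = mcomp_at N ap B (ap r (ap ?p x)) (ap r (ap ?q x))"
  if N: "canon N ap" and x: "x : N ?M" for N ap x
 proof -
  interpret model C N ap by fact
  have "ap ?c x = mcomp B (ap (r \<cdot> ?p) x) (ap (r \<cdot> ?q) x)"
   by (rule icomp_arr(4)[OF internal_groupoid_category[OF B] ty(1-5) cM N]) (use x ty(6) in simp_all)
  then show ?thesis using M rA x by simp
 qed
 have cimg: "ap ?c x : img_at N ap r" if N: "canon N ap" and x: "x : N (Dom C ?c)" for N ap x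
 proof -
  interpret model C N ap by fact
  have x: "x : N ?M" using x ic by simp
  have i: "ap ?p x : N ?R" "ap ?q x : N ?R" using x M by simp_all
  show ?thesis unfolding ic4[OF N x]
   using cl(2)[OF N, of "ap r (ap ?p x)" "ap r (ap ?q x)"] rin[OF N i(1)] rin[OF N i(2)] rst[OF N i] pb_elt_commutes[OF st x] by simp
 qed
 obtain m where m: "m : Arr C" "Dom C m = ?M" "Cod C m = ?R" and Mm: "\<And>N ap x. [|canon N ap; x : N ?M|] ==> ap m x : N ?R \<and> ap r (ap m x) = ap ?c x"
  using factor[OF r(1) ic(1) _ cimg] ic r by auto
 define S' :: "('o, 'm) igpd" where "S' = \<lparr>iObj = ?J, iArr = ?R, iSrc = s, iTgt = t, iUnit = u, iComp = m, iInv = i\<rparr>"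
 have P: "iObj S' = ?J" "iArr S' = ?R" "iSrc S' = s" "iTgt S' = t" "iUnit S' = u" "iComp S' = m" "iInv S' = i" by (simp_all add: S'_def)
 have ops: "ap j (ap s x) = ap ?s (ap r x)" "ap j (ap t x) = ap ?t (ap r x)" "ap r (ap i x) = ap ?i (ap r x)" "ap s x : N ?J" "ap t x : N ?J" "ap i x : N ?R" "ap r x : N (iArr B)"
  if N: "canon N ap" and x: "x : N ?R" for N ap x
 proof -
  interpret model C N ap by fact
  show "ap j (ap s x) = ap ?s (ap r x)" "ap j (ap t x) = ap ?t (ap r x)" "ap r (ap i x) = ap ?i (ap r x)" "ap s x : N ?J" "ap t x : N ?J" "ap i x : N ?R" "ap r x : N (iArr B)"
   using S[OF N x] Tt[OF N x] I[OF N x] rin[OF N x] x T rA r by simp_all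
 qed
 have uops: "ap r (ap u x) = ap ?u (ap j x)" "ap u x : N ?R" "ap j x : N (iObj B)" if N: "canon N ap" and x: "x : N ?J" for N ap x
 proof -
  interpret model C N ap by fact
  show "ap r (ap u x) = ap ?u (ap j x)" "ap u x : N ?R" "ap j x : N (iObj B)" using U[OF N x] jin[OF N x] x T j by simp_all
 qed
 have pm: "mcomp_at N ap S' g f : N ?R" "ap r (mcomp_at N ap S' g f) = mcomp_at N ap B (ap r g) (ap r f)"
  if N: "canon N ap" and gf: "g : N ?R" "f : N ?R" "ap s g = ap t f" for N ap g f
 proof -
  interpret model C N ap by fact
  have z: "pbe s t g f : N ?M" "ap ?p (pbe s t g f) = g" "ap ?q (pbe s t g f) = f" using gf s t by simp_all
  show "mcomp S' g f : N ?R" "ap r (mcomp S' g f) = mcomp B (ap r g) (ap r f)"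
   unfolding mcomp_def[of S'] P using Mm[OF N z(1)] ic4[OF N z(1)] z by simp_all
 qed
 have el: "model.elt_gpd C N ap S'" if N: "canon N ap" for N ap
 proof -
  interpret model C N ap by fact
  interpret GB: gpd_elts C N ap B by unfold_locales (rule B)
  note O = ops[OF N] and UO = uops[OF N] and e = rst[OF N] and pm = pm[OF N]
  have su: "ap s (ap u x) = x" "ap t (ap u x) = x" if "x : N ?J" for x
   by (rule jinj[OF N]; use that in "simp add: O UO")+
  have si: "ap s (ap i a) = ap t a" "ap t (ap i a) = ap s a" if "a : N ?R" for a
   by (rule jinj[OF N]; use that in "simp add: O")+
  have sc: "ap s (mcomp S' g h) = ap s h" "ap t (mcomp S' g h) = ap t g" if gh: "g : N ?R" "h : N ?R" "ap s g = ap t h" for g h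
   by (rule jinj[OF N]; use gh e[OF gh] pm[OF gh] in "simp add: O")+
  show ?thesis unfolding P
  proof
   fix a assume a: "a : N ?R"
   show "mcomp S' a (ap u (ap s a)) = a"
    by (rule rinj[OF N]) (use a su pm[of a "ap u (ap s a)"] in "simp_all add: O UO")
   show "mcomp S' (ap u (ap t a)) a = a"
    by (rule rinj[OF N]) (use a su pm[of "ap u (ap t a)" a] in "simp_all add: O UO")
   show "mcomp S' (ap i a) a = ap u (ap s a)"
    by (rule rinj[OF N]) (use a si pm[of "ap i a" a] in "simp_all add: O UO")
   show "mcomp S' a (ap i a) = ap u (ap t a)"
    by (rule rinj[OF N]) (use a si pm[of a "ap i a"] in "simp_all add: O UO")
  next
   fix k g h assume a: "k : N ?R" "g : N ?R" "h : N ?R" "ap s k = ap t g" "ap s g = ap t h"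
   show "mcomp S' (mcomp S' k g) h = mcomp S' k (mcomp S' g h)"
    by (rule rinj[OF N])
     (use a e[OF a(1,2,4)] e[OF a(2,3,5)] pm[OF a(1,2,4)] pm[OF a(2,3,5)] sc[OF a(1,2,4)] sc[OF a(2,3,5)]
      pm[of "mcomp S' k g" h] pm[of k "mcomp S' g h"] in "simp_all add: O GB.c_assoc")
  qed (use O UO su si sc pm in auto)
 qed
 have ICS: "internal_category C S'"
 proof (rule internal_categoryI)
  fix N ap assume "canon N ap"
  then show "model.elt_cat C N ap S'" using el set_gpd.axioms(1) by blast
 qed (use s t u m in "simp_all add: P")
 have IS: "internal_groupoid C S'"
 proof (rule internal_groupoidI[OF ICS])
  fix N ap assume "canon N ap"
  then show "model.elt_gpd C N ap S'" by (rule el)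
 qed (use i in "simp_all add: P")
 let ?F = "\<lparr>tdom = S', tcod = B, tmap = (j, r)\<rparr>"
 have "?F : Arr (Gpd C)"
 proof (rule Gpd_ArrI)
  fix N ap assume N: "canon N ap"
  interpret model C N ap by fact
  show "elt_functor (tdom ?F) (tcod ?F) (omap ?F) (amap ?F)"
   using ops[OF N] uops[OF N] pm[OF N] by (simp add: elt_functor_def P)
 qed (use IS B j r rA in "simp_all add: P")
 then show ?thesis using that[of ?F] by simp
qed

text \<open>An arrow into the codomain of a functor that is injective on arrows lifts to a functor as soon
 as it lifts on arrows.\<close>

lemma gpd_lift:
 assumes M: "M : Arr (Gpd C)" and F: "F : Arr (Gpd C)" and cod: "tcod M = tcod F"
  and inj: "\<And>N ap x y. [|canon N ap; x : N (iArr (tdom M)); y : N (iArr (tdom M)); ap (amap M) x = ap (amap M) y|] ==> x = y"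
  and h: "h : Arr C" "Dom C h = iArr (tdom F)" "Cod C h = iArr (tdom M)" "amap M \<cdot> h = amap F"
 obtains H where "H : Arr (Gpd C)" "tdom H = tdom F" "tcod H = tdom M" "amap H = h" "M \<bullet> H = F"
proof -
 let ?A = "tdom F" and ?S = "tdom M"
 note MD = Gpd_ArrD[OF M] and FD = Gpd_ArrD[OF F]
 let ?m0 = "omap M" and ?m1 = "amap M" and ?f0 = "omap F" and ?f1 = "amap F"
 \<comment> \<open>the object part is forced: it is the source of the lifted identity\<close>
 define h0 where "h0 = iSrc ?S \<cdot> (h \<cdot> iUnit ?A)"
 have h0: "h0 : Arr C" "Dom C h0 = iObj ?A" "Cod C h0 = iObj ?S" using h FD MD by (simp_all add: h0_def)
 let ?H = "\<lparr>tdom = ?A, tcod = ?S, tmap = (h0, h)\<rparr>"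
 have mh: "ap ?m1 (ap h x) = ap ?f1 x" if N: "canon N ap" and x: "x : N (iArr ?A)" for N ap x
 proof -
  interpret model C N ap by fact
  show ?thesis unfolding h(4)[symmetric] using h(1-3) x MD(6-8) by simp
 qed
 have HA: "?H : Arr (Gpd C)"
 proof (rule Gpd_ArrI)
  fix N ap assume N: "canon N ap"
  interpret model C N ap by fact
  interpret GA: gpd_elts C N ap ?A by unfold_locales (rule FD(1))
  interpret GS: gpd_elts C N ap ?S by unfold_locales (rule MD(1))
  note m = elt_functorD[OF MD(9)[OF N]] and f = elt_functorD[OF FD(9)[OF N]]
  have hin: "ap h x : N (iArr ?S)" if "x : N (iArr ?A)" for x using that h by simp
  have h0e: "ap h0 x = ap (iSrc ?S) (ap h (ap (iUnit ?A) x))" if "x : N (iObj ?A)" for x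
   unfolding h0_def using that h FD(1) MD(1) by simp
  have m0inj: "x = y" if xy: "x : N (iObj ?S)" "y : N (iObj ?S)" "ap ?m0 x = ap ?m0 y" for x y
  proof -
   have "ap (iUnit ?S) x = ap (iUnit ?S) y"
    by (rule inj[OF N]) (use xy m(3) in simp_all)
   then show ?thesis using xy by (metis GS.s_u)
  qed
  have m0h: "ap ?m0 (ap h0 x) = ap ?f0 x" if x: "x : N (iObj ?A)" for x
  proof -
   have "ap ?m0 (ap h0 x) = ap (iSrc (tcod F)) (ap ?f1 (ap (iUnit ?A) x))"
    unfolding h0e[OF x] using m(1)[OF hin[OF GA.u_in[OF x]]] mh[OF N GA.u_in[OF x]] cod by simp
   then show ?thesis using f(1)[OF GA.u_in[OF x]] x by simp
  qed
  have h0in: "ap h0 x : N (iObj ?S)" if "x : N (iObj ?A)" for x using that h0 by simp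
  have st: "ap (iSrc ?S) (ap h a) = ap h0 (ap (iSrc ?A) a)" "ap (iTgt ?S) (ap h a) = ap h0 (ap (iTgt ?A) a)" if a: "a : N (iArr ?A)" for a
   by (rule m0inj; use a hin h0in m0h m(1,2)[OF hin[OF a]] f(1,2)[OF a] mh[OF N a] cod in simp)+
  show "elt_functor (tdom ?H) (tcod ?H) (omap ?H) (amap ?H)"
   unfolding elt_functor_def tarr.simps fst_conv snd_conv
  proof (intro conjI ballI impI)
   fix x assume x: "x : N (iObj ?A)"
   show "ap h (ap (iUnit ?A) x) = ap (iUnit ?S) (ap h0 x)"
    by (rule inj[OF N]) (use x hin h0in mh[OF N GA.u_in[OF x]] f(3)[OF x] m(3)[OF h0in[OF x]] m0h[OF x] cod in simp_all)
  next
   fix g k assume gk: "g : N (iArr ?A)" "k : N (iArr ?A)" "ap (iSrc ?A) g = ap (iTgt ?A) k"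
   have c: "ap (iSrc ?S) (ap h g) = ap (iTgt ?S) (ap h k)" using st gk by simp
   show "ap h (mcomp ?A g k) = mcomp ?S (ap h g) (ap h k)"
    by (rule inj[OF N]) (use gk hin c mh[OF N] GA.c_in[OF gk] f(4)[OF gk] m(4)[OF hin[OF gk(1)] hin[OF gk(2)] c] cod in simp_all)
  qed (use st in simp_all)
 qed (use h h0 FD MD in simp_all)
 interpret GG: category "Gpd C" by unfold_locales (rule is_category_Gpd)
 have "M \<bullet> ?H = F"
  by (rule Gpd_arr_eqI) (use GG.Cmp_Arr[OF HA M] F cod h(4) in simp_all)
 then show ?thesis using that[of ?H] HA by simp
qed

text \<open>A monomorphism has a trivial kernel pair, and kernel pairs are computed on arrows.\<close>

lemma gpd_mono_inj:
 assumes m: "is_mono (Gpd C) M" and N: "model C (N :: 'o => 'a set) ap"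
  and xy: "x : N (iArr (tdom M))" "y : N (iArr (tdom M))" "ap (amap M) x = ap (amap M) y"
 shows "x = y"
proof -
 interpret GG: category "Gpd C" by unfold_locales (rule is_category_Gpd)
 interpret model C N ap by fact
 have MA: "M : Arr (Gpd C)" using m by (simp add: is_mono_def)
 let ?i = "Ident (Gpd C) (tdom M)"
 have I: "?i : hom (Gpd C) (tdom M) (tdom M)" using GG.Ident_Arr[of "tdom M"] Gpd_ArrD(1)[OF MA] by (simp add: hom_def)
 have "is_pullback (Gpd C) M M (tdom M) ?i ?i"
  unfolding is_pullback_def
 proof (intro conjI allI ballI impI)
  fix X a b assume ab: "a : hom (Gpd C) X (Dom (Gpd C) M)" "b : hom (Gpd C) X (Dom (Gpd C) M)" "M \<bullet> a = M \<bullet> b"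
  then have "a = b" using m unfolding is_mono_def by blast
  moreover have "?i \<bullet> h = h" if "h : hom (Gpd C) X (tdom M)" for h
   using GG.Ident_Cmp[of h "tdom M"] that by (simp add: hom_def del: Gpd_simps(4,5))
  ultimately show "\<exists>!h. h : hom (Gpd C) X (tdom M) \<and> ?i \<bullet> h = a \<and> ?i \<bullet> h = b"
   using ab(1) by (metis (no_types, lifting) Gpd_simps(2))
 qed (use MA I Gpd_ArrD(1)[OF MA] in simp_all)
 from gpd_pullback_elts[OF this xy] Gpd_ArrD(1)[OF MA] xy(1,2) show ?thesis by auto
qed

text \<open>A functor that is surjective on arrows is a coequalizer of its kernel pair. The comparison
 arrow exists in the base category, and it preserves composition by the Mal'cev property.\<close>

lemma malcev_surjective_coequalizer:
 assumes mal: "malcev C" and E: "E : Arr (Gpd C)"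
  and surj: "\<And>N ap y. [|canon N ap; y : N (iArr (tcod E))|] ==> \<exists>x\<in>N (iArr (tdom E)). ap (amap E) x = y"
  and pq: "p : Arr (Gpd C)" "q : Arr (Gpd C)" "tdom p = tdom q" "tcod p = tdom E" "tcod q = tdom E" "E \<bullet> p = E \<bullet> q"
  and ker: "\<And>N ap x y. [|canon N ap; x : N (iArr (tdom E)); y : N (iArr (tdom E)); ap (amap E) x = ap (amap E) y|]
   ==> \<exists>z\<in>N (iArr (tdom p)). ap (amap p) z = x \<and> ap (amap q) z = y"
 shows "is_coequalizer (Gpd C) p q E"
proof -
 interpret GG: category "Gpd C" by unfold_locales (rule is_category_Gpd)
 let ?A = "tdom E" and ?S = "tcod E"
 note ED = Gpd_ArrD[OF E] and pD = Gpd_ArrD[OF pq(1)] and qD = Gpd_ArrD[OF pq(2)]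
 let ?e0 = "omap E" and ?e1 = "amap E"
 have surj0: "\<exists>a\<in>N (iObj ?A). ap ?e0 a = x" if N: "canon N ap" and x: "x : N (iObj ?S)" for N ap x
 proof -
  interpret model C N ap by fact
  interpret GS: gpd_elts C N ap ?S by unfold_locales (rule ED(2))
  obtain a where a: "a : N (iArr ?A)" "ap ?e1 a = ap (iUnit ?S) x" using surj[OF N, of "ap (iUnit ?S) x"] x by auto
  have "ap ?e0 (ap (iSrc ?A) a) = x" using elt_functorD(1)[OF ED(9)[OF N] a(1)] a(2) x by simp
  then show ?thesis using a(1) ED(1) by (intro bexI[of _ "ap (iSrc ?A) a"]) simp_all
 qed
 have re1: "regular_epi C ?e1"
  by (rule regular_epiI[OF ED(6)]) (use surj ED in "auto simp: model.img_def image_iff dest!: surj")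
 have re0: "regular_epi C ?e0"
  by (rule regular_epiI[OF ED(3)]) (use surj0 ED in "auto simp: model.img_def image_iff dest!: surj0")
 \<comment> \<open>An arrow that identifies the elements identified by a regular epimorphism factors through it.\<close>
 have fac: "\<exists>k. k : Arr C \<and> Dom C k = Cod C e \<and> Cod C k = Cod C h \<and> k \<cdot> e = h"
  if e: "regular_epi C e" and h: "h : Arr C" "Dom C h = Dom C e"
   and id: "\<And>N ap x y. [|canon N ap; x : N (Dom C e); y : N (Dom C e); ap e x = ap e y|] ==> ap h x = ap h y" for e h
 proof -
  obtain a b where ab: "is_coequalizer C a b e" using e by (auto simp: regular_epi_def)
  note cf = coequalizer_facts[OF ab]
  have "h \<cdot> a = h \<cdot> b"
  proof (rule arr_eqI)
   fix N ap x assume N: "canon N ap" and "x : N (Dom C (h \<cdot> b))"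
   then have x: "x : N (Dom C b)" using h cf by simp
   interpret model C N ap by fact
   have "ap (e \<cdot> a) x = ap (e \<cdot> b) x" using cf(7) by simp
   then have "ap e (ap a x) = ap e (ap b x)" using x cf(1-6) by simp
   then have "ap h (ap a x) = ap h (ap b x)" using x cf by (intro id[OF N]) simp_all
   then show "ap (h \<cdot> a) x = ap (h \<cdot> b) x" using x cf(1-6) h by simp
  qed (use h cf in simp_all)
  then show ?thesis using coequalizer_factor[OF ab h(1,2)] by metis
 qed
 show ?thesis unfolding is_coequalizer_def
 proof (intro conjI allI ballI impI)
  fix X H assume "H : hom (Gpd C) (Cod (Gpd C) p) X" and Hpq: "H \<bullet> p = H \<bullet> q"
  then have H: "H : Arr (Gpd C)" "tdom H = ?A" "tcod H = X" using pq(4) by (auto simp: hom_def)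
  note HD = Gpd_ArrD[OF H(1), unfolded H(2,3)]
  let ?h0 = "omap H" and ?h1 = "amap H"
  have hpq: "?h1 \<cdot> amap p = ?h1 \<cdot> amap q" using Hpq by simp
  have id1: "ap ?h1 x = ap ?h1 y" if N: "canon N ap" and xy: "x : N (iArr ?A)" "y : N (iArr ?A)" "ap ?e1 x = ap ?e1 y" for N ap x y
  proof -
   interpret model C N ap by fact
   obtain z where z: "z : N (iArr (tdom p))" "ap (amap p) z = x" "ap (amap q) z = y" using ker[OF N xy] by blast
   have "ap (?h1 \<cdot> amap p) z = ap (?h1 \<cdot> amap q) z" using hpq by simp
   then show ?thesis using z pD(6-8) qD(6-8) HD(6-8) pq(3-5) by simp
  qed
  have id0: "ap ?h0 x = ap ?h0 y" if N: "canon N ap" and xy: "x : N (iObj ?A)" "y : N (iObj ?A)" "ap ?e0 x = ap ?e0 y" for N ap x y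
  proof -
   interpret model C N ap by fact
   interpret GA: gpd_elts C N ap ?A by unfold_locales (rule ED(1))
   have "ap ?h1 (ap (iUnit ?A) x) = ap ?h1 (ap (iUnit ?A) y)"
    by (rule id1[OF N]) (use xy elt_functorD(3)[OF ED(9)[OF N]] in simp_all)
   then have "ap (iSrc X) (ap ?h1 (ap (iUnit ?A) x)) = ap (iSrc X) (ap ?h1 (ap (iUnit ?A) y))" by simp
   then show ?thesis using elt_functorD(1)[OF HD(9)[OF N]] xy by simp
  qed
  obtain k1 where k1: "k1 : Arr C" "Dom C k1 = iArr ?S" "Cod C k1 = iArr X" "k1 \<cdot> ?e1 = ?h1"
   using fac[OF re1 HD(6)] id1 ED HD by auto
  obtain k0 where k0: "k0 : Arr C" "Dom C k0 = iObj ?S" "Cod C k0 = iObj X" "k0 \<cdot> ?e0 = ?h0"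
   using fac[OF re0 HD(3)] id0 ED HD by auto
  have ke: "ap k1 (ap ?e1 x) = ap ?h1 x" if N: "canon N ap" and x: "x : N (iArr ?A)" for N ap x
  proof -
   interpret model C N ap by fact
   have "ap (k1 \<cdot> ?e1) x = ap k1 (ap ?e1 x)" using k1(1-3) ED(6-8) x by simp
   then show ?thesis unfolding k1(4) by simp
  qed
  have ke0: "ap k0 (ap ?e0 x) = ap ?h0 x" if N: "canon N ap" and x: "x : N (iObj ?A)" for N ap x
  proof -
   interpret model C N ap by fact
   have "ap (k0 \<cdot> ?e0) x = ap k0 (ap ?e0 x)" using k0(1-3) ED(3-5) x by simp
   then show ?thesis unfolding k0(4) by simp
  qed
  let ?K = "\<lparr>tdom = ?S, tcod = X, tmap = (k0, k1)\<rparr>"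
  have KA: "?K : Arr (Gpd C)"
  proof (rule Gpd_ArrI)
   fix N ap assume N: "canon N ap"
   show "model.elt_functor C N ap (tdom ?K) (tcod ?K) (omap ?K) (amap ?K)"
    unfolding tarr.simps fst_conv snd_conv
   proof (rule malcev_graph_morphism[OF mal _ _ k0(1-3) k1(1-3) _ _ N])
    fix N ap a assume N: "canon N ap" and a: "a : N (iArr ?S)"
    interpret model C N ap by fact
    obtain x where x: "x : N (iArr ?A)" "ap ?e1 x = a" using surj[OF N a] by blast
    have st: "ap (iSrc ?A) x : N (iObj ?A)" "ap (iTgt ?A) x : N (iObj ?A)" using x ED(1) by simp_all
    show "ap (iSrc X) (ap k1 a) = ap k0 (ap (iSrc ?S) a) \<and> ap (iTgt X) (ap k1 a) = ap k0 (ap (iTgt ?S) a)"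
     unfolding x(2)[symmetric] ke[OF N x(1)]
     using elt_functorD(1,2)[OF HD(9)[OF N] x(1)] elt_functorD(1,2)[OF ED(9)[OF N] x(1)] ke0[OF N st(1)] ke0[OF N st(2)] by simp
   next
    fix N ap y assume N: "canon N ap" and y: "y : N (iObj ?S)"
    interpret model C N ap by fact
    obtain x where x: "x : N (iObj ?A)" "ap ?e0 x = y" using surj0[OF N y] by blast
    have ux: "ap (iUnit ?A) x : N (iArr ?A)" using x ED(1) by simp
    show "ap k1 (ap (iUnit ?S) y) = ap (iUnit X) (ap k0 y)"
     unfolding x(2)[symmetric]
     using elt_functorD(3)[OF HD(9)[OF N] x(1)] elt_functorD(3)[OF ED(9)[OF N] x(1)] ke[OF N ux] ke0[OF N x(1)] by simp
   qed (use ED HD in simp_all)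
  qed (use ED HD k0 k1 in simp_all)
  have KE: "?K \<bullet> E = H"
   by (rule Gpd_arr_eqI) (use GG.Cmp_Arr[OF E KA] H k1(4) in simp_all)
  have "L = ?K" if L: "L : hom (Gpd C) (Cod (Gpd C) E) X" "L \<bullet> E = H" for L
  proof (rule Gpd_arr_eqI)
   fix N ap y assume N: "canon N ap" and "y : N (iArr (tdom ?K))"
   then have y: "y : N (iArr ?S)" by simp
   interpret model C N ap by fact
   have LD: "amap L : Arr C" "Dom C (amap L) = iArr ?S" using Gpd_ArrD(6,7)[of L] L(1) by (auto simp: hom_def)
   obtain x where x: "x : N (iArr ?A)" "ap ?e1 x = y" using surj[OF N y] by blast
   have "amap L \<cdot> ?e1 = ?h1" using arg_cong[OF L(2), of "\<lambda>F. amap F"] by simp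
   moreover have "ap (amap L \<cdot> ?e1) x = ap (amap L) (ap ?e1 x)" using LD ED(6-8) x(1) by simp
   ultimately show "ap (amap L) y = ap (amap ?K) y" using ke[OF N x(1)] x(2) by simp
  qed (use L KA in "auto simp: hom_def")
  then show "\<exists>!k. k : hom (Gpd C) (Cod (Gpd C) E) X \<and> k \<bullet> E = H"
   using KE KA by (intro ex1I[of _ ?K]) (auto simp: hom_def)
 qed (use pq E in simp_all)
qed

text \<open>The image of a functor on arrows is a subobject closed under identities and inverses. Closure under
composition, which images of functors lack in general, comes from the Mal'cev property.\<close>

lemma malcev_image_factorization:
 assumes mal: "malcev C" and F: "F : Arr (Gpd C)"
 obtains M E where "M : Arr (Gpd C)" "E : Arr (Gpd C)" "tdom E = tdom F" "tcod E = tdom M" "tcod M = tcod F" "M \<bullet> E = F"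
  "is_mono C (amap M)" "regular_epi C (amap E)"
proof -
 note FD = Gpd_ArrD[OF F]
 let ?A = "tdom F" and ?B = "tcod F" and ?f1 = "amap F"
 obtain r e where r: "is_mono C r" "regular_epi C e" "e : Arr C" "Dom C e = Dom C ?f1" "Cod C e = Dom C r" "r \<cdot> e = ?f1"
  using image_ex[OF FD(6)] unfolding is_image_def hom_def by auto
 note rA = is_mono_Arr[OF r(1)]
 have "Cod C (r \<cdot> e) = Cod C r" using r(3-5) rA by simp
 then have rc: "Cod C r = iArr ?B" unfolding r(6) using FD by simp
 have img: "img_at N ap r = ap ?f1 ` N (iArr ?A)" if N: "canon N ap" for N ap
 proof -
  interpret model C N ap by fact
  have re: "ap ?f1 x = ap r (ap e x)" if "x : N (iArr ?A)" for x unfolding r(6)[symmetric] using that r(3-5) rA FD by simp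
  have "ap e x : N (Dom C r)" if "x : N (iArr ?A)" for x using that r(3-5) FD by simp
  moreover have "\<exists>x\<in>N (iArr ?A). ap e x = y" if "y : N (Dom C r)" for y using ap_regular_epi[OF r(2), of y] that r(4,5) FD by simp
  ultimately show ?thesis unfolding img_def using re by (auto simp: image_iff)
 qed
 have cl: "ap (iUnit ?B) (ap (iSrc ?B) a) : img_at N ap r \<and> ap (iUnit ?B) (ap (iTgt ?B) a) : img_at N ap r \<and> ap (iInv ?B) a : img_at N ap r"
  if N: "canon N ap" and a: "a : img_at N ap r" for N ap a
 proof -
  interpret model C N ap by fact
  interpret GA: gpd_elts C N ap ?A by unfold_locales (rule FD(1))
  note f = elt_functorD[OF FD(9)[OF N]]
  obtain x where x: "x : N (iArr ?A)" "a = ap ?f1 x" using a img[OF N] by auto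
  have "ap (iUnit ?B) (ap (iSrc ?B) a) = ap ?f1 (ap (iUnit ?A) (ap (iSrc ?A) x))"
   "ap (iUnit ?B) (ap (iTgt ?B) a) = ap ?f1 (ap (iUnit ?A) (ap (iTgt ?A) x))"
   "ap (iInv ?B) a = ap ?f1 (ap (iInv ?A) x)"
   using f(1-3) x elt_functor_inverse[OF FD(1,2) FD(9)[OF N] FD(3,4,6-8) x(1)] by simp_all
  then show ?thesis unfolding img[OF N] using x(1) by simp
 qed
 obtain M where M: "M : Arr (Gpd C)" "tcod M = ?B" "amap M = r"
 proof (rule subgroupoid_ex[OF FD(2) r(1) rc])
  fix N ap g f
  assume "canon N ap" "g : img_at N ap r" "f : img_at N ap r" "ap (iSrc ?B) g = ap (iTgt ?B) f"
  then show "mcomp_at N ap ?B g f : img_at N ap r"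
   using malcev_subgraph[OF mal internal_groupoid_category[OF FD(2)] r(1) rc] cl by blast
 qed (use cl in blast)+
 note MD = Gpd_ArrD[OF M(1), unfolded M(2,3)]
 obtain E where E: "E : Arr (Gpd C)" "tdom E = ?A" "tcod E = tdom M" "amap E = e" "M \<bullet> E = F"
 proof (rule gpd_lift[OF M(1) F M(2), of e])
  fix N ap x y
  assume "canon N ap" "x : N (iArr (tdom M))" "y : N (iArr (tdom M))" "ap (amap M) x = ap (amap M) y"
  then show "x = y" using model.mono_elt_eq[of C N ap r x y] r(1) MD M(3) by simp
 qed (use r FD MD M(3) in simp_all)
 show ?thesis by (rule that[OF M(1) E(1-3) M(2) E(5)]) (use M E r in simp_all)
qed

text \<open>Let \<open>E = M F\<close> be the image factorization. A coequalizer factors through the subgroupoid \<open>M\<close>, say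
\<open>F = k E\<close>, and then \<open>M k = id\<close>, so that \<open>M\<close> is surjective on arrows, as is \<open>F\<close>.\<close>

lemma malcev_regular_epi_surjective:
 assumes mal: "malcev C" and E: "regular_epi (Gpd C) E" and N: "model C (N :: 'o => 'a set) ap" and y: "y : N (iArr (tcod E))"
 shows "\<exists>x\<in>N (iArr (tdom E)). ap (amap E) x = y"
proof -
 interpret GG: category "Gpd C" by unfold_locales (rule is_category_Gpd)
 have EA: "E : Arr (Gpd C)" using E by (rule GG.regular_epi_Arr)
 obtain a b where ab: "is_coequalizer (Gpd C) a b E" using E by (auto simp: regular_epi_def)
 note cf = GG.coequalizer_facts[OF ab]
 obtain M F where MF: "M : Arr (Gpd C)" "F : Arr (Gpd C)" "tdom F = tdom E" "tcod F = tdom M" "tcod M = tcod E" "M \<bullet> F = E"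
  "is_mono C (amap M)" "regular_epi C (amap F)" using malcev_image_factorization[OF mal EA] by blast
 note D = Gpd_ArrD(6-8)[OF MF(1)] Gpd_ArrD(6-8)[OF MF(2)] Gpd_ArrD(6-8)[OF EA]
 have abA: "a : Arr (Gpd C)" "b : Arr (Gpd C)" "tdom b = tdom a" "tcod b = tcod a" "tdom E = tcod a" using cf by simp_all
 have m1: "amap M \<cdot> amap F = amap E" using arg_cong[OF MF(6), of "\<lambda>F. amap F"] by simp
 have "F \<bullet> a = F \<bullet> b"
 proof (rule Gpd_arr_eqI)
  fix N ap x assume N: "canon N ap" and "x : N (iArr (tdom (F \<bullet> b)))"
  then have x: "x : N (iArr (tdom a))" using abA by simp
  interpret model C N ap by fact
  note abD = Gpd_ArrD(6-8)[OF abA(1)] Gpd_ArrD(6-8)[OF abA(2), unfolded abA]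
  have "amap E \<cdot> amap a = amap E \<cdot> amap b" using arg_cong[OF cf(7), of "\<lambda>F. amap F"] by simp
  then have "ap (amap E \<cdot> amap a) x = ap (amap E \<cdot> amap b) x" by simp
  then have "ap (amap M \<cdot> amap F) (ap (amap a) x) = ap (amap M \<cdot> amap F) (ap (amap b) x)"
   unfolding m1 using x abD D abA by simp
  then have "ap (amap M) (ap (amap F) (ap (amap a) x)) = ap (amap M) (ap (amap F) (ap (amap b) x))"
   using x abD D abA MF by simp
  then have "ap (amap F) (ap (amap a) x) = ap (amap F) (ap (amap b) x)"
   by (rule mono_elt_eq[OF MF(7), rotated 2]) (use x abD D abA MF in simp_all)
  then show "ap (amap (F \<bullet> a)) x = ap (amap (F \<bullet> b)) x" using x abD D abA MF by simp
 qed (use GG.Cmp_Arr[OF abA(1) MF(2)] GG.Cmp_Arr[OF abA(2) MF(2)] abA MF in simp_all)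
 then obtain k where k: "k : Arr (Gpd C)" "Dom (Gpd C) k = Cod (Gpd C) E" "Cod (Gpd C) k = Cod (Gpd C) F" "k \<bullet> E = F"
  using GG.coequalizer_factor[OF ab MF(2)] MF(3) by auto
 have Mk: "M \<bullet> k : Arr (Gpd C)" using GG.Cmp_Arr[OF k(1) MF(1)] k MF by simp
 have "(M \<bullet> k) \<bullet> E = Ident (Gpd C) (tcod E) \<bullet> E"
  using GG.Cmp_assoc[of E k M] GG.Ident_Cmp[of E "tcod E"] k MF EA by (simp del: Gpd_simps(4,5))
 then have "M \<bullet> k = Ident (Gpd C) (tcod E)"
  by (intro GG.coequalizer_epi[OF E, of "M \<bullet> k" "Ident (Gpd C) (tcod E)"])
   (use Mk k Gpd_ArrD(2)[OF EA] GG.Ident_Arr[of "tcod E"] in simp_all)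
 then have mk: "amap M \<cdot> amap k = Ident C (iArr (tcod E))" using arg_cong[of _ _ "\<lambda>F. amap F"] by fastforce
 interpret model C N ap by fact
 have kD: "amap k : Arr C" "Dom C (amap k) = iArr (tcod E)" "Cod C (amap k) = iArr (tdom M)"
  using Gpd_ArrD(6-8)[OF k(1)] k MF by simp_all
 have "ap (amap M \<cdot> amap k) y = y" unfolding mk using y Gpd_ArrD(2)[OF EA] by simp
 then have my: "ap (amap M) (ap (amap k) y) = y" using kD D y by simp
 obtain x where x: "x : N (iArr (tdom E))" "ap (amap F) x = ap (amap k) y"
  using ap_regular_epi[OF MF(8), of "ap (amap k) y"] D kD y MF(3,4) by auto
 have "ap (amap M \<cdot> amap F) x = y" using x my D MF by simp
 then show ?thesis unfolding m1 using x by blast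
qed

theorem malcev_regular_Gpd:
 assumes mal: "malcev C"
 shows "regular (Gpd C)"
proof -
 interpret GG: category "Gpd C" by unfold_locales (rule is_category_Gpd)
 have coeq: "is_coequalizer (Gpd C) p q E"
  if E: "E : Arr (Gpd C)" and surj: "\<And>N ap y. [|canon N ap; y : N (iArr (tcod E))|] ==> \<exists>x\<in>N (iArr (tdom E)). ap (amap E) x = y"
   and M: "M : Arr (Gpd C)" "tcod E = tdom M" "M \<bullet> E = F"
   and inj: "\<And>N ap x y. [|canon N ap; x : N (iArr (tdom M)); y : N (iArr (tdom M)); ap (amap M) x = ap (amap M) y|] ==> x = y"
   and P: "is_pullback (Gpd C) F F P p q" for E M F P p q
 proof -
  note pf = GG.pullback_facts[OF P]
  have Fd: "tdom F = tdom E" unfolding M(3)[symmetric] by simp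
  have pq: "p : Arr (Gpd C)" "q : Arr (Gpd C)" "tdom p = tdom q" "tcod p = tdom E" "tcod q = tdom E" using pf Fd by simp_all
  note D = Gpd_ArrD(6-8)[OF E] Gpd_ArrD(6-8)[OF M(1)] Gpd_ArrD(6-8)[OF pq(1)] Gpd_ArrD(6-8)[OF pq(2)]
  have F1: "amap F = amap M \<cdot> amap E" using arg_cong[OF M(3), of "\<lambda>F. amap F"] by simp
  have Fe: "ap (amap F) x = ap (amap M) (ap (amap E) x)" if "canon N ap" "x : N (iArr (tdom E))" for N ap x
   unfolding F1 using model.ap_Cmp[OF that(1), of "amap E" "amap M" x] that D M(2) by simp
  show ?thesis
  proof (rule malcev_surjective_coequalizer[OF mal E _ pq])
   show "E \<bullet> p = E \<bullet> q"
   proof (rule Gpd_arr_eqI)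
    fix N ap x assume N: "canon N ap" and "x : N (iArr (tdom (E \<bullet> q)))"
    then have x: "x : N (iArr (tdom q))" by simp
    interpret model C N ap by fact
    have "amap F \<cdot> amap p = amap F \<cdot> amap q" using arg_cong[OF pf(11), of "\<lambda>F. amap F"] by simp
    then have "ap (amap F \<cdot> amap p) x = ap (amap F \<cdot> amap q) x" by simp
    then have "ap (amap F) (ap (amap p) x) = ap (amap F) (ap (amap q) x)"
     using x D pq Gpd_ArrD(6-8)[of F] pf(1) Fd by simp
    moreover have i: "ap (amap p) x : N (iArr (tdom E))" "ap (amap q) x : N (iArr (tdom E))" using x D pq by simp_all
    ultimately have "ap (amap E) (ap (amap p) x) = ap (amap E) (ap (amap q) x)"
     using D M(2) by (intro inj[OF N, of "ap (amap E) (ap (amap p) x)" "ap (amap E) (ap (amap q) x)"]) (simp_all add: Fe[OF N])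
    then show "ap (amap (E \<bullet> p)) x = ap (amap (E \<bullet> q)) x" using x D pq by simp
   qed (use GG.Cmp_Arr[OF pq(1) E] GG.Cmp_Arr[OF pq(2) E] pq in simp_all)
   fix N ap x y
   assume N: "canon N ap" and xy: "x : N (iArr (tdom E))" "y : N (iArr (tdom E))" "ap (amap E) x = ap (amap E) y"
   have "\<exists>!z. z : N (iArr P) \<and> ap (amap p) z = x \<and> ap (amap q) z = y"
    by (rule model.gpd_pullback_elts[OF N P]) (use xy Fe[OF N] Fd in simp_all)
   then show "\<exists>z\<in>N (iArr (tdom p)). ap (amap p) z = x \<and> ap (amap q) z = y" using pf(7) by auto
  qed (rule surj)
 qed
 have re_surj: "\<exists>x\<in>N (iArr (tdom E)). ap (amap E) x = y" if "E : Arr (Gpd C)" "regular_epi C (amap E)" "canon N ap" "y : N (iArr (tcod E))" for E N ap y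
  using model.ap_regular_epi[OF that(3,2), of y] that(4) Gpd_ArrD(6-8)[OF that(1)] by simp
 show ?thesis unfolding regular_def
 proof (intro conjI allI impI is_category_Gpd has_finite_limits_Gpd)
  fix F P p q assume P: "is_pullback (Gpd C) F F P p q"
  then have F: "F : Arr (Gpd C)" using GG.pullback_facts by blast
  obtain M E where ME: "M : Arr (Gpd C)" "E : Arr (Gpd C)" "tdom E = tdom F" "tcod E = tdom M" "tcod M = tcod F" "M \<bullet> E = F"
   "is_mono C (amap M)" "regular_epi C (amap E)" using malcev_image_factorization[OF mal F] by blast
  have "is_coequalizer (Gpd C) p q E"
  proof (rule coeq[OF ME(2) _ ME(1,4,6) _ P])
   show "\<exists>x\<in>N (iArr (tdom E)). ap (amap E) x = y" if "canon N ap" "y : N (iArr (tcod E))" for N ap y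
    using re_surj[OF ME(2,8) that] .
  next
   fix N ap x y
   assume "canon N ap" "x : N (iArr (tdom M))" "y : N (iArr (tdom M))" "ap (amap M) x = ap (amap M) y"
   then show "x = y" using model.mono_elt_eq[OF _ ME(7)] Gpd_ArrD(7)[OF ME(1)] by metis
  qed
  then show "\<exists>e. is_coequalizer (Gpd C) p q e" ..
 next
  fix E G P p q assume E: "regular_epi (Gpd C) E" and P: "is_pullback (Gpd C) E G P p q"
  note pf = GG.pullback_facts[OF P]
  have qA: "q : Arr (Gpd C)" and GA: "G : Arr (Gpd C)" using pf by blast+
  have qs: "\<exists>x\<in>N (iArr (tdom q)). ap (amap q) x = y" if N: "canon N ap" and y: "y : N (iArr (tcod q))" for N ap y
  proof -
   interpret model C N ap by fact
   have yG: "y : N (iArr (tdom G))" using y pf(10) by simp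
   have "ap (amap G) y : N (iArr (tcod E))" using yG Gpd_ArrD(6-8)[OF GA] pf(3) by simp
   then obtain x where x: "x : N (iArr (tdom E))" "ap (amap E) x = ap (amap G) y"
    using malcev_regular_epi_surjective[OF mal E N] by blast
   obtain z where "z : N (iArr P)" "ap (amap q) z = y" using gpd_pullback_elts[OF P x(1) yG x(2)] by blast
   then show ?thesis using pf(8) by auto
  qed
  obtain K a b where K: "is_pullback (Gpd C) q q K a b" using has_finite_limits_Gpd qA unfolding has_finite_limits_def by blast
  let ?I = "Ident (Gpd C) (tcod q)"
  have "is_coequalizer (Gpd C) a b q"
  proof (rule coeq[OF qA _ _ _ _ _ K, of ?I])
   show "\<exists>x\<in>N (iArr (tdom q)). ap (amap q) x = y" if "canon N ap" "y : N (iArr (tcod q))" for N ap y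
    using qs[OF that] .
  next
   show "?I : Arr (Gpd C)" "tcod q = tdom ?I" using GG.Ident_Arr[of "tcod q"] Gpd_ArrD(2)[OF qA] by simp_all
   show "?I \<bullet> q = q" using GG.Ident_Cmp[OF qA, of "tcod q"] by (simp del: Gpd_simps(4,5))
  next
   fix N ap x y
   assume "canon N ap" "x : N (iArr (tdom ?I))" "y : N (iArr (tdom ?I))" "ap (amap ?I) x = ap (amap ?I) y"
   then show "x = y" using Gpd_ArrD(2)[OF qA] by (simp add: model.ap_Ident)
  qed
  then show "regular_epi (Gpd C) q" by (auto simp: regular_epi_def)
 qed
qed

end

section \<open>Functors inducing functors on relations\<close>

text \<open>A functor is regular when it pulls models back to models. The action of such a functor on
 relations does not change the sets of related elements, so that functoriality and bijectivity
 of \<open>rel_ftr\<close> can be checked in models.\<close>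

locale regular_functor = D: regular_category D + E: regular_category E
 for D :: "('p, 'n, 'y) cat_scheme" and E :: "('o, 'm, 'z) cat_scheme" +
 fixes F :: "('p, 'n, 'o, 'm) ftr"
 assumes is_ftr: "is_functor D E F"
  and reindex: "model E (N :: 'o => 'm tm set set) ap ==> model D (\<lambda>A. N (OMap F A)) (\<lambda>f. ap (AMap F f))"
begin

lemma F_simps [simp]:
 "A : Obj D ==> OMap F A : Obj E" "f : Arr D ==> AMap F f : Arr E"
 "f : Arr D ==> Dom E (AMap F f) = OMap F (Dom D f)" "f : Arr D ==> Cod E (AMap F f) = OMap F (Cod D f)"
 using is_ftr by (auto simp: is_functor_def hom_def)

lemma rel_ftr_span:
 assumes R: "is_relation D R" and r: "r : tmap R"
 shows "AMap (rel_ftr D E F) R = span_rel E (AMap F (leg1 D R r)) (AMap F (leg2 D R r))"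
  and "is_mono E (pairing E (AMap F (leg1 D R r)) (AMap F (leg2 D R r)))"
proof -
 let ?S = "\<lambda>r. span_rel E (AMap F (leg1 D R r)) (AMap F (leg2 D R r))"
 have mono: "is_mono E (pairing E (AMap F (leg1 D R r)) (AMap F (leg2 D R r)))" if r: "r : tmap R" for r
 proof (rule E.pairing_monoI)
  fix N :: "'o => 'm tm set set" and ap x y
  assume N: "model E N ap" and xy: "x : N (Dom E (AMap F (leg2 D R r)))" "y : N (Dom E (AMap F (leg2 D R r)))"
   "ap (AMap F (leg1 D R r)) x = ap (AMap F (leg1 D R r)) y" "ap (AMap F (leg2 D R r)) x = ap (AMap F (leg2 D R r)) y"
  show "x = y" by (rule model.rel_legs_inj[OF reindex[OF N] R r]) (use xy D.relationD[OF R] r in simp_all)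
 qed (use D.relationD[OF R] r in simp_all)
 show "is_mono E (pairing E (AMap F (leg1 D R r)) (AMap F (leg2 D R r)))" using mono[OF r] .
 have S: "is_relation E (?S q)" "tdom (?S q) = OMap F (tdom R)" "tcod (?S q) = OMap F (tcod R)" if "q : tmap R" for q
  using mono[OF that] D.relationD[OF R] that by simp_all
 have eq: "?S q = ?S r" if q: "q : tmap R" for q
 proof (rule E.relation_eqI[OF S(1)[OF q] S(1)[OF r]])
  fix N :: "'o => 'm tm set set" and ap a b assume N: "model E N ap"
  have "model.rel E N ap (?S q) a b \<longleftrightarrow> model.rel D (\<lambda>A. N (OMap F A)) (\<lambda>f. ap (AMap F f)) R a b" if q: "q : tmap R" for q
   unfolding model.rel_rep[OF reindex[OF N] R q]
   using model.rel_span[OF N mono[OF q]] D.relationD(6-9)[OF R q] by simp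
  from this[OF q] this[OF r] show "model.rel E N ap (?S q) a b = model.rel E N ap (?S r) a b" by (simp only:)
 qed (use S q r in simp_all)
 have "(\<Union>q\<in>tmap R. tmap (?S q)) = (\<Union>q\<in>tmap R. tmap (?S r))" by (rule SUP_cong[OF refl], rule arg_cong[OF eq])
 then have "(\<Union>q\<in>tmap R. tmap (?S q)) = tmap (?S r)" using r by auto
 then show "AMap (rel_ftr D E F) R = ?S r"
  using D.relationD[OF R] r by (simp add: rel_ftr_def span_rel_def)
qed

lemma rel_ftr_simps [simp]:
 assumes R: "is_relation D R"
 shows "is_relation E (AMap (rel_ftr D E F) R)" "tdom (AMap (rel_ftr D E F) R) = OMap F (tdom R)"
  "tcod (AMap (rel_ftr D E F) R) = OMap F (tcod R)"
proof -
 obtain r where r: "r : tmap R" using D.relation_ex[OF R] by blast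
 show "is_relation E (AMap (rel_ftr D E F) R)" "tdom (AMap (rel_ftr D E F) R) = OMap F (tdom R)"
  "tcod (AMap (rel_ftr D E F) R) = OMap F (tcod R)"
  unfolding rel_ftr_span(1)[OF R r] using rel_ftr_span(2)[OF R r] D.relationD[OF R] r by simp_all
qed

lemma rel_ftr_rel:
 assumes R: "is_relation D R" and N: "model E N ap" "model D (\<lambda>A. N (OMap F A)) (\<lambda>f. ap (AMap F f))"
 shows "model.rel E N ap (AMap (rel_ftr D E F) R) a b \<longleftrightarrow> model.rel D (\<lambda>A. N (OMap F A)) (\<lambda>f. ap (AMap F f)) R a b"
proof -
 obtain r where r: "r : tmap R" using D.relation_ex[OF R] by blast
 show ?thesis
  unfolding rel_ftr_span(1)[OF R r] model.rel_rep[OF N(2) R r]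
  using model.rel_span[OF N(1) rel_ftr_span(2)[OF R r]] D.relationD(6-9)[OF R r] by simp
qed

lemma rel_ftr_ident:
 assumes A: "A : Obj D"
 shows "AMap (rel_ftr D E F) (rel_ident D A) = rel_ident E (OMap F A)"
proof (rule E.relation_eqI)
 fix N :: "'o => 'm tm set set" and ap a b assume N: "model E N ap"
 show "model.rel E N ap (AMap (rel_ftr D E F) (rel_ident D A)) a b = model.rel E N ap (rel_ident E (OMap F A)) a b"
  unfolding rel_ftr_rel[OF D.is_relation_ident[OF A] N reindex[OF N]] model.rel_rel_ident[OF N F_simps(1)[OF A]]
   model.rel_rel_ident[OF reindex[OF N] A] ..
qed (use A in simp_all)

lemma rel_ftr_comp:
 assumes R: "is_relation D R" and S: "is_relation D S" and RS: "tcod R = tdom S"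
 shows "AMap (rel_ftr D E F) (rel_comp D S R) = rel_comp E (AMap (rel_ftr D E F) S) (AMap (rel_ftr D E F) R)"
proof (rule E.relation_eqI)
 have RS': "tcod (AMap (rel_ftr D E F) R) = tdom (AMap (rel_ftr D E F) S)" using R S RS by simp
 note SR = D.is_relation_comp[OF R S RS]
 show "is_relation E (rel_comp E (AMap (rel_ftr D E F) S) (AMap (rel_ftr D E F) R))"
  using RS' R S by simp
 fix N :: "'o => 'm tm set set" and ap a b assume N: "model E N ap"
 show "model.rel E N ap (AMap (rel_ftr D E F) (rel_comp D S R)) a b =
   model.rel E N ap (rel_comp E (AMap (rel_ftr D E F) S) (AMap (rel_ftr D E F) R)) a b"
  unfolding rel_ftr_rel[OF SR N reindex[OF N]] model.rel_comp[OF reindex[OF N] R S RS]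
   model.rel_comp[OF N rel_ftr_simps(1)[OF R] rel_ftr_simps(1)[OF S] RS']
   rel_ftr_rel[OF R N reindex[OF N]] rel_ftr_rel[OF S N reindex[OF N]] rel_ftr_simps(3)[OF R] ..
qed (use R S RS in simp_all)

theorem is_functor_rel_ftr: "is_functor (Rel D) (Rel E) (rel_ftr D E F)"
 unfolding is_functor_def hom_def
 using D.is_category_Rel E.is_category_Rel rel_ftr_ident rel_ftr_comp by (simp add: rel_ftr_def[THEN arg_cong, of OMap])

end

section \<open>Isomorphisms of categories preserve regularity\<close>

locale cat_isomorphism = D: category D + E: category E
 for D :: "('p, 'n, 'y) cat_scheme" and E :: "('o, 'm, 'z) cat_scheme" +
 fixes F :: "('p, 'n, 'o, 'm) ftr" and G :: "('o, 'm, 'p, 'n) ftr"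
 assumes F: "is_functor D E F" and G: "is_functor E D G"
  and GF: "A : Obj D ==> OMap G (OMap F A) = A" "f : Arr D ==> AMap G (AMap F f) = f"
  and FG: "B : Obj E ==> OMap F (OMap G B) = B" "g : Arr E ==> AMap F (AMap G g) = g"
begin

lemma swap: "cat_isomorphism E D G F"
 by unfold_locales (use F G GF FG in simp_all)

lemma FF [simp]:
 "A : Obj D ==> OMap F A : Obj E" "f : Arr D ==> AMap F f : Arr E"
 "f : Arr D ==> Dom E (AMap F f) = OMap F (Dom D f)" "f : Arr D ==> Cod E (AMap F f) = OMap F (Cod D f)"
 using F by (auto simp: is_functor_def hom_def)

lemma F_Cmp: "[|f : Arr D; g : Arr D; Cod D f = Dom D g|] ==> AMap F (g \<cdot>\<^bsub>D\<^esub> f) = AMap F g \<cdot>\<^bsub>E\<^esub> AMap F f"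
 using F by (simp add: is_functor_def)

lemma F_inj: "[|f : Arr D; g : Arr D; AMap F f = AMap F g|] ==> f = g"
 by (metis GF(2))

lemma F_hom:
 assumes "A : Obj D" "B : Obj D"
 shows "f : hom E (OMap F A) (OMap F B) \<longleftrightarrow> (\<exists>g. g : hom D A B \<and> f = AMap F g)"
proof
 assume f: "f : hom E (OMap F A) (OMap F B)"
 interpret G: cat_isomorphism E D G F by (rule swap)
 have "AMap G f : hom D A B" using f assms GF(1) by (simp add: hom_def)
 moreover have "f = AMap F (AMap G f)" using FG(2) f by (simp add: hom_def)
 ultimately show "\<exists>g. g : hom D A B \<and> f = AMap F g" by blast
qed (auto simp: hom_def)

lemma F_Ball_Obj: "(\<forall>B\<in>Obj E. P B) \<longleftrightarrow> (\<forall>A\<in>Obj D. P (OMap F A))"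
 by (metis FF(1) FG(1) cat_isomorphism.FF(1) swap)

lemma F_ex1:
 assumes "A : Obj D" "B : Obj D" and "\<And>h. h : hom D A B ==> P h \<longleftrightarrow> Q (AMap F h)"
 shows "(\<exists>!h. h : hom D A B \<and> P h) ==> \<exists>!h. h : hom E (OMap F A) (OMap F B) \<and> Q h"
 using F_hom[OF assms(1,2)] assms(3) by (metis (no_types, lifting))

lemma terminal: "is_terminal D T ==> is_terminal E (OMap F T)"
proof -
 assume T: "is_terminal D T"
 then have T': "T : Obj D" by (simp add: is_terminal_def)
 have "\<exists>!h. h : hom E (OMap F A) (OMap F T)" if "A : Obj D" for A
  using F_ex1[of A T "\<lambda>_. True" "\<lambda>_. True"] T that T' by (simp add: is_terminal_def)
 then show ?thesis unfolding is_terminal_def F_Ball_Obj using T' by simp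
qed

lemma pullback:
 assumes P: "is_pullback D f g P p q"
 shows "is_pullback E (AMap F f) (AMap F g) (OMap F P) (AMap F p) (AMap F q)"
proof -
 note pf = D.pullback_facts[OF P]
 have "\<exists>!h. h : hom E X (OMap F P) \<and> AMap F p \<cdot>\<^bsub>E\<^esub> h = a \<and> AMap F q \<cdot>\<^bsub>E\<^esub> h = b"
  if a: "a : hom E X (OMap F (Dom D f))" and b: "b : hom E X (OMap F (Dom D g))"
   and e: "AMap F f \<cdot>\<^bsub>E\<^esub> a = AMap F g \<cdot>\<^bsub>E\<^esub> b" for X a b
 proof -
  interpret G: cat_isomorphism E D G F by (rule swap)
  obtain Y where Y: "Y : Obj D" "X = OMap F Y" using E.hom_Obj(1)[OF a] G.FF(1) FG(1) by metis
  obtain a' where a': "a' : hom D Y (Dom D f)" "a = AMap F a'" using a F_hom[OF Y(1)] pf Y(2) by (metis D.Dom_Obj)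
  obtain b' where b': "b' : hom D Y (Dom D g)" "b = AMap F b'" using b F_hom[OF Y(1)] pf Y(2) by (metis D.Dom_Obj)
  have e': "f \<cdot>\<^bsub>D\<^esub> a' = g \<cdot>\<^bsub>D\<^esub> b'"
   by (rule F_inj) (use e a' b' pf F_Cmp in "simp_all add: hom_def")
  have "\<exists>!h. h : hom D Y P \<and> p \<cdot>\<^bsub>D\<^esub> h = a' \<and> q \<cdot>\<^bsub>D\<^esub> h = b'"
   using D.pullback_ex1[OF P, of a' b'] a' b' e' by (simp add: hom_def)
  moreover have "(p \<cdot>\<^bsub>D\<^esub> h = a' \<and> q \<cdot>\<^bsub>D\<^esub> h = b') \<longleftrightarrow> (AMap F p \<cdot>\<^bsub>E\<^esub> AMap F h = a \<and> AMap F q \<cdot>\<^bsub>E\<^esub> AMap F h = b)"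
   if h: "h : hom D Y P" for h
  proof -
   have "p \<cdot>\<^bsub>D\<^esub> h : Arr D" "q \<cdot>\<^bsub>D\<^esub> h : Arr D" using h pf by (simp_all add: hom_def)
   then show ?thesis using h a' b' pf F_Cmp[of h p] F_Cmp[of h q] F_inj[of "p \<cdot>\<^bsub>D\<^esub> h" a'] F_inj[of "q \<cdot>\<^bsub>D\<^esub> h" b']
    by (auto simp: hom_def)
  qed
  ultimately show ?thesis unfolding Y(2) by (rule F_ex1[OF Y(1) pf(4), rotated 1])
 qed
 then show ?thesis unfolding is_pullback_def using pf F_Cmp[of p f] F_Cmp[of q g] by (simp add: hom_def)
qed

lemma coequalizer:
 assumes e: "is_coequalizer D f g e"
 shows "is_coequalizer E (AMap F f) (AMap F g) (AMap F e)"
proof -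
 note ef = D.coequalizer_facts[OF e]
 have "\<exists>!k. k : hom E (OMap F (Cod D e)) X \<and> k \<cdot>\<^bsub>E\<^esub> AMap F e = h"
  if h: "h : hom E (OMap F (Cod D f)) X" and eq: "h \<cdot>\<^bsub>E\<^esub> AMap F f = h \<cdot>\<^bsub>E\<^esub> AMap F g" for X h
 proof -
  interpret G: cat_isomorphism E D G F by (rule swap)
  obtain Y where Y: "Y : Obj D" "X = OMap F Y" using E.hom_Obj(2)[OF h] G.FF(1) FG(1) by metis
  obtain h' where h': "h' : hom D (Cod D f) Y" "h = AMap F h'" using h F_hom[OF _ Y(1)] ef Y(2) by (metis D.Cod_Obj)
  have eq': "h' \<cdot>\<^bsub>D\<^esub> f = h' \<cdot>\<^bsub>D\<^esub> g"
   by (rule F_inj) (use eq h' ef F_Cmp in "simp_all add: hom_def")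
  have "\<exists>!k. k : hom D (Cod D e) Y \<and> k \<cdot>\<^bsub>D\<^esub> e = h'" using e h' eq' unfolding is_coequalizer_def by blast
  moreover have "k \<cdot>\<^bsub>D\<^esub> e = h' \<longleftrightarrow> AMap F k \<cdot>\<^bsub>E\<^esub> AMap F e = h" if k: "k : hom D (Cod D e) Y" for k
  proof -
   have "k \<cdot>\<^bsub>D\<^esub> e : Arr D" using k ef by (simp add: hom_def)
   then show ?thesis using k h' ef F_Cmp[of e k] F_inj[of "k \<cdot>\<^bsub>D\<^esub> e" h'] by (auto simp: hom_def)
  qed
  ultimately show ?thesis unfolding Y(2) by (rule F_ex1[OF D.Cod_Obj[OF ef(3)] Y(1), rotated 1])
 qed
 then show ?thesis unfolding is_coequalizer_def using ef F_Cmp[of f e] F_Cmp[of g e] by simp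
qed

lemma regular_image:
 assumes reg: "regular D"
 shows "regular E"
proof -
 interpret G: cat_isomorphism E D G F by (rule swap)
 have "\<exists>e. is_coequalizer E p q e" if P: "is_pullback E f f P p q" for f P p q
 proof -
  obtain e where "is_coequalizer D (AMap G p) (AMap G q) e" using G.pullback[OF P] reg unfolding regular_def by blast
  from coequalizer[OF this] show ?thesis using E.pullback_facts[OF P] FG(2) by auto
 qed
 moreover have "regular_epi E q" if e: "regular_epi E e" and P: "is_pullback E e g P p q" for e g P p q
 proof -
  have "regular_epi D (AMap G e)" using e G.coequalizer unfolding regular_epi_def by blast
  then have "regular_epi D (AMap G q)" using G.pullback[OF P] reg unfolding regular_def by blast
  then have "regular_epi E (AMap F (AMap G q))" using coequalizer unfolding regular_epi_def by blast
  then show ?thesis using E.pullback_facts[OF P] FG(2) by simp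
 qed
 moreover have "has_finite_limits E" unfolding has_finite_limits_def
 proof (intro conjI ballI impI)
  show "\<exists>T. is_terminal E T" using reg terminal unfolding regular_def has_finite_limits_def by blast
  fix f g assume fg: "f : Arr E" "g : Arr E" "Cod E f = Cod E g"
  then have "\<exists>P p q. is_pullback D (AMap G f) (AMap G g) P p q"
   using reg unfolding regular_def has_finite_limits_def by simp
  then show "\<exists>P p q. is_pullback E f g P p q" using pullback[of "AMap G f" "AMap G g"] fg FG(2) by metis
 qed
 ultimately show ?thesis unfolding regular_def using E.is_cat by blast
qed

lemma reindex_model:
 assumes reg: "regular D" and N: "model E N ap"
 shows "model D (\<lambda>A. N (OMap F A)) (\<lambda>f. ap (AMap F f))"
proof -
 interpret model E N ap by fact
 show ?thesis
 proof unfold_locales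
  fix T assume "is_terminal D T" then show "\<exists>!x. x : N (OMap F T)" by (rule ap_terminal[OF terminal])
 next
  fix f g P p q x y assume P: "is_pullback D f g P p q" and "x : N (OMap F (Dom D f))" "y : N (OMap F (Dom D g))" "ap (AMap F f) x = ap (AMap F g) y"
  then show "\<exists>!z. z : N (OMap F P) \<and> ap (AMap F p) z = x \<and> ap (AMap F q) z = y"
   using ap_pullback[OF pullback[OF P]] D.pullback_facts[OF P] by simp
 next
  fix e y assume e: "regular_epi D e" and y: "y : N (OMap F (Cod D e))"
  have "regular_epi E (AMap F e)" using e coequalizer unfolding regular_epi_def by blast
  then show "\<exists>x\<in>N (OMap F (Dom D e)). ap (AMap F e) x = y" using ap_regular_epi[of "AMap F e" y] y D.regular_epi_Arr[OF e] by simp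
 next
  fix A x assume "A : Obj D" "x : N (OMap F A)"
  moreover then have "AMap F (Ident D A) = Ident E (OMap F A)" using F by (simp add: is_functor_def)
  ultimately show "ap (AMap F (Ident D A)) x = x" by (simp add: ap_Ident)
 qed (use reg F_Cmp in "simp_all add: ap_Cmp")
qed

lemma regular_functor: "regular D ==> regular_functor D E F"
 using regular_image reindex_model F D.category_axioms E.category_axioms
 by (intro regular_functor.intro regular_functor_axioms.intro regular_category.intro regular_category_axioms.intro)

text \<open>Passing to a model and reindexing it along both functors changes nothing.\<close>

lemma rel_ftr_inverse:
 assumes reg: "regular D" and R: "is_relation D R"
 shows "AMap (rel_ftr E D G) (AMap (rel_ftr D E F) R) = R"
proof -
 interpret G: cat_isomorphism E D G F by (rule swap)
 interpret RF: regular_functor D E F by (rule regular_functor[OF reg])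
 interpret RG: regular_functor E D G by (rule G.regular_functor[OF regular_image[OF reg]])
 note D' = RF.D.relationD[OF R]
 show ?thesis
 proof (rule RF.D.relation_eqI)
  fix N :: "'p => 'n tm set set" and ap a b assume N: "model D N ap"
  obtain r where r: "r : tmap R" using RF.D.relation_ex[OF R] by blast
  have NE: "model E (\<lambda>A. N (OMap G A)) (\<lambda>f. ap (AMap G f))" using RG.reindex[OF N] .
  have ND: "model D (\<lambda>A. N (OMap G (OMap F A))) (\<lambda>f. ap (AMap G (AMap F f)))" by (rule reindex_model[OF reg NE])
  show "model.rel D N ap (AMap (rel_ftr E D G) (AMap (rel_ftr D E F) R)) a b = model.rel D N ap R a b"
   unfolding RG.rel_ftr_rel[OF RF.rel_ftr_simps(1)[OF R] N NE] RF.rel_ftr_rel[OF R NE ND]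
    model.rel_rep[OF ND R r] model.rel_rep[OF N R r]
   using D' r GF by simp
 qed (use R GF D' in simp_all)
qed

theorem rel_ftr_equivalence:
 assumes reg: "regular D"
 shows "is_equivalence (Rel D) (Rel E) (rel_ftr D E F)"
proof (rule surjective_fully_faithful_equivalence)
 interpret G: cat_isomorphism E D G F by (rule swap)
 interpret RF: regular_functor D E F by (rule regular_functor[OF reg])
 interpret RG: regular_functor E D G by (rule G.regular_functor[OF regular_image[OF reg]])
 have O: "OMap (rel_ftr D E F) = OMap F" by (simp add: rel_ftr_def)
 show "is_functor (Rel D) (Rel E) (rel_ftr D E F)" by (rule RF.is_functor_rel_ftr)
 show "\<exists>A\<in>Obj (Rel D). OMap (rel_ftr D E F) A = B" if "B : Obj (Rel E)" for B
  using that G.FF(1)[of B] FG(1)[of B] by (auto simp: O)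
 fix A A' assume A: "A : Obj (Rel D)" "A' : Obj (Rel D)"
 show "bij_betw (AMap (rel_ftr D E F)) (hom (Rel D) A A') (hom (Rel E) (OMap (rel_ftr D E F) A) (OMap (rel_ftr D E F) A'))"
  by (rule bij_betw_byWitness[where f' = "AMap (rel_ftr E D G)"])
   (use A GF FG in "auto simp: O RF.D.hom_Rel RF.E.hom_Rel rel_ftr_inverse[OF reg] G.rel_ftr_inverse[OF regular_image[OF reg]]")
qed

end

lemma is_cat_isomorphism_inverse:
 assumes F: "is_cat_isomorphism D E F"
 obtains G where "cat_isomorphism D E F G"
proof -
 have b: "bij_betw (OMap F) (Obj D) (Obj E)" "bij_betw (AMap F) (Arr D) (Arr E)" and f: "is_functor D E F"
  using F by (simp_all add: is_cat_isomorphism_def)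
 interpret D: category D by unfold_locales (use f in "simp add: is_functor_def")
 interpret E: category E by unfold_locales (use f in "simp add: is_functor_def")
 define G where "G = \<lparr>OMap = inv_into (Obj D) (OMap F), AMap = inv_into (Arr D) (AMap F)\<rparr>"
 have FG: "OMap F (OMap G B) = B" "OMap G B : Obj D" if "B : Obj E" for B
  using bij_betw_inv_into_right[OF b(1) that] bij_betw_apply[OF bij_betw_inv_into[OF b(1)] that] by (simp_all add: G_def)
 have FGA: "AMap F (AMap G g) = g" "AMap G g : Arr D" if "g : Arr E" for g
  using bij_betw_inv_into_right[OF b(2) that] bij_betw_apply[OF bij_betw_inv_into[OF b(2)] that] by (simp_all add: G_def)
 have GF: "OMap G (OMap F A) = A" if "A : Obj D" for A using bij_betw_inv_into_left[OF b(1) that] by (simp add: G_def)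
 have GFA: "AMap G (AMap F g) = g" if "g : Arr D" for g using bij_betw_inv_into_left[OF b(2) that] by (simp add: G_def)
 have FF: "AMap F g : Arr E" "Dom E (AMap F g) = OMap F (Dom D g)" "Cod E (AMap F g) = OMap F (Cod D g)" if "g : Arr D" for g
  using f that by (simp_all add: is_functor_def hom_def)
 have dc: "Dom D (AMap G g) = OMap G (Dom E g)" "Cod D (AMap G g) = OMap G (Cod E g)" if "g : Arr E" for g
  using FF[OF FGA(2)[OF that]] FGA[OF that] GF by (metis D.Dom_Obj, metis D.Cod_Obj)
 have "is_functor E D G" unfolding is_functor_def hom_def
 proof (intro conjI ballI impI)
  fix A assume A: "A : Obj E"
  have "AMap F (Ident D (OMap G A)) = Ident E A" using f FG[OF A] by (simp add: is_functor_def)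
  then show "AMap G (Ident E A) = Ident D (OMap G A)" using GFA[of "Ident D (OMap G A)"] FG[OF A] by simp
 next
  fix g h assume gh: "g : Arr E" "h : Arr E" "Cod E g = Dom E h"
  have gh': "Cod D (AMap G g) = Dom D (AMap G h)" using dc gh by simp
  have "AMap F (AMap G h \<cdot>\<^bsub>D\<^esub> AMap G g) = h \<cdot>\<^bsub>E\<^esub> g" using f FGA gh gh' by (simp add: is_functor_def)
  then show "AMap G (h \<cdot>\<^bsub>E\<^esub> g) = AMap G h \<cdot>\<^bsub>D\<^esub> AMap G g"
   using GFA[of "AMap G h \<cdot>\<^bsub>D\<^esub> AMap G g"] FGA gh gh' by simp
 qed (use D.is_cat E.is_cat FG FGA dc in simp_all)
 then have "cat_isomorphism D E F G" by unfold_locales (use f FG FGA GF GFA in simp_all)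
 then show ?thesis by (rule that)
qed

section \<open>Relations of internal groupoids\<close>

context regular_category
begin

abbreviation arr_rel :: "(('o, 'm) igpd, (('o, 'm) igpd, 'm \<times> 'm) tarr) relation => ('o, 'm) relation" where
 "arr_rel \<equiv> AMap (rel_ftr (Gpd C) C arrows_ftr)"

lemma arrows_ftr_simps [simp]: "OMap arrows_ftr = iArr" "AMap arrows_ftr F = amap F"
 by (simp_all add: arrows_ftr_def)

text \<open>The arrow part \<open>Gpd C \<rightarrow> C\<close> is a regular functor, so it carries models of \<open>C\<close> to models of \<open>Gpd C\<close>.\<close>

lemma malcev_reindex_gpd:
 assumes mal: "malcev C" and N: "model C N ap"
 shows "model (Gpd C) (\<lambda>A. N (iArr A)) (\<lambda>F. ap (amap F))"
proof -
 interpret model C N ap by fact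
 interpret GG: regular_category "Gpd C" by unfold_locales (rule is_category_Gpd, rule malcev_regular_Gpd[OF mal])
 show ?thesis
 proof unfold_locales
  fix F x assume "F : Arr (Gpd C)" "x : N (iArr (Dom (Gpd C) F))"
  then show "ap (amap F) x : N (iArr (Cod (Gpd C) F))" using Gpd_ArrD(6-8)[of F] by simp
 next
  fix A x assume "A : Obj (Gpd C)" "x : N (iArr A)"
  then show "ap (amap (Ident (Gpd C) A)) x = x" by (simp add: ap_Ident)
 next
  fix F G x assume "F : Arr (Gpd C)" "G : Arr (Gpd C)" "Cod (Gpd C) F = Dom (Gpd C) G" "x : N (iArr (Dom (Gpd C) F))"
  then show "ap (amap (G \<bullet> F)) x = ap (amap G) (ap (amap F) x)"
   using Gpd_ArrD(6-8)[of F] Gpd_ArrD(6-8)[of G] by (simp add: ap_Cmp)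
 next
  fix T assume T: "is_terminal (Gpd C) T"
  obtain T' :: "('o, 'm) igpd" where T': "is_terminal (Gpd C) T'" "iArr T' = one C" using terminal_gpd by metis
  obtain H where H: "H : hom (Gpd C) T T'" using T' T unfolding is_terminal_def by blast
  obtain K where K: "K : hom (Gpd C) T' T" using T' T unfolding is_terminal_def by blast
  have KH: "K \<bullet> H = Ident (Gpd C) T"
  proof -
   have "K \<bullet> H : hom (Gpd C) T T" using H K GG.Cmp_Arr[of H K] by (simp add: hom_def)
   moreover have "Ident (Gpd C) T : hom (Gpd C) T T" using T GG.Ident_Arr[of T] by (simp add: hom_def is_terminal_def)
   moreover have "\<exists>!f. f : hom (Gpd C) T T" using T unfolding is_terminal_def by blast
   ultimately show ?thesis by blast
  qed
  have HD: "H : Arr (Gpd C)" "tdom H = T" "tcod H = T'" and KD: "K : Arr (Gpd C)" "tdom K = T'" "tcod K = T" using H K by (simp_all add: hom_def)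
  note Hs = Gpd_ArrD(6-8)[OF HD(1), unfolded HD T'(2)] and Ks = Gpd_ArrD(6-8)[OF KD(1), unfolded KD T'(2)]
  have e: "ap (amap K) (ap (amap H) x) = x" if "x : N (iArr T)" for x
  proof -
   have "amap K \<cdot> amap H = Ident C (iArr T)" using arg_cong[OF KH, of "\<lambda>F. amap F"] by simp
   then have "ap (amap K \<cdot> amap H) x = x" using that T by (simp add: is_terminal_def ap_Ident)
   then show ?thesis using Hs Ks that by (simp add: ap_Cmp)
  qed
  obtain y where y: "y : N (one C)" using one_elt by blast
  have "ap (amap K) y : N (iArr T)" using y Ks by simp
  moreover have "x = ap (amap K) y" if "x : N (iArr T)" for x
   using e[OF that] one_eq[OF _ y, of "ap (amap H) x"] that Hs by simp
  ultimately show "\<exists>!x. x : N (iArr T)" by blast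
 next
  fix F G P p q x y
  assume P: "is_pullback (Gpd C) F G P p q" and "x : N (iArr (Dom (Gpd C) F))" "y : N (iArr (Dom (Gpd C) G))"
   "ap (amap F) x = ap (amap G) y"
  then show "\<exists>!z. z : N (iArr P) \<and> ap (amap p) z = x \<and> ap (amap q) z = y"
   using gpd_pullback_elts[OF P, of x y] by simp
 next
  fix E y assume "regular_epi (Gpd C) E" "y : N (iArr (Cod (Gpd C) E))"
  then show "\<exists>x\<in>N (iArr (Dom (Gpd C) E)). ap (amap E) x = y"
   using malcev_regular_epi_surjective[OF mal _ N] by simp
 qed
qed

lemma malcev_regular_functor:
 assumes mal: "malcev C"
 shows "regular_functor (Gpd C) C arrows_ftr"
proof -
 interpret GG: regular_category "Gpd C" by unfold_locales (rule is_category_Gpd, rule malcev_regular_Gpd[OF mal])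
 have f: "is_functor (Gpd C) C arrows_ftr"
  unfolding is_functor_def using is_category_Gpd is_cat Gpd_ArrD(6-8) by (simp add: hom_def)
 show ?thesis
  by (intro regular_functor.intro regular_functor_axioms.intro)
   (use f malcev_reindex_gpd[OF mal] GG.regular_category_axioms regular_category_axioms in simp_all)
qed

lemma gpd_monoI:
 assumes M: "M : Arr (Gpd C)" and m: "is_mono C (amap M)"
 shows "is_mono (Gpd C) M"
 unfolding is_mono_def
proof (intro conjI allI ballI impI M)
 fix X F G assume F: "F : hom (Gpd C) X (Dom (Gpd C) M)" and G: "G : hom (Gpd C) X (Dom (Gpd C) M)" and e: "M \<bullet> F = M \<bullet> G"
 have FG: "F : Arr (Gpd C)" "G : Arr (Gpd C)" "tdom F = X" "tcod F = tdom M" "tdom G = X" "tcod G = tdom M" using F G by (simp_all add: hom_def)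
 note FD = Gpd_ArrD(6-8)[OF FG(1)] and GD = Gpd_ArrD(6-8)[OF FG(2)] and MD = Gpd_ArrD(6-8)[OF M]
 have "amap F = amap G"
  by (rule is_monoD[OF m]) (use arg_cong[OF e, of "\<lambda>F. amap F"] FG FD GD MD in simp_all)
 then show "F = G" by (intro Gpd_arr_eqI) (use FG in simp_all)
qed

lemma RelGpd_to_GRel_simps:
 "OMap (RelGpd_to_GRel C) A = A"
 "AMap (RelGpd_to_GRel C) R = \<lparr>tdom = tdom R, tcod = tcod R, tmap = arr_rel R\<rparr>"
 by (simp_all add: RelGpd_to_GRel_def)

context
 assumes mal: "malcev C"
begin

interpretation U: regular_functor "Gpd C" C arrows_ftr by (rule malcev_regular_functor[OF mal])

text \<open>The legs of a relation of groupoids are functors, and functors preserve inverses and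
 identities.\<close>

lemma RelGpd_respects_inverses:
 assumes R: "is_relation (Gpd C) R"
 shows "respects_inverses C (tdom R) (tcod R) (arr_rel R)"
proof -
 let ?A = "tdom R" and ?B = "tcod R"
 have AB: "internal_groupoid C ?A" "internal_groupoid C ?B" using U.D.relationD(1,2)[OF R] by simp_all
 obtain r where r: "r : tmap R" using U.D.relation_ex[OF R] by blast
 let ?l = "leg1 (Gpd C) R r" and ?k = "leg2 (Gpd C) R r"
 have l: "?l : Arr (Gpd C)" "tdom ?l = tdom r" "tcod ?l = ?A" and k: "?k : Arr (Gpd C)" "tdom ?k = tdom r" "tcod ?k = ?B"
  using U.D.relationD(6-11)[OF R r] by simp_all
 note lD = Gpd_ArrD[OF l(1), unfolded l] and kD = Gpd_ArrD[OF k(1), unfolded k]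
 have "inverse_closed N ap ?A ?B (arr_rel R)" if N: "canon N ap" for N ap
 proof -
  interpret model C N ap by fact
  interpret G: gpd_elts C N ap "tdom r" by unfold_locales (rule lD(1))
  have rel: "rel (arr_rel R) a b \<longleftrightarrow> (\<exists>z\<in>N (iArr (tdom r)). ap (amap ?l) z = a \<and> ap (amap ?k) z = b)" for a b
   using U.rel_ftr_rel[OF R N U.reindex[OF N]] model.rel_rep[OF U.reindex[OF N] R r] by simp
  note lF = lD(9)[OF N] and kF = kD(9)[OF N]
  show ?thesis unfolding inverse_closed_def
  proof (intro allI impI conjI)
   fix a b assume "rel (arr_rel R) a b"
   then obtain z where z: "z : N (iArr (tdom r))" "a = ap (amap ?l) z" "b = ap (amap ?k) z" unfolding rel by auto
   have "ap (amap ?l) (ap (iInv (tdom r)) z) = ap (iInv ?A) a" "ap (amap ?k) (ap (iInv (tdom r)) z) = ap (iInv ?B) b"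
    unfolding z(2,3) by (rule elt_functor_inverse[OF lD(1,2) lF lD(3,4,6-8) z(1)], rule elt_functor_inverse[OF kD(1,2) kF kD(3,4,6-8) z(1)])
   then show "rel (arr_rel R) (ap (iInv ?A) a) (ap (iInv ?B) b)" unfolding rel by (intro bexI[OF _ G.i_in[OF z(1)]] conjI)
   have "ap (amap ?l) (ap (iUnit (tdom r)) (ap (iSrc (tdom r)) z)) = ap (iUnit ?A) (ap (iSrc ?A) a)"
    "ap (amap ?k) (ap (iUnit (tdom r)) (ap (iSrc (tdom r)) z)) = ap (iUnit ?B) (ap (iSrc ?B) b)"
    using elt_functorD(1,3)[OF lF] elt_functorD(1,3)[OF kF] z by simp_all
   then show "rel (arr_rel R) (ap (iUnit ?A) (ap (iSrc ?A) a)) (ap (iUnit ?B) (ap (iSrc ?B) b))"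
    unfolding rel by (intro bexI[OF _ G.u_in[OF G.s_in[OF z(1)]]] conjI)
  qed
 qed
 then show ?thesis using respects_inverses_iff[OF AB] U.rel_ftr_simps[OF R] by simp
qed

lemma malcev_is_functor_RelGpd_to_GRel: "is_functor (Rel (Gpd C)) (GRel C) (RelGpd_to_GRel C)"
 unfolding is_functor_def hom_def RelGpd_to_GRel_simps
proof (intro conjI ballI impI U.D.is_category_Rel is_category_GRel)
 fix A assume "A : Obj (Rel (Gpd C))"
 then have A: "A : Obj (Gpd C)" using U.D.Rel_simps(1) by simp
 then show "A : Obj (GRel C)" by simp
 show "\<lparr>tdom = tdom (Ident (Rel (Gpd C)) A), tcod = tcod (Ident (Rel (Gpd C)) A),
   tmap = arr_rel (Ident (Rel (Gpd C)) A)\<rparr> = Ident (GRel C) A"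
  using U.rel_ftr_ident[OF A] U.D.tdom_tcod_graph(3,4)[OF A] U.D.Rel_simps(5) by simp
next
 fix R assume "R : Arr (Rel (Gpd C))"
 then have R: "is_relation (Gpd C) R" using U.D.Rel_simps(2) by simp
 show "\<lparr>tdom = tdom R, tcod = tcod R, tmap = arr_rel R\<rparr> \<in>
   {f : Arr (GRel C). Dom (GRel C) f = Dom (Rel (Gpd C)) R \<and> Cod (GRel C) f = Cod (Rel (Gpd C)) R}"
  using U.D.relationD(1,2)[OF R] U.rel_ftr_simps[OF R] RelGpd_respects_inverses[OF R] U.D.Rel_simps(3,4) by simp
next
 fix R S assume "R : Arr (Rel (Gpd C))" "S : Arr (Rel (Gpd C))" and "Cod (Rel (Gpd C)) R = Dom (Rel (Gpd C)) S"
 then have R: "is_relation (Gpd C) R" "is_relation (Gpd C) S" "tcod R = tdom S" using U.D.Rel_simps(2-4) by simp_all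
 show "\<lparr>tdom = tdom (S \<cdot>\<^bsub>Rel (Gpd C)\<^esub> R), tcod = tcod (S \<cdot>\<^bsub>Rel (Gpd C)\<^esub> R),
   tmap = arr_rel (S \<cdot>\<^bsub>Rel (Gpd C)\<^esub> R)\<rparr> =
  \<lparr>tdom = tdom S, tcod = tcod S, tmap = arr_rel S\<rparr> \<cdot>\<^bsub>GRel C\<^esub>
  \<lparr>tdom = tdom R, tcod = tcod R, tmap = arr_rel R\<rparr>"
  using U.rel_ftr_comp[OF R] U.D.tdom_tcod_simps(5,6) U.D.Rel_simps(6) by simp
qed

text \<open>A relation of groupoids is determined by its relation of arrows: representing monomorphisms factor
through one another as soon as they do so on arrows.\<close>

lemma RelGpd_le:
 assumes R: "is_relation (Gpd C) R" and S: "is_relation (Gpd C) S" and eq: "tdom R = tdom S" "tcod R = tcod S"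
  and e: "arr_rel R = arr_rel S"
  and rs: "r : tmap R" "s : tmap S"
 obtains H where "H : Arr (Gpd C)" "tdom H = tdom r" "tcod H = tdom s" "s \<bullet> H = r"
proof -
 have r: "r : Arr (Gpd C)" "is_mono (Gpd C) r" "tcod r = prd (Gpd C) (tdom R) (tcod R)" using U.D.relationD(3-5)[OF R rs(1)] by simp_all
 have s: "s : Arr (Gpd C)" "is_mono (Gpd C) s" "tcod s = prd (Gpd C) (tdom R) (tcod R)" using U.D.relationD(3-5)[OF S rs(2)] eq by simp_all
 note rD = Gpd_ArrD(6-8)[OF r(1)] and sD = Gpd_ArrD(6-8)[OF s(1)]
 have AB: "tdom R : Obj (Gpd C)" "tcod R : Obj (Gpd C)" using U.D.relationD(1,2)[OF R] .
 have inj: "x = y" if "canon N ap" "x : N (iArr (tdom s))" "y : N (iArr (tdom s))" "ap (amap s) x = ap (amap s) y"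
  for N ap x y using gpd_mono_inj[OF s(2) that] .
 have m: "is_mono C (amap s)"
  by (rule is_monoI) (use sD inj in simp_all)
 obtain h where h: "h : Arr C" "Dom C h = Dom C (amap r)" "Cod C h = Dom C (amap s)" "amap s \<cdot> h = amap r"
 proof (rule mono_factorI[OF m rD(1)])
  show "Cod C (amap r) = Cod C (amap s)" using rD sD r s by simp
  fix N ap x assume N: "canon N ap" and x: "x : N (Dom C (amap r))"
  interpret model C N ap by fact
  interpret G: model "Gpd C" "\<lambda>A. N (iArr A)" "\<lambda>F. ap (amap F)" using U.reindex[OF N] by simp
  have x': "x : N (iArr (tdom r))" using x rD by simp
  have rel: "G.rel R a b = G.rel S a b" for a b
   using U.rel_ftr_rel[OF R N U.reindex[OF N], of a b] U.rel_ftr_rel[OF S N U.reindex[OF N], of a b] e by simp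
  have "G.rel R (ap (amap (leg1 (Gpd C) R r)) x) (ap (amap (leg2 (Gpd C) R r)) x)"
   unfolding G.rel_rep[OF R rs(1)] using x' by auto
  then obtain z where z: "z : N (iArr (tdom s))" "ap (amap (leg1 (Gpd C) S s)) z = ap (amap (leg1 (Gpd C) R r)) x"
   "ap (amap (leg2 (Gpd C) S s)) z = ap (amap (leg2 (Gpd C) R r)) x"
   unfolding rel G.rel_rep[OF S rs(2)] by auto
  have pr: "pr1 (Gpd C) (tdom R) (tcod R) : Arr (Gpd C)" "pr2 (Gpd C) (tdom R) (tcod R) : Arr (Gpd C)"
   "tdom (pr1 (Gpd C) (tdom R) (tcod R)) = prd (Gpd C) (tdom R) (tcod R)" "tdom (pr2 (Gpd C) (tdom R) (tcod R)) = prd (Gpd C) (tdom R) (tcod R)"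
   using U.D.prd_simps[OF AB] by simp_all
  have "ap (amap s) z = ap (amap r) x"
  proof (rule G.prd_elt_eq[OF AB])
   show "ap (amap s) z : N (iArr (prd (Gpd C) (tdom R) (tcod R)))" "ap (amap r) x : N (iArr (prd (Gpd C) (tdom R) (tcod R)))"
    using z(1) x' rD sD r s by simp_all
   show "ap (amap (pr1 (Gpd C) (tdom R) (tcod R))) (ap (amap s) z) = ap (amap (pr1 (Gpd C) (tdom R) (tcod R))) (ap (amap r) x)"
    "ap (amap (pr2 (Gpd C) (tdom R) (tcod R))) (ap (amap s) z) = ap (amap (pr2 (Gpd C) (tdom R) (tcod R))) (ap (amap r) x)"
    using z(2,3) unfolding leg1_def leg2_def eq[symmetric]
    using G.ap_Cmp[OF s(1) pr(1), of z] G.ap_Cmp[OF r(1) pr(1), of x] G.ap_Cmp[OF s(1) pr(2), of z] G.ap_Cmp[OF r(1) pr(2), of x] z(1) x' r s pr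
    by simp_all
  qed
  then show "ap (amap r) x : img (amap s)" unfolding img_def using z(1) sD by auto
 qed
 show ?thesis
 proof (rule gpd_lift[OF s(1) r(1) _ inj, where h = h])
  show "tcod s = tcod r" using r s by simp
  show "h : Arr C" "Dom C h = iArr (tdom r)" "Cod C h = iArr (tdom s)" "amap s \<cdot> h = amap r" using h rD sD by simp_all
 qed (use that in blast)+
qed

lemma RelGpd_to_GRel_inj:
 assumes R: "is_relation (Gpd C) R" and S: "is_relation (Gpd C) S" and eq: "tdom R = tdom S" "tcod R = tcod S"
  and e: "arr_rel R = arr_rel S"
 shows "R = S"
proof -
 obtain r where r: "r : tmap R" using U.D.relation_ex[OF R] by blast
 obtain s where s: "s : tmap S" using U.D.relation_ex[OF S] by blast
 obtain H where H: "H : Arr (Gpd C)" "tdom H = tdom r" "tcod H = tdom s" "s \<bullet> H = r"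
  using RelGpd_le[OF R S eq e r s] by blast
 obtain K where K: "K : Arr (Gpd C)" "tdom K = tdom s" "tcod K = tdom r" "r \<bullet> K = s"
  using RelGpd_le[OF S R eq[symmetric] e[symmetric] s r] by blast
 have rm: "is_mono (Gpd C) r" "is_mono (Gpd C) s" "tcod s = tcod r" using U.D.relationD(3,5)[OF R r] U.D.relationD(3,5)[OF S s] eq by simp_all
 have "is_iso (Gpd C) H"
  by (rule U.D.mutual_factor_iso[OF rm(1,2) H(1) _ _ H(4) K(1) _ _ K(4)]) (use H(2,3) K(2,3) in simp_all)
 then have "s : sub_class (Gpd C) r" unfolding sub_class_def using rm H by (auto simp: hom_def)
 then have "sub_class (Gpd C) s = sub_class (Gpd C) r" by (rule U.D.sub_class_eqI[OF rm(1)])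
 then have "tmap R = tmap S" using U.D.relationD(12)[OF R r] U.D.relationD(12)[OF S s] by simp
 then show ?thesis using eq by (cases R, cases S) simp
qed

text \<open>A relation that respects inverses is closed under identities and inverses as a subobject of
 the arrows of the product groupoid. In a Mal'cev category it is then a subgroupoid.\<close>

lemma RelGpd_to_GRel_surj:
 assumes A: "internal_groupoid C A" and B: "internal_groupoid C B"
  and R: "is_relation C R" "tdom R = iArr A" "tcod R = iArr B" "respects_inverses C A B R"
 obtains S where "is_relation (Gpd C) S" "tdom S = A" "tcod S = B" "arr_rel S = R"
proof -
 have AB: "A : Obj (Gpd C)" "B : Obj (Gpd C)" using A B by simp_all
 let ?Q = "prd (Gpd C) A B" and ?\<pi> = "pr1 (Gpd C) A B" and ?\<rho> = "pr2 (Gpd C) A B"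
 have P: "?\<pi> : Arr (Gpd C)" "tdom ?\<pi> = ?Q" "tcod ?\<pi> = A" "?\<rho> : Arr (Gpd C)" "tdom ?\<rho> = ?Q" "tcod ?\<rho> = B" and Q: "internal_groupoid C ?Q"
  using U.D.prd_simps[OF AB] by simp_all
 let ?p = "amap ?\<pi>" and ?q = "amap ?\<rho>"
 note pD = Gpd_ArrD[OF P(1), unfolded P(2,3)] and qD = Gpd_ArrD[OF P(4), unfolded P(5,6)]
 obtain j where j: "is_mono C j" "j : Arr C" "Cod C j = iArr ?Q" and
  J: "\<And>N ap z. [|canon N ap; z : N (iArr ?Q)|] ==> z : img_at N ap j \<longleftrightarrow> rel_at N ap R (ap ?p z) (ap ?q z)"
  using comprehension[OF R(1), of ?p ?q] pD qD R(2,3) by (metis (no_types, lifting))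
 have cl: "ap (iUnit ?Q) (ap (iSrc ?Q) a) : img_at N ap j \<and> ap (iUnit ?Q) (ap (iTgt ?Q) a) : img_at N ap j \<and> ap (iInv ?Q) a : img_at N ap j"
  if N: "canon N ap" and a: "a : img_at N ap j" for N ap a
 proof -
  interpret model C N ap by fact
  interpret Q: gpd_elts C N ap ?Q by unfold_locales (rule Q)
  have aQ: "a : N (iArr ?Q)" using a j by (auto simp: img_def)
  note pF = elt_functorD[OF pD(9)[OF N]] and qF = elt_functorD[OF qD(9)[OF N]]
  have ic: "inverse_closed N ap A B R" using respects_inverses_iff[OF A B R(1-3)] R(4) N by blast
  have inv: "z : img j ==> z : N (iArr ?Q) ==> ap (iInv ?Q) z : img j" for z
  proof -
   assume z: "z : img j" "z : N (iArr ?Q)"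
   have "rel R (ap (iInv A) (ap ?p z)) (ap (iInv B) (ap ?q z))" using ic J[OF N z(2)] z(1) unfolding inverse_closed_def by blast
   then have "rel R (ap ?p (ap (iInv ?Q) z)) (ap ?q (ap (iInv ?Q) z))"
    using elt_functor_inverse[OF pD(1,2) pD(9)[OF N] pD(3,4,6-8) z(2)] elt_functor_inverse[OF qD(1,2) qD(9)[OF N] qD(3,4,6-8) z(2)] by simp
   then show ?thesis using J[OF N Q.i_in[OF z(2)]] by simp
  qed
  have src: "z : img j ==> z : N (iArr ?Q) ==> ap (iUnit ?Q) (ap (iSrc ?Q) z) : img j" for z
  proof -
   assume z: "z : img j" "z : N (iArr ?Q)"
   have "rel R (ap (iUnit A) (ap (iSrc A) (ap ?p z))) (ap (iUnit B) (ap (iSrc B) (ap ?q z)))" using ic J[OF N z(2)] z(1) unfolding inverse_closed_def by blast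
   then have "rel R (ap ?p (ap (iUnit ?Q) (ap (iSrc ?Q) z))) (ap ?q (ap (iUnit ?Q) (ap (iSrc ?Q) z)))"
    using pF(1,3) qF(1,3) z(2) by simp
   then show ?thesis using J[OF N Q.u_in[OF Q.s_in[OF z(2)]]] by simp
  qed
  show ?thesis using src[OF a aQ] inv[OF a aQ] src[OF inv[OF a aQ] Q.i_in[OF aQ]] aQ by simp
 qed
 obtain M where M: "M : Arr (Gpd C)" "tcod M = ?Q" "amap M = j"
 proof (rule subgroupoid_ex[OF Q j(1,3)])
  fix N ap g f
  assume N: "canon N ap" and gf: "g : img_at N ap j" "f : img_at N ap j" "ap (iSrc ?Q) g = ap (iTgt ?Q) f"
  show "mcomp_at N ap ?Q g f : img_at N ap j"
   by (rule malcev_subgraph[OF mal _ j(1,3) _ N gf]) (use Q cl in simp_all)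
 qed (use cl in blast)+
 have Mm: "is_mono (Gpd C) M" using gpd_monoI[OF M(1)] j(1) unfolding M(3) .
 let ?S = "\<lparr>tdom = A, tcod = B, tmap = sub_class (Gpd C) M\<rparr>"
 have S: "is_relation (Gpd C) ?S" unfolding is_relation_def is_subobject_def using AB Mm M(2) by auto
 have Ms: "M : tmap ?S" using U.D.sub_class_self[OF Mm] by simp
 have jd: "Dom C j = iArr (tdom M)" using Gpd_ArrD(7)[OF M(1)] M(3) by simp
 have "arr_rel ?S = R"
 proof (rule relation_eqI[OF U.rel_ftr_simps(1)[OF S] R(1)])
  fix N ap a b assume N: "canon N ap"
  interpret model C N ap by fact
  interpret G: model "Gpd C" "\<lambda>A. N (iArr A)" "\<lambda>F. ap (amap F)" using U.reindex[OF N] by simp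
  have "rel (arr_rel ?S) a b \<longleftrightarrow> G.rel ?S a b"
   using U.rel_ftr_rel[OF S N U.reindex[OF N], of a b] by simp
  also have "\<dots> \<longleftrightarrow> (\<exists>z\<in>N (Dom C j). ap ?p (ap j z) = a \<and> ap ?q (ap j z) = b)"
   using G.ap_Cmp[OF M(1) P(1)] G.ap_Cmp[OF M(1) P(4)] M P unfolding G.rel_rep[OF S Ms] leg1_def leg2_def by (simp add: jd)
  also have "\<dots> \<longleftrightarrow> (\<exists>w\<in>img j. ap ?p w = a \<and> ap ?q w = b)" by (simp add: img_def)
  also have "\<dots> \<longleftrightarrow> rel R a b"
  proof
   assume "\<exists>w\<in>img j. ap ?p w = a \<and> ap ?q w = b"
   then obtain w where w: "w : img j" "ap ?p w = a" "ap ?q w = b" by blast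
   have "w : N (iArr ?Q)" using w(1) j by (auto simp: img_def)
   then show "rel R a b" using J[OF N] w by blast
  next
   assume ab: "rel R a b"
   have i: "a : N (iArr A)" "b : N (iArr B)" using rel_in[OF R(1) ab] R(2,3) by simp_all
   note pp = G.pp_simps[OF AB, OF i]
   have "G.pp A B a b : img j" using J[OF N pp(1)] ab pp(2,3) by simp
   then show "\<exists>w\<in>img j. ap ?p w = a \<and> ap ?q w = b" using pp(2,3) by blast
  qed
  finally show "rel (arr_rel ?S) a b = rel R a b" .
 qed (use U.rel_ftr_simps[OF S] R in simp_all)
 then show ?thesis using that[of ?S] S by simp
qed

theorem malcev_RelGpd_isomorphism: "is_cat_isomorphism (Rel (Gpd C)) (GRel C) (RelGpd_to_GRel C)"
 unfolding is_cat_isomorphism_def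
proof (intro conjI malcev_is_functor_RelGpd_to_GRel)
 show "bij_betw (OMap (RelGpd_to_GRel C)) (Obj (Rel (Gpd C))) (Obj (GRel C))"
  by (intro bij_betwI') (use U.D.Rel_simps(1) in "auto simp: RelGpd_to_GRel_simps")
 show "bij_betw (AMap (RelGpd_to_GRel C)) (Arr (Rel (Gpd C))) (Arr (GRel C))"
 proof (rule bij_betwI')
  fix R S assume "R : Arr (Rel (Gpd C))" "S : Arr (Rel (Gpd C))"
  then show "AMap (RelGpd_to_GRel C) R = AMap (RelGpd_to_GRel C) S \<longleftrightarrow> R = S"
   using RelGpd_to_GRel_inj[of R S] U.D.Rel_simps(2) by (auto simp: RelGpd_to_GRel_simps)
 next
  fix R assume "R : Arr (Rel (Gpd C))"
  then have R: "is_relation (Gpd C) R" using U.D.Rel_simps(2) by simp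
  show "AMap (RelGpd_to_GRel C) R : Arr (GRel C)"
   using U.D.relationD(1,2)[OF R] U.rel_ftr_simps[OF R] RelGpd_respects_inverses[OF R] by (simp add: RelGpd_to_GRel_simps)
 next
  fix R assume "R : Arr (GRel C)"
  then obtain S where "is_relation (Gpd C) S" "tdom S = tdom R" "tcod S = tcod R" "arr_rel S = tmap R"
   using RelGpd_to_GRel_surj[of "tdom R" "tcod R" "tmap R"] by (metis GRel_simps(2))
  then show "\<exists>S\<in>Arr (Rel (Gpd C)). R = AMap (RelGpd_to_GRel C) S"
   using U.D.Rel_simps(2) by (intro bexI[of _ S]) (simp_all add: RelGpd_to_GRel_simps)
 qed
qed

end

end

section \<open>Internal categories and internal groupoids\<close>

context regular_category
begin

lemma truncate_simps [simp]:
 "iObj (icat.truncate A) = iObj A" "iArr (icat.truncate A) = iArr A" "iSrc (icat.truncate A) = iSrc A"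
 "iTgt (icat.truncate A) = iTgt A" "iUnit (icat.truncate A) = iUnit A" "iComp (icat.truncate A) = iComp A"
 by (simp_all add: icat.truncate_def)

lemma internal_category_truncate [simp]: "internal_category C (icat.truncate A) \<longleftrightarrow> internal_category C A"
 unfolding internal_category_def cp1_def cp2_def icomp_def comp_pairs_def truncate_simps ..

lemma internal_functor_truncate [simp]:
 "internal_functor C (icat.truncate A) (icat.truncate B) f \<longleftrightarrow> internal_functor C A B f"
 unfolding internal_functor_def cp1_def cp2_def icomp_def truncate_simps ..

lemma Cat_simps [simp]:
 "A : Obj (Cat C) \<longleftrightarrow> internal_category C A"
 "F : Arr (Cat C) \<longleftrightarrow> internal_category C (tdom F) \<and> internal_category C (tcod F) \<and> internal_functor C (tdom F) (tcod F) (tmap F)"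
 "Dom (Cat C) = tdom" "Cod (Cat C) = tcod"
 "Ident (Cat C) A = \<lparr>tdom = A, tcod = A, tmap = (Ident C (iObj A), Ident C (iArr A))\<rparr>"
 "Cmp (Cat C) G F = \<lparr>tdom = tdom F, tcod = tcod G, tmap = (omap G \<cdot> omap F, amap G \<cdot> amap F)\<rparr>"
 by (simp_all add: Cat_def ifun_ident_def ifun_comp_def)

lemma gpd_to_cat_simps [simp]:
 "OMap gpd_to_cat A = icat.truncate A"
 "AMap gpd_to_cat F = \<lparr>tdom = icat.truncate (tdom F), tcod = icat.truncate (tcod F), tmap = tmap F\<rparr>"
 by (simp_all add: gpd_to_cat_def)

text \<open>Inverses are unique, so that an internal category is a groupoid in at most one way.\<close>

lemma gpd_truncate_inj:
 fixes A B :: "('o, 'm) igpd"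
 assumes A: "internal_groupoid C A" and B: "internal_groupoid C B" and e: "icat.truncate A = icat.truncate B"
 shows "A = B"
proof -
 have eq: "iObj A = iObj B" "iArr A = iArr B" "iSrc A = iSrc B" "iTgt A = iTgt B" "iUnit A = iUnit B" "iComp A = iComp B"
  using e by (simp_all add: icat.truncate_def)
 have "iInv A = iInv B"
 proof (rule arr_eqI)
  fix N ap x assume N: "canon N ap" and x: "x : N (Dom C (iInv B))"
  interpret model C N ap by fact
  have x: "x : N (iArr B)" using x B by simp
  interpret A: gpd_elts C N ap A by unfold_locales (rule A)
  interpret B: gpd_elts C N ap B by unfold_locales (rule B)
  have m: "mcomp A = mcomp B" by (intro ext) (simp add: mcomp_def eq)
  show "ap (iInv A) x = ap (iInv B) x"
   using B.i_unique[OF x] A.i_in[of x] A.s_i[of x] A.c_i_left[of x] x unfolding m eq by simp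
 qed (use A B eq in simp_all)
 then show ?thesis using eq by (intro igpd.equality) simp_all
qed

context
 assumes mal: "malcev C"
begin

lemma cat_gpd_ex:
 fixes A :: "('o, 'm) icat"
 assumes A: "internal_category C A"
 obtains G :: "('o, 'm) igpd" where "internal_groupoid C G" "icat.truncate G = A"
proof -
 obtain i where i: "i : Arr C" "Dom C i = iArr A" "Cod C i = iArr A" and
  I: "\<And>N ap. canon N ap ==>
   set_gpd (N (iObj A)) (N (iArr A)) (ap (iSrc A)) (ap (iTgt A)) (ap (iUnit A)) (mcomp_at N ap A) (ap i)"
  using malcev_category_groupoid[OF mal A] by blast
 define G :: "('o, 'm) igpd" where
  "G = \<lparr>iObj = iObj A, iArr = iArr A, iSrc = iSrc A, iTgt = iTgt A, iUnit = iUnit A, iComp = iComp A, iInv = i\<rparr>"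
 have t: "icat.truncate G = A" by (simp add: G_def icat.truncate_def)
 have "internal_groupoid C G"
 proof (rule internal_groupoidI)
  show "internal_category C G" using A unfolding t[symmetric] by simp
  fix N ap assume N: "canon N ap"
  interpret model C N ap by fact
  have "mcomp G = mcomp A" by (intro ext) (simp add: mcomp_def G_def)
  then show "elt_gpd G" using I[OF N] by (simp add: G_def)
 qed (use i in "simp_all add: G_def")
 then show ?thesis using t by (rule that)
qed

lemma cat_functor_gpd_functor:
 assumes AB: "internal_groupoid C A" "internal_groupoid C B" and f: "internal_functor C A B f"
 shows "\<lparr>tdom = A, tcod = B, tmap = f\<rparr> : Arr (Gpd C)"
proof (rule Gpd_ArrI)
 fix N ap assume N: "canon N ap"
 show "model.elt_functor C N ap (tdom \<lparr>tdom = A, tcod = B, tmap = f\<rparr>) (tcod \<lparr>tdom = A, tcod = B, tmap = f\<rparr>)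
   (fst (tmap \<lparr>tdom = A, tcod = B, tmap = f\<rparr>)) (snd (tmap \<lparr>tdom = A, tcod = B, tmap = f\<rparr>))"
  using model.internal_functor_elts[OF N, of A B "fst f" "snd f"] AB f by simp
qed (use AB f in "auto simp: internal_functor_def hom_def")

lemma gpd_to_cat_lift:
 assumes F: "F : Arr (Cat C)"
 obtains F' where "F' : Arr (Gpd C)" "AMap gpd_to_cat F' = F"
proof -
 have FD: "internal_category C (tdom F)" "internal_category C (tcod F)" "internal_functor C (tdom F) (tcod F) (tmap F)" using F by simp_all
 obtain A B :: "('o, 'm) igpd" where A: "internal_groupoid C A" "icat.truncate A = tdom F" and B: "internal_groupoid C B" "icat.truncate B = tcod F"
  using cat_gpd_ex[OF FD(1)] cat_gpd_ex[OF FD(2)] by metis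
 have "internal_functor C A B (tmap F)" using FD(3) unfolding A(2)[symmetric] B(2)[symmetric] by simp
 from cat_functor_gpd_functor[OF A(1) B(1) this] show ?thesis by (rule that) (use A B in simp)
qed

lemma gpd_to_cat_Arr: "F : Arr (Gpd C) ==> AMap gpd_to_cat F : Arr (Cat C)"
 by (simp add: Gpd_def)

lemma gpd_to_cat_Cmp: "AMap gpd_to_cat (G \<bullet> F) = AMap gpd_to_cat G \<cdot>\<^bsub>Cat C\<^esub> AMap gpd_to_cat F"
 by simp

lemma gpd_to_cat_composable:
 assumes "F : Arr (Gpd C)" "G : Arr (Gpd C)" "Cod (Cat C) (AMap gpd_to_cat F) = Dom (Cat C) (AMap gpd_to_cat G)"
 shows "Cod (Gpd C) F = Dom (Gpd C) G"
 using gpd_truncate_inj[OF Gpd_ArrD(2)[OF assms(1)] Gpd_ArrD(1)[OF assms(2)]] assms(3) by simp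

text \<open>The laws are transported along \<open>gpd_to_cat\<close>, which is bijective and compatible with composition.\<close>

lemma malcev_is_category_Cat: "is_category (Cat C)"
proof -
 interpret GG: category "Gpd C" by unfold_locales (rule is_category_Gpd)
 have "\<exists>A :: ('o, 'm) igpd. A : Obj (Gpd C) \<and> icat.truncate A = B" if "B : Obj (Cat C)" for B :: "('o, 'm) icat"
  using cat_gpd_ex[of B] that by (metis Cat_simps(1) Gpd_simps(1))
 note obj = this and [simp del] = gpd_to_cat_simps(2) Gpd_simps(5) Cat_simps(2,6)
 show ?thesis unfolding is_category_def
 proof (intro conjI ballI impI)
  fix f assume "f : Arr (Cat C)"
  then show "Dom (Cat C) f : Obj (Cat C)" "Cod (Cat C) f : Obj (Cat C)" by (simp_all add: Cat_simps(2))
 next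
  fix B assume "B : Obj (Cat C)"
  then obtain A :: "('o, 'm) igpd" where A: "A : Obj (Gpd C)" "icat.truncate A = B" using obj by blast
  have "Ident (Gpd C) A : Arr (Gpd C)" using A(1) by (rule GG.Ident_Arr)
  from gpd_to_cat_Arr[OF this] show "Ident (Cat C) B : hom (Cat C) B B" using A(2)
   by (auto simp add: hom_def gpd_to_cat_simps(2))
 next
  fix f g assume "f : Arr (Cat C)" "g : Arr (Cat C)" and c: "Cod (Cat C) f = Dom (Cat C) g"
  then obtain f' g' where fg: "f' : Arr (Gpd C)" "AMap gpd_to_cat f' = f" "g' : Arr (Gpd C)" "AMap gpd_to_cat g' = g"
   using gpd_to_cat_lift by metis
  have "g' \<bullet> f' : Arr (Gpd C)" using fg c gpd_to_cat_composable[of f' g'] by (intro GG.Cmp_Arr) auto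
  from gpd_to_cat_Arr[OF this] show "g \<cdot>\<^bsub>Cat C\<^esub> f : hom (Cat C) (Dom (Cat C) f) (Cod (Cat C) g)"
   unfolding gpd_to_cat_Cmp fg hom_def by (simp add: Cat_simps(6))
 next
  fix f assume "f : Arr (Cat C)"
  then obtain f' where f: "f' : Arr (Gpd C)" "AMap gpd_to_cat f' = f" using gpd_to_cat_lift by metis
  have "AMap gpd_to_cat (f' \<bullet> Ident (Gpd C) (Dom (Gpd C) f')) = f \<cdot>\<^bsub>Cat C\<^esub> Ident (Cat C) (Dom (Cat C) f)"
   "AMap gpd_to_cat (Ident (Gpd C) (Cod (Gpd C) f') \<bullet> f') = Ident (Cat C) (Cod (Cat C) f) \<cdot>\<^bsub>Cat C\<^esub> f"
   unfolding gpd_to_cat_Cmp f(2) by (simp_all add: gpd_to_cat_simps(2) f(2)[symmetric])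
  moreover have "f' \<bullet> Ident (Gpd C) (Dom (Gpd C) f') = f'" "Ident (Gpd C) (Cod (Gpd C) f') \<bullet> f' = f'"
   by (rule GG.Cmp_Ident[OF f(1) refl], rule GG.Ident_Cmp[OF f(1) refl])
  ultimately show "f \<cdot>\<^bsub>Cat C\<^esub> Ident (Cat C) (Dom (Cat C) f) = f" "Ident (Cat C) (Cod (Cat C) f) \<cdot>\<^bsub>Cat C\<^esub> f = f"
   using f(2) by metis+
 next
  fix f g h assume "f : Arr (Cat C)" "g : Arr (Cat C)" "h : Arr (Cat C)" and c: "Cod (Cat C) f = Dom (Cat C) g" "Cod (Cat C) g = Dom (Cat C) h"
  then obtain f' g' h' where fgh: "f' : Arr (Gpd C)" "AMap gpd_to_cat f' = f" "g' : Arr (Gpd C)" "AMap gpd_to_cat g' = g"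
   "h' : Arr (Gpd C)" "AMap gpd_to_cat h' = h"
   using gpd_to_cat_lift by metis
  have "(h' \<bullet> g') \<bullet> f' = h' \<bullet> (g' \<bullet> f')"
   using fgh c gpd_to_cat_composable[of f' g'] gpd_to_cat_composable[of g' h'] by (intro GG.Cmp_assoc) auto
  from arg_cong[OF this, of "AMap gpd_to_cat"]
  show "h \<cdot>\<^bsub>Cat C\<^esub> (g \<cdot>\<^bsub>Cat C\<^esub> f) = (h \<cdot>\<^bsub>Cat C\<^esub> g) \<cdot>\<^bsub>Cat C\<^esub> f" unfolding gpd_to_cat_Cmp fgh by (rule sym)
 qed
qed

theorem malcev_gpd_to_cat_isomorphism: "is_cat_isomorphism (Gpd C) (Cat C) gpd_to_cat"
 unfolding is_cat_isomorphism_def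
proof (intro conjI)
 show "is_functor (Gpd C) (Cat C) gpd_to_cat"
  unfolding is_functor_def hom_def using is_category_Gpd malcev_is_category_Cat gpd_to_cat_Arr by auto
 show "bij_betw (OMap gpd_to_cat) (Obj (Gpd C)) (Obj (Cat C))"
 proof (rule bij_betwI')
  fix A B :: "('o, 'm) igpd" assume "A : Obj (Gpd C)" "B : Obj (Gpd C)"
  then show "OMap gpd_to_cat A = OMap gpd_to_cat B \<longleftrightarrow> A = B" using gpd_truncate_inj[of A B] by auto
 next
  fix B :: "('o, 'm) icat" assume "B : Obj (Cat C)"
  then show "\<exists>A\<in>Obj (Gpd C). B = OMap gpd_to_cat A" using cat_gpd_ex[of B] by (metis Cat_simps(1) Gpd_simps(1) gpd_to_cat_simps(1))
 qed simp
 show "bij_betw (AMap gpd_to_cat) (Arr (Gpd C)) (Arr (Cat C))"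
 proof (rule bij_betwI')
  fix F G assume F: "F : Arr (Gpd C)" and G: "G : Arr (Gpd C)"
  show "AMap gpd_to_cat F = AMap gpd_to_cat G \<longleftrightarrow> F = G"
   using gpd_truncate_inj[OF Gpd_ArrD(1)[OF F] Gpd_ArrD(1)[OF G]] gpd_truncate_inj[OF Gpd_ArrD(2)[OF F] Gpd_ArrD(2)[OF G]]
   by (cases F, cases G) auto
 qed (use gpd_to_cat_Arr gpd_to_cat_lift in "blast, metis")
qed

end

end

section \<open>Lifting relations to groupoids forces the Mal'cev property\<close>

context regular_category
begin

lemma indiscrete_gpd:
 assumes X: "X : Obj C"
 obtains I :: "('o, 'm) igpd" where "internal_groupoid C I" "iObj I = X" "iArr I = prd C X X" "iSrc I = pr2 C X X" "iTgt I = pr1 C X X"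
  "iInv I = pairing C (pr2 C X X) (pr1 C X X)" "iUnit I = pairing C (Ident C X) (Ident C X)"
  "\<And>N ap x y w. [|canon N ap; x : N X; y : N X; w : N X|] ==>
   mcomp_at N ap I (pp_at N ap X X x y) (pp_at N ap X X y w) = pp_at N ap X X x w"
proof -
 let ?s = "pr2 C X X" and ?t = "pr1 C X X"
 define I :: "('o, 'm) igpd" where "I = \<lparr>iObj = X, iArr = prd C X X, iSrc = ?s, iTgt = ?t, iUnit = pairing C (Ident C X) (Ident C X),
   iComp = pairing C (?t \<cdot> pb1 C ?s ?t) (?s \<cdot> pb2 C ?s ?t), iInv = pairing C ?s ?t\<rparr>"
 have I: "iObj I = X" "iArr I = prd C X X" "iSrc I = ?s" "iTgt I = ?t" "iUnit I = pairing C (Ident C X) (Ident C X)"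
   "iComp I = pairing C (?t \<cdot> pb1 C ?s ?t) (?s \<cdot> pb2 C ?s ?t)" "iInv I = pairing C ?s ?t" by (simp_all add: I_def)
 have st: "?s : Arr C" "?t : Arr C" "Cod C ?s = Cod C ?t" "Dom C ?s = prd C X X" "Dom C ?t = prd C X X" "Cod C ?t = X" using X by simp_all
 have m: "mcomp_at N ap I g f = pp_at N ap X X (ap ?t g) (ap ?s f)"
  if N: "canon N ap" and gf: "g : N (prd C X X)" "f : N (prd C X X)" "ap ?s g = ap ?t f" for N ap g f
 proof -
  interpret model C N ap by fact
  show ?thesis using gf st pb_simps[OF st(1-3)] pbe_simps[OF st(1-3), of g f] by (simp add: mcomp_def I ap_Cmp)
 qed
 have el: "model.elt_gpd C N ap I" if N: "canon N ap" for N ap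
 proof -
  interpret model C N ap by fact
  show ?thesis unfolding I
   by unfold_locales (use X in "simp_all add: m[OF N] ap_Ident pp_eta")
 qed
 have "internal_category C I"
 proof (rule internal_categoryI)
  fix N ap assume "canon N ap"
  then show "model.elt_cat C N ap I" using el set_gpd.axioms(1) by blast
 qed (use X in "simp_all add: I")
 then have "internal_groupoid C I"
 proof (rule internal_groupoidI)
  fix N ap assume "canon N ap"
  then show "model.elt_gpd C N ap I" by (rule el)
 qed (use X in "simp_all add: I")
 then show ?thesis
 proof (rule that[OF _ I(1-4,7,5)])
  fix N ap x y w assume N: "canon N ap" and xyw: "x : N X" "y : N X" "w : N X"
  interpret model C N ap by fact
  show "mcomp I (pp X X x y) (pp X X y w) = pp X X x w" using m[OF N] X xyw by simp
 qed
qed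

text \<open>A relation of groupoids from an indiscrete groupoid to the terminal one is a subgroupoid of
 an indiscrete groupoid, hence closed under composition.\<close>

lemma RelGpd_indiscrete_transitive:
 assumes reg: "regular (Gpd C)" and S: "is_relation (Gpd C) S" and T: "iArr (tcod S) = one C"
  and I: "tdom S = I" "iObj I = X" "iArr I = prd C X X" "iSrc I = pr2 C X X" "iTgt I = pr1 C X X" and X: "X : Obj C"
  and mI: "mcomp_at N ap I (pp_at N ap X X x y) (pp_at N ap X X y w) = pp_at N ap X X x w"
  and Q: "Q = arr_rel S" "is_relation C Q"
  and N: "canon N ap" and xyw: "x : N X" "y : N X" "w : N X"
  and xy: "rel_at N ap Q (pp_at N ap X X x y) c" "rel_at N ap Q (pp_at N ap X X y w) c"
 shows "rel_at N ap Q (pp_at N ap X X x w) c"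
proof -
 interpret model C N ap by fact
 interpret GG: regular_category "Gpd C" by unfold_locales (rule is_category_Gpd, rule reg)
 obtain n where n: "n : tmap Q" using relation_ex[OF Q(2)] by blast
 let ?l = "\<lambda>r. amap (leg1 (Gpd C) S r)" and ?k = "\<lambda>r. amap (leg2 (Gpd C) S r)"
 have Qd: "tdom Q = iArr I" "tcod Q = one C" unfolding Q(1) rel_ftr_def using I T by simp_all
 obtain r where r: "r : tmap S" "n : sub_class C (pairing C (?l r) (?k r))"
  using n unfolding Q(1) rel_ftr_def by auto
 have L: "leg1 (Gpd C) S r : Arr (Gpd C)" "tdom (leg1 (Gpd C) S r) = tdom r" "tcod (leg1 (Gpd C) S r) = I"
  and K: "leg2 (Gpd C) S r : Arr (Gpd C)" "tdom (leg2 (Gpd C) S r) = tdom r" "iArr (tcod (leg2 (Gpd C) S r)) = one C"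
  using GG.relationD(6-11)[OF S r(1)] I T by simp_all
 note LD = Gpd_ArrD[OF L(1), unfolded L] and KD = Gpd_ArrD[OF K(1), unfolded K]
 obtain h where h: "is_iso C h" "h : Arr C" "Cod C h = Dom C n" "n \<cdot> h = pairing C (?l r) (?k r)" and n': "is_mono C n"
  using r(2) unfolding sub_class_def hom_def by blast
 have m: "is_mono C (pairing C (?l r) (?k r))"
  using mono_Cmp[OF n' iso_is_mono[OF h(1)] h(3)] unfolding h(4) .
 have "tmap Q = sub_class C (pairing C (?l r) (?k r))"
  using sub_class_eqI[OF m r(2)] relationD(12)[OF Q(2) n] by simp
 then have Qs: "Q = span_rel C (?l r) (?k r)" using Qd LD(8) KD(8) I by (cases Q) (simp add: span_rel_def)
 have rel: "rel Q a b \<longleftrightarrow> (\<exists>z\<in>N (iArr (tdom r)). ap (?l r) z = a \<and> ap (?k r) z = b)" for a b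
  unfolding Qs using rel_span[OF m LD(6) KD(6)] LD(7) KD(7) by simp
 let ?D = "tdom r" and ?f0 = "omap (leg1 (Gpd C) S r)"
 interpret D: gpd_elts C N ap ?D by unfold_locales (rule LD(1))
 note F = elt_functorD[OF LD(9)[OF N]]
 obtain z1 where z1: "z1 : N (iArr ?D)" "ap (?l r) z1 = pp X X x y" using xy(1) unfolding rel by blast
 obtain z2 where z2: "z2 : N (iArr ?D)" "ap (?l r) z2 = pp X X y w" using xy(2) unfolding rel by blast
 have kone: "ap (?k r) z : N (one C)" if "z : N (iArr ?D)" for z using that KD(6-8) by simp
 have c: "c : N (one C)" using rel_in(2)[OF Q(2) xy(1)] Qd by simp
 let ?o1 = "ap (iSrc ?D) z1" and ?o2 = "ap (iTgt ?D) z2"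
 have o: "?o1 : N (iObj ?D)" "?o2 : N (iObj ?D)" using z1 z2 by simp_all
 have "ap ?f0 ?o1 = y" "ap ?f0 ?o2 = y" using F(1)[OF z1(1)] F(2)[OF z2(1)] z1 z2 I X xyw by simp_all
 then have lu: "ap (?l r) (ap (iUnit ?D) ?o1) = ap (?l r) (ap (iUnit ?D) ?o2)" using F(3) o by simp
 \<comment> \<open>the relation is a subobject of pairs of arrows, so it identifies the two middle objects\<close>
 have "ap (iUnit ?D) ?o1 = ap (iUnit ?D) ?o2"
 proof (rule mono_elt_eq[OF m])
  have ku: "ap (?k r) (ap (iUnit ?D) ?o1) = ap (?k r) (ap (iUnit ?D) ?o2)"
   by (rule one_eq) (use kone o in simp_all)
  show "ap (pairing C (?l r) (?k r)) (ap (iUnit ?D) ?o1) = ap (pairing C (?l r) (?k r)) (ap (iUnit ?D) ?o2)"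
   using ap_pairing[OF LD(6) KD(6)] LD(7) KD(7) o lu ku by simp
 qed (use LD(6,7) KD(6,7) o in simp_all)
 from arg_cong[OF this, of "ap (iSrc ?D)"] have st: "?o1 = ?o2" unfolding D.s_u[OF o(1)] D.s_u[OF o(2)] .
 have z: "mcomp ?D z1 z2 : N (iArr ?D)" using z1 z2 st by simp
 have "ap (?l r) (mcomp ?D z1 z2) = pp X X x w" using F(4)[OF z1(1) z2(1) st] z1 z2 mI by simp
 moreover have "ap (?k r) (mcomp ?D z1 z2) = c" by (rule one_eq[OF kone[OF z] c])
 ultimately show ?thesis unfolding rel using z by blast
qed

text \<open>The tolerance \<open>R(a, b') \<and> R(a', b)\<close> on the points of a relation, as a subobject of pairs of points.\<close>

lemma tolerance_ex:
 assumes R: "is_relation C R" "tdom R = tcod R" and r: "r : tmap R"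
 obtains j where "is_mono C j" "j : Arr C" "Cod C j = prd C (Dom C r) (Dom C r)"
  "\<And>N ap x y. [|canon N ap; x : N (Dom C r); y : N (Dom C r)|] ==>
   pp_at N ap (Dom C r) (Dom C r) x y : img_at N ap j \<longleftrightarrow>
   rel_at N ap R (ap (leg1 C R r) x) (ap (leg2 C R r) y) \<and> rel_at N ap R (ap (leg1 C R r) y) (ap (leg2 C R r) x)"
proof -
 let ?X = "Dom C r" and ?l = "leg1 C R r" and ?k = "leg2 C R r"
 let ?p = "pr1 C ?X ?X" and ?q = "pr2 C ?X ?X"
 note D = relationD(4,6-11)[OF R(1) r]
 have X: "?X : Obj C" using D by simp
 obtain i where i: "is_mono C i" "i : Arr C" "Cod C i = prd C ?X ?X" and
  I: "\<And>N ap z. [|canon N ap; z : N (prd C ?X ?X)|] ==>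
   z : img_at N ap i \<longleftrightarrow> rel_at N ap R (ap (?l \<cdot> ?p) z) (ap (?k \<cdot> ?q) z)"
  using comprehension[OF R(1), of "?l \<cdot> ?p" "?k \<cdot> ?q"] D X R(2) by (simp add: Cmp_Arr) (metis (no_types, lifting))
 obtain j where j: "is_mono C j" "j : Arr C" "Cod C j = Dom C i" and
  J: "\<And>N ap z. [|canon N ap; z : N (Dom C i)|] ==>
   z : img_at N ap j \<longleftrightarrow> rel_at N ap R (ap (?l \<cdot> (?q \<cdot> i)) z) (ap (?k \<cdot> (?p \<cdot> i)) z)"
  using comprehension[OF R(1), of "?l \<cdot> (?q \<cdot> i)" "?k \<cdot> (?p \<cdot> i)"] D X R(2) i by simp (metis (no_types, lifting))
 show ?thesis
 proof (rule that[of "i \<cdot> j"])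
  show "is_mono C (i \<cdot> j)" using mono_Cmp[OF i(1) j(1,3)] .
  show "i \<cdot> j : Arr C" "Cod C (i \<cdot> j) = prd C ?X ?X" using i j by simp_all
  fix N ap x y assume N: "canon N ap" and xy: "x : N ?X" "y : N ?X"
  interpret model C N ap by fact
  let ?z = "pp ?X ?X x y"
  note pp = pp_simps[OF X X xy]
  have i': "ap i u : N (prd C ?X ?X)" if "u : N (Dom C i)" for u using that i by simp
  have "?z : img (i \<cdot> j) \<longleftrightarrow> (\<exists>u\<in>N (Dom C i). ap i u = ?z \<and> u : img j)"
   using i j by (auto simp: img_def ap_Cmp image_iff)
  also have "\<dots> \<longleftrightarrow> (\<exists>u\<in>N (Dom C i). ap i u = ?z \<and> rel R (ap ?l y) (ap ?k x))"
  proof (rule bex_cong[OF refl], rule conj_cong[OF refl])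
   fix u assume u: "u : N (Dom C i)" and e: "ap i u = ?z"
   have "ap (?l \<cdot> (?q \<cdot> i)) u = ap ?l y" "ap (?k \<cdot> (?p \<cdot> i)) u = ap ?k x" using u e pp D X i by (simp_all add: ap_Cmp)
   then show "u : img j \<longleftrightarrow> rel R (ap ?l y) (ap ?k x)" using J[OF N u] by simp
  qed
  also have "\<dots> \<longleftrightarrow> ?z : img i \<and> rel R (ap ?l y) (ap ?k x)" by (auto simp: img_def)
  also have "?z : img i \<longleftrightarrow> rel R (ap ?l x) (ap ?k y)"
   using I[OF N pp(1)] pp D X by (simp add: ap_Cmp)
  finally show "?z : img (i \<cdot> j) \<longleftrightarrow> rel R (ap ?l x) (ap ?k y) \<and> rel R (ap ?l y) (ap ?k x)" .
 qed
qed

text \<open>The relation \<open>R(a, b') \<and> R(a', b)\<close> between the points \<open>(a, b)\<close> and \<open>(a', b')\<close> of a relation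
 \<open>R\<close> is reflexive and symmetric, that is, it respects inverses as a relation from the indiscrete
 groupoid on \<open>R\<close> to the terminal groupoid. If it lifts to groupoids then it is transitive,
 which says that \<open>R\<close> is difunctional.\<close>

lemma RelGpd_surjective_difunctional:
 assumes reg: "regular (Gpd C)" and surj: "\<And>Q. Q : Arr (GRel C) ==> \<exists>S\<in>Arr (Rel (Gpd C)). AMap (RelGpd_to_GRel C) S = Q"
  and R: "is_relation C R" "tdom R = tcod R" and N: "canon N ap"
  and abc: "rel_at N ap R a b" "rel_at N ap R c b" "rel_at N ap R c d"
 shows "rel_at N ap R a d"
proof -
 interpret GG: regular_category "Gpd C" by unfold_locales (rule is_category_Gpd, rule reg)
 obtain r where r: "r : tmap R" using relation_ex[OF R(1)] by blast
 let ?X = "Dom C r" and ?l = "leg1 C R r" and ?k = "leg2 C R r"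
 note D = relationD(4,6-11)[OF R(1) r]
 have X: "?X : Obj C" using D by simp
 obtain j where j: "is_mono C j" "j : Arr C" "Cod C j = prd C ?X ?X" and
  J: "\<And>N ap x y. [|canon N ap; x : N (Dom C r); y : N (Dom C r)|] ==>
   pp_at N ap ?X ?X x y : img_at N ap j \<longleftrightarrow>
   rel_at N ap R (ap ?l x) (ap ?k y) \<and> rel_at N ap R (ap ?l y) (ap ?k x)"
  using tolerance_ex[OF R r] by blast
 obtain I :: "('o, 'm) igpd" where I: "internal_groupoid C I" "iObj I = ?X" "iArr I = prd C ?X ?X" "iSrc I = pr2 C ?X ?X" "iTgt I = pr1 C ?X ?X"
  "iInv I = pairing C (pr2 C ?X ?X) (pr1 C ?X ?X)" "iUnit I = pairing C (Ident C ?X) (Ident C ?X)" and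
  mI: "\<And>N ap x y w. [|canon N ap; x : N ?X; y : N ?X; w : N ?X|] ==>
   mcomp_at N ap I (pp_at N ap ?X ?X x y) (pp_at N ap ?X ?X y w) = pp_at N ap ?X ?X x w"
  using indiscrete_gpd[OF X] by blast
 obtain T :: "('o, 'm) igpd" where T: "internal_groupoid C T" "iArr T = one C"
  using terminal_gpd by (metis is_terminal_def Gpd_simps(1))
 let ?Q = "span_rel C j (bang C (Dom C j))"
 have m: "is_mono C (pairing C j (bang C (Dom C j)))"
 proof (rule pairing_monoI)
  fix N ap x y
  assume "canon N ap" "x : N (Dom C (bang C (Dom C j)))" "y : N (Dom C (bang C (Dom C j)))" "ap j x = ap j y"
  then show "x = y" using model.mono_elt_eq[OF _ j(1)] j(2) by simp
 qed (use j in simp_all)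
 have Q: "is_relation C ?Q" "tdom ?Q = iArr I" "tcod ?Q = iArr T" using m j I T by simp_all
 have rel: "rel_at N ap ?Q u v \<longleftrightarrow> u : img_at N ap j \<and> v : N (one C)" if N: "canon N ap" for N ap u v
 proof -
  interpret model C N ap by fact
  have b: "ap (bang C (Dom C j)) z : N (one C)" if "z : N (Dom C j)" for z using that j by simp
  have "rel ?Q u v \<longleftrightarrow> (\<exists>z\<in>N (Dom C j). ap j z = u \<and> ap (bang C (Dom C j)) z = v)" using m j by simp
  then show ?thesis using b one_eq unfolding img_def by blast
 qed
 have "respects_inverses C I T ?Q" unfolding respects_inverses_iff[OF I(1) T(1) Q]
 proof (intro allI impI)
  fix N ap assume N: "canon N ap"
  interpret model C N ap by fact
  interpret T: gpd_elts C N ap T by unfold_locales (rule T(1))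
  show "inverse_closed N ap I T ?Q" unfolding inverse_closed_def rel[OF N] T(2)[symmetric]
  proof (intro allI impI conjI)
   fix u v assume uv: "u : img j \<and> v : N (iArr T)"
   then show "ap (iInv T) v : N (iArr T)" "ap (iUnit T) (ap (iSrc T) v) : N (iArr T)" by simp_all
   have u: "u : N (prd C ?X ?X)" using uv j by (auto simp: img_def)
   let ?x = "ap (pr1 C ?X ?X) u" and ?y = "ap (pr2 C ?X ?X) u"
   have xy: "?x : N ?X" "?y : N ?X" "pp ?X ?X ?x ?y = u" using u X pp_eta by simp_all
   have t: "rel R (ap ?l ?x) (ap ?k ?y) \<and> rel R (ap ?l ?y) (ap ?k ?x)" using J[OF N xy(1,2)] uv xy(3) by simp
   have "ap (iInv I) u = pp ?X ?X ?y ?x" using u X by (simp add: I)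
   then show "ap (iInv I) u : img j" using J[OF N xy(2,1)] t by simp
   have "ap (iUnit I) (ap (iSrc I) u) = pp ?X ?X ?y ?y" using u X xy by (simp add: I ap_Ident)
   moreover have "rel R (ap ?l ?y) (ap ?k ?y)" unfolding rel_rep[OF R(1) r] using xy by blast
   ultimately show "ap (iUnit I) (ap (iSrc I) u) : img j" using J[OF N xy(2,2)] by simp
  qed
 qed
 then have "\<lparr>tdom = I, tcod = T, tmap = ?Q\<rparr> : Arr (GRel C)" using I(1) T(1) Q by simp
 then obtain S where S: "S : Arr (Rel (Gpd C))" "AMap (RelGpd_to_GRel C) S = \<lparr>tdom = I, tcod = T, tmap = ?Q\<rparr>" using surj by blast
 have S': "is_relation (Gpd C) S" using S(1) GG.Rel_simps(2) by simp
 have S'': "tdom S = I" "tcod S = T" "?Q = arr_rel S" using S(2) by (simp_all add: RelGpd_to_GRel_simps)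
 interpret model C N ap by fact
 obtain x where x: "x : N ?X" "ap ?l x = a" "ap ?k x = b" using abc(1) rel_rep[OF R(1) r] by auto
 obtain y where y: "y : N ?X" "ap ?l y = c" "ap ?k y = b" using abc(2) rel_rep[OF R(1) r] by auto
 obtain w where w: "w : N ?X" "ap ?l w = c" "ap ?k w = d" using abc(3) rel_rep[OF R(1) r] by auto
 obtain e where e: "e : N (one C)" using one_elt by blast
 have "rel_at N ap ?Q (pp ?X ?X x w) e"
 proof (rule RelGpd_indiscrete_transitive[OF reg S' _ S''(1) I(2-5) X mI[OF N x(1) y(1) w(1)] S''(3) Q(1) N x(1) y(1) w(1)])
  show "iArr (tcod S) = one C" using S''(2) T(2) by simp
  show "rel ?Q (pp ?X ?X x y) e" "rel ?Q (pp ?X ?X y w) e"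
   unfolding rel[OF N] using J[OF N x(1) y(1)] J[OF N y(1) w(1)] x y w abc e by simp_all
 qed
 then show ?thesis unfolding rel[OF N] using J[OF N x(1) w(1)] x w by simp
qed

text \<open>A reflexive difunctional relation is symmetric by \<open>R b b\<close>, \<open>R a b\<close>, \<open>R a a\<close> and transitive by \<open>R a b\<close>,
\<open>R b b\<close>, \<open>R b c\<close>.\<close>

theorem RelGpd_surjective_malcev:
 assumes reg: "regular (Gpd C)" and surj: "\<And>Q. Q : Arr (GRel C) ==> \<exists>S\<in>Arr (Rel (Gpd C)). AMap (RelGpd_to_GRel C) S = Q"
 shows "malcev C"
 unfolding malcev_def
proof (intro conjI allI impI)
 show "is_category C" by (rule is_cat)
 show "has_finite_limits C" using regular by (simp add: regular_def)
 fix R assume A: "is_relation C R \<and> tdom R = tcod R \<and> reflexive_rel C R"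
 then have R: "is_relation C R" "tdom R = tcod R" by simp_all
 note O = relationD(1,2)[OF R(1)]
 have refl: "rel_at N ap R a a" if N: "canon N ap" and a: "a : N (tcod R)" for N ap a
 proof (rule model.sub_le_rel[OF N _ R(1)])
  show "sub_le C (tmap (rel_ident C (tcod R))) (tmap R)" using A unfolding reflexive_rel_def R(2) by simp
  show "rel_at N ap (rel_ident C (tcod R)) a a" using model.rel_rel_ident[OF N O(2)] a by simp
 qed (use R O in simp_all)
 have dif: "rel_at N ap R a d" if "canon N ap" "rel_at N ap R a b" "rel_at N ap R c b" "rel_at N ap R c d"
  for N ap a b c d
  by (rule RelGpd_surjective_difunctional[OF reg surj R that])
 show "symmetric_rel C R" unfolding symmetric_rel_def
 proof (rule relation_leI)
  fix N ap a b assume N: "canon N ap" and ab: "rel_at N ap R a b"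
  interpret model C N ap by fact
  have "a : N (tcod R)" "b : N (tcod R)" using rel_in[OF R(1) ab] R(2) by simp_all
  then have "rel R b a" using dif[OF N _ ab, of b a] refl[OF N] by blast
  then show "rel (rel_dagger C R) a b" using rel_dagger[OF R(1)] by simp
 qed (use R in simp_all)
 show "transitive_rel C R" unfolding transitive_rel_def
 proof (intro ballI allI impI)
  fix r P p q assume r: "r : tmap R" and P: "is_pullback C (leg2 C R r) (leg1 C R r) P p q"
  note D = relationD(3-11)[OF R(1) r] and pf = pullback_facts[OF P]
  let ?h = "pairing C (leg1 C R r \<cdot> p) (leg2 C R r \<cdot> q)"
  have T: "leg1 C R r \<cdot> p : Arr C" "leg2 C R r \<cdot> q : Arr C" "Dom C (leg1 C R r \<cdot> p) = P" "Dom C (leg2 C R r \<cdot> q) = P"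
   "Cod C (leg1 C R r \<cdot> p) = tdom R" "Cod C (leg2 C R r \<cdot> q) = tcod R" using D pf by simp_all
  obtain k where "k : Arr C" "Dom C k = Dom C ?h" "Cod C k = Dom C r" "r \<cdot> k = ?h"
  proof (rule mono_factorI[OF D(1), of ?h])
   show "?h : Arr C" "Cod C ?h = Cod C r" using T D by simp_all
   fix N ap x assume N: "canon N ap" and "x : N (Dom C ?h)"
   interpret model C N ap by fact
   have x: "x : N P" using \<open>x : N (Dom C ?h)\<close> T by simp
   let ?a = "ap (leg1 C R r) (ap p x)" and ?b = "ap (leg2 C R r) (ap p x)" and ?c = "ap (leg2 C R r) (ap q x)"
   have b: "?b = ap (leg1 C R r) (ap q x)"
    using arg_cong[OF pf(11), of "\<lambda>f. ap f x"] ap_Cmp[of p "leg2 C R r" x] ap_Cmp[of q "leg1 C R r" x] pf D x by (simp del: pb_simps)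
   have ab: "rel R ?a ?b" "rel R ?b ?c" unfolding b unfolding b[symmetric] rel_rep[OF R(1) r] using pf D x b by auto
   have "?b : N (tcod R)" using rel_in(2)[OF R(1) ab(1)] .
   then have "rel R ?a ?c" using dif[OF N ab(1) refl[OF N] ab(2)] by blast
   moreover have "?a : N (tdom R)" "?c : N (tcod R)" using calculation rel_in[OF R(1)] by blast+
   moreover have "ap ?h x = pp (tdom R) (tcod R) ?a ?c" using T pf D x by (simp add: ap_Cmp)
   ultimately show "ap ?h x : img r" using rel_img[OF R(1) r] by simp
  qed
  then show "\<exists>h\<in>hom C P (Dom C r). r \<cdot> h = ?h" using T by (auto simp: hom_def)
 qed
qed

end

section \<open>Composing an isomorphism with an equivalence\<close>

lemma (in cat_isomorphism) F_bij_hom: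
 assumes "A : Obj D" "B : Obj D"
 shows "bij_betw (AMap F) (hom D A B) (hom E (OMap F A) (OMap F B))"
 unfolding bij_betw_def inj_on_def using F_hom[OF assms] F_inj by (auto simp: hom_def)

lemma is_functor_comp:
 assumes F: "is_functor D E F" and G: "is_functor E H G"
 shows "is_functor D H (comp_ftr G F)"
 using assms unfolding is_functor_def comp_ftr_def hom_def by auto

lemma comp_isomorphism_equivalence:
 assumes F: "is_cat_isomorphism D E F" and G: "is_functor E H G"
  and surj: "\<And>B. B : Obj H ==> \<exists>A\<in>Obj E. OMap G A = B"
  and ff: "\<And>A A'. [|A : Obj E; A' : Obj E|] ==> bij_betw (AMap G) (hom E A A') (hom H (OMap G A) (OMap G A'))"
 shows "is_equivalence D H (comp_ftr G F)"
proof -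
 obtain K where "cat_isomorphism D E F K" using F by (rule is_cat_isomorphism_inverse)
 then interpret K: cat_isomorphism D E F K .
 have c: "OMap (comp_ftr G F) = (\<lambda>A. OMap G (OMap F A))" "AMap (comp_ftr G F) = AMap G \<circ> AMap F" by (simp_all add: comp_ftr_def o_def)
 show ?thesis
 proof (rule surjective_fully_faithful_equivalence)
  show "is_functor D H (comp_ftr G F)" by (rule is_functor_comp[OF K.F G])
  show "\<exists>A\<in>Obj D. OMap (comp_ftr G F) A = B" if "B : Obj H" for B
   using surj[OF that] K.FG(1) cat_isomorphism.FF(1)[OF K.swap] unfolding c by metis
  show "bij_betw (AMap (comp_ftr G F)) (hom D A A') (hom H (OMap (comp_ftr G F) A) (OMap (comp_ftr G F) A'))"
   if "A : Obj D" "A' : Obj D" for A A'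
   unfolding c by (rule bij_betw_trans[OF K.F_bij_hom[OF that] ff]) (use that in simp_all)
 qed
qed

theorem theorem4p5:
  fixes C :: "('o, 'm) cat"
  shows "(regular C \<and> malcev C \<longrightarrow> positively_regular C) \<and>
    (positively_regular C \<longrightarrow>
       is_equivalence (GRel C) (CP (Rel C)) (GRel_to_CP C) \<and>
       (malcev C \<longleftrightarrow>
          regular (Gpd C) \<and> regular (Cat C) \<and>
          is_cat_isomorphism (Rel (Gpd C)) (GRel C) (RelGpd_to_GRel C) \<and>
          is_equivalence (Rel (Gpd C)) (CP (Rel C)) (comp_ftr (GRel_to_CP C) (RelGpd_to_GRel C)) \<and>
          is_cat_isomorphism (Gpd C) (Cat C) gpd_to_cat \<and>
          is_equivalence (Rel (Gpd C)) (Rel (Cat C)) (rel_ftr (Gpd C) (Cat C) gpd_to_cat)))"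
proof (intro conjI impI)
 assume "regular C \<and> malcev C"
 then interpret regular_category C by unfold_locales (simp_all add: regular_def)
 show "positively_regular C" using \<open>regular C \<and> malcev C\<close> malcev_positively_regular by blast
next
 assume pr: "positively_regular C"
 then interpret regular_category C by unfold_locales (simp_all add: positively_regular_def regular_def)
 show "is_equivalence (GRel C) (CP (Rel C)) (GRel_to_CP C)" by (rule GRel_to_CP_equivalence[OF pr])
 show "malcev C \<longleftrightarrow>
     regular (Gpd C) \<and> regular (Cat C) \<and>
     is_cat_isomorphism (Rel (Gpd C)) (GRel C) (RelGpd_to_GRel C) \<and>
     is_equivalence (Rel (Gpd C)) (CP (Rel C)) (comp_ftr (GRel_to_CP C) (RelGpd_to_GRel C)) \<and>
     is_cat_isomorphism (Gpd C) (Cat C) gpd_to_cat \<and>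
     is_equivalence (Rel (Gpd C)) (Rel (Cat C)) (rel_ftr (Gpd C) (Cat C) gpd_to_cat)"
  (is "_ \<longleftrightarrow> ?rhs")
 proof
  assume mal: "malcev C"
  note iso = malcev_gpd_to_cat_isomorphism[OF mal]
  obtain K where "cat_isomorphism (Gpd C) (Cat C) gpd_to_cat K" using iso by (rule is_cat_isomorphism_inverse)
  then interpret K: cat_isomorphism "Gpd C" "Cat C" gpd_to_cat K .
  note reg = malcev_regular_Gpd[OF mal]
  show ?rhs
   using reg K.regular_image[OF reg] K.rel_ftr_equivalence[OF reg] iso malcev_RelGpd_isomorphism[OF mal]
    comp_isomorphism_equivalence[OF malcev_RelGpd_isomorphism[OF mal] is_functor_GRel_to_CP[OF pr]
     GRel_to_CP_surjective[OF pr] GRel_to_CP_fully_faithful[OF pr]] by blast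
 next
  assume r: ?rhs
  show "malcev C"
  proof (rule RelGpd_surjective_malcev)
   show "regular (Gpd C)" using r by blast
   have e: "AMap (RelGpd_to_GRel C) ` Arr (Rel (Gpd C)) = Arr (GRel C)" using r unfolding is_cat_isomorphism_def bij_betw_def by blast
   fix Q assume "Q : Arr (GRel C)"
   then show "\<exists>S\<in>Arr (Rel (Gpd C)). AMap (RelGpd_to_GRel C) S = Q" unfolding e[symmetric] by blast
  qed
 qed
qed

end
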